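(* Suppose that $\mathrm{E}[v_1^2(\Sigma)]>0$ and that for some $\delta>0$, as $n\to\infty$, $$\max\left\{\frac{\mathrm{E}|e_1(\Sigma)|^{2+\delta}}{(\mathrm{E}[e_1^2(\Sigma)])^{(2+\delta)/2}},\ \frac{\mathrm{E}|v_1(\Sigma)|^{2+\delta}}{(\mathrm{E}[v_1^2(\Sigma)])^{(2+\delta)/2}}\right\}=o\left(N^{(\delta+\min\{2,\delta\})/4}\right).$$ Then under $H_0:\Sigma=\Sigma_0$, $-2\log L_1(\Sigma_0)$ converges in distribution to a chi-square distribution with two degrees of freedom as $n\to\infty$. If, in addition, $$(\mathrm{tr}(\Sigma^2))^2=o\left(N^2\,\mathrm{E}[e_1^2(\Sigma)]\right)\quad\text{and}\quad \Big(\sum_{i=1}^p\sum_{j=1}^p\sigma_{ij}\Big)^2=o\left(N\,\mathrm{E}[v_1^2(\Sigma)]\right),$$ then under $H_0:\Sigma=\Sigma_0$, $-2\log L_2(\Sigma_0)$ also converges in distribution to a chi-square distribution with two degrees of freedom as $n\to\infty$.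
   Context: For each $n$, $X_1,\dots,X_n$ are i.i.d. random vectors in $\mathbb{R}^p$ with mean $\mu$ and covariance matrix $\Sigma=(\sigma_{ij})_{1\le i,j\le p}$. The dimension $p$, and hence $\mu$, $\Sigma$, the given covariance matrix $\Sigma_0$ and the distribution of $X_1$, may depend on $n$ ($p$ may be fixed or divergent). Let $N=[n/2]$ (integer part) and $\mathbf{1}_p=(1,\dots,1)^T\in\mathbb{R}^p$. Known mean: $Y_i=(X_i-\mu)(X_i-\mu)^T$ for $i=1,\dots,n$. For a $p\times p$ matrix $M$ and $i=1,\dots,N$ put $$e_i(M)=\mathrm{tr}\big((Y_i-M)(Y_{i+N}-M)\big),\quad v_i(M)=\mathbf{1}_p^T(Y_i+Y_{i+N}-2M)\mathbf{1}_p,\quad R_i(M)=(e_i(M),v_i(M))^T,$$ $$L_1(M)=\sup\Big\{\prod_{i=1}^N(Np_i):\ \sum_{i=1}^Np_i=1,\ \sum_{i=1}^Np_iR_i(M)=0,\ p_1\ge0,\dots,p_N\ge0\Big\}.$$ Unknown mean: $\overline{X}^1=\frac1N\sum_{i=1}^NX_i$, $\overline{X}^2=\frac1N\sum_{i=N+1}^{2N}X_i$, and for $i=1,\dots,N$, $Y_i^*=(X_i-\overline{X}^1)(X_i-\overline{X}^1)^T$, $Y_{N+i}^*=(X_{N+i}-\overline{X}^2)(X_{N+i}-\overline{X}^2)^T$, $$e_i^*(M)=\mathrm{tr}\Big(\big(Y_i^*-\tfrac{N-1}{N}M\big)\big(Y_{i+N}^*-\tfrac{N-1}{N}M\big)\Big),\quad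 v_i^*(M)=\mathbf{1}_p^T\Big(Y_i^*+Y_{i+N}^*-\tfrac{2(N-1)}{N}M\Big)\mathbf{1}_p,$$ $R_i^*(M)=(e_i^*(M),v_i^*(M))^T$, and $L_2(M)$ is defined as $L_1(M)$ with $R_i(M)$ replaced by $R_i^*(M)$. Convention: $\sup\emptyset=0$ and $-2\log 0=+\infty$. *)

theory Defs
  imports "HOL-Probability.Probability"
begin

text \<open>
  Since the dimension varies with the sample size, a vector in dimension \<open>p\<close> is a function
  \<^typ>\<open>nat \<Rightarrow> real\<close> and a \<open>p \<times> p\<close> matrix a function \<^typ>\<open>nat \<Rightarrow> nat \<Rightarrow> real\<close>, of which only the
  values at indices in \<open>{1..p}\<close> matter.  A sample is a function \<open>x\<close> with \<open>x i a\<close> the \<open>a\<close>-th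
  coordinate of the \<open>i\<close>-th observation.
\<close>

abbreviation Rvec :: "nat \<Rightarrow> (nat \<Rightarrow> real) measure" where
  "Rvec p \<equiv> PiM {1..p} (\<lambda>_. borel)"

definition mmult :: "nat \<Rightarrow> (nat \<Rightarrow> nat \<Rightarrow> real) \<Rightarrow> (nat \<Rightarrow> nat \<Rightarrow> real) \<Rightarrow> nat \<Rightarrow> nat \<Rightarrow> real" where
  "mmult p A B = (\<lambda>a b. \<Sum>c=1..p. A a c * B c b)"

definition mtrace :: "nat \<Rightarrow> (nat \<Rightarrow> nat \<Rightarrow> real) \<Rightarrow> real" where
  "mtrace p A = (\<Sum>a=1..p. A a a)"

definition quad_form :: "nat \<Rightarrow> (nat \<Rightarrow> real) \<Rightarrow> (nat \<Rightarrow> nat \<Rightarrow> real) \<Rightarrow> real" where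
  "quad_form p u A = (\<Sum>a=1..p. \<Sum>b=1..p. u a * A a b * u b)"

definition outer_sq :: "(nat \<Rightarrow> real) \<Rightarrow> nat \<Rightarrow> nat \<Rightarrow> real" where
  "outer_sq u = (\<lambda>a b. u a * u b)"

text \<open>
  Empirical likelihood ratio for the estimating equation \<open>E R = 0\<close>.  The case distinction
  implements \<open>sup \<emptyset> = 0\<close>, since \<^term>\<open>Sup {} :: real\<close> is unspecified; the set is bounded above
  (by 1, by the arithmetic-geometric mean inequality), so \<^term>\<open>Sup\<close> is the true supremum otherwise.
\<close>

definition el_values :: "nat \<Rightarrow> (nat \<Rightarrow> real \<times> real) \<Rightarrow> real set" where
  "el_values N R = {(\<Prod>i=1..N. real N * w i) | w :: nat \<Rightarrow> real.
     (\<Sum>i=1..N. w i) = 1 \<and> (\<Sum>i=1..N. w i *\<^sub>R R i) = 0 \<and> (\<forall>i\<in>{1..N}. 0 \<le> w i)}"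

definition el_ratio :: "nat \<Rightarrow> (nat \<Rightarrow> real \<times> real) \<Rightarrow> real" where
  "el_ratio N R = (if el_values N R = {} then 0 else Sup (el_values N R))"

definition neg2log :: "real \<Rightarrow> ereal" where
  "neg2log l = (if l = 0 then \<infinity> else ereal (- 2 * ln l))"

definition Ymat :: "(nat \<Rightarrow> real) \<Rightarrow> (nat \<Rightarrow> nat \<Rightarrow> real) \<Rightarrow> nat \<Rightarrow> nat \<Rightarrow> nat \<Rightarrow> real" where
  "Ymat \<mu> x i = outer_sq (\<lambda>a. x i a - \<mu> a)"

definition e_stat ::
  "nat \<Rightarrow> nat \<Rightarrow> (nat \<Rightarrow> real) \<Rightarrow> (nat \<Rightarrow> nat \<Rightarrow> real) \<Rightarrow> (nat \<Rightarrow> nat \<Rightarrow> real) \<Rightarrow> nat \<Rightarrow> real" where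
  "e_stat p N \<mu> x A i =
     mtrace p (mmult p (\<lambda>a b. Ymat \<mu> x i a b - A a b) (\<lambda>a b. Ymat \<mu> x (i + N) a b - A a b))"

definition v_stat ::
  "nat \<Rightarrow> nat \<Rightarrow> (nat \<Rightarrow> real) \<Rightarrow> (nat \<Rightarrow> nat \<Rightarrow> real) \<Rightarrow> (nat \<Rightarrow> nat \<Rightarrow> real) \<Rightarrow> nat \<Rightarrow> real" where
  "v_stat p N \<mu> x A i =
     quad_form p (\<lambda>_. 1) (\<lambda>a b. Ymat \<mu> x i a b + Ymat \<mu> x (i + N) a b - 2 * A a b)"

definition L1 ::
  "nat \<Rightarrow> nat \<Rightarrow> (nat \<Rightarrow> real) \<Rightarrow> (nat \<Rightarrow> nat \<Rightarrow> real) \<Rightarrow> (nat \<Rightarrow> nat \<Rightarrow> real) \<Rightarrow> real" where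
  "L1 p N \<mu> x A = el_ratio N (\<lambda>i. (e_stat p N \<mu> x A i, v_stat p N \<mu> x A i))"

text \<open>
  Versions for unknown mean.  The factor \<open>(N - 1) / N\<close> below makes the centred outer products
  have mean zero, since each half of the sample is centred at its own sample mean.
\<close>

definition Xbar1 :: "nat \<Rightarrow> (nat \<Rightarrow> nat \<Rightarrow> real) \<Rightarrow> nat \<Rightarrow> real" where
  "Xbar1 N x a = (1 / real N) * (\<Sum>i=1..N. x i a)"

definition Xbar2 :: "nat \<Rightarrow> (nat \<Rightarrow> nat \<Rightarrow> real) \<Rightarrow> nat \<Rightarrow> real" where
  "Xbar2 N x a = (1 / real N) * (\<Sum>i=N+1..2*N. x i a)"

definition Ymat_star :: "nat \<Rightarrow> (nat \<Rightarrow> nat \<Rightarrow> real) \<Rightarrow> nat \<Rightarrow> nat \<Rightarrow> nat \<Rightarrow> real" where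
  "Ymat_star N x i =
     (if i \<le> N then outer_sq (\<lambda>a. x i a - Xbar1 N x a) else outer_sq (\<lambda>a. x i a - Xbar2 N x a))"

definition e_star ::
  "nat \<Rightarrow> nat \<Rightarrow> (nat \<Rightarrow> nat \<Rightarrow> real) \<Rightarrow> (nat \<Rightarrow> nat \<Rightarrow> real) \<Rightarrow> nat \<Rightarrow> real" where
  "e_star p N x A i =
     mtrace p (mmult p
       (\<lambda>a b. Ymat_star N x i a b - (real N - 1) / real N * A a b)
       (\<lambda>a b. Ymat_star N x (i + N) a b - (real N - 1) / real N * A a b))"

definition v_star ::
  "nat \<Rightarrow> nat \<Rightarrow> (nat \<Rightarrow> nat \<Rightarrow> real) \<Rightarrow> (nat \<Rightarrow> nat \<Rightarrow> real) \<Rightarrow> nat \<Rightarrow> real" where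
  "v_star p N x A i =
     quad_form p (\<lambda>_. 1)
       (\<lambda>a b. Ymat_star N x i a b + Ymat_star N x (i + N) a b - 2 * (real N - 1) / real N * A a b)"

definition L2 ::
  "nat \<Rightarrow> nat \<Rightarrow> (nat \<Rightarrow> nat \<Rightarrow> real) \<Rightarrow> (nat \<Rightarrow> nat \<Rightarrow> real) \<Rightarrow> real" where
  "L2 p N x A = el_ratio N (\<lambda>i. (e_star p N x A i, v_star p N x A i))"

definition chi_square :: "nat \<Rightarrow> real measure" where
  "chi_square k =
     distr (PiM {..<k} (\<lambda>_. std_normal_distribution)) borel (\<lambda>z. \<Sum>i<k. (z i)\<^sup>2)"

text \<open>
  Convergence in distribution of random variables that may take the value \<open>\<infinity>\<close> to a probability
  distribution on the reals; \<^const>\<open>weak_conv\<close> is convergence of distribution functions at all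
  continuity points of the limit.
\<close>

definition converges_in_distr ::
  "(nat \<Rightarrow> 'a measure) \<Rightarrow> (nat \<Rightarrow> 'a \<Rightarrow> ereal) \<Rightarrow> real measure \<Rightarrow> bool" where
  "converges_in_distr M T \<nu> \<longleftrightarrow>
     (\<forall>n. T n \<in> borel_measurable (M n)) \<and>
     weak_conv (\<lambda>n t. measure (M n) {\<omega> \<in> space (M n). T n \<omega> \<le> ereal t}) (cdf \<nu>)"

end

theory Submission imports Defs begin

text \<open>
  Divide \<open>e\<^sub>i\<close> and \<open>v\<^sub>i\<close> by the square roots of their second moments.  This gives a row-wise i.i.d. array
  \<open>(x\<^sub>i, y\<^sub>i)\<close> of pairs with mean zero, unit variances and zero correlation (the latter because
  \<open>Y\<^sub>1 - \<Sigma>\<close> and \<open>Y\<^bsub>1+N\<^esub> - \<Sigma>\<close> are independent and centred), and the assumption on the moment ratios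
  implies Lyapunov's condition.  Let \<open>U\<close>, \<open>V\<close> be the sums of the \<open>x\<^sub>i\<close> and of the \<open>y\<^sub>i\<close> divided by \<open>\<surd>N\<close>.
  Then the likelihood ratio is \<open>exp (- (U\<^sup>2 + V\<^sup>2) / 2) + o(1)\<close> in probability: weak duality with the dual vector
  \<open>(U, V) / \<surd>N\<close> gives the upper bound, explicit weights that are affine in \<open>(x\<^sub>i, y\<^sub>i)\<close> the lower one.
  The law of a \<open>[0,1]\<close>-valued variable is determined by its moments, and
  \<open>E exp (- k (U\<^sup>2 + V\<^sup>2) / 2)\<close> is a Gaussian average of the joint characteristic function of \<open>U\<close> and \<open>V\<close>,
  so convergence of characteristic functions suffices and no bivariate continuity theorem is needed.

  For the unknown mean, \<open>Y\<^sub>i\<^sup>* - (N - 1)/N \<Sigma> = (Y\<^sub>i - \<Sigma>) + \<Delta>\<^sub>i\<close>.  Independence of the two halves turns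
  \<open>E e\<^sub>1\<^sup>2\<close> into \<open>\<sigma>\<^sup>2\<close>, where \<open>\<sigma>\<close> is the Hilbert-Schmidt norm of the covariance operator of \<open>Y\<^sub>1\<close>, and bounds
  the second moments of \<open>e\<^sub>i\<^sup>* - e\<^sub>i\<close> by Hilbert-Schmidt norms of the second moments of \<open>\<Delta>\<^sub>i\<close>, which are of order
  \<open>tr (\<Sigma>\<^sup>2) / N + \<sigma> / N\<^sup>2\<close>.  The additional assumptions make these perturbations negligible.
\<close>

section \<open>The empirical likelihood ratio of a deterministic sample\<close>

text \<open>Nothing ties p to n, so no bound may count coordinates: everything is measured by
  E[e^2], E[v^2], tr(Sigma^2) and the sum of the entries of Sigma. Working with L in [0,1] rather
  than with -2 log L makes infeasible samples harmless: they have the value 0, and the explicit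
  weights show that they are rare. The corrected pairs for the unknown mean are not independent, as
  they share the sample means. The conditions used by the likelihood expansion are therefore
  isolated in \<open>el_array\<close>, free of independence, and shown to survive perturbations that
  are small in mean square and in normalised sum. The sum is the delicate part, since adding N
  corrections by the triangle inequality loses a factor N. Terms that pair \<open>Dl i\<close> with
  the \<open>W i\<close> of the other half are orthogonal for different i. Terms that pair two
  perturbations are not; there exchangeability and the cancellation in the sum of the
  \<open>Dl i\<close> give off-diagonal moments of order \<open>eta\<close> / N. Fourth moments of
  the coordinates enter throughout, although moments are assumed only of e and v;
  \<open>w_sq\<close> extracts them from E[e^2].\<close>

lemma ln_one_plus_ge_cubic:
  fixes l :: real
  assumes "\<bar>l\<bar> \<le> 1/2"
  shows "l - l\<^sup>2 / 2 - \<bar>l\<bar> ^ 3 \<le> ln (1 + l)"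
proof (cases "l \<ge> 0")
  case True
  have "(\<lambda>s. ln (1 + s) - s + s\<^sup>2 / 2) 0 \<le> (\<lambda>s. ln (1 + s) - s + s\<^sup>2 / 2) l"
  proof (rule DERIV_nonneg_imp_nondecreasing[where f = "\<lambda>s. ln (1 + s) - s + s\<^sup>2 / 2"])
    show "0 \<le> l" using True .
    fix s :: real assume s: "0 \<le> s" "s \<le> l"
    have "((\<lambda>s. ln (1 + s) - s + s\<^sup>2 / 2) has_real_derivative s\<^sup>2 / (1 + s)) (at s)"
      by (rule derivative_eq_intros refl | use s in \<open>simp add: field_simps power2_eq_square\<close>)+
    then show "\<exists>y. ((\<lambda>s. ln (1 + s) - s + s\<^sup>2 / 2) has_real_derivative y) (at s) \<and> 0 \<le> y"
      using s by (intro exI[of _ "s\<^sup>2 / (1 + s)"]) auto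
  qed
  then have "l - l\<^sup>2 / 2 \<le> ln (1 + l)" by simp
  moreover have "0 \<le> \<bar>l\<bar> ^ 3" by simp
  ultimately show ?thesis by linarith
next
  case False
  \<comment> \<open>For negative l the term -|l|^3 equals l^3, and l >= -1/2 gives 3 (1 + s) >= 1,
    which makes the derivative s^2 / (1 + s) - 3 s^2 nonpositive.\<close>
  have "(\<lambda>s. ln (1 + s) - s + s\<^sup>2 / 2 - s ^ 3) 0 \<le> (\<lambda>s. ln (1 + s) - s + s\<^sup>2 / 2 - s ^ 3) l"
  proof (rule DERIV_nonpos_imp_nonincreasing[where f = "\<lambda>s. ln (1 + s) - s + s\<^sup>2 / 2 - s ^ 3"])
    show "l \<le> 0" using False by simp
    fix s :: real assume s: "l \<le> s" "s \<le> 0"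
    have "((\<lambda>s. ln (1 + s) - s + s\<^sup>2 / 2 - s ^ 3) has_real_derivative s\<^sup>2 / (1 + s) - 3 * s\<^sup>2) (at s)"
      by (rule derivative_eq_intros refl | use s assms in \<open>simp add: field_simps power2_eq_square\<close>)+
    moreover have "s\<^sup>2 / (1 + s) - 3 * s\<^sup>2 \<le> 0"
    proof -
      have "s\<^sup>2 \<le> s\<^sup>2 * (3 * (1 + s))"
        using mult_left_mono[of 1 "3 * (1 + s)" "s\<^sup>2"] s assms by simp
      then show ?thesis using s assms by (simp add: field_simps)
    qed
    ultimately show "\<exists>y. ((\<lambda>s. ln (1 + s) - s + s\<^sup>2 / 2 - s ^ 3) has_real_derivative y) (at s) \<and> y \<le> 0"
      by blast
  qed
  then show ?thesis using False by (simp add: algebra_simps power3_eq_cube)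
qed

text \<open>Since |l|^3 <= m l^2, the cubic remainder is a multiple of the sum of squares. Both
  halves of the expansion rest on it: it is applied to the dual product in
  \<open>el_ratio_upper\<close> and to the weights themselves in
  \<open>el_ratio_lower\<close>.\<close>

lemma prod_one_plus_ge:
  fixes l :: "'i \<Rightarrow> real"
  assumes "finite I" and bnd: "\<And>i. i \<in> I \<Longrightarrow> \<bar>l i\<bar> \<le> m" and "m \<le> 1/2"
  shows "exp ((\<Sum>i\<in>I. l i) - (\<Sum>i\<in>I. (l i)\<^sup>2) / 2 - m * (\<Sum>i\<in>I. (l i)\<^sup>2)) \<le> (\<Prod>i\<in>I. 1 + l i)"
proof -
  have "exp ((\<Sum>i\<in>I. l i) - (\<Sum>i\<in>I. (l i)\<^sup>2) / 2 - m * (\<Sum>i\<in>I. (l i)\<^sup>2))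
      = exp (\<Sum>i\<in>I. l i - (l i)\<^sup>2 / 2 - m * (l i)\<^sup>2)"
    by (simp add: sum_subtractf sum_distrib_left sum_divide_distrib)
  also have "\<dots> = (\<Prod>i\<in>I. exp (l i - (l i)\<^sup>2 / 2 - m * (l i)\<^sup>2))"
    using assms(1) by (rule exp_sum)
  also have "\<dots> \<le> (\<Prod>i\<in>I. 1 + l i)"
  proof (intro prod_mono conjI)
    fix i assume i: "i \<in> I"
    have l: "\<bar>l i\<bar> \<le> 1/2" using bnd[OF i] assms(3) by simp
    have "\<bar>l i\<bar> ^ 3 \<le> m * (l i)\<^sup>2"
      using mult_right_mono[OF bnd[OF i], of "(l i)\<^sup>2"] by (simp add: power3_eq_cube power2_eq_square abs_mult)
    then have "l i - (l i)\<^sup>2 / 2 - m * (l i)\<^sup>2 \<le> ln (1 + l i)"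
      using ln_one_plus_ge_cubic[OF l] by linarith
    moreover have "0 < 1 + l i" using l by (simp add: abs_if split: if_splits)
    ultimately show "exp (l i - (l i)\<^sup>2 / 2 - m * (l i)\<^sup>2) \<le> 1 + l i"
      by (metis exp_le_cancel_iff exp_ln)
  qed simp
  finally show ?thesis .
qed

lemma el_values_nonneg: "v \<in> el_values N R \<Longrightarrow> 0 \<le> v"
  unfolding el_values_def by (auto intro!: prod_nonneg)

text \<open>Weak duality: every dual vector \<open>(a, b)\<close> bounds the likelihood, because \<open>t \<le> exp (t - 1)\<close>.\<close>

lemma el_values_dual_bound:
  assumes v: "v \<in> el_values N (\<lambda>i. (x i, y i))"
    and pos: "\<And>i. i \<in> {1..N} \<Longrightarrow> 0 < 1 + a * x i + b * y i"
  shows "v * (\<Prod>i=1..N. 1 + a * x i + b * y i) \<le> 1"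
proof -
  obtain w where w: "v = (\<Prod>i=1..N. real N * w i)" "(\<Sum>i=1..N. w i) = 1"
    "(\<Sum>i=1..N. w i *\<^sub>R (x i, y i)) = 0" "\<forall>i\<in>{1..N}. 0 \<le> w i"
    using v unfolding el_values_def by blast
  have wx: "(\<Sum>i=1..N. w i * x i) = 0" and wy: "(\<Sum>i=1..N. w i * y i) = 0"
    using w(3) by (simp_all add: prod_eq_iff fst_sum snd_sum)
  have "v * (\<Prod>i=1..N. 1 + a * x i + b * y i) = (\<Prod>i=1..N. (real N * w i) * (1 + a * x i + b * y i))"
    by (simp add: w(1) prod.distrib)
  also have "\<dots> \<le> (\<Prod>i=1..N. exp ((real N * w i) * (1 + a * x i + b * y i) - 1))"
  proof (intro prod_mono conjI)
    fix i assume i: "i \<in> {1..N}"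
    show "0 \<le> real N * w i * (1 + a * x i + b * y i)"
      using w(4) pos[OF i] i by (simp add: less_imp_le)
    show "real N * w i * (1 + a * x i + b * y i) \<le> exp (real N * w i * (1 + a * x i + b * y i) - 1)"
      using exp_ge_add_one_self[of "real N * w i * (1 + a * x i + b * y i) - 1"] by simp
  qed
  also have "\<dots> = exp (\<Sum>i=1..N. (real N * w i) * (1 + a * x i + b * y i) - 1)"
    by (simp add: exp_sum)
  also have "(\<Sum>i=1..N. (real N * w i) * (1 + a * x i + b * y i) - 1)
      = real N * (\<Sum>i=1..N. w i) + a * real N * (\<Sum>i=1..N. w i * x i) + b * real N * (\<Sum>i=1..N. w i * y i) - real N"
    by (simp add: sum_subtractf sum.distrib sum_distrib_left algebra_simps)
  also have "\<dots> = 0" by (simp only: w(2) wx wy)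
  finally show ?thesis by simp
qed

text \<open>The dual vector (0, 0) turns weak duality into the arithmetic-geometric mean
  bound.\<close>

lemma el_values_le_1: "v \<in> el_values N R \<Longrightarrow> v \<le> 1"
  using el_values_dual_bound[of v N "\<lambda>i. fst (R i)" "\<lambda>i. snd (R i)" 0 0] by simp

lemma bdd_above_el_values: "bdd_above (el_values N R)"
  using el_values_le_1 by (auto simp: bdd_above_def)

lemma el_ratio_nonneg: "0 \<le> el_ratio N R"
proof (cases "el_values N R = {}")
  case False
  then obtain v where v: "v \<in> el_values N R" by blast
  have "0 \<le> Sup (el_values N R)"
    by (rule cSup_upper2[OF v el_values_nonneg[OF v] bdd_above_el_values])
  then show ?thesis using False by (simp add: el_ratio_def)
qed (simp add: el_ratio_def)

lemma el_ratio_le_1: "el_ratio N R \<le> 1"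
  unfolding el_ratio_def using cSup_least[OF _ el_values_le_1] by auto

lemma el_ratio_ge: "v \<in> el_values N R \<Longrightarrow> v \<le> el_ratio N R"
  using cSup_upper[OF _ bdd_above_el_values] by (auto simp: el_ratio_def)

lemma el_ratio_le: "0 \<le> B \<Longrightarrow> (\<And>v. v \<in> el_values N R \<Longrightarrow> v \<le> B) \<Longrightarrow> el_ratio N R \<le> B"
  unfolding el_ratio_def by (auto intro!: cSup_least)

lemma el_ratio_cong:
  assumes "\<And>i. i \<in> {1..N} \<Longrightarrow> R i = R' i"
  shows "el_ratio N R = el_ratio N R'"
proof -
  have "(\<Sum>i=1..N. w i *\<^sub>R R i) = (\<Sum>i=1..N. w i *\<^sub>R R' i)" for w :: "nat \<Rightarrow> real"
    using assms by (auto intro!: sum.cong)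
  then have "el_values N R = el_values N R'" unfolding el_values_def by presburger
  then show ?thesis by (simp add: el_ratio_def)
qed

text \<open>Each coordinate of the constraint is homogeneous, so the likelihood ratio does not see
  the scale of e and v. This lets the standardised array be analysed and the standard deviations be
  removed at the end.\<close>

lemma el_ratio_scale:
  assumes "c \<noteq> 0" "d \<noteq> 0"
  shows "el_ratio N (\<lambda>i. (c * x i, d * y i)) = el_ratio N (\<lambda>i. (x i, y i))"
proof -
  have "(\<Sum>i=1..N. w i *\<^sub>R (c * x i, d * y i)) = 0 \<longleftrightarrow> (\<Sum>i=1..N. w i *\<^sub>R (x i, y i)) = 0" for w :: "nat \<Rightarrow> real"
  proof -
    have "(\<Sum>i=1..N. w i * (c * x i)) = c * (\<Sum>i=1..N. w i * x i)"
      "(\<Sum>i=1..N. w i * (d * y i)) = d * (\<Sum>i=1..N. w i * y i)"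
      by (simp_all add: sum_distrib_left mult_ac)
    then show ?thesis using assms by (simp add: prod_eq_iff fst_sum snd_sum)
  qed
  then have "el_values N (\<lambda>i. (c * x i, d * y i)) = el_values N (\<lambda>i. (x i, y i))"
    unfolding el_values_def by presburger
  then show ?thesis by (simp add: el_ratio_def)
qed

text \<open>One \<open>\<epsilon>\<close> bounds every source of error at once: the maxima relative
  to sqrt N, the deviation of the second moment matrix from the identity, and 1/N. The condition 40
  K^2 \<epsilon> <= 1 keeps every relative change of a weight below 1/2 and the centred second
  moment matrix entrywise within 1/20 of the identity.\<close>

locale el_moments =
  fixes N :: nat and x y :: "nat \<Rightarrow> real" and K \<epsilon> :: real
  fixes A B s11 s12 s22 :: real
  defines "A \<equiv> (\<Sum>i=1..N. x i) / sqrt N" and "B \<equiv> (\<Sum>i=1..N. y i) / sqrt N"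
    and "s11 \<equiv> (\<Sum>i=1..N. x i * x i) / N" and "s12 \<equiv> (\<Sum>i=1..N. x i * y i) / N"
    and "s22 \<equiv> (\<Sum>i=1..N. y i * y i) / N"
  assumes N: "0 < N" and K1: "1 \<le> K" and e0: "0 \<le> \<epsilon>" and eK: "40 * K\<^sup>2 * \<epsilon> \<le> 1"
    and AK: "\<bar>A\<bar> \<le> K" and BK: "\<bar>B\<bar> \<le> K"
    and xe: "\<And>i. i \<in> {1..N} \<Longrightarrow> \<bar>x i\<bar> \<le> \<epsilon> * sqrt N"
    and ye: "\<And>i. i \<in> {1..N} \<Longrightarrow> \<bar>y i\<bar> \<le> \<epsilon> * sqrt N"
    and s11: "\<bar>s11 - 1\<bar> \<le> \<epsilon>" and s12: "\<bar>s12\<bar> \<le> \<epsilon>" and s22: "\<bar>s22 - 1\<bar> \<le> \<epsilon>"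
    and Ne: "1 / N \<le> \<epsilon>"
begin

lemma sqrtN: "0 < sqrt N" "sqrt N * sqrt N = N" using N by auto

lemma sum_x: "(\<Sum>i=1..N. x i) = A * sqrt N" and sum_y: "(\<Sum>i=1..N. y i) = B * sqrt N"
  using N by (simp_all add: A_def B_def)

lemma sum_xx: "(\<Sum>i=1..N. x i * x i) = s11 * N" and sum_xy: "(\<Sum>i=1..N. x i * y i) = s12 * N"
  and sum_yy: "(\<Sum>i=1..N. y i * y i) = s22 * N"
  using N by (simp_all add: s11_def s12_def s22_def)

lemma eK1: "40 * K * \<epsilon> \<le> 1" "40 * \<epsilon> \<le> 1"
proof -
  have "K * 1 \<le> K * K" using K1 by (intro mult_left_mono) auto
  then have K2: "K \<le> K\<^sup>2" by (simp add: power2_eq_square)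
  then have "40 * K * \<epsilon> \<le> 40 * K\<^sup>2 * \<epsilon>" using e0 by (intro mult_right_mono) auto
  then show 1: "40 * K * \<epsilon> \<le> 1" using eK by linarith
  have "40 * 1 * \<epsilon> \<le> 40 * K * \<epsilon>" using e0 K1 by (intro mult_right_mono) auto
  then show "40 * \<epsilon> \<le> 1" using 1 by linarith
qed

lemma A2: "A\<^sup>2 \<le> K\<^sup>2" and B2: "B\<^sup>2 \<le> K\<^sup>2" and AB: "2 * \<bar>A * B\<bar> \<le> A\<^sup>2 + B\<^sup>2"
proof -
  show "A\<^sup>2 \<le> K\<^sup>2" "B\<^sup>2 \<le> K\<^sup>2" using AK BK by (metis abs_le_square_iff abs_of_nonneg abs_ge_zero order_trans)+
  show "2 * \<bar>A * B\<bar> \<le> A\<^sup>2 + B\<^sup>2"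
    using sum_squares_bound[of "\<bar>A\<bar>" "\<bar>B\<bar>"] by (simp add: abs_mult)
qed

text \<open>The two diagonal deviations contribute h (A^2 + B^2) in total, and the cross term at
  most as much because 2 |A B| <= A^2 + B^2. It serves the second moment matrix in the upper bound
  and the adjugate of its centred version in the lower one.\<close>

lemma quad_form_close:
  assumes "\<bar>p - 1\<bar> \<le> h" "\<bar>q\<bar> \<le> h" "\<bar>r - 1\<bar> \<le> h"
  shows "\<bar>p * A\<^sup>2 + 2 * q * (A * B) + r * B\<^sup>2 - (A\<^sup>2 + B\<^sup>2)\<bar> \<le> 2 * h * (A\<^sup>2 + B\<^sup>2)"
proof -
  have h: "0 \<le> h" using assms(1) by linarith
  have "\<bar>(p - 1) * A\<^sup>2\<bar> \<le> h * A\<^sup>2" "\<bar>(r - 1) * B\<^sup>2\<bar> \<le> h * B\<^sup>2"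
    using assms by (auto simp: abs_mult intro!: mult_right_mono)
  moreover have "\<bar>q * (2 * (A * B))\<bar> \<le> h * (A\<^sup>2 + B\<^sup>2)"
    unfolding abs_mult[of q] using AB by (intro mult_mono assms h) (auto simp: abs_mult)
  ultimately show ?thesis by (simp add: algebra_simps)
qed

text \<open>With the dual vector (A, B) / sqrt N the \<open>l i\<close> sum to A^2 + B^2 and their
  squares to nearly the same value, so the logarithm of the dual product is about half of it. The
  errors here add up to 8 K^4 \<epsilon>; the constant 33 is shared with the lower bound, whose
  estimates use 30.\<close>

lemma el_ratio_upper: "el_ratio N (\<lambda>i. (x i, y i)) \<le> exp (- (A\<^sup>2 + B\<^sup>2) / 2 + 33 * K ^ 4 * \<epsilon>)"
proof -
  define l where "l i = (A / sqrt N) * x i + (B / sqrt N) * y i" for i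
  define q where "q = s11 * A\<^sup>2 + 2 * s12 * (A * B) + s22 * B\<^sup>2"
  have bnd: "\<bar>l i\<bar> \<le> 2 * K * \<epsilon>" if "i \<in> {1..N}" for i
  proof -
    have "\<bar>A / sqrt N * x i\<bar> \<le> (K / sqrt N) * (\<epsilon> * sqrt N)"
      unfolding abs_mult using sqrtN AK xe[OF that] K1 by (intro mult_mono) (auto simp: field_simps)
    moreover have "\<bar>B / sqrt N * y i\<bar> \<le> (K / sqrt N) * (\<epsilon> * sqrt N)"
      unfolding abs_mult using sqrtN BK ye[OF that] K1 by (intro mult_mono) (auto simp: field_simps)
    ultimately show ?thesis using sqrtN unfolding l_def by (simp add: abs_triangle_ineq[THEN order_trans])
  qed
  have half: "2 * K * \<epsilon> \<le> 1/2" using eK1 by linarith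
  have sl: "(\<Sum>i=1..N. l i) = A\<^sup>2 + B\<^sup>2"
    unfolding l_def sum.distrib sum_distrib_left[symmetric] sum_x sum_y
    using sqrtN by (simp add: power2_eq_square)
  have sl2: "(\<Sum>i=1..N. (l i)\<^sup>2) = q"
  proof -
    have "(l i)\<^sup>2 = (A\<^sup>2 / N) * (x i * x i) + (2 * (A * B) / N) * (x i * y i) + (B\<^sup>2 / N) * (y i * y i)" for i
      unfolding l_def using sqrtN N by (simp add: power2_eq_square field_simps)
    then have "(\<Sum>i=1..N. (l i)\<^sup>2) = (A\<^sup>2 / N) * (s11 * N) + (2 * (A * B) / N) * (s12 * N) + (B\<^sup>2 / N) * (s22 * N)"
      by (simp only: sum.distrib sum_distrib_left[symmetric] sum_xx sum_xy sum_yy)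
    then show ?thesis unfolding q_def using N by simp
  qed
  have qb: "\<bar>q - (A\<^sup>2 + B\<^sup>2)\<bar> \<le> 2 * \<epsilon> * (A\<^sup>2 + B\<^sup>2)"
    unfolding q_def by (rule quad_form_close[OF s11 s12 s22])
  have Q: "A\<^sup>2 + B\<^sup>2 \<le> 2 * K\<^sup>2" using A2 B2 by simp
  have e4: "2 * \<epsilon> * (A\<^sup>2 + B\<^sup>2) \<le> 4 * K\<^sup>2 * \<epsilon>"
    using mult_left_mono[OF Q, of "2 * \<epsilon>"] e0 by (simp add: algebra_simps)
  have q3: "q \<le> 3 * K\<^sup>2"
    using qb e4 Q eK one_le_power[OF K1, of 2] by linarith
  have "2 * K * \<epsilon> * q \<le> 2 * K * \<epsilon> * (3 * K\<^sup>2)" using q3 K1 e0 by (intro mult_left_mono) auto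
  then have m: "2 * K * \<epsilon> * q \<le> 6 * (K ^ 3 * \<epsilon>)" by (simp add: power2_eq_square power3_eq_cube)
  have K34: "K ^ 3 * \<epsilon> \<le> K ^ 4 * \<epsilon>" "K ^ 2 * \<epsilon> \<le> K ^ 4 * \<epsilon>"
    using K1 e0 by (auto intro!: mult_right_mono power_increasing)
  have K4p: "0 \<le> K ^ 4 * \<epsilon>" using e0 by simp
  have ex: "(A\<^sup>2 + B\<^sup>2) / 2 - 33 * K ^ 4 * \<epsilon> \<le> (A\<^sup>2 + B\<^sup>2) - q / 2 - 2 * K * \<epsilon> * q"
  proof -
    have "q \<le> (A\<^sup>2 + B\<^sup>2) + 4 * (K\<^sup>2 * \<epsilon>)" using qb e4 by linarith
    moreover have "Q / 2 - 33 * k \<le> Q - q' / 2 - t"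
      if "q' \<le> Q + 4 * k2" "t \<le> 6 * k3" "k3 \<le> k" "k2 \<le> k" "0 \<le> k" for Q q' t k k2 k3 :: real
      using that by linarith
    ultimately show ?thesis using m K34 K4p unfolding mult.assoc[of 33] by blast
  qed
  have P: "exp ((A\<^sup>2 + B\<^sup>2) / 2 - 33 * K ^ 4 * \<epsilon>) \<le> (\<Prod>i=1..N. 1 + l i)"
    using prod_one_plus_ge[of "{1..N}" l, OF _ bnd half] ex unfolding sl sl2
    by (smt (verit) exp_le_cancel_iff finite_atLeastAtMost)
  show ?thesis
  proof (rule el_ratio_le)
    fix v assume v: "v \<in> el_values N (\<lambda>i. (x i, y i))"
    have "v * (\<Prod>i=1..N. 1 + (A / sqrt N) * x i + (B / sqrt N) * y i) \<le> 1"
    proof (rule el_values_dual_bound[OF v])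
      fix i assume i: "i \<in> {1..N}"
      show "0 < 1 + A / sqrt N * x i + B / sqrt N * y i"
        using bnd[OF i] half unfolding l_def by linarith
    qed
    then have "v * (\<Prod>i=1..N. 1 + l i) \<le> 1" by (simp add: l_def add.assoc)
    moreover have "v * exp ((A\<^sup>2 + B\<^sup>2) / 2 - 33 * K ^ 4 * \<epsilon>) \<le> v * (\<Prod>i=1..N. 1 + l i)"
      by (rule mult_left_mono[OF P el_values_nonneg[OF v]])
    ultimately have "v * exp ((A\<^sup>2 + B\<^sup>2) / 2 - 33 * K ^ 4 * \<epsilon>) \<le> 1" by linarith
    then have "v \<le> 1 / exp ((A\<^sup>2 + B\<^sup>2) / 2 - 33 * K ^ 4 * \<epsilon>)" by (simp add: field_simps)
    also have "\<dots> = exp (- ((A\<^sup>2 + B\<^sup>2) / 2 - 33 * K ^ 4 * \<epsilon>))" by (simp add: exp_minus field_simps)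
    also have "- ((A\<^sup>2 + B\<^sup>2) / 2 - 33 * K ^ 4 * \<epsilon>) = - (A\<^sup>2 + B\<^sup>2) / 2 + 33 * K ^ 4 * \<epsilon>" by (simp add: field_simps)
    finally show "v \<le> exp (- (A\<^sup>2 + B\<^sup>2) / 2 + 33 * K ^ 4 * \<epsilon>)" .
  qed simp
qed

text \<open>A feasible point: the weights \<open>(1 - a \<cdot> (z\<^sub>i - mean)) / N\<close>, where \<open>a\<close> solves the normal
  equations of the centred second moment matrix by Cramer's rule.\<close>

lemma el_ratio_lower: "exp (- (A\<^sup>2 + B\<^sup>2) / 2 - 33 * K ^ 4 * \<epsilon>) \<le> el_ratio N (\<lambda>i. (x i, y i))"
proof -
  define V11 V12 V22 where V: "V11 = s11 - A\<^sup>2 / N" "V12 = s12 - A * B / N" "V22 = s22 - B\<^sup>2 / N"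
  define d where "d = V11 * V22 - V12\<^sup>2"
  \<comment> \<open>The entries of V differ from those of the identity by \<epsilon> through the raw
    moments and by at most K^2 / N <= K^2 \<epsilon> through centring.\<close>
  define h where "h = 2 * K\<^sup>2 * \<epsilon>"
  have Kp: "1 \<le> K\<^sup>2" using K1 by (rule one_le_power)
  have eKe: "\<epsilon> \<le> K\<^sup>2 * \<epsilon>" using mult_right_mono[OF Kp e0] by simp
  have "K\<^sup>2 * (1 / N) \<le> K\<^sup>2 * \<epsilon>" using Ne by (intro mult_left_mono) auto
  then have KN: "K\<^sup>2 / N \<le> K\<^sup>2 * \<epsilon>" by simp
  have "A\<^sup>2 / N \<le> K\<^sup>2 / N" "B\<^sup>2 / N \<le> K\<^sup>2 / N" "\<bar>A * B\<bar> / N \<le> K\<^sup>2 / N"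
    using A2 B2 AB N by (auto intro!: divide_right_mono)
  then have "\<bar>A\<^sup>2 / N\<bar> \<le> K\<^sup>2 * \<epsilon>" "\<bar>B\<^sup>2 / N\<bar> \<le> K\<^sup>2 * \<epsilon>" "\<bar>A * B / N\<bar> \<le> K\<^sup>2 * \<epsilon>" using KN by auto
  then have Vh: "\<bar>V11 - 1\<bar> \<le> h" "\<bar>V12\<bar> \<le> h" "\<bar>V22 - 1\<bar> \<le> h"
    using s11 s12 s22 eKe unfolding V h_def by linarith+
  have h: "0 \<le> h" "h \<le> 1/20" using eK e0 unfolding h_def by auto
  \<comment> \<open>The bound is (1 - h)^2 - h^2.\<close>
  have d: "1 - 2 * h \<le> d"
  proof -
    have "(1 - h) * (1 - h) \<le> V11 * V22" using Vh h by (intro mult_mono) auto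
    moreover have "V12\<^sup>2 \<le> h\<^sup>2" using Vh(2) by (simp add: abs_le_square_iff[symmetric])
    ultimately show ?thesis unfolding d_def by (simp add: algebra_simps power2_eq_square)
  qed
  have d9: "9/10 \<le> d" using d h by linarith
  define a b where ab: "a = (V22 * A - V12 * B) / d" "b = (V11 * B - V12 * A) / d"
  have norm1: "V11 * a + V12 * b = A"
  proof -
    have "V11 * (V22 * A - V12 * B) + V12 * (V11 * B - V12 * A) = A * d"
      unfolding d_def by (simp add: algebra_simps power2_eq_square)
    then show ?thesis using d9 unfolding ab by (simp add: add_divide_distrib[symmetric])
  qed
  have norm2: "V12 * a + V22 * b = B"
  proof -
    have "V12 * (V22 * A - V12 * B) + V22 * (V11 * B - V12 * A) = B * d"
      unfolding d_def by (simp add: algebra_simps power2_eq_square)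
    then show ?thesis using d9 unfolding ab by (simp add: add_divide_distrib[symmetric])
  qed
  have num: "\<bar>v * C - u * D\<bar> \<le> 11/10 * K" if "\<bar>v - 1\<bar> \<le> h" "\<bar>u\<bar> \<le> h" "\<bar>C\<bar> \<le> K" "\<bar>D\<bar> \<le> K" for u v C D :: real
  proof -
    have "\<bar>v * C\<bar> \<le> 21/20 * K" unfolding abs_mult using that h by (intro mult_mono) auto
    moreover have "\<bar>u * D\<bar> \<le> 1/20 * K" unfolding abs_mult using that h by (intro mult_mono) auto
    ultimately show ?thesis by linarith
  qed
  have quot: "\<bar>t / d\<bar> \<le> 2 * K" if "\<bar>t\<bar> \<le> 11/10 * K" for t :: real
  proof -
    have "\<bar>t / d\<bar> = \<bar>t\<bar> / d" using d9 by simp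
    also have "\<dots> \<le> (11/10 * K) / (9/10)" using d9 that K1 by (intro frac_le) auto
    also have "\<dots> \<le> 2 * K" using K1 by simp
    finally show ?thesis .
  qed
  have aK: "\<bar>a\<bar> \<le> 2 * K" and bK: "\<bar>b\<bar> \<le> 2 * K"
    unfolding ab by (intro quot num Vh AK BK)+
  \<comment> \<open>A / sqrt N and B / sqrt N are the sample means, so the \<open>l i\<close> sum to
    0 and the weights (1 + l i) / N have total mass 1.\<close>
  define l where "l i = - ((a / sqrt N) * (x i - A / sqrt N) + (b / sqrt N) * (y i - B / sqrt N))" for i
  \<comment> \<open>Each of the two products in \<open>l i\<close> is at most (2 K / sqrt N) (2 K
    \<epsilon> sqrt N) = 4 K^2 \<epsilon>.\<close>
  define m where "m = 8 * K\<^sup>2 * \<epsilon>"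
  have bnd: "\<bar>l i\<bar> \<le> m" if i: "i \<in> {1..N}" for i
  proof -
    have KK: "K / sqrt N \<le> K * \<epsilon> * sqrt N"
    proof -
      have "1 / N * (K * sqrt N) \<le> \<epsilon> * (K * sqrt N)" using Ne K1 by (intro mult_right_mono) auto
      moreover have "1 / N * (K * sqrt N) = K / sqrt N"
        using real_div_sqrt[of "real N"] N by (simp add: field_simps)
      ultimately show ?thesis by (simp add: mult_ac)
    qed
    have t: "\<bar>(c / sqrt N) * (z - C / sqrt N)\<bar> \<le> m / 2"
      if "\<bar>c\<bar> \<le> 2 * K" "\<bar>C\<bar> \<le> K" "\<bar>z\<bar> \<le> \<epsilon> * sqrt N" for c z C
    proof -
      have "\<bar>C / sqrt N\<bar> \<le> K / sqrt N" using that sqrtN by (simp add: divide_right_mono)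
      then have "\<bar>z - C / sqrt N\<bar> \<le> \<epsilon> * sqrt N + K * \<epsilon> * sqrt N" using that KK by linarith
      also have "\<dots> \<le> 2 * (K * \<epsilon> * sqrt N)" using K1 e0 sqrtN mult_right_mono[of 1 K "\<epsilon> * sqrt N"] by simp
      finally have "\<bar>z - C / sqrt N\<bar> \<le> 2 * (K * \<epsilon> * sqrt N)" .
      moreover have "\<bar>c / sqrt N\<bar> \<le> 2 * K / sqrt N" using that sqrtN by (simp add: divide_right_mono)
      ultimately have "\<bar>(c / sqrt N) * (z - C / sqrt N)\<bar> \<le> (2 * K / sqrt N) * (2 * (K * \<epsilon> * sqrt N))"
        unfolding abs_mult using K1 sqrtN by (intro mult_mono) auto
      also have "\<dots> = m / 2" using sqrtN by (simp add: m_def power2_eq_square)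
      finally show ?thesis .
    qed
    show ?thesis using t[OF aK AK xe[OF i]] t[OF bK BK ye[OF i]] unfolding l_def abs_minus_cancel
        by (intro order_trans[OF abs_triangle_ineq]) argo
  qed
  have half: "m \<le> 1/2" using eK e0 unfolding m_def by linarith
  have Np: "real N \<noteq> 0" using N by simp
  have cx: "(\<Sum>i=1..N. x i - A / sqrt N) = 0" and cy: "(\<Sum>i=1..N. y i - B / sqrt N) = 0"
    unfolding sum_subtractf sum_x sum_y using sqrtN by (simp_all add: field_simps)
  have sl: "(\<Sum>i=1..N. l i) = 0"
    unfolding l_def sum_negf sum.distrib sum_distrib_left[symmetric] cx cy by simp
  have cxx: "(\<Sum>i=1..N. (x i - A / sqrt N) * x i) = V11 * N"
    and cxy: "(\<Sum>i=1..N. (x i - A / sqrt N) * y i) = V12 * N"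
    and cyx: "(\<Sum>i=1..N. (y i - B / sqrt N) * x i) = V12 * N"
    and cyy: "(\<Sum>i=1..N. (y i - B / sqrt N) * y i) = V22 * N"
    unfolding left_diff_distrib sum_subtractf sum_distrib_left[symmetric] mult.commute[of "y _" "x _"]
      sum_x sum_y sum_xx sum_xy sum_yy V
    using sqrtN N by (simp_all add: field_simps power2_eq_square)
  \<comment> \<open>Here the normal equations enter: the tilt cancels the raw sum exactly, so the
    weighted mean of the \<open>x i\<close> is 0.\<close>
  have slx: "(\<Sum>i=1..N. l i * x i) = - (\<Sum>i=1..N. x i)"
  proof -
    have "l i * x i = - (a / sqrt N) * ((x i - A / sqrt N) * x i) - (b / sqrt N) * ((y i - B / sqrt N) * x i)" for i
      unfolding l_def by (simp add: algebra_simps)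
    then have "(\<Sum>i=1..N. l i * x i) = - (a / sqrt N) * (V11 * N) - (b / sqrt N) * (V12 * N)"
      by (simp only: sum_subtractf sum_distrib_left[symmetric] cxx cyx)
    also have "\<dots> = - (V11 * a + V12 * b) * (N / sqrt N)" using sqrtN by (simp add: field_simps)
    also have "N / sqrt N = sqrt N" by (simp add: real_div_sqrt)
    finally show ?thesis unfolding norm1 sum_x by simp
  qed
  have sly: "(\<Sum>i=1..N. l i * y i) = - (\<Sum>i=1..N. y i)"
  proof -
    have "l i * y i = - (a / sqrt N) * ((x i - A / sqrt N) * y i) - (b / sqrt N) * ((y i - B / sqrt N) * y i)" for i
      unfolding l_def by (simp add: algebra_simps)
    then have "(\<Sum>i=1..N. l i * y i) = - (a / sqrt N) * (V12 * N) - (b / sqrt N) * (V22 * N)"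
      by (simp only: sum_subtractf sum_distrib_left[symmetric] cxy cyy)
    also have "\<dots> = - (V12 * a + V22 * b) * (N / sqrt N)" using sqrtN by (simp add: field_simps)
    also have "N / sqrt N = sqrt N" by (simp add: real_div_sqrt)
    finally show ?thesis unfolding norm2 sum_y by simp
  qed
  define q where "q = (\<Sum>i=1..N. (l i)\<^sup>2)"
  \<comment> \<open>Only one factor of the square is expanded; the constraints just proved evaluate
    the rest, and the quadratic form of the inverse of V at (A, B) appears as a A + b B.\<close>
  have q_eq: "q = a * A + b * B"
  proof -
    have "(l i)\<^sup>2 = - (a / sqrt N) * (l i * x i) - (b / sqrt N) * (l i * y i) + (a * A / N + b * B / N) * l i" for i
    proof -
      have "(l i)\<^sup>2 = l i * - ((a / sqrt N) * (x i - A / sqrt N) + (b / sqrt N) * (y i - B / sqrt N))"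
        by (simp add: l_def power2_eq_square)
      then show ?thesis using sqrtN N by (simp add: algebra_simps)
    qed
    then have "q = - (a / sqrt N) * - (A * sqrt N) - (b / sqrt N) * - (B * sqrt N)"
      unfolding q_def by (simp only: sum.distrib sum_subtractf sum_distrib_left[symmetric] slx sly sum_x sum_y sl mult_zero_right add_0_right)
    then show ?thesis using sqrtN by simp
  qed
  define Q where "Q = A\<^sup>2 + B\<^sup>2"
  have Q: "Q \<le> 2 * K\<^sup>2" "0 \<le> Q" using A2 B2 by (simp_all add: Q_def)
  \<comment> \<open>Multiplication by the determinant replaces the inverse of V by its adjugate,
    whose entries are as close to the identity as those of V.\<close>
  have qd: "q * d = V22 * A\<^sup>2 + 2 * (- V12) * (A * B) + V11 * B\<^sup>2"
    unfolding q_eq ab using d9 by (simp add: field_simps power2_eq_square)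
  have "\<bar>q * d - Q\<bar> \<le> 2 * h * Q"
    unfolding qd Q_def by (rule quad_form_close) (use Vh in auto)
  then have qd1: "q * d \<le> (1 + 2 * h) * Q" by (simp add: algebra_simps)
  have q0: "0 \<le> q" unfolding q_def by (intro sum_nonneg) auto
  have "q * (1 - 2 * h) \<le> q * d" using q0 d by (intro mult_left_mono) auto
  then have q1: "q * (1 - 2 * h) \<le> (1 + 2 * h) * Q" using qd1 by linarith
  have qb: "q \<le> (1 + 5 * h) * Q"
  proof -
    have "(1 + 2 * h) * Q \<le> ((1 + 5 * h) * (1 - 2 * h)) * Q"
    proof (rule mult_right_mono[OF _ Q(2)])
      have "10 * (h * h) \<le> h" using mult_right_mono[OF h(2) h(1)] h by simp
      then show "1 + 2 * h \<le> (1 + 5 * h) * (1 - 2 * h)" by (simp add: algebra_simps)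
    qed
    then have "q * (1 - 2 * h) \<le> ((1 + 5 * h) * Q) * (1 - 2 * h)" using q1 by (simp add: algebra_simps)
    then show ?thesis using h by (simp add: mult_le_cancel_right)
  qed
  have hQ: "h * Q \<le> 4 * (K ^ 4 * \<epsilon>)"
    using mult_left_mono[OF Q(1) h(1)] by (simp add: h_def power2_eq_square power4_eq_xxxx)
  have "h * Q \<le> (1/20) * Q" using h Q by (intro mult_right_mono) auto
  then have "q \<le> 5/4 * Q" using qb by (simp add: algebra_simps)
  then have "q \<le> 5/2 * K\<^sup>2" using Q by linarith
  then have "m * q \<le> m * (5/2 * K\<^sup>2)" using e0 by (intro mult_left_mono) (auto simp: m_def)
  then have mq: "m * q \<le> 20 * (K ^ 4 * \<epsilon>)" by (simp add: m_def power2_eq_square power4_eq_xxxx)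
  have K4p: "0 \<le> K ^ 4 * \<epsilon>" using e0 by simp
  \<comment> \<open>Half of 5 h Q is at most 10 K^4 \<epsilon> and m q at most 20 K^4 \<epsilon>,
    together 30.\<close>
  have "q \<le> Q + 5 * (h * Q)" using qb by (simp add: algebra_simps)
  then have ex: "- Q / 2 - 33 * K ^ 4 * \<epsilon> \<le> 0 - q / 2 - m * q" using hQ mq K4p by linarith
  have "exp (0 - q / 2 - m * q) \<le> (\<Prod>i=1..N. 1 + l i)"
    using prod_one_plus_ge[of "{1..N}" l, OF _ bnd half] unfolding sl q_def by simp
  moreover have "(\<Prod>i=1..N. 1 + l i) \<in> el_values N (\<lambda>i. (x i, y i))"
    unfolding el_values_def
  proof (intro CollectI exI conjI ballI)
    let ?w = "\<lambda>i. (1 + l i) / N"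
    show "(\<Prod>i=1..N. 1 + l i) = (\<Prod>i=1..N. real N * ?w i)" using Np by simp
    show "(\<Sum>i=1..N. ?w i) = 1" unfolding sum_divide_distrib[symmetric] sum.distrib sl using Np by simp
    have "(\<Sum>i=1..N. ?w i * x i) = ((\<Sum>i=1..N. x i) + (\<Sum>i=1..N. l i * x i)) / N"
      "(\<Sum>i=1..N. ?w i * y i) = ((\<Sum>i=1..N. y i) + (\<Sum>i=1..N. l i * y i)) / N"
      by (simp_all add: sum_divide_distrib sum.distrib[symmetric] algebra_simps)
    then show "(\<Sum>i=1..N. ?w i *\<^sub>R (x i, y i)) = 0"
      unfolding slx sly by (simp add: prod_eq_iff fst_sum snd_sum)
    fix i assume "i \<in> {1..N}"
    then show "0 \<le> ?w i" using bnd[of i] half by (intro divide_nonneg_nonneg) linarith+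
  qed
  then have "(\<Prod>i=1..N. 1 + l i) \<le> el_ratio N (\<lambda>i. (x i, y i))" by (rule el_ratio_ge)
  ultimately have "exp (0 - q / 2 - m * q) \<le> el_ratio N (\<lambda>i. (x i, y i))" by linarith
  then show ?thesis using ex unfolding Q_def by (smt (verit) exp_le_cancel_iff)
qed

text \<open>Both bounds are multiplicative around a leading term that is at most 1, so exp c - 1
  bounds the absolute error on either side.\<close>

lemma el_ratio_approx:
  "\<bar>el_ratio N (\<lambda>i. (x i, y i)) - exp (- (A\<^sup>2 + B\<^sup>2) / 2)\<bar> \<le> exp (33 * K ^ 4 * \<epsilon>) - 1"
proof -
  let ?c = "33 * K ^ 4 * \<epsilon>" and ?E = "exp (- (A\<^sup>2 + B\<^sup>2) / 2)"
  have E: "0 \<le> ?E" "?E \<le> 1" by auto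
  have "?E * (exp ?c - 1) \<le> 1 * (exp ?c - 1)" using E e0 by (intro mult_right_mono) auto
  then have 1: "?E * exp ?c - ?E \<le> exp ?c - 1" by (simp add: algebra_simps)
  have "?E * (1 - exp (- ?c)) \<le> 1 * (1 - exp (- ?c))" using E e0 by (intro mult_right_mono) auto
  moreover have "1 - exp (- ?c) \<le> exp ?c - 1"
    using exp_ge_add_one_self[of ?c] exp_ge_add_one_self[of "- ?c"] by linarith
  ultimately have 2: "?E - ?E * exp (- ?c) \<le> exp ?c - 1" by (simp add: algebra_simps)
  have "el_ratio N (\<lambda>i. (x i, y i)) \<le> ?E * exp ?c" using el_ratio_upper by (simp add: exp_add)
  moreover have "?E * exp (- ?c) \<le> el_ratio N (\<lambda>i. (x i, y i))" using el_ratio_lower by (simp add: exp_add[symmetric])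
  ultimately show ?thesis using 1 2 by linarith
qed

end

section \<open>Measurability of the empirical likelihood ratio\<close>

text \<open>Tychonoff. Weights are functions on all of \<open>nat\<close>, so the coordinates
  outside the sample range have to be confined as well.\<close>

lemma compact_unit_cube: "compact {w :: nat \<Rightarrow> real. \<forall>i. w i \<in> {0..1}}"
proof -
  have "compactin (product_topology (\<lambda>_. euclidean) UNIV) (PiE UNIV (\<lambda>_::nat. {0..1::real}))"
    by (subst compactin_PiE) auto
  moreover have "PiE UNIV (\<lambda>_::nat. {0..1::real}) = {w. \<forall>i. w i \<in> {0..1}}" by (auto simp: PiE_UNIV_domain)
  ultimately show ?thesis by (simp add: euclidean_product_topology)
qed

text \<open>One point is picked from every basic open set that meets S. A dense set of the ambient
  space would not do, as the points have to lie in S itself.\<close>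

lemma countable_dense_in:
  fixes S :: "'a::second_countable_topology set"
  obtains T where "countable T" "T \<subseteq> S" "S \<subseteq> closure T"
proof -
  obtain B :: "'a set set" where B: "countable B" "topological_basis B"
    using ex_countable_basis by blast
  define pick where "pick b = (SOME x. x \<in> S \<inter> b)" for b
  have pick: "pick b \<in> S \<inter> b" if "S \<inter> b \<noteq> {}" for b
  proof -
    have "\<exists>x. x \<in> S \<inter> b" using that by blast
    then show ?thesis unfolding pick_def by (rule someI_ex)
  qed
  define T where "T = pick ` {b \<in> B. S \<inter> b \<noteq> {}}"
  have "S \<subseteq> closure T"
  proof
    fix x assume x: "x \<in> S"
    show "x \<in> closure T"
      unfolding closure_iff_nhds_not_empty
    proof (intro allI impI)
      fix A U assume U: "U \<subseteq> A" "open U" "x \<in> U"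
      obtain b where b: "b \<in> B" "x \<in> b" "b \<subseteq> U"
        by (rule topological_basisE[OF B(2) U(2) U(3)])
      have ne: "S \<inter> b \<noteq> {}" using x b by blast
      then have "pick b \<in> T" using b unfolding T_def by (intro imageI) simp
      then show "T \<inter> A \<noteq> {}" using pick[OF ne] b U by blast
    qed
  qed
  moreover have "countable T" "T \<subseteq> S" using B(1) pick unfolding T_def by auto
  ultimately show thesis using that by blast
qed

text \<open>The set of weights with likelihood at least \<open>c\<close> is compact and does not depend on \<open>\<omega>\<close>, so
  solvability of the estimating equation can be tested on a countable dense subset.\<close>

lemma sets_el_values_ge:
  assumes R[measurable]: "\<And>i. i \<in> {1..N} \<Longrightarrow> (\<lambda>\<omega>. R \<omega> i :: real \<times> real) \<in> borel_measurable M"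
  shows "{\<omega> \<in> space M. \<exists>v\<in>el_values N (R \<omega>). c \<le> v} \<in> sets M"
proof -
  define K where "K = {w :: nat \<Rightarrow> real. \<forall>i. w i \<in> {0..1}} \<inter>
    ({w. (\<Sum>i=1..N. w i) = 1} \<inter> {w. c \<le> (\<Prod>i=1..N. real N * w i)})"
  have "compact K"
    unfolding K_def
    by (intro compact_Int_closed compact_unit_cube closed_Int closed_Collect_eq closed_Collect_le
        continuous_intros continuous_on_product_coordinates)
  have ex: "(\<exists>v\<in>el_values N (R \<omega>). c \<le> v) \<longleftrightarrow> (\<exists>w\<in>K. (\<Sum>i=1..N. w i *\<^sub>R R \<omega> i) = 0)" for \<omega>
  proof
    assume "\<exists>v\<in>el_values N (R \<omega>). c \<le> v"
    then obtain w where w: "c \<le> (\<Prod>i=1..N. real N * w i)" "(\<Sum>i=1..N. w i) = 1"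
      "(\<Sum>i=1..N. w i *\<^sub>R R \<omega> i) = 0" "\<forall>i\<in>{1..N}. 0 \<le> w i"
      unfolding el_values_def by blast
    \<comment> \<open>Setting the irrelevant coordinates to 0 moves the weights into the compact
      cube and changes neither the likelihood nor the constraint.\<close>
    define u where "u i = (if i \<in> {1..N} then w i else 0)" for i
    have "w i \<le> 1" if "i \<in> {1..N}" for i
      using member_le_sum[of i "{1..N}" w] w that by auto
    moreover have "(\<Sum>i=1..N. u i) = (\<Sum>i=1..N. w i)"
      "(\<Prod>i=1..N. real N * u i) = (\<Prod>i=1..N. real N * w i)"
      "(\<Sum>i=1..N. u i *\<^sub>R R \<omega> i) = (\<Sum>i=1..N. w i *\<^sub>R R \<omega> i)"
      by (auto simp: u_def intro!: sum.cong prod.cong)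
    moreover have "\<forall>i. u i \<in> {0..1}" using w(4) calculation(1) by (auto simp: u_def)
    ultimately have "u \<in> K" "(\<Sum>i=1..N. u i *\<^sub>R R \<omega> i) = 0" using w(1-3) unfolding K_def by simp_all
    then show "\<exists>w\<in>K. (\<Sum>i=1..N. w i *\<^sub>R R \<omega> i) = 0" by blast
  qed (auto simp: K_def el_values_def)
  obtain T where T: "countable T" "T \<subseteq> K" "K \<subseteq> closure T" by (rule countable_dense_in)
  have cont: "continuous_on UNIV (\<lambda>w. norm (\<Sum>i=1..N. w i *\<^sub>R R \<omega> i))" for \<omega>
    by (intro continuous_intros continuous_on_product_coordinates)
  \<comment> \<open>From right to left, the minimum of the norm over the compact \<open>K\<close> is
    attained, and arbitrarily small values on \<open>T\<close> force it to be 0. The right-hand side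
    is a countable combination of events.\<close>
  have dense: "(\<exists>w\<in>K. (\<Sum>i=1..N. w i *\<^sub>R R \<omega> i) = 0) \<longleftrightarrow>
      (\<forall>k::nat. \<exists>w\<in>T. norm (\<Sum>i=1..N. w i *\<^sub>R R \<omega> i) < 1 / Suc k)" (is "?L \<longleftrightarrow> ?R") for \<omega>
  proof
    assume ?L
    then obtain w where w: "w \<in> K" "(\<Sum>i=1..N. w i *\<^sub>R R \<omega> i) = 0" by blast
    show ?R
    proof
      fix k :: nat
      have "open {w. norm (\<Sum>i=1..N. w i *\<^sub>R R \<omega> i) < 1 / Suc k}"
        by (rule open_Collect_less[OF cont]) (rule continuous_on_const)
      moreover have "w \<in> {w. norm (\<Sum>i=1..N. w i *\<^sub>R R \<omega> i) < 1 / Suc k}" using w by simp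
      moreover have "w \<in> closure T" using w T by blast
      ultimately show "\<exists>w\<in>T. norm (\<Sum>i=1..N. w i *\<^sub>R R \<omega> i) < 1 / Suc k"
        unfolding closure_iff_nhds_not_empty by blast
    qed
  next
    assume R: ?R
    then have "K \<noteq> {}" using T by blast
    then obtain w where w: "w \<in> K"
      "\<And>u. u \<in> K \<Longrightarrow> norm (\<Sum>i=1..N. w i *\<^sub>R R \<omega> i) \<le> norm (\<Sum>i=1..N. u i *\<^sub>R R \<omega> i)"
      using continuous_attains_inf[OF \<open>compact K\<close> _ continuous_on_subset[OF cont subset_UNIV]] by metis
    have lt: "norm (\<Sum>i=1..N. w i *\<^sub>R R \<omega> i) < 1 / Suc k" for k
    proof -
      obtain u where "u \<in> T" "norm (\<Sum>i=1..N. u i *\<^sub>R R \<omega> i) < 1 / Suc k" using R by blast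
      then show ?thesis using w(2)[of u] T(2) by auto
    qed
    have "\<not> 0 < norm (\<Sum>i=1..N. w i *\<^sub>R R \<omega> i)"
    proof
      assume "0 < norm (\<Sum>i=1..N. w i *\<^sub>R R \<omega> i)"
      then obtain k where "1 / Suc k < norm (\<Sum>i=1..N. w i *\<^sub>R R \<omega> i)" by (rule nat_approx_posE)
      then show False using lt[of k] by linarith
    qed
    then show ?L using w(1) by (intro bexI[of _ w]) simp_all
  qed
  show ?thesis
    unfolding ex dense
  proof (intro sets.sets_Collect_countable_All sets.sets_Collect_countable_Ex'[OF _ T(1)])
    fix k :: nat and w
    have "(\<lambda>\<omega>. \<Sum>i=1..N. w i *\<^sub>R R \<omega> i) \<in> borel_measurable M"
      by (intro borel_measurable_sum borel_measurable_scaleR borel_measurable_const R)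
    from measurable_compose[OF this borel_measurable_norm] show "{\<omega> \<in> space M. norm (\<Sum>i=1..N. w i *\<^sub>R R \<omega> i) < 1 / Suc k} \<in> sets M"
      by (rule borel_measurable_less[OF _ borel_measurable_const])
  qed
qed

lemma borel_measurable_el_ratio:
  assumes R: "\<And>i. i \<in> {1..N} \<Longrightarrow> (\<lambda>\<omega>. R \<omega> i) \<in> borel_measurable M"
  shows "(\<lambda>\<omega>. el_ratio N (R \<omega>)) \<in> borel_measurable M"
  unfolding borel_measurable_iff_greater
proof
  fix c :: real
  show "{\<omega> \<in> space M. c < el_ratio N (R \<omega>)} \<in> sets M"
  proof (cases "c < 0")
    case True
    then have "{\<omega> \<in> space M. c < el_ratio N (R \<omega>)} = space M"
      by (auto intro: less_le_trans[OF _ el_ratio_nonneg])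
    then show ?thesis by simp
  next
    case False
    \<comment> \<open>Here c >= 0, so an infeasible sample, whose ratio is 0 by convention, fails
      both sides.\<close>
    have "c < el_ratio N (R \<omega>) \<longleftrightarrow> (\<exists>m::nat. \<exists>v\<in>el_values N (R \<omega>). c + 1 / Suc m \<le> v)" for \<omega>
    proof
      assume c: "c < el_ratio N (R \<omega>)"
      then have "el_values N (R \<omega>) \<noteq> {}" using False by (auto simp: el_ratio_def)
      then obtain v where v: "v \<in> el_values N (R \<omega>)" "c < v"
        using c less_cSup_iff[OF _ bdd_above_el_values] by (auto simp: el_ratio_def)
      then have "0 < v - c" by simp
      then obtain m where "1 / Suc m < v - c" by (rule nat_approx_posE)
      then show "\<exists>m::nat. \<exists>v\<in>el_values N (R \<omega>). c + 1 / Suc m \<le> v"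
        using v by (intro exI[of _ m] bexI[of _ v]) auto
    next
      assume "\<exists>m::nat. \<exists>v\<in>el_values N (R \<omega>). c + 1 / Suc m \<le> v"
      then obtain m :: nat and v where "v \<in> el_values N (R \<omega>)" "c + 1 / Suc m \<le> v" by blast
      moreover have "0 < 1 / real (Suc m)" by simp
      ultimately show "c < el_ratio N (R \<omega>)" using el_ratio_ge[of v N "R \<omega>"] by linarith
    qed
    then show ?thesis
      by (simp only:) (intro sets.sets_Collect_countable_Ex sets_el_values_ge R)
  qed
qed

lemma borel_measurable_neg2log: "neg2log \<in> borel_measurable borel"
  unfolding neg2log_def
proof (rule measurable_If)
  have "(\<lambda>l::real. - 2 * ln l) \<in> borel_measurable borel" by measurable
  then show "(\<lambda>l::real. ereal (- 2 * ln l)) \<in> borel_measurable borel" by (rule borel_measurable_ereal)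
  show "{l \<in> space borel. (l::real) = 0} \<in> sets borel" by simp
qed simp

section \<open>Convergence in probability and tightness along a sequence of spaces\<close>

text \<open>The o_P(1) of statistics, for probability spaces that change with n. Measurability is
  required for every n so that the exceedance sets are events without side conditions; only the
  probabilities are asymptotic.\<close>

definition op1 :: "(nat \<Rightarrow> 'a measure) \<Rightarrow> (nat \<Rightarrow> 'a \<Rightarrow> real) \<Rightarrow> bool" where
  "op1 M f \<longleftrightarrow> (\<forall>n. f n \<in> borel_measurable (M n)) \<and>
     (\<forall>\<epsilon>>0. (\<lambda>n. measure (M n) {\<omega> \<in> space (M n). \<epsilon> < \<bar>f n \<omega>\<bar>}) \<longlonglongrightarrow> 0)"

text \<open>The O_P(1). The bound is asked only eventually, since the moment bounds behind it hold
  only for large n.\<close>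

definition tight_rv :: "(nat \<Rightarrow> 'a measure) \<Rightarrow> (nat \<Rightarrow> 'a \<Rightarrow> real) \<Rightarrow> bool" where
  "tight_rv M f \<longleftrightarrow> (\<forall>n. f n \<in> borel_measurable (M n)) \<and>
     (\<forall>\<eta>>0. \<exists>K. eventually (\<lambda>n. measure (M n) {\<omega> \<in> space (M n). K < \<bar>f n \<omega>\<bar>} \<le> \<eta>) sequentially)"

locale prob_seq =
  fixes M :: "nat \<Rightarrow> 'a measure"
  assumes prob_M: "\<And>n. prob_space (M n)"
begin

lemma measure_M_mono: "A \<subseteq> B \<Longrightarrow> B \<in> sets (M n) \<Longrightarrow> measure (M n) A \<le> measure (M n) B"
  using finite_measure.finite_measure_mono[OF prob_space.axioms(1)[OF prob_M]] .

lemma measure_M_Un: "A \<in> sets (M n) \<Longrightarrow> B \<in> sets (M n) \<Longrightarrow> measure (M n) (A \<union> B) \<le> measure (M n) A + measure (M n) B"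
  by (rule measure_Un_le)

lemma sets_gt: "f n \<in> borel_measurable (M n) \<Longrightarrow> {\<omega> \<in> space (M n). \<epsilon> < \<bar>f n \<omega> :: real\<bar>} \<in> sets (M n)"
  by measurable

lemma op1_meas: "op1 M f \<Longrightarrow> f n \<in> borel_measurable (M n)" by (simp add: op1_def)

lemma op1D: "op1 M f \<Longrightarrow> 0 < \<epsilon> \<Longrightarrow> (\<lambda>n. measure (M n) {\<omega> \<in> space (M n). \<epsilon> < \<bar>f n \<omega>\<bar>}) \<longlonglongrightarrow> 0"
  by (simp add: op1_def)

lemma op1_ev: "op1 M f \<Longrightarrow> 0 < \<epsilon> \<Longrightarrow> 0 < \<eta> \<Longrightarrow>
    eventually (\<lambda>n. measure (M n) {\<omega> \<in> space (M n). \<epsilon> < \<bar>f n \<omega>\<bar>} < \<eta>) sequentially"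
  using order_tendstoD(2)[OF op1D] by blast

lemma op1I:
  assumes "\<And>n. f n \<in> borel_measurable (M n)"
    and "\<And>\<epsilon> \<eta>. 0 < \<epsilon> \<Longrightarrow> 0 < \<eta> \<Longrightarrow>
      eventually (\<lambda>n. measure (M n) {\<omega> \<in> space (M n). \<epsilon> < \<bar>f n \<omega>\<bar>} \<le> \<eta>) sequentially"
  shows "op1 M f"
  unfolding op1_def
proof (intro conjI allI impI assms(1))
  fix \<epsilon> :: real assume \<epsilon>: "0 < \<epsilon>"
  show "(\<lambda>n. measure (M n) {\<omega> \<in> space (M n). \<epsilon> < \<bar>f n \<omega>\<bar>}) \<longlonglongrightarrow> 0"
  proof (rule tendstoI)
    fix e :: real assume "0 < e"
    then have "eventually (\<lambda>n. measure (M n) {\<omega> \<in> space (M n). \<epsilon> < \<bar>f n \<omega>\<bar>} \<le> e / 2) sequentially"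
      using assms(2)[OF \<epsilon>, of "e/2"] by simp
    then show "eventually (\<lambda>n. dist (measure (M n) {\<omega> \<in> space (M n). \<epsilon> < \<bar>f n \<omega>\<bar>}) 0 < e) sequentially"
      by eventually_elim (use \<open>0 < e\<close> in simp)
  qed
qed

lemma op1_mono:
  assumes f: "op1 M f" and g: "\<And>n. g n \<in> borel_measurable (M n)"
    and le: "eventually (\<lambda>n. \<forall>\<omega>\<in>space (M n). \<bar>g n \<omega>\<bar> \<le> \<bar>f n \<omega>\<bar>) sequentially"
  shows "op1 M g"
proof (rule op1I[OF g])
  fix \<epsilon> \<eta> :: real assume "0 < \<epsilon>" "0 < \<eta>"
  from op1_ev[OF f this] le
  show "eventually (\<lambda>n. measure (M n) {\<omega> \<in> space (M n). \<epsilon> < \<bar>g n \<omega>\<bar>} \<le> \<eta>) sequentially"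
  proof eventually_elim
    case (elim n)
    have "measure (M n) {\<omega> \<in> space (M n). \<epsilon> < \<bar>g n \<omega>\<bar>} \<le> measure (M n) {\<omega> \<in> space (M n). \<epsilon> < \<bar>f n \<omega>\<bar>}"
      using elim(2) by (intro measure_M_mono sets_gt op1_meas[OF f]) force
    then show ?case using elim(1) by linarith
  qed
qed

lemma op1_add:
  assumes f: "op1 M f" and g: "op1 M g"
  shows "op1 M (\<lambda>n \<omega>. f n \<omega> + g n \<omega>)"
proof (rule op1I)
  show "(\<lambda>\<omega>. f n \<omega> + g n \<omega>) \<in> borel_measurable (M n)" for n
    using op1_meas[OF f, of n] op1_meas[OF g, of n] by measurable
  fix \<epsilon> \<eta> :: real assume "0 < \<epsilon>" "0 < \<eta>"
  then have h: "0 < \<epsilon>/2" "0 < \<eta>/2" by auto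
  from op1_ev[OF f h] op1_ev[OF g h]
  show "eventually (\<lambda>n. measure (M n) {\<omega> \<in> space (M n). \<epsilon> < \<bar>f n \<omega> + g n \<omega>\<bar>} \<le> \<eta>) sequentially"
  proof eventually_elim
    case (elim n)
    have "measure (M n) {\<omega> \<in> space (M n). \<epsilon> < \<bar>f n \<omega> + g n \<omega>\<bar>} \<le>
        measure (M n) ({\<omega> \<in> space (M n). \<epsilon>/2 < \<bar>f n \<omega>\<bar>} \<union> {\<omega> \<in> space (M n). \<epsilon>/2 < \<bar>g n \<omega>\<bar>})"
      by (intro measure_M_mono sets.Un sets_gt op1_meas[OF f] op1_meas[OF g]) (auto simp: abs_if split: if_splits)
    also have "\<dots> \<le> measure (M n) {\<omega> \<in> space (M n). \<epsilon>/2 < \<bar>f n \<omega>\<bar>} + measure (M n) {\<omega> \<in> space (M n). \<epsilon>/2 < \<bar>g n \<omega>\<bar>}"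
      by (intro measure_M_Un sets_gt op1_meas[OF f] op1_meas[OF g])
    finally show ?case using elim by linarith
  qed
qed

lemma op1_mult_tight:
  assumes f: "tight_rv M f" and g: "op1 M g"
  shows "op1 M (\<lambda>n \<omega>. f n \<omega> * g n \<omega>)"
proof (rule op1I)
  have fm: "f n \<in> borel_measurable (M n)" for n using f by (simp add: tight_rv_def)
  show "(\<lambda>\<omega>. f n \<omega> * g n \<omega>) \<in> borel_measurable (M n)" for n
    using fm[of n] op1_meas[OF g, of n] by measurable
  fix \<epsilon> \<eta> :: real assume e: "0 < \<epsilon>" "0 < \<eta>"
  then have "0 < \<eta>/2" by auto
  then obtain K where K: "eventually (\<lambda>n. measure (M n) {\<omega> \<in> space (M n). K < \<bar>f n \<omega>\<bar>} \<le> \<eta>/2) sequentially"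
    using f unfolding tight_rv_def by blast
  define K' where "K' = max K 1"
  have K': "K \<le> K'" "1 \<le> K'" by (auto simp: K'_def)
  have h: "0 < \<epsilon> / K'" "0 < \<eta>/2" using e K' by auto
  from K op1_ev[OF g h]
  show "eventually (\<lambda>n. measure (M n) {\<omega> \<in> space (M n). \<epsilon> < \<bar>f n \<omega> * g n \<omega>\<bar>} \<le> \<eta>) sequentially"
  proof eventually_elim
    case (elim n)
    have "measure (M n) {\<omega> \<in> space (M n). \<epsilon> < \<bar>f n \<omega> * g n \<omega>\<bar>} \<le>
        measure (M n) ({\<omega> \<in> space (M n). K < \<bar>f n \<omega>\<bar>} \<union> {\<omega> \<in> space (M n). \<epsilon> / K' < \<bar>g n \<omega>\<bar>})"
    proof (intro measure_M_mono sets.Un sets_gt fm op1_meas[OF g] subsetI)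
      fix \<omega> assume \<omega>: "\<omega> \<in> {\<omega> \<in> space (M n). \<epsilon> < \<bar>f n \<omega> * g n \<omega>\<bar>}"
      show "\<omega> \<in> {\<omega> \<in> space (M n). K < \<bar>f n \<omega>\<bar>} \<union> {\<omega> \<in> space (M n). \<epsilon> / K' < \<bar>g n \<omega>\<bar>}"
      proof (rule ccontr)
        assume "\<not> ?thesis"
        then have "\<bar>f n \<omega>\<bar> \<le> K'" "\<bar>g n \<omega>\<bar> \<le> \<epsilon> / K'" using \<omega> K' by auto
        then have "\<bar>f n \<omega> * g n \<omega>\<bar> \<le> K' * (\<epsilon> / K')" unfolding abs_mult using K' by (intro mult_mono) auto
        then show False using \<omega> K' by simp
      qed
    qed
    also have "\<dots> \<le> measure (M n) {\<omega> \<in> space (M n). K < \<bar>f n \<omega>\<bar>} + measure (M n) {\<omega> \<in> space (M n). \<epsilon> / K' < \<bar>g n \<omega>\<bar>}"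
      by (intro measure_M_Un sets_gt fm op1_meas[OF g])
    finally show ?case using elim by linarith
  qed
qed

lemma tight_rv_mono:
  assumes f: "tight_rv M f" and g: "\<And>n. g n \<in> borel_measurable (M n)"
    and le: "eventually (\<lambda>n. \<forall>\<omega>\<in>space (M n). \<bar>g n \<omega>\<bar> \<le> \<bar>f n \<omega>\<bar>) sequentially"
  shows "tight_rv M g"
  unfolding tight_rv_def
proof (intro conjI allI impI g)
  fix \<eta> :: real assume "0 < \<eta>"
  then obtain K where K: "eventually (\<lambda>n. measure (M n) {\<omega> \<in> space (M n). K < \<bar>f n \<omega>\<bar>} \<le> \<eta>) sequentially"
    using f unfolding tight_rv_def by blast
  from K le have "eventually (\<lambda>n. measure (M n) {\<omega> \<in> space (M n). K < \<bar>g n \<omega>\<bar>} \<le> \<eta>) sequentially"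
  proof eventually_elim
    case (elim n)
    have "measure (M n) {\<omega> \<in> space (M n). K < \<bar>g n \<omega>\<bar>} \<le> measure (M n) {\<omega> \<in> space (M n). K < \<bar>f n \<omega>\<bar>}"
      using elim(2) f by (intro measure_M_mono sets_gt) (force simp: tight_rv_def)+
    then show ?case using elim(1) by linarith
  qed
  then show "\<exists>K. eventually (\<lambda>n. measure (M n) {\<omega> \<in> space (M n). K < \<bar>g n \<omega>\<bar>} \<le> \<eta>) sequentially" by blast
qed

lemma tight_rv_add_op1:
  assumes f: "tight_rv M f" and g: "op1 M g"
  shows "tight_rv M (\<lambda>n \<omega>. f n \<omega> + g n \<omega>)"
  unfolding tight_rv_def
proof (intro conjI allI impI)
  have fm: "f n \<in> borel_measurable (M n)" for n using f by (simp add: tight_rv_def)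
  show "(\<lambda>\<omega>. f n \<omega> + g n \<omega>) \<in> borel_measurable (M n)" for n
    using fm[of n] op1_meas[OF g, of n] by measurable
  fix \<eta> :: real assume e: "0 < \<eta>"
  then have e2: "0 < \<eta>/2" by auto
  then obtain K where K: "eventually (\<lambda>n. measure (M n) {\<omega> \<in> space (M n). K < \<bar>f n \<omega>\<bar>} \<le> \<eta>/2) sequentially"
    using f unfolding tight_rv_def by blast
  from K op1_ev[OF g zero_less_one e2]
  have "eventually (\<lambda>n. measure (M n) {\<omega> \<in> space (M n). K + 1 < \<bar>f n \<omega> + g n \<omega>\<bar>} \<le> \<eta>) sequentially"
  proof eventually_elim
    case (elim n)
    have "measure (M n) {\<omega> \<in> space (M n). K + 1 < \<bar>f n \<omega> + g n \<omega>\<bar>} \<le>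
        measure (M n) ({\<omega> \<in> space (M n). K < \<bar>f n \<omega>\<bar>} \<union> {\<omega> \<in> space (M n). 1 < \<bar>g n \<omega>\<bar>})"
      by (intro measure_M_mono sets.Un sets_gt fm op1_meas[OF g]) (auto simp: abs_if split: if_splits)
    also have "\<dots> \<le> measure (M n) {\<omega> \<in> space (M n). K < \<bar>f n \<omega>\<bar>} + measure (M n) {\<omega> \<in> space (M n). 1 < \<bar>g n \<omega>\<bar>}"
      by (intro measure_M_Un sets_gt fm op1_meas[OF g])
    finally show ?case using elim by linarith
  qed
  then show "\<exists>K. eventually (\<lambda>n. measure (M n) {\<omega> \<in> space (M n). K < \<bar>f n \<omega> + g n \<omega>\<bar>} \<le> \<eta>) sequentially" by blast
qed

lemma tight_rv_const: "tight_rv M (\<lambda>n \<omega>. c)"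
  unfolding tight_rv_def
proof (intro conjI allI impI)
  fix \<eta> :: real assume "0 < \<eta>"
  then show "\<exists>K. eventually (\<lambda>n. measure (M n) {\<omega> \<in> space (M n). K < \<bar>c\<bar>} \<le> \<eta>) sequentially"
    by (intro exI[of _ "\<bar>c\<bar>"]) auto
qed simp

lemma op1_cmult: "op1 M f \<Longrightarrow> op1 M (\<lambda>n \<omega>. c * f n \<omega>)"
  by (rule op1_mult_tight[OF tight_rv_const])

lemma op1_sqrt:
  assumes f: "op1 M f"
  shows "op1 M (\<lambda>n \<omega>. sqrt \<bar>f n \<omega>\<bar>)"
proof (rule op1I)
  show "(\<lambda>\<omega>. sqrt \<bar>f n \<omega>\<bar>) \<in> borel_measurable (M n)" for n using op1_meas[OF f, of n] by measurable
  fix \<epsilon> \<eta> :: real assume e: "0 < \<epsilon>" "0 < \<eta>"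
  then have "0 < \<epsilon>\<^sup>2" by simp
  from op1_ev[OF f this e(2)]
  show "eventually (\<lambda>n. measure (M n) {\<omega> \<in> space (M n). \<epsilon> < \<bar>sqrt \<bar>f n \<omega>\<bar>\<bar>} \<le> \<eta>) sequentially"
  proof eventually_elim
    case (elim n)
    have "measure (M n) {\<omega> \<in> space (M n). \<epsilon> < \<bar>sqrt \<bar>f n \<omega>\<bar>\<bar>} \<le> measure (M n) {\<omega> \<in> space (M n). \<epsilon>\<^sup>2 < \<bar>f n \<omega>\<bar>}"
    proof (intro measure_M_mono sets_gt op1_meas[OF f] subsetI)
      fix \<omega> assume \<omega>: "\<omega> \<in> {\<omega> \<in> space (M n). \<epsilon> < \<bar>sqrt \<bar>f n \<omega>\<bar>\<bar>}"
      then have "\<epsilon>\<^sup>2 < (sqrt \<bar>f n \<omega>\<bar>)\<^sup>2" using e by (intro power_strict_mono) auto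
      then show "\<omega> \<in> {\<omega> \<in> space (M n). \<epsilon>\<^sup>2 < \<bar>f n \<omega>\<bar>}" using \<omega> by simp
    qed
    then show ?case using elim by linarith
  qed
qed

lemma markov_abs:
  assumes "integrable (M n) f" "0 < \<epsilon>"
  shows "measure (M n) {\<omega> \<in> space (M n). \<epsilon> < \<bar>f \<omega> :: real\<bar>} \<le> (\<integral>\<omega>. \<bar>f \<omega>\<bar> \<partial>M n) / \<epsilon>"
proof -
  have "measure (M n) {\<omega> \<in> space (M n). \<epsilon> < \<bar>f \<omega>\<bar>} \<le> measure (M n) {\<omega> \<in> space (M n). \<epsilon> \<le> \<bar>f \<omega>\<bar>}"
    using assms by (intro measure_M_mono) auto
  also have "\<dots> \<le> (\<integral>\<omega>. \<bar>f \<omega>\<bar> \<partial>M n) / \<epsilon>"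
    using assms by (intro integral_Markov_inequality_measure[where A = "{}"]) auto
  finally show ?thesis .
qed

lemma op1_of_L1:
  assumes f: "\<And>n. f n \<in> borel_measurable (M n)"
    and int: "eventually (\<lambda>n. integrable (M n) (f n) \<and> (\<integral>\<omega>. \<bar>f n \<omega>\<bar> \<partial>M n) \<le> c n) sequentially"
    and lim: "c \<longlonglongrightarrow> 0"
  shows "op1 M f"
proof (rule op1I[OF f])
  fix \<epsilon> \<eta> :: real assume e: "0 < \<epsilon>" "0 < \<eta>"
  then have "eventually (\<lambda>n. c n < \<epsilon> * \<eta>) sequentially" using lim by (intro order_tendstoD(2)) auto
  with int show "eventually (\<lambda>n. measure (M n) {\<omega> \<in> space (M n). \<epsilon> < \<bar>f n \<omega>\<bar>} \<le> \<eta>) sequentially"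
  proof eventually_elim
    case (elim n)
    have "measure (M n) {\<omega> \<in> space (M n). \<epsilon> < \<bar>f n \<omega>\<bar>} \<le> (\<integral>\<omega>. \<bar>f n \<omega>\<bar> \<partial>M n) / \<epsilon>"
      using elim e by (intro markov_abs) auto
    also have "\<dots> \<le> \<epsilon> * \<eta> / \<epsilon>" using elim e by (intro divide_right_mono) auto
    finally show ?case using e by simp
  qed
qed

lemma op1_of_L2:
  assumes f: "\<And>n. f n \<in> borel_measurable (M n)"
    and int: "eventually (\<lambda>n. integrable (M n) (\<lambda>\<omega>. (f n \<omega>)\<^sup>2) \<and> (\<integral>\<omega>. (f n \<omega>)\<^sup>2 \<partial>M n) \<le> c n) sequentially"
    and lim: "c \<longlonglongrightarrow> 0"
  shows "op1 M f"
proof -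
  have "op1 M (\<lambda>n \<omega>. (f n \<omega>)\<^sup>2)"
    using assms by (intro op1_of_L1[OF _ _ lim]) auto
  from op1_mono[OF op1_sqrt[OF this] f] show ?thesis by simp
qed

lemma tight_rv_of_L2:
  assumes f: "\<And>n. f n \<in> borel_measurable (M n)"
    and int: "eventually (\<lambda>n. integrable (M n) (\<lambda>\<omega>. (f n \<omega>)\<^sup>2) \<and> (\<integral>\<omega>. (f n \<omega>)\<^sup>2 \<partial>M n) \<le> c) sequentially"
  shows "tight_rv M f"
  unfolding tight_rv_def
proof (intro conjI allI impI f)
  fix \<eta> :: real assume e: "0 < \<eta>"
  define K where "K = sqrt ((\<bar>c\<bar> + 1) / \<eta>)"
  have K: "0 < K" "K\<^sup>2 = (\<bar>c\<bar> + 1) / \<eta>" using e by (auto simp: K_def)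
  from int have "eventually (\<lambda>n. measure (M n) {\<omega> \<in> space (M n). K < \<bar>f n \<omega>\<bar>} \<le> \<eta>) sequentially"
  proof eventually_elim
    case (elim n)
    have "{\<omega> \<in> space (M n). K < \<bar>f n \<omega>\<bar>} \<subseteq> {\<omega> \<in> space (M n). K\<^sup>2 < \<bar>(f n \<omega>)\<^sup>2\<bar>}"
    proof safe
      fix \<omega> assume "K < \<bar>f n \<omega>\<bar>"
      then have "K\<^sup>2 < \<bar>f n \<omega>\<bar>\<^sup>2" using K by (intro power_strict_mono) auto
      then show "K\<^sup>2 < \<bar>(f n \<omega>)\<^sup>2\<bar>" by simp
    qed
    then have "measure (M n) {\<omega> \<in> space (M n). K < \<bar>f n \<omega>\<bar>} \<le> measure (M n) {\<omega> \<in> space (M n). K\<^sup>2 < \<bar>(f n \<omega>)\<^sup>2\<bar>}"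
      using f by (intro measure_M_mono) auto
    also have "\<dots> \<le> (\<integral>\<omega>. \<bar>(f n \<omega>)\<^sup>2\<bar> \<partial>M n) / K\<^sup>2"
      using elim zero_less_power[OF K(1), of 2] by (intro markov_abs) auto
    also have "\<dots> \<le> (\<bar>c\<bar> + 1) / K\<^sup>2" using elim by (intro divide_right_mono) auto
    also have "\<dots> = \<eta>" using e unfolding K(2) by simp
    finally show ?case .
  qed
  then show "\<exists>K. eventually (\<lambda>n. measure (M n) {\<omega> \<in> space (M n). K < \<bar>f n \<omega>\<bar>} \<le> \<eta>) sequentially" by blast
qed

lemma op1_bounded_integral:
  assumes f: "op1 M f" and b: "\<And>n \<omega>. \<omega> \<in> space (M n) \<Longrightarrow> \<bar>f n \<omega>\<bar> \<le> B"
  shows "(\<lambda>n. \<integral>\<omega>. \<bar>f n \<omega>\<bar> \<partial>M n) \<longlonglongrightarrow> 0"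
proof (rule tendstoI)
  fix e :: real assume e: "0 < e"
  have B: "0 \<le> \<bar>B\<bar> + 1" by simp
  have h: "0 < e/2" "0 < e / (2 * (\<bar>B\<bar> + 1))" using e by auto
  from op1_ev[OF f h]
  show "eventually (\<lambda>n. dist (\<integral>\<omega>. \<bar>f n \<omega>\<bar> \<partial>M n) 0 < e) sequentially"
  proof eventually_elim
    case (elim n)
    interpret prob_space "M n" by (rule prob_M)
    have [measurable]: "f n \<in> borel_measurable (M n)" using f by (rule op1_meas)
    let ?A = "{\<omega> \<in> space (M n). e/2 < \<bar>f n \<omega>\<bar>}"
    have [measurable]: "?A \<in> sets (M n)" by measurable
    have i1: "integrable (M n) (f n)" by (rule integrable_const_bound[where B = B]) (use b in auto)
    have "(\<integral>\<omega>. \<bar>f n \<omega>\<bar> \<partial>M n) \<le> (\<integral>\<omega>. e/2 + (\<bar>B\<bar> + 1) * indicator ?A \<omega> \<partial>M n)"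
    proof (rule integral_mono)
      fix \<omega> assume \<omega>: "\<omega> \<in> space (M n)"
      show "\<bar>f n \<omega>\<bar> \<le> e/2 + (\<bar>B\<bar> + 1) * indicator ?A \<omega>"
        using b[OF \<omega>] e \<omega> by (auto simp: indicator_def)
    qed (use i1 in \<open>auto simp: emeasure_eq_measure\<close>)
    also have "\<dots> = e/2 + (\<bar>B\<bar> + 1) * measure (M n) ?A"
      by (simp add: prob_space emeasure_eq_measure)
    also have "\<dots> < e/2 + (\<bar>B\<bar> + 1) * (e / (2 * (\<bar>B\<bar> + 1)))"
      using elim by (intro add_strict_left_mono mult_strict_left_mono) auto
    also have "\<dots> = e" by (simp add: field_simps)
    finally show ?case by (simp add: integral_nonneg_AE)
  qed
qed

end

section \<open>The empirical likelihood ratio of a triangular array\<close>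

context prob_seq
begin

lemma integral_bdd_cont:
  assumes "prob_space P" and L[measurable]: "L \<in> borel_measurable P"
    and b: "\<And>\<omega>. \<omega> \<in> space P \<Longrightarrow> L \<omega> \<in> {0..1}" and g: "continuous_on UNIV (g :: real \<Rightarrow> real)"
  shows "integrable P (\<lambda>\<omega>. g (L \<omega>))"
proof -
  interpret prob_space P by fact
  have gm[measurable]: "g \<in> borel_measurable borel" using g by (rule borel_measurable_continuous_onI)
  have "compact (g ` {0..1})"
    by (rule compact_continuous_image[OF continuous_on_subset[OF g]]) auto
  then have "bounded (g ` {0..1})" by (rule compact_imp_bounded)
  then obtain B where "\<forall>y\<in>g ` {0..1}. norm y \<le> B" unfolding bounded_iff by (rule exE)
  then have B: "\<And>y. y \<in> g ` {0..1} \<Longrightarrow> norm y \<le> B" by (rule bspec)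
  show ?thesis
    by (rule integrable_const_bound[where B = B]) (use b B in auto)
qed

text \<open>The Hausdorff moment problem is determinate: polynomials are dense in \<open>C[0,1]\<close>.\<close>

lemma moments_imp_integral_conv:
  assumes L[measurable]: "\<And>n. L n \<in> borel_measurable (M n)"
    and L01: "\<And>n \<omega>. \<omega> \<in> space (M n) \<Longrightarrow> L n \<omega> \<in> {0..1}"
    and P: "prob_space P" and Z[measurable]: "Z \<in> borel_measurable P"
    and Z01: "\<And>\<omega>. \<omega> \<in> space P \<Longrightarrow> Z \<omega> \<in> {0..1}"
    and mom: "\<And>k::nat. (\<lambda>n. \<integral>\<omega>. L n \<omega> ^ k \<partial>M n) \<longlonglongrightarrow> (\<integral>\<omega>. Z \<omega> ^ k \<partial>P)"
    and g: "continuous_on UNIV (g :: real \<Rightarrow> real)"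
  shows "(\<lambda>n. \<integral>\<omega>. g (L n \<omega>) \<partial>M n) \<longlonglongrightarrow> (\<integral>\<omega>. g (Z \<omega>) \<partial>P)"
proof (rule tendstoI)
  fix e :: real assume e: "0 < e"
  obtain h where h: "real_polynomial_function h" "\<And>x. x \<in> {0..1} \<Longrightarrow> \<bar>g x - h x\<bar> < e/3"
    using Stone_Weierstrass_real_polynomial_function[of "{0..1::real}" g "e/3"] e continuous_on_subset[OF g]
    by auto
  obtain a m where hs: "h = (\<lambda>x. \<Sum>i\<le>m. a i * x ^ i)" using h(1) by (auto simp: real_polynomial_function_iff_sum)
  have hc: "continuous_on UNIV h" unfolding hs by (intro continuous_intros)
  have powc: "continuous_on UNIV (\<lambda>x::real. x ^ i)" for i by (intro continuous_intros)
  have close: "\<bar>(\<integral>\<omega>. g (X \<omega>) \<partial>Q) - (\<integral>\<omega>. h (X \<omega>) \<partial>Q)\<bar> \<le> e/3"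
    if Q: "prob_space Q" and X: "X \<in> borel_measurable Q" "\<And>\<omega>. \<omega> \<in> space Q \<Longrightarrow> X \<omega> \<in> {0..1}" for Q and X :: "_ \<Rightarrow> real"
  proof -
    interpret Q: prob_space Q by fact
    note ig = integral_bdd_cont[OF Q X g] and ih = integral_bdd_cont[OF Q X hc]
    have "\<bar>(\<integral>\<omega>. g (X \<omega>) \<partial>Q) - (\<integral>\<omega>. h (X \<omega>) \<partial>Q)\<bar> = \<bar>\<integral>\<omega>. g (X \<omega>) - h (X \<omega>) \<partial>Q\<bar>"
      using ig ih by simp
    also have "\<dots> \<le> (\<integral>\<omega>. \<bar>g (X \<omega>) - h (X \<omega>)\<bar> \<partial>Q)" by (rule integral_abs_bound)
    also have "\<dots> \<le> (\<integral>\<omega>. e/3 \<partial>Q)"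
      using ig ih h(2) X(2) by (intro integral_mono) (auto intro: less_imp_le)
    finally show ?thesis by (simp add: Q.prob_space)
  qed
  have hi: "(\<integral>\<omega>. h (X \<omega>) \<partial>Q) = (\<Sum>i\<le>m. a i * (\<integral>\<omega>. X \<omega> ^ i \<partial>Q))"
    if Q: "prob_space Q" and X: "X \<in> borel_measurable Q" "\<And>\<omega>. \<omega> \<in> space Q \<Longrightarrow> X \<omega> \<in> {0..1}" for Q and X :: "_ \<Rightarrow> real"
    unfolding hs using integral_bdd_cont[OF Q X powc] by (simp add: Bochner_Integration.integral_sum)
  have "(\<lambda>n. \<integral>\<omega>. h (L n \<omega>) \<partial>M n) \<longlonglongrightarrow> (\<integral>\<omega>. h (Z \<omega>) \<partial>P)"
  proof -
    have "(\<lambda>n. \<integral>\<omega>. h (L n \<omega>) \<partial>M n) = (\<lambda>n. \<Sum>i\<le>m. a i * (\<integral>\<omega>. L n \<omega> ^ i \<partial>M n))"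
      by (intro ext hi prob_M L L01)
    moreover have "(\<integral>\<omega>. h (Z \<omega>) \<partial>P) = (\<Sum>i\<le>m. a i * (\<integral>\<omega>. Z \<omega> ^ i \<partial>P))"
      by (intro hi P Z Z01)
    ultimately show ?thesis using mom by (auto intro!: tendsto_sum tendsto_mult_left)
  qed
  then have "eventually (\<lambda>n. dist (\<integral>\<omega>. h (L n \<omega>) \<partial>M n) (\<integral>\<omega>. h (Z \<omega>) \<partial>P) < e/3) sequentially"
    using e by (intro tendstoD) auto
  then show "eventually (\<lambda>n. dist (\<integral>\<omega>. g (L n \<omega>) \<partial>M n) (\<integral>\<omega>. g (Z \<omega>) \<partial>P) < e) sequentially"
  proof eventually_elim
    case (elim n)
    then show ?case using close[OF prob_M L L01, of n] close[OF P Z Z01] unfolding dist_real_def by linarith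
  qed
qed

text \<open>The case l = 0 fits without exception: the value \<infinity> exceeds every real t, and
  exp is positive.\<close>

lemma neg2log_le_iff: "neg2log l \<le> ereal t \<longleftrightarrow> exp (- t / 2) \<le> l" if "0 \<le> l"
proof (cases "l = 0")
  case True
  then show ?thesis by (simp add: neg2log_def not_le)
next
  case False
  then have "exp (- t / 2) \<le> l \<longleftrightarrow> - t / 2 \<le> ln l" using that by (simp add: ln_ge_iff)
  then show ?thesis using False by (auto simp: neg2log_def)
qed

text \<open>Convergence of all moments of a [0,1]-valued variable gives weak convergence of L. The
  event -2 log L <= t is L >= exp (- t / 2), so the transfer to distribution functions goes through
  -L, which is ordered like -2 log L.\<close>

lemma neg2log_weak_conv:
  assumes L[measurable]: "\<And>n. L n \<in> borel_measurable (M n)"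
    and L01: "\<And>n \<omega>. \<omega> \<in> space (M n) \<Longrightarrow> L n \<omega> \<in> {0..1}"
    and P: "prob_space P" and V[measurable]: "V \<in> borel_measurable P"
    and V0: "\<And>\<omega>. \<omega> \<in> space P \<Longrightarrow> 0 \<le> V \<omega>"
    and mom: "\<And>k::nat. (\<lambda>n. \<integral>\<omega>. L n \<omega> ^ k \<partial>M n) \<longlonglongrightarrow> (\<integral>\<omega>. exp (- V \<omega> / 2) ^ k \<partial>P)"
  shows "weak_conv (\<lambda>n t. measure (M n) {\<omega> \<in> space (M n). neg2log (L n \<omega>) \<le> ereal t}) (cdf (distr P borel V))"
proof -
  interpret P: prob_space P by fact
  define Q where "Q n = distr (M n) borel (\<lambda>\<omega>. - L n \<omega>)" for n
  define Qi where "Qi = distr P borel (\<lambda>\<omega>. - exp (- V \<omega> / 2))"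
  have Q: "real_distribution (Q n)" for n
    unfolding Q_def by (rule prob_space.real_distribution_distr[OF prob_M]) measurable
  have Qi: "real_distribution Qi"
    unfolding Qi_def by (rule P.real_distribution_distr) measurable
  have wc: "weak_conv_m Q Qi"
  proof (rule integral_cts_step_conv_imp_weak_conv[OF Q Qi])
    fix x y :: real assume xy: "x < y"
    let ?g = "\<lambda>l. cts_step x y (- l)"
    have c: "continuous_on UNIV (cts_step x y)"
      by (rule uniformly_continuous_imp_continuous[OF cts_step_uniformly_continuous[OF xy]])
    then have [measurable]: "cts_step x y \<in> borel_measurable borel" by (rule borel_measurable_continuous_onI)
    have g: "continuous_on UNIV ?g"
      by (rule continuous_on_compose2[OF c]) (auto intro: continuous_on_minus continuous_on_id)
    have "(\<lambda>n. \<integral>\<omega>. ?g (L n \<omega>) \<partial>M n) \<longlonglongrightarrow> (\<integral>\<omega>. ?g (exp (- V \<omega> / 2)) \<partial>P)"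
      by (rule moments_imp_integral_conv[OF L L01 P _ _ mom g]) (use V0 in auto)
    then show "(\<lambda>n. integral\<^sup>L (Q n) (cts_step x y)) \<longlonglongrightarrow> integral\<^sup>L Qi (cts_step x y)"
      unfolding Q_def Qi_def by (simp add: integral_distr)
  qed
  show ?thesis
    unfolding weak_conv_def
  proof (intro allI impI)
    fix t assume ct: "isCont (cdf (distr P borel V)) t"
    let ?y = "- exp (- t / 2)"
    interpret D: real_distribution "distr P borel V" by (rule P.real_distribution_distr) measurable
    interpret Qi: real_distribution Qi by (rule Qi)
    \<comment> \<open>The map from V to -exp (- V / 2) is injective, so atoms correspond and
      continuity of the limit at t becomes continuity at the transformed point.\<close>
    have "measure Qi {?y} = measure P {\<omega> \<in> space P. V \<omega> = t}"
      unfolding Qi_def by (subst measure_distr) (auto intro!: arg_cong[of _ _ "measure P"])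
    also have "\<dots> = measure (distr P borel V) {t}"
      by (subst measure_distr) (auto intro!: arg_cong[of _ _ "measure P"])
    also have "\<dots> = 0" using ct by (simp add: D.isCont_cdf)
    finally have "isCont (cdf Qi) ?y" by (simp add: Qi.isCont_cdf)
    then have lim: "(\<lambda>n. cdf (Q n) ?y) \<longlonglongrightarrow> cdf Qi ?y"
      using wc unfolding weak_conv_m_def weak_conv_def by blast
    have "cdf (Q n) ?y = measure (M n) {\<omega> \<in> space (M n). neg2log (L n \<omega>) \<le> ereal t}" for n
      unfolding Q_def cdf_def
      using L01[of _ n] by (subst measure_distr) (auto simp: neg2log_le_iff intro!: arg_cong[of _ _ "measure (M n)"])
    moreover have "cdf Qi ?y = cdf (distr P borel V) t"
      unfolding Qi_def cdf_def
      by (subst (1 2) measure_distr) (auto intro!: arg_cong[of _ _ "measure P"])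
    ultimately show "(\<lambda>n. measure (M n) {\<omega> \<in> space (M n). neg2log (L n \<omega>) \<le> ereal t}) \<longlonglongrightarrow> cdf (distr P borel V) t"
      using lim by simp
  qed
qed

end

section \<open>Moments of exp (- (U^2 + V^2) / 2) from characteristic functions\<close>

abbreviation gauss2 :: "(nat \<Rightarrow> real) measure" where
  "gauss2 \<equiv> PiM {..<2} (\<lambda>_. std_normal_distribution)"

lemma prob_space_gauss2: "prob_space gauss2"
  by (rule prob_space_PiM) (rule real_distribution.axioms(1)[OF real_dist_normal_dist])

lemma integral_iexp_gauss2:
  "(\<integral>\<zeta>. iexp (\<Sum>i<2. s i * \<zeta> i) \<partial>gauss2) = of_real (exp (- (\<Sum>i<2::nat. (s i)\<^sup>2) / 2))"
proof -
  interpret N: real_distribution std_normal_distribution by (rule real_dist_normal_dist)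
  interpret product_sigma_finite "\<lambda>_::nat. std_normal_distribution" by unfold_locales
  have "(\<integral>\<zeta>. iexp (\<Sum>i<2. s i * \<zeta> i) \<partial>gauss2) = (\<integral>\<zeta>. (\<Prod>i<2. iexp (s i * \<zeta> i)) \<partial>gauss2)"
    by (simp add: exp_sum[symmetric] sum_distrib_left)
  also have "\<dots> = (\<Prod>i<2. \<integral>z. iexp (s i * z) \<partial>std_normal_distribution)"
    by (rule product_integral_prod) (auto intro!: N.integrable_const_bound[where B = 1])
  also have "\<dots> = (\<Prod>i<2. char std_normal_distribution (s i))" by (simp add: char_def)
  also have "\<dots> = of_real (\<Prod>i<2. exp (- (s i)\<^sup>2 / 2))" by (simp add: char_std_normal_distribution)
  also have "(\<Prod>i<2. exp (- (s i)\<^sup>2 / 2)) = exp (- (\<Sum>i<2::nat. (s i)\<^sup>2) / 2)"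
    by (simp add: exp_sum[symmetric] sum_divide_distrib sum_negf)
  finally show ?thesis .
qed

context prob_seq
begin

text \<open>As exp (- c^2 / 2) is the characteristic function of a standard normal at c, two
  auxiliary normals \<open>\<zeta>\<close> linearise the squares, and Fubini leaves characteristic
  functions of (U, V) at sqrt k times \<open>\<zeta>\<close>. Their limit, read as a function of
  \<open>\<zeta>\<close>, is already the k-th power of exp (- |\<zeta>|^2 / 2), so its Gaussian
  average is the moment of the limit variable.\<close>

lemma exp_quadratic_moment_conv:
  assumes U[measurable]: "\<And>n. U n \<in> borel_measurable (M n)" and V[measurable]: "\<And>n. V n \<in> borel_measurable (M n)"
    and char: "\<And>s t. (\<lambda>n. \<integral>\<omega>. iexp (s * U n \<omega> + t * V n \<omega>) \<partial>M n) \<longlonglongrightarrow> of_real (exp (- (s\<^sup>2 + t\<^sup>2) / 2))"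
  shows "(\<lambda>n. \<integral>\<omega>. exp (- ((U n \<omega>)\<^sup>2 + (V n \<omega>)\<^sup>2) / 2) ^ k \<partial>M n)
    \<longlonglongrightarrow> (\<integral>\<zeta>. exp (- (\<Sum>i<2. (\<zeta> i)\<^sup>2) / 2) ^ k \<partial>gauss2)"
proof -
  interpret G: prob_space gauss2 by (rule prob_space_gauss2)
  let ?r = "sqrt (real k)"
  have m01[measurable]: "(\<lambda>\<zeta>. \<zeta> 0) \<in> borel_measurable gauss2" "(\<lambda>\<zeta>. \<zeta> (Suc 0)) \<in> borel_measurable gauss2"
    using measurable_component_singleton[of 0 "{..<2::nat}" "\<lambda>_. std_normal_distribution"]
      measurable_component_singleton[of "Suc 0" "{..<2::nat}" "\<lambda>_. std_normal_distribution"] by simp_all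
  define f where "f n \<zeta> \<omega> = iexp (?r * \<zeta> 0 * U n \<omega> + ?r * \<zeta> 1 * V n \<omega>)" for n and \<zeta> :: "nat \<Rightarrow> real" and \<omega>
  have exp_eq: "exp (- (u\<^sup>2 + v\<^sup>2) / 2) ^ k = exp (- ((?r * u)\<^sup>2 + (?r * v)\<^sup>2) / 2)" for u v :: real
    by (simp add: exp_of_nat_mult[symmetric] power_mult_distrib algebra_simps)
  have lhs: "of_real (\<integral>\<omega>. exp (- ((U n \<omega>)\<^sup>2 + (V n \<omega>)\<^sup>2) / 2) ^ k \<partial>M n) = (\<integral>\<zeta>. (\<integral>\<omega>. f n \<zeta> \<omega> \<partial>M n) \<partial>gauss2)" for n
  proof -
    interpret Mn: prob_space "M n" by (rule prob_M)
    interpret pair_prob_space "M n" gauss2 ..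
    have "of_real (exp (- ((U n \<omega>)\<^sup>2 + (V n \<omega>)\<^sup>2) / 2) ^ k) = (\<integral>\<zeta>. f n \<zeta> \<omega> \<partial>gauss2)" for \<omega>
    proof -
      let ?s = "\<lambda>i::nat. if i = 0 then ?r * U n \<omega> else ?r * V n \<omega>"
      have "(\<integral>\<zeta>. f n \<zeta> \<omega> \<partial>gauss2) = (\<integral>\<zeta>. iexp (\<Sum>i<2. ?s i * \<zeta> i) \<partial>gauss2)"
        by (simp add: f_def numeral_2_eq_2 mult_ac)
      also have "\<dots> = of_real (exp (- (\<Sum>i<2::nat. (?s i)\<^sup>2) / 2))" by (rule integral_iexp_gauss2)
      also have "(\<Sum>i<2::nat. (?s i)\<^sup>2) = (?r * U n \<omega>)\<^sup>2 + (?r * V n \<omega>)\<^sup>2" by (simp add: numeral_2_eq_2)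
      finally show ?thesis unfolding exp_eq by simp
    qed
    then have "of_real (\<integral>\<omega>. exp (- ((U n \<omega>)\<^sup>2 + (V n \<omega>)\<^sup>2) / 2) ^ k \<partial>M n) = (\<integral>\<omega>. (\<integral>\<zeta>. f n \<zeta> \<omega> \<partial>gauss2) \<partial>M n)"
      by (subst integral_complex_of_real[symmetric]) (simp only:)
    also have "\<dots> = (\<integral>\<zeta>. (\<integral>\<omega>. f n \<zeta> \<omega> \<partial>M n) \<partial>gauss2)"
    proof (rule Fubini_integral[symmetric])
      show "integrable (M n \<Otimes>\<^sub>M gauss2) (\<lambda>(\<omega>, \<zeta>). f n \<zeta> \<omega>)"
        by (rule P.integrable_const_bound[where B = 1]) (auto simp: f_def)
    qed
    finally show ?thesis .
  qed
  have "(\<lambda>n. \<integral>\<zeta>. (\<integral>\<omega>. f n \<zeta> \<omega> \<partial>M n) \<partial>gauss2)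
      \<longlonglongrightarrow> (\<integral>\<zeta>. of_real (exp (- (\<Sum>i<2. (\<zeta> i)\<^sup>2) / 2) ^ k) \<partial>gauss2)"
  proof (rule integral_dominated_convergence[where w = "\<lambda>_. 1"])
    show "(\<lambda>\<zeta>. \<integral>\<omega>. f n \<zeta> \<omega> \<partial>M n) \<in> borel_measurable gauss2" for n
    proof -
      interpret Mn: prob_space "M n" by (rule prob_M)
      show ?thesis unfolding f_def by measurable
    qed
    show "AE \<zeta> in gauss2. (\<lambda>n. \<integral>\<omega>. f n \<zeta> \<omega> \<partial>M n) \<longlonglongrightarrow> of_real (exp (- (\<Sum>i<2. (\<zeta> i)\<^sup>2) / 2) ^ k)"
    proof (rule AE_I2)
      fix \<zeta> :: "nat \<Rightarrow> real"
      have "exp (- (\<Sum>i<2. (\<zeta> i)\<^sup>2) / 2) ^ k = exp (- ((?r * \<zeta> 0)\<^sup>2 + (?r * \<zeta> 1)\<^sup>2) / 2)"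
        unfolding exp_eq[symmetric] by (simp add: numeral_2_eq_2)
      then show "(\<lambda>n. \<integral>\<omega>. f n \<zeta> \<omega> \<partial>M n) \<longlonglongrightarrow> of_real (exp (- (\<Sum>i<2. (\<zeta> i)\<^sup>2) / 2) ^ k)"
        unfolding f_def using char[of "?r * \<zeta> 0" "?r * \<zeta> 1"] by simp
    qed
    show "AE \<zeta> in gauss2. norm (\<integral>\<omega>. f n \<zeta> \<omega> \<partial>M n) \<le> 1" for n
    proof (rule AE_I2)
      fix \<zeta> :: "nat \<Rightarrow> real"
      interpret Mn: prob_space "M n" by (rule prob_M)
      have "norm (\<integral>\<omega>. f n \<zeta> \<omega> \<partial>M n) \<le> (\<integral>\<omega>. norm (f n \<zeta> \<omega>) \<partial>M n)" by (rule integral_norm_bound)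
      also have "\<dots> = 1" by (simp add: f_def Mn.prob_space)
      finally show "norm (\<integral>\<omega>. f n \<zeta> \<omega> \<partial>M n) \<le> 1" .
    qed
    have s2: "(\<Sum>i<2::nat. (\<zeta> i)\<^sup>2) = (\<zeta> 0)\<^sup>2 + (\<zeta> (Suc 0))\<^sup>2" for \<zeta> :: "nat \<Rightarrow> real"
      by (simp add: numeral_2_eq_2)
    show "(\<lambda>\<zeta>. of_real (exp (- (\<Sum>i<2. (\<zeta> i)\<^sup>2) / 2) ^ k) :: complex) \<in> borel_measurable gauss2"
      unfolding s2 by measurable
  qed simp
  then have "(\<lambda>n. complex_of_real (\<integral>\<omega>. exp (- ((U n \<omega>)\<^sup>2 + (V n \<omega>)\<^sup>2) / 2) ^ k \<partial>M n))
      \<longlonglongrightarrow> of_real (\<integral>\<zeta>. exp (- (\<Sum>i<2. (\<zeta> i)\<^sup>2) / 2) ^ k \<partial>gauss2)"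
    unfolding lhs[symmetric] integral_complex_of_real .
  then show ?thesis by (simp only: tendsto_of_real_iff)
qed

end

text \<open>What the deterministic expansion consumes, in asymptotic form and without independence,
  so that the array for the unknown mean is an instance too. \<open>mx\<close> and \<open>my\<close>
  are any negligible bounds for the normalised entries rather than the maxima themselves, which
  makes them easy to produce and to perturb.\<close>

locale el_array = prob_seq M for M :: "nat \<Rightarrow> 'a measure" +
  fixes N :: "nat \<Rightarrow> nat" and x y :: "nat \<Rightarrow> nat \<Rightarrow> 'a \<Rightarrow> real" and mx my :: "nat \<Rightarrow> 'a \<Rightarrow> real"
  fixes U V s11 s12 s22 :: "nat \<Rightarrow> 'a \<Rightarrow> real"
  defines "U \<equiv> \<lambda>n \<omega>. (\<Sum>i=1..N n. x n i \<omega>) / sqrt (N n)" and "V \<equiv> \<lambda>n \<omega>. (\<Sum>i=1..N n. y n i \<omega>) / sqrt (N n)"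
    and "s11 \<equiv> \<lambda>n \<omega>. (\<Sum>i=1..N n. x n i \<omega> * x n i \<omega>) / N n"
    and "s12 \<equiv> \<lambda>n \<omega>. (\<Sum>i=1..N n. x n i \<omega> * y n i \<omega>) / N n"
    and "s22 \<equiv> \<lambda>n \<omega>. (\<Sum>i=1..N n. y n i \<omega> * y n i \<omega>) / N n"
  assumes N: "filterlim N at_top sequentially"
    and x_meas: "\<And>n i. i \<in> {1..N n} \<Longrightarrow> x n i \<in> borel_measurable (M n)"
    and y_meas: "\<And>n i. i \<in> {1..N n} \<Longrightarrow> y n i \<in> borel_measurable (M n)"
    and char: "\<And>s t. (\<lambda>n. \<integral>\<omega>. iexp (s * U n \<omega> + t * V n \<omega>) \<partial>M n) \<longlonglongrightarrow> of_real (exp (- (s\<^sup>2 + t\<^sup>2) / 2))"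
    and tU: "tight_rv M U" and tV: "tight_rv M V"
    and o11: "op1 M (\<lambda>n \<omega>. s11 n \<omega> - 1)" and o12: "op1 M s12" and o22: "op1 M (\<lambda>n \<omega>. s22 n \<omega> - 1)"
    and omx: "op1 M mx" and omy: "op1 M my"
    and mx: "\<And>n i \<omega>. i \<in> {1..N n} \<Longrightarrow> \<omega> \<in> space (M n) \<Longrightarrow> \<bar>x n i \<omega>\<bar> \<le> \<bar>mx n \<omega>\<bar> * sqrt (N n)"
    and my: "\<And>n i \<omega>. i \<in> {1..N n} \<Longrightarrow> \<omega> \<in> space (M n) \<Longrightarrow> \<bar>y n i \<omega>\<bar> \<le> \<bar>my n \<omega>\<bar> * sqrt (N n)"
begin

abbreviation "L n \<omega> \<equiv> el_ratio (N n) (\<lambda>i. (x n i \<omega>, y n i \<omega>))"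

lemma L_meas: "(\<lambda>\<omega>. L n \<omega>) \<in> borel_measurable (M n)"
  using x_meas y_meas by (intro borel_measurable_el_ratio borel_measurable_Pair)

lemma L01: "L n \<omega> \<in> {0..1}"
  using el_ratio_nonneg el_ratio_le_1 by simp

lemma U_meas: "U n \<in> borel_measurable (M n)" and V_meas: "V n \<in> borel_measurable (M n)"
  using tU tV by (auto simp: tight_rv_def)

lemma L_approx: "op1 M (\<lambda>n \<omega>. L n \<omega> - exp (- ((U n \<omega>)\<^sup>2 + (V n \<omega>)\<^sup>2) / 2))"
proof (rule op1I)
  note [measurable] = U_meas V_meas L_meas
  show "(\<lambda>\<omega>. L n \<omega> - exp (- ((U n \<omega>)\<^sup>2 + (V n \<omega>)\<^sup>2) / 2)) \<in> borel_measurable (M n)" for n by measurable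
  fix \<epsilon> \<eta> :: real assume e: "0 < \<epsilon>" "0 < \<eta>"
  then have \<eta>3: "0 < \<eta> / 3" by simp
  obtain K1 where K1: "eventually (\<lambda>n. measure (M n) {\<omega> \<in> space (M n). K1 < \<bar>U n \<omega>\<bar>} \<le> \<eta> / 3) sequentially"
    using tU \<eta>3 unfolding tight_rv_def by blast
  obtain K2 where K2: "eventually (\<lambda>n. measure (M n) {\<omega> \<in> space (M n). K2 < \<bar>V n \<omega>\<bar>} \<le> \<eta> / 3) sequentially"
    using tV \<eta>3 unfolding tight_rv_def by blast
  define K where "K = max 1 (max K1 K2)"
  have K: "1 \<le> K" "K1 \<le> K" "K2 \<le> K" by (auto simp: K_def)
  \<comment> \<open>The first bound secures the side condition of \<open>el_moments\<close>, the
    second makes the error exp (33 K^4 h) - 1 at most \<open>\<epsilon>\<close>.\<close>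
  define h where "h = min (1 / (40 * K\<^sup>2)) (ln (1 + \<epsilon>) / (33 * K ^ 4))"
  have h0: "0 < h" using K e unfolding h_def by (simp add: ln_gt_zero)
  have hK: "40 * K\<^sup>2 * h \<le> 1"
  proof -
    have "40 * K\<^sup>2 * h \<le> 40 * K\<^sup>2 * (1 / (40 * K\<^sup>2))" by (intro mult_left_mono) (auto simp: h_def)
    then show ?thesis using K by simp
  qed
  have he: "exp (33 * K ^ 4 * h) - 1 \<le> \<epsilon>"
  proof -
    have "33 * K ^ 4 * h \<le> 33 * K ^ 4 * (ln (1 + \<epsilon>) / (33 * K ^ 4))" by (intro mult_left_mono) (auto simp: h_def)
    also have "\<dots> = ln (1 + \<epsilon>)" using K by simp
    finally have "exp (33 * K ^ 4 * h) \<le> exp (ln (1 + \<epsilon>))" by simp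
    then show ?thesis using e by simp
  qed
  \<comment> \<open>One negligible variable dominates the five errors, so that a single exceptional
    event covers them all.\<close>
  define T where "T n \<omega> = \<bar>s11 n \<omega> - 1\<bar> + \<bar>s12 n \<omega>\<bar> + \<bar>s22 n \<omega> - 1\<bar> + \<bar>mx n \<omega>\<bar> + \<bar>my n \<omega>\<bar>" for n \<omega>
  have absop: "op1 M f \<Longrightarrow> op1 M (\<lambda>n \<omega>. \<bar>f n \<omega>\<bar>)" for f
    by (rule op1_mono[of f]) (auto intro: borel_measurable_abs op1_meas)
  have T: "op1 M T"
    unfolding T_def by (intro op1_add absop o11 o12 o22 omx omy)
  have "eventually (\<lambda>n. nat \<lceil>1 / h\<rceil> + 1 \<le> N n) sequentially"
    using N by (simp add: filterlim_at_top)
  with K1 K2 op1_ev[OF T h0 \<eta>3]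
  show "eventually (\<lambda>n. measure (M n) {\<omega> \<in> space (M n). \<epsilon> < \<bar>L n \<omega> - exp (- ((U n \<omega>)\<^sup>2 + (V n \<omega>)\<^sup>2) / 2)\<bar>} \<le> \<eta>) sequentially"
  proof eventually_elim
    case (elim n)
    have Nn: "0 < N n" using elim(4) by simp
    have "1 / h \<le> real (N n)" using elim(4) by linarith
    then have Nh: "1 / real (N n) \<le> h" using h0 Nn by (simp add: field_simps)
    let ?A = "{\<omega> \<in> space (M n). K1 < \<bar>U n \<omega>\<bar>}" and ?B = "{\<omega> \<in> space (M n). K2 < \<bar>V n \<omega>\<bar>}"
      and ?C = "{\<omega> \<in> space (M n). h < \<bar>T n \<omega>\<bar>}"
    have sets: "?A \<in> sets (M n)" "?B \<in> sets (M n)" "?C \<in> sets (M n)"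
      by (intro sets_gt U_meas V_meas op1_meas[OF T])+
    have "measure (M n) {\<omega> \<in> space (M n). \<epsilon> < \<bar>L n \<omega> - exp (- ((U n \<omega>)\<^sup>2 + (V n \<omega>)\<^sup>2) / 2)\<bar>}
        \<le> measure (M n) ((?A \<union> ?B) \<union> ?C)"
    proof (intro measure_M_mono sets.Un sets subsetI)
      fix \<omega> assume \<omega>: "\<omega> \<in> {\<omega> \<in> space (M n). \<epsilon> < \<bar>L n \<omega> - exp (- ((U n \<omega>)\<^sup>2 + (V n \<omega>)\<^sup>2) / 2)\<bar>}"
      show "\<omega> \<in> (?A \<union> ?B) \<union> ?C"
      proof (rule ccontr)
        assume "\<omega> \<notin> (?A \<union> ?B) \<union> ?C"
        then have c: "\<bar>U n \<omega>\<bar> \<le> K" "\<bar>V n \<omega>\<bar> \<le> K" "\<bar>T n \<omega>\<bar> \<le> h" "\<omega> \<in> space (M n)" using \<omega> K by auto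
        then have T5: "\<bar>s11 n \<omega> - 1\<bar> \<le> h" "\<bar>s12 n \<omega>\<bar> \<le> h" "\<bar>s22 n \<omega> - 1\<bar> \<le> h" "\<bar>mx n \<omega>\<bar> \<le> h" "\<bar>my n \<omega>\<bar> \<le> h"
          unfolding T_def by linarith+
        have "el_moments (N n) (\<lambda>i. x n i \<omega>) (\<lambda>i. y n i \<omega>) K h"
        proof
          fix i assume i: "i \<in> {1..N n}"
          have "\<bar>mx n \<omega>\<bar> * sqrt (N n) \<le> h * sqrt (N n)" "\<bar>my n \<omega>\<bar> * sqrt (N n) \<le> h * sqrt (N n)"
            using T5 by (auto intro!: mult_right_mono)
          then show "\<bar>x n i \<omega>\<bar> \<le> h * sqrt (N n)" "\<bar>y n i \<omega>\<bar> \<le> h * sqrt (N n)"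
            using mx[OF i c(4)] my[OF i c(4)] by linarith+
        next
          show "0 < N n" by (rule Nn)
          show "1 \<le> K" by (rule K(1))
          show "0 \<le> h" using h0 by (rule less_imp_le)
          show "40 * K\<^sup>2 * h \<le> 1" by (rule hK)
          show "\<bar>(\<Sum>i=1..N n. x n i \<omega>) / sqrt (N n)\<bar> \<le> K" using c(1) unfolding U_def .
          show "\<bar>(\<Sum>i=1..N n. y n i \<omega>) / sqrt (N n)\<bar> \<le> K" using c(2) unfolding V_def .
          show "\<bar>(\<Sum>i=1..N n. x n i \<omega> * x n i \<omega>) / N n - 1\<bar> \<le> h" using T5(1) unfolding s11_def .
          show "\<bar>(\<Sum>i=1..N n. x n i \<omega> * y n i \<omega>) / N n\<bar> \<le> h" using T5(2) unfolding s12_def .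
          show "\<bar>(\<Sum>i=1..N n. y n i \<omega> * y n i \<omega>) / N n - 1\<bar> \<le> h" using T5(3) unfolding s22_def .
          show "1 / real (N n) \<le> h" by (rule Nh)
        qed
        from el_moments.el_ratio_approx[OF this]
        have "\<bar>L n \<omega> - exp (- ((U n \<omega>)\<^sup>2 + (V n \<omega>)\<^sup>2) / 2)\<bar> \<le> exp (33 * K ^ 4 * h) - 1"
          unfolding U_def V_def .
        then show False using \<omega> he by auto
      qed
    qed
    also have "\<dots> \<le> measure (M n) (?A \<union> ?B) + measure (M n) ?C" by (intro measure_M_Un sets.Un sets)
    also have "\<dots> \<le> measure (M n) ?A + measure (M n) ?B + measure (M n) ?C"
      by (intro add_right_mono measure_M_Un sets)
    finally show ?case using elim by linarith
  qed
qed

theorem el_ratio_weak_conv: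
  "weak_conv (\<lambda>n t. measure (M n) {\<omega> \<in> space (M n). neg2log (L n \<omega>) \<le> ereal t}) (cdf (chi_square 2))"
  unfolding chi_square_def
proof (rule neg2log_weak_conv[OF L_meas L01 prob_space_gauss2])
  note [measurable] = U_meas V_meas L_meas
  show "(\<lambda>z. \<Sum>i<2. (z i)\<^sup>2) \<in> borel_measurable gauss2"
  proof (intro borel_measurable_sum borel_measurable_power)
    fix i :: nat assume "i \<in> {..<2}"
    then show "(\<lambda>z. z i) \<in> borel_measurable gauss2"
      using measurable_component_singleton[of i "{..<2}" "\<lambda>_. std_normal_distribution"] by simp
  qed
  show "0 \<le> (\<Sum>i<2. (z i)\<^sup>2)" for z :: "nat \<Rightarrow> real" by (simp add: sum_nonneg)
  fix k :: nat
  let ?E = "\<lambda>n \<omega>. exp (- ((U n \<omega>)\<^sup>2 + (V n \<omega>)\<^sup>2) / 2)"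
  have E01: "?E n \<omega> \<in> {0..1}" for n \<omega> by simp
  have d: "op1 M (\<lambda>n \<omega>. L n \<omega> ^ k - ?E n \<omega> ^ k)"
  proof (rule op1_mono[OF op1_cmult[OF L_approx, of "real k"]])
    \<comment> \<open>On [0,1] the k-th power is Lipschitz with constant k. Closeness of L and the
      exponential in probability thus passes to powers, and boundedness turns it into closeness of
      moments.\<close>
    have "\<bar>a ^ k - b ^ k\<bar> \<le> real k * \<bar>a - b\<bar>" if "a \<in> {0..1}" "b \<in> {0..1}" for a b :: real
      using norm_power_diff[of a b k] that by simp
    then show "eventually (\<lambda>n. \<forall>\<omega>\<in>space (M n). \<bar>L n \<omega> ^ k - ?E n \<omega> ^ k\<bar> \<le> \<bar>real k * (L n \<omega> - ?E n \<omega>)\<bar>) sequentially"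
      using L01 E01 by (simp add: abs_mult)
  qed measurable
  have b: "\<bar>a ^ k - b ^ k\<bar> \<le> 1" if "a \<in> {0..1}" "b \<in> {0..1}" for a b :: real
    using that power_le_one[of a k] power_le_one[of b k] zero_le_power[of a k] zero_le_power[of b k]
    unfolding abs_le_iff atLeastAtMost_iff by linarith
  have "(\<lambda>n. \<integral>\<omega>. \<bar>L n \<omega> ^ k - ?E n \<omega> ^ k\<bar> \<partial>M n) \<longlonglongrightarrow> 0"
    by (rule op1_bounded_integral[OF d, of 1]) (intro b L01 E01)
  then have "(\<lambda>n. (\<integral>\<omega>. L n \<omega> ^ k \<partial>M n) - (\<integral>\<omega>. ?E n \<omega> ^ k \<partial>M n)) \<longlonglongrightarrow> 0"
  proof (rule Lim_null_comparison[rotated], intro always_eventually allI)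
    fix n
    interpret prob_space "M n" by (rule prob_M)
    have powc: "continuous_on UNIV (\<lambda>x::real. x ^ k)" by (intro continuous_intros)
    have "integrable (M n) (\<lambda>\<omega>. L n \<omega> ^ k)" by (rule integral_bdd_cont[OF prob_M L_meas L01 powc])
    moreover have "integrable (M n) (\<lambda>\<omega>. ?E n \<omega> ^ k)" by (rule integral_bdd_cont[OF prob_M _ E01 powc]) measurable
    ultimately have "(\<integral>\<omega>. L n \<omega> ^ k \<partial>M n) - (\<integral>\<omega>. ?E n \<omega> ^ k \<partial>M n) = (\<integral>\<omega>. L n \<omega> ^ k - ?E n \<omega> ^ k \<partial>M n)"
      by (rule Bochner_Integration.integral_diff[symmetric])
    then show "norm ((\<integral>\<omega>. L n \<omega> ^ k \<partial>M n) - (\<integral>\<omega>. ?E n \<omega> ^ k \<partial>M n)) \<le> (\<integral>\<omega>. \<bar>L n \<omega> ^ k - ?E n \<omega> ^ k\<bar> \<partial>M n)"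
      using integral_abs_bound by simp
  qed
  from tendsto_add[OF this exp_quadratic_moment_conv[OF U_meas V_meas char, where k = k]]
  show "(\<lambda>n. \<integral>\<omega>. L n \<omega> ^ k \<partial>M n) \<longlonglongrightarrow> (\<integral>\<zeta>. exp (- (\<Sum>i<2. (\<zeta> i)\<^sup>2) / 2) ^ k \<partial>gauss2)"
    by simp
qed

end

section \<open>Row-wise i.i.d. arrays under the Lyapunov condition\<close>

declare One_nat_def [simp del]

lemma integrable_mult_of_sq:
  fixes f g :: "'a \<Rightarrow> real"
  assumes [measurable]: "f \<in> borel_measurable M" "g \<in> borel_measurable M"
    and "integrable M (\<lambda>x. (f x)\<^sup>2)" "integrable M (\<lambda>x. (g x)\<^sup>2)"
  shows "integrable M (\<lambda>x. f x * g x)"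
proof (rule Bochner_Integration.integrable_bound)
  show "integrable M (\<lambda>x. (f x)\<^sup>2 + (g x)\<^sup>2)" using assms by simp
  have "\<bar>a * b\<bar> \<le> a\<^sup>2 + b\<^sup>2" for a b :: real
  proof -
    have "2 * (\<bar>a\<bar> * \<bar>b\<bar>) \<le> a\<^sup>2 + b\<^sup>2" using sum_squares_bound[of "\<bar>a\<bar>" "\<bar>b\<bar>"] by simp
    moreover have "0 \<le> \<bar>a\<bar> * \<bar>b\<bar>" by simp
    ultimately show ?thesis unfolding abs_mult by linarith
  qed
  then show "AE x in M. norm (f x * g x) \<le> norm ((f x)\<^sup>2 + (g x)\<^sup>2)" by simp
qed measurable

lemma uncorrelated_sum_sq:
  fixes g :: "'i \<Rightarrow> 'a \<Rightarrow> real"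
  assumes I: "finite I" and m: "\<And>i. i \<in> I \<Longrightarrow> g i \<in> borel_measurable M"
    and sq: "\<And>i. i \<in> I \<Longrightarrow> integrable M (\<lambda>x. (g i x)\<^sup>2)"
    and orth: "\<And>i j. i \<in> I \<Longrightarrow> j \<in> I \<Longrightarrow> i \<noteq> j \<Longrightarrow> (\<integral>x. g i x * g j x \<partial>M) = 0"
  shows "integrable M (\<lambda>x. (\<Sum>i\<in>I. g i x)\<^sup>2)"
    and "(\<integral>x. (\<Sum>i\<in>I. g i x)\<^sup>2 \<partial>M) = (\<Sum>i\<in>I. \<integral>x. (g i x)\<^sup>2 \<partial>M)"
proof -
  have int: "integrable M (\<lambda>x. g i x * g j x)" if "i \<in> I" "j \<in> I" for i j
    using that by (intro integrable_mult_of_sq m sq)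
  have e: "(\<Sum>i\<in>I. g i x)\<^sup>2 = (\<Sum>i\<in>I. \<Sum>j\<in>I. g i x * g j x)" for x
    by (simp add: power2_eq_square sum_product)
  show "integrable M (\<lambda>x. (\<Sum>i\<in>I. g i x)\<^sup>2)"
    unfolding e by (intro Bochner_Integration.integrable_sum int)
  have "(\<integral>x. (\<Sum>i\<in>I. g i x)\<^sup>2 \<partial>M) = (\<Sum>i\<in>I. \<integral>x. (\<Sum>j\<in>I. g i x * g j x) \<partial>M)"
    unfolding e by (intro Bochner_Integration.integral_sum Bochner_Integration.integrable_sum int)
  also have "\<dots> = (\<Sum>i\<in>I. \<Sum>j\<in>I. \<integral>x. g i x * g j x \<partial>M)"
    by (intro sum.cong refl Bochner_Integration.integral_sum int)
  also have "\<dots> = (\<Sum>i\<in>I. \<Sum>j\<in>I. if j = i then \<integral>x. (g i x)\<^sup>2 \<partial>M else 0)"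
    using orth by (intro sum.cong refl) (auto simp: power2_eq_square)
  also have "\<dots> = (\<Sum>i\<in>I. \<integral>x. (g i x)\<^sup>2 \<partial>M)" using I by simp
  finally show "(\<integral>x. (\<Sum>i\<in>I. g i x)\<^sup>2 \<partial>M) = (\<Sum>i\<in>I. \<integral>x. (g i x)\<^sup>2 \<partial>M)" .
qed

lemma (in prob_space) integrable_of_powr:
  assumes [measurable]: "f \<in> borel_measurable M" and "integrable M (\<lambda>x. \<bar>f x :: real\<bar> powr q)" "1 \<le> q"
  shows "integrable M f"
proof (rule Bochner_Integration.integrable_bound)
  show "integrable M (\<lambda>x. 1 + \<bar>f x\<bar> powr q)" using assms by simp
  have "\<bar>a\<bar> \<le> 1 + \<bar>a\<bar> powr q" for a :: real
  proof (cases "\<bar>a\<bar> \<le> 1")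
    case False
    then have "\<bar>a\<bar> powr 1 \<le> \<bar>a\<bar> powr q" using assms(3) by (intro powr_mono) auto
    then show ?thesis using False by simp
  next
    case True
    then show ?thesis using powr_ge_zero[of "\<bar>a\<bar>" q] by linarith
  qed
  then show "AE x in M. norm (f x) \<le> norm (1 + \<bar>f x\<bar> powr q)" by simp
qed measurable

lemma (in prob_space) sq_integrable_of_powr:
  assumes [measurable]: "f \<in> borel_measurable M" and "integrable M (\<lambda>x. \<bar>f x :: real\<bar> powr (2 + \<delta>))" "0 \<le> \<delta>"
  shows "integrable M (\<lambda>x. (f x)\<^sup>2)"
proof (rule integrable_of_powr)
  have "\<bar>a\<^sup>2\<bar> powr ((2 + \<delta>) / 2) = \<bar>a\<bar> powr (2 + \<delta>)" for a :: real
  proof -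
    have b: "\<bar>a\<^sup>2\<bar> = \<bar>a\<bar> powr 2" by simp
    have "2 * ((2 + \<delta>) / 2) = 2 + \<delta>" by simp
    then show ?thesis unfolding b powr_powr by (rule arg_cong)
  qed
  then show "integrable M (\<lambda>x. \<bar>(f x)\<^sup>2\<bar> powr ((2 + \<delta>) / 2))" using assms(2) by simp
qed (use assms(3) in auto)

text \<open>\<open>Z1\<close> is a separate requirement because \<open>{1..N n}\<close> may be
  empty, while the first entry occurs in the moments for every n.\<close>

locale iid_array = prob_seq M for M :: "nat \<Rightarrow> 'a measure" +
  fixes N :: "nat \<Rightarrow> nat" and S :: "nat \<Rightarrow> 'b measure" and Z :: "nat \<Rightarrow> nat \<Rightarrow> 'a \<Rightarrow> 'b"
  assumes N: "filterlim N at_top sequentially"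
    and indep: "\<And>n. prob_space.indep_vars (M n) (\<lambda>_. S n) (Z n) {1..N n}"
    and ident: "\<And>n i. i \<in> {1..N n} \<Longrightarrow> distr (M n) (S n) (Z n i) = distr (M n) (S n) (Z n 1)"
    and Z1: "\<And>n. Z n 1 \<in> measurable (M n) (S n)"
begin

lemma Z_meas: "i \<in> {1..N n} \<Longrightarrow> Z n i \<in> measurable (M n) (S n)"
  using indep[of n] unfolding prob_space.indep_vars_def[OF prob_M] by (elim conjE bspec)

lemma fZ_meas: "i \<in> {1..N n} \<Longrightarrow> f \<in> borel_measurable (S n) \<Longrightarrow> (\<lambda>\<omega>. f (Z n i \<omega>)) \<in> borel_measurable (M n)"
  using measurable_compose[OF Z_meas] .

lemma fZ1_meas: "f \<in> borel_measurable (S n) \<Longrightarrow> (\<lambda>\<omega>. f (Z n 1 \<omega>)) \<in> borel_measurable (M n)"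
  using measurable_compose[OF Z1] .

lemma N_pos: "eventually (\<lambda>n. 0 < N n) sequentially"
proof -
  have "eventually (\<lambda>n. 1 \<le> N n) sequentially" using N by (simp add: filterlim_at_top)
  then show ?thesis by eventually_elim simp
qed

lemma N_real: "filterlim (\<lambda>n. real (N n)) at_top sequentially"
  using filterlim_compose[OF filterlim_real_sequentially N] .

lemma integral_fZ:
  assumes "i \<in> {1..N n}" "f \<in> borel_measurable (S n)"
  shows "(\<integral>\<omega>. (f (Z n i \<omega>) :: real) \<partial>M n) = (\<integral>\<omega>. f (Z n 1 \<omega>) \<partial>M n)"
  using integral_distr[OF Z_meas[OF assms(1)] assms(2)] integral_distr[OF Z1 assms(2)] ident[OF assms(1)] by simp

lemma integrable_fZ:
  assumes "i \<in> {1..N n}" "f \<in> borel_measurable (S n)"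
  shows "integrable (M n) (\<lambda>\<omega>. f (Z n i \<omega>) :: real) \<longleftrightarrow> integrable (M n) (\<lambda>\<omega>. f (Z n 1 \<omega>))"
  using integrable_distr_eq[OF Z_meas[OF assms(1)] assms(2)] integrable_distr_eq[OF Z1 assms(2)] ident[OF assms(1)] by simp

lemma indep_fZ:
  assumes "f \<in> borel_measurable (S n)"
  shows "prob_space.indep_vars (M n) (\<lambda>_. borel) (\<lambda>i \<omega>. f (Z n i \<omega>) :: real) {1..N n}"
  by (rule prob_space.indep_vars_compose2[OF prob_M indep]) (rule assms)

lemma variance_fZ:
  assumes f: "f \<in> borel_measurable (S n)" and sq: "integrable (M n) (\<lambda>\<omega>. (f (Z n 1 \<omega>))\<^sup>2)"
    and i1: "integrable (M n) (\<lambda>\<omega>. f (Z n 1 \<omega>) :: real)" and m0: "(\<integral>\<omega>. f (Z n 1 \<omega>) \<partial>M n) = 0"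
  shows "integrable (M n) (\<lambda>\<omega>. (\<Sum>i=1..N n. f (Z n i \<omega>))\<^sup>2)"
    and "(\<integral>\<omega>. (\<Sum>i=1..N n. f (Z n i \<omega>))\<^sup>2 \<partial>M n) = N n * (\<integral>\<omega>. (f (Z n 1 \<omega>))\<^sup>2 \<partial>M n)"
proof -
  interpret prob_space "M n" by (rule prob_M)
  have f2: "(\<lambda>z. (f z)\<^sup>2) \<in> borel_measurable (S n)" using f by measurable
  have sqi: "integrable (M n) (\<lambda>\<omega>. (f (Z n i \<omega>))\<^sup>2)" if "i \<in> {1..N n}" for i
    using integrable_fZ[OF that f2] sq by simp
  have orth: "(\<integral>\<omega>. f (Z n i \<omega>) * f (Z n j \<omega>) \<partial>M n) = 0" if ij: "i \<in> {1..N n}" "j \<in> {1..N n}" "i \<noteq> j" for i j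
  proof -
    have "(\<integral>\<omega>. (\<Prod>k\<in>{i, j}. f (Z n k \<omega>)) \<partial>M n) = (\<Prod>k\<in>{i, j}. \<integral>\<omega>. f (Z n k \<omega>) \<partial>M n)"
    proof (rule indep_vars_lebesgue_integral)
      show "indep_vars (\<lambda>_. borel) (\<lambda>k \<omega>. f (Z n k \<omega>)) {i, j}"
        by (rule indep_vars_subset[OF indep_fZ[OF f]]) (use ij in auto)
      fix k assume "k \<in> {i, j}"
      then show "integrable (M n) (\<lambda>\<omega>. f (Z n k \<omega>))" using integrable_fZ[OF _ f, of k] i1 ij by blast
    qed simp
    then have "(\<integral>\<omega>. f (Z n i \<omega>) * f (Z n j \<omega>) \<partial>M n) = (\<integral>\<omega>. f (Z n i \<omega>) \<partial>M n) * (\<integral>\<omega>. f (Z n j \<omega>) \<partial>M n)"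
      using ij by simp
    then show ?thesis using m0 integral_fZ[OF ij(1) f] by simp
  qed
  show "integrable (M n) (\<lambda>\<omega>. (\<Sum>i=1..N n. f (Z n i \<omega>))\<^sup>2)"
    by (rule uncorrelated_sum_sq(1)) (auto intro: sqi orth fZ_meas f)
  have "(\<integral>\<omega>. (\<Sum>i=1..N n. f (Z n i \<omega>))\<^sup>2 \<partial>M n) = (\<Sum>i=1..N n. \<integral>\<omega>. (f (Z n i \<omega>))\<^sup>2 \<partial>M n)"
    by (rule uncorrelated_sum_sq(2)) (auto intro: sqi orth fZ_meas f)
  also have "\<dots> = (\<Sum>i=1..N n. \<integral>\<omega>. (f (Z n 1 \<omega>))\<^sup>2 \<partial>M n)"
    by (intro sum.cong refl) (rule integral_fZ[OF _ f2])
  finally show "(\<integral>\<omega>. (\<Sum>i=1..N n. f (Z n i \<omega>))\<^sup>2 \<partial>M n) = N n * (\<integral>\<omega>. (f (Z n 1 \<omega>))\<^sup>2 \<partial>M n)" by simp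
qed

text \<open>Only moments of some order q > 1 are available, so there need not be a variance. Each
  term is cut at h N: the bounded part has second moment at most h N times a first absolute moment,
  which Chebyshev handles, and the rest is small in L^1 by the moment of order q.\<close>

lemma lyapunov_wlln:
  fixes f :: "nat \<Rightarrow> 'b \<Rightarrow> real"
  assumes f: "\<And>n. f n \<in> borel_measurable (S n)" and q: "1 < q"
    and mom: "eventually (\<lambda>n. integrable (M n) (\<lambda>\<omega>. \<bar>f n (Z n 1 \<omega>)\<bar> powr q) \<and> (\<integral>\<omega>. \<bar>f n (Z n 1 \<omega>)\<bar> \<partial>M n) \<le> C) sequentially"
    and lyap: "(\<lambda>n. (\<integral>\<omega>. \<bar>f n (Z n 1 \<omega>)\<bar> powr q \<partial>M n) / N n powr (q - 1)) \<longlonglongrightarrow> 0"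
  shows "op1 M (\<lambda>n \<omega>. (\<Sum>i=1..N n. f n (Z n i \<omega>)) / N n - (\<integral>\<omega>. f n (Z n 1 \<omega>) \<partial>M n))"
proof (rule op1I)
  show "(\<lambda>\<omega>. (\<Sum>i=1..N n. f n (Z n i \<omega>)) / N n - (\<integral>\<omega>. f n (Z n 1 \<omega>) \<partial>M n)) \<in> borel_measurable (M n)" for n
    by (intro borel_measurable_diff borel_measurable_divide borel_measurable_sum borel_measurable_const fZ_meas f)
  fix \<epsilon> \<eta> :: real assume e: "0 < \<epsilon>" "0 < \<eta>"
  define C' where "C' = \<bar>C\<bar> + 1"
  have C': "0 < C'" "C \<le> C'" by (auto simp: C'_def)
  \<comment> \<open>This makes the Chebyshev bound 4 h C' / \<epsilon>^2 equal to \<eta> /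
    2.\<close>
  define h where "h = \<eta> * \<epsilon>\<^sup>2 / (8 * C')"
  have h: "0 < h" using e C' by (simp add: h_def)
  define r where "r n = (\<integral>\<omega>. \<bar>f n (Z n 1 \<omega>)\<bar> powr q \<partial>M n) / N n powr (q - 1)" for n
  \<comment> \<open>The factor 1/8: centring doubles the tail mean, and Markov's inequality at
    \<epsilon> / 2 doubles it again, which leaves \<eta> / 2.\<close>
  have "eventually (\<lambda>n. r n < \<eta> * \<epsilon> * h powr (q - 1) / 8) sequentially"
    using lyap e h unfolding r_def by (intro order_tendstoD(2)) auto
  with mom N_pos show "eventually (\<lambda>n. measure (M n) {\<omega> \<in> space (M n).
      \<epsilon> < \<bar>(\<Sum>i=1..N n. f n (Z n i \<omega>)) / N n - (\<integral>\<omega>. f n (Z n 1 \<omega>) \<partial>M n)\<bar>} \<le> \<eta>) sequentially"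
  proof eventually_elim
    case (elim n)
    interpret prob_space "M n" by (rule prob_M)
    have Nn: "0 < real (N n)" using elim by simp
    note [measurable] = f[of n]
    have [measurable]: "(\<lambda>\<omega>. f n (Z n 1 \<omega>)) \<in> borel_measurable (M n)" by (rule fZ1_meas[OF f])
    have fi: "integrable (M n) (\<lambda>\<omega>. f n (Z n 1 \<omega>))"
      by (rule integrable_of_powr[where q = q]) (use elim(1) q in \<open>simp_all\<close>)
    let ?c = "h * N n"
    have c: "0 < ?c" using h Nn by simp
    define f1 f2 where "f1 z = (if \<bar>f n z\<bar> \<le> ?c then f n z else 0)" and "f2 z = (if \<bar>f n z\<bar> \<le> ?c then 0 else f n z)" for z
    have fm[measurable]: "f1 \<in> borel_measurable (S n)" "f2 \<in> borel_measurable (S n)"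
      unfolding f1_def f2_def by measurable
    have fZm[measurable]: "(\<lambda>\<omega>. f1 (Z n 1 \<omega>)) \<in> borel_measurable (M n)" "(\<lambda>\<omega>. f2 (Z n 1 \<omega>)) \<in> borel_measurable (M n)"
      by (rule fZ1_meas, fact)+
    have f12: "f n z = f1 z + f2 z" for z by (simp add: f1_def f2_def)
    have i1: "integrable (M n) (\<lambda>\<omega>. f1 (Z n 1 \<omega>))" and i2: "integrable (M n) (\<lambda>\<omega>. f2 (Z n 1 \<omega>))"
      by (rule Bochner_Integration.integrable_bound[OF fi]; auto simp: f1_def f2_def)+
    define g1 g2 where "g1 z = f1 z - (\<integral>\<omega>. f1 (Z n 1 \<omega>) \<partial>M n)" and "g2 z = f2 z - (\<integral>\<omega>. f2 (Z n 1 \<omega>) \<partial>M n)" for z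
    have gm[measurable]: "g1 \<in> borel_measurable (S n)" "g2 \<in> borel_measurable (S n)"
      unfolding g1_def g2_def by measurable
    let ?T1 = "\<lambda>\<omega>. (\<Sum>i=1..N n. g1 (Z n i \<omega>)) / N n" and ?T2 = "\<lambda>\<omega>. (\<Sum>i=1..N n. g2 (Z n i \<omega>)) / N n"
    have Tm: "?T1 \<in> borel_measurable (M n)" "?T2 \<in> borel_measurable (M n)"
      by ((intro borel_measurable_divide borel_measurable_sum borel_measurable_const fZ_meas gm; assumption)+)
    have split: "(\<Sum>i=1..N n. f n (Z n i \<omega>)) / N n - (\<integral>\<omega>. f n (Z n 1 \<omega>) \<partial>M n) = ?T1 \<omega> + ?T2 \<omega>" for \<omega>
      using Nn i1 i2 by (simp add: f12 g1_def g2_def sum.distrib sum_subtractf field_simps)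
    have b1: "(f1 z)\<^sup>2 \<le> ?c * \<bar>f n z\<bar>" for z
    proof -
      have "(f1 z)\<^sup>2 = \<bar>f1 z\<bar> * \<bar>f1 z\<bar>" by (simp add: power2_eq_square)
      also have "\<dots> \<le> ?c * \<bar>f n z\<bar>" using c by (intro mult_mono) (auto simp: f1_def)
      finally show ?thesis .
    qed
    have if1: "integrable (M n) (\<lambda>\<omega>. (f1 (Z n 1 \<omega>))\<^sup>2)"
      by (rule Bochner_Integration.integrable_bound[where f = "\<lambda>\<omega>. ?c * f n (Z n 1 \<omega>)"])
         (use fi b1 h in \<open>simp_all add: abs_mult abs_of_pos\<close>)
    have ig1: "integrable (M n) (\<lambda>\<omega>. (g1 (Z n 1 \<omega>))\<^sup>2)"
    proof -
      define m where "m = (\<integral>\<omega>. f1 (Z n 1 \<omega>) \<partial>M n)"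
      have g: "(g1 z)\<^sup>2 = (f1 z)\<^sup>2 - (2 * m) * f1 z + m\<^sup>2" for z
        by (simp add: g1_def m_def power2_eq_square algebra_simps)
      show ?thesis
        unfolding g by (intro Bochner_Integration.integrable_add Bochner_Integration.integrable_diff
            integrable_const integrable_mult_right if1 i1)
    qed
    have v1: "(\<integral>\<omega>. (g1 (Z n 1 \<omega>))\<^sup>2 \<partial>M n) \<le> ?c * C'"
    proof -
      have "(\<integral>\<omega>. (g1 (Z n 1 \<omega>))\<^sup>2 \<partial>M n) = (\<integral>\<omega>. (f1 (Z n 1 \<omega>))\<^sup>2 \<partial>M n) - (\<integral>\<omega>. f1 (Z n 1 \<omega>) \<partial>M n)\<^sup>2"
        unfolding g1_def by (rule variance_eq[OF i1 if1])
      also have "\<dots> \<le> (\<integral>\<omega>. (f1 (Z n 1 \<omega>))\<^sup>2 \<partial>M n)" by simp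
      also have "\<dots> \<le> (\<integral>\<omega>. ?c * \<bar>f n (Z n 1 \<omega>)\<bar> \<partial>M n)" using if1 fi b1 by (intro integral_mono) auto
      also have "\<dots> = ?c * (\<integral>\<omega>. \<bar>f n (Z n 1 \<omega>)\<bar> \<partial>M n)" by simp
      also have "\<dots> \<le> ?c * C'" using elim c C' by (intro mult_left_mono) auto
      finally show ?thesis .
    qed
    have z1: "(\<integral>\<omega>. g1 (Z n 1 \<omega>) \<partial>M n) = 0" unfolding g1_def using i1 by (simp add: prob_space)
    have ig: "integrable (M n) (\<lambda>\<omega>. g1 (Z n 1 \<omega>))" "integrable (M n) (\<lambda>\<omega>. g2 (Z n 1 \<omega>))"
      unfolding g1_def g2_def using i1 i2 by auto
    have P1: "measure (M n) {\<omega> \<in> space (M n). \<epsilon>/2 < \<bar>?T1 \<omega>\<bar>} \<le> \<eta>/2"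
    proof -
      have "{\<omega> \<in> space (M n). \<epsilon>/2 < \<bar>?T1 \<omega>\<bar>} \<subseteq> {\<omega> \<in> space (M n). (\<epsilon>/2)\<^sup>2 < \<bar>(?T1 \<omega>)\<^sup>2\<bar>}"
      proof safe
        fix \<omega> assume "\<epsilon>/2 < \<bar>?T1 \<omega>\<bar>"
        then have "(\<epsilon>/2)\<^sup>2 < \<bar>?T1 \<omega>\<bar>\<^sup>2" using e by (intro power_strict_mono) auto
        then show "(\<epsilon>/2)\<^sup>2 < \<bar>(?T1 \<omega>)\<^sup>2\<bar>" by (simp only: power2_abs abs_power2)
      qed
      then have "measure (M n) {\<omega> \<in> space (M n). \<epsilon>/2 < \<bar>?T1 \<omega>\<bar>} \<le> measure (M n) {\<omega> \<in> space (M n). (\<epsilon>/2)\<^sup>2 < \<bar>(?T1 \<omega>)\<^sup>2\<bar>}"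
        using Tm(1) by (intro measure_M_mono sets_gt borel_measurable_power)
      also have "\<dots> \<le> (\<integral>\<omega>. \<bar>(?T1 \<omega>)\<^sup>2\<bar> \<partial>M n) / (\<epsilon>/2)\<^sup>2"
        using variance_fZ(1)[OF gm(1) ig1 ig(1) z1] e by (intro markov_abs) (auto simp: power_divide)
      also have "(\<integral>\<omega>. \<bar>(?T1 \<omega>)\<^sup>2\<bar> \<partial>M n) = (\<integral>\<omega>. (g1 (Z n 1 \<omega>))\<^sup>2 \<partial>M n) / N n"
        using variance_fZ(2)[OF gm(1) ig1 ig(1) z1] Nn by (simp add: power_divide power2_eq_square)
      also have "\<dots> \<le> (?c * C') / N n" using v1 Nn by (intro divide_right_mono) auto
      also have "\<dots> = h * C'" using Nn by simp
      also have "h * C' / (\<epsilon>/2)\<^sup>2 = \<eta>/2" using e C' by (simp add: h_def field_simps power2_eq_square)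
      finally show ?thesis using e by (simp add: divide_right_mono)
    qed
    have P2: "measure (M n) {\<omega> \<in> space (M n). \<epsilon>/2 < \<bar>?T2 \<omega>\<bar>} \<le> \<eta>/2"
    proof -
      have b2: "\<bar>f2 z\<bar> \<le> \<bar>f n z\<bar> powr q / ?c powr (q - 1)" for z
      proof (cases "\<bar>f n z\<bar> \<le> ?c")
        case False
        then have "?c powr (q - 1) \<le> \<bar>f n z\<bar> powr (q - 1)" using c q by (intro powr_mono2) auto
        then have "\<bar>f n z\<bar> * ?c powr (q - 1) \<le> \<bar>f n z\<bar> * \<bar>f n z\<bar> powr (q - 1)" by (intro mult_left_mono) auto
        also have "\<dots> = \<bar>f n z\<bar> powr q" using False c powr_add[of "\<bar>f n z\<bar>" 1 "q - 1"] by simp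
        finally have "\<bar>f n z\<bar> * ?c powr (q - 1) \<le> \<bar>f n z\<bar> powr q" .
        moreover have "0 < ?c powr (q - 1)" using h Nn by simp
        moreover have "f2 z = f n z" using False by (simp only: f2_def if_False)
        ultimately show ?thesis by (simp only: pos_le_divide_eq)
      next
        case True
        then have "f2 z = 0" by (simp only: f2_def if_True)
        then show ?thesis by simp
      qed
      have "(\<integral>\<omega>. \<bar>f2 (Z n 1 \<omega>)\<bar> \<partial>M n) \<le> (\<integral>\<omega>. \<bar>f n (Z n 1 \<omega>)\<bar> powr q / ?c powr (q - 1) \<partial>M n)"
        by (rule integral_mono[OF integrable_abs[OF i2] integrable_divide[OF conjunct1[OF elim(1)]]]) (rule b2)
      also have "\<dots> = r n / h powr (q - 1)"
        using h Nn by (simp add: r_def powr_mult)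
      also have "\<dots> \<le> (\<eta> * \<epsilon> * h powr (q - 1) / 8) / h powr (q - 1)"
        using elim by (intro divide_right_mono) auto
      also have "\<dots> = \<eta> * \<epsilon> / 8" using h by simp
      finally have E2: "(\<integral>\<omega>. \<bar>f2 (Z n 1 \<omega>)\<bar> \<partial>M n) \<le> \<eta> * \<epsilon> / 8" .
      have "(\<integral>\<omega>. \<bar>g2 (Z n 1 \<omega>)\<bar> \<partial>M n) \<le> (\<integral>\<omega>. \<bar>f2 (Z n 1 \<omega>)\<bar> + \<bar>\<integral>\<omega>. f2 (Z n 1 \<omega>) \<partial>M n\<bar> \<partial>M n)"
        unfolding g2_def
        by (rule integral_mono[OF integrable_abs[OF ig(2)[unfolded g2_def]]
              Bochner_Integration.integrable_add[OF integrable_abs[OF i2] integrable_const]])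
           (rule abs_triangle_ineq4)
      also have "\<dots> = (\<integral>\<omega>. \<bar>f2 (Z n 1 \<omega>)\<bar> \<partial>M n) + \<bar>\<integral>\<omega>. f2 (Z n 1 \<omega>) \<partial>M n\<bar>" using i2 by (simp add: prob_space)
      also have "\<dots> \<le> 2 * (\<eta> * \<epsilon> / 8)"
        using E2 integral_abs_bound[of "M n" "\<lambda>\<omega>. f2 (Z n 1 \<omega>)"] by linarith
      finally have G2: "(\<integral>\<omega>. \<bar>g2 (Z n 1 \<omega>)\<bar> \<partial>M n) \<le> \<eta> * \<epsilon> / 4" by (simp add: mult.commute)
      have gi: "integrable (M n) (\<lambda>\<omega>. g2 (Z n i \<omega>))" if "i \<in> {1..N n}" for i
        using integrable_fZ[OF that gm(2)] ig(2) by simp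
      have abm: "(\<lambda>z. \<bar>g2 z\<bar>) \<in> borel_measurable (S n)" by measurable
      have Ti: "integrable (M n) ?T2" by (intro integrable_divide Bochner_Integration.integrable_sum gi)
      have "(\<integral>\<omega>. \<bar>?T2 \<omega>\<bar> \<partial>M n) \<le> (\<integral>\<omega>. (\<Sum>i=1..N n. \<bar>g2 (Z n i \<omega>)\<bar>) / N n \<partial>M n)"
      proof (rule integral_mono)
        show "integrable (M n) (\<lambda>\<omega>. \<bar>?T2 \<omega>\<bar>)" using Ti by (rule integrable_abs)
        show "integrable (M n) (\<lambda>\<omega>. (\<Sum>i=1..N n. \<bar>g2 (Z n i \<omega>)\<bar>) / N n)"
          by (intro integrable_divide Bochner_Integration.integrable_sum integrable_abs gi)
        show "\<bar>?T2 \<omega>\<bar> \<le> (\<Sum>i=1..N n. \<bar>g2 (Z n i \<omega>)\<bar>) / N n" for \<omega>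
          using sum_abs[of "\<lambda>i. g2 (Z n i \<omega>)" "{1..N n}"] by (simp add: divide_right_mono)
      qed
      also have "\<dots> = (\<Sum>i=1..N n. \<integral>\<omega>. \<bar>g2 (Z n i \<omega>)\<bar> \<partial>M n) / N n"
        by (subst Bochner_Integration.integral_sum[OF integrable_abs[OF gi], symmetric]) simp_all
      also have "(\<Sum>i=1..N n. \<integral>\<omega>. \<bar>g2 (Z n i \<omega>)\<bar> \<partial>M n) = (\<Sum>i=1..N n. \<integral>\<omega>. \<bar>g2 (Z n 1 \<omega>)\<bar> \<partial>M n)"
        by (intro sum.cong refl) (rule integral_fZ[OF _ abm])
      also have "\<dots> / N n = (\<integral>\<omega>. \<bar>g2 (Z n 1 \<omega>)\<bar> \<partial>M n)" using Nn by simp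
      finally have "(\<integral>\<omega>. \<bar>?T2 \<omega>\<bar> \<partial>M n) \<le> \<eta> * \<epsilon> / 4" using G2 by linarith
      then have "(\<integral>\<omega>. \<bar>?T2 \<omega>\<bar> \<partial>M n) / (\<epsilon>/2) \<le> (\<eta> * \<epsilon> / 4) / (\<epsilon>/2)" using e by (intro divide_right_mono) auto
      also have "\<dots> = \<eta>/2" using e by simp
      finally show ?thesis using markov_abs[OF Ti, of "\<epsilon>/2"] e by linarith
    qed
    have "measure (M n) {\<omega> \<in> space (M n). \<epsilon> < \<bar>?T1 \<omega> + ?T2 \<omega>\<bar>} \<le>
        measure (M n) ({\<omega> \<in> space (M n). \<epsilon>/2 < \<bar>?T1 \<omega>\<bar>} \<union> {\<omega> \<in> space (M n). \<epsilon>/2 < \<bar>?T2 \<omega>\<bar>})"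
    proof (intro measure_M_mono sets.Un sets_gt Tm subsetI)
      fix \<omega> assume \<omega>: "\<omega> \<in> {\<omega> \<in> space (M n). \<epsilon> < \<bar>?T1 \<omega> + ?T2 \<omega>\<bar>}"
      moreover have "\<bar>?T1 \<omega> + ?T2 \<omega>\<bar> \<le> \<bar>?T1 \<omega>\<bar> + \<bar>?T2 \<omega>\<bar>" by (rule abs_triangle_ineq)
      ultimately have "\<epsilon>/2 < \<bar>?T1 \<omega>\<bar> \<or> \<epsilon>/2 < \<bar>?T2 \<omega>\<bar>" by (simp only: mem_Collect_eq) linarith
      then show "\<omega> \<in> {\<omega> \<in> space (M n). \<epsilon>/2 < \<bar>?T1 \<omega>\<bar>} \<union> {\<omega> \<in> space (M n). \<epsilon>/2 < \<bar>?T2 \<omega>\<bar>}" using \<omega> by blast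
    qed
    also have "\<dots> \<le> measure (M n) {\<omega> \<in> space (M n). \<epsilon>/2 < \<bar>?T1 \<omega>\<bar>} + measure (M n) {\<omega> \<in> space (M n). \<epsilon>/2 < \<bar>?T2 \<omega>\<bar>}"
      by (intro measure_M_Un sets_gt Tm)
    finally show ?case using P1 P2 unfolding split by linarith
  qed
qed

end

context prob_seq
begin

lemma op1_powr:
  assumes f: "op1 M f" and a: "0 < a"
  shows "op1 M (\<lambda>n \<omega>. \<bar>f n \<omega>\<bar> powr a)"
proof (rule op1I)
  show "(\<lambda>\<omega>. \<bar>f n \<omega>\<bar> powr a) \<in> borel_measurable (M n)" for n using op1_meas[OF f, of n] by measurable
  fix \<epsilon> \<eta> :: real assume e: "0 < \<epsilon>" "0 < \<eta>"
  then have "0 < \<epsilon> powr (1/a)" by simp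
  from op1_ev[OF f this e(2)]
  show "eventually (\<lambda>n. measure (M n) {\<omega> \<in> space (M n). \<epsilon> < \<bar>\<bar>f n \<omega>\<bar> powr a\<bar>} \<le> \<eta>) sequentially"
  proof eventually_elim
    case (elim n)
    have "measure (M n) {\<omega> \<in> space (M n). \<epsilon> < \<bar>\<bar>f n \<omega>\<bar> powr a\<bar>}
        \<le> measure (M n) {\<omega> \<in> space (M n). \<epsilon> powr (1/a) < \<bar>f n \<omega>\<bar>}"
    proof (intro measure_M_mono sets_gt op1_meas[OF f] subsetI)
      fix \<omega> assume \<omega>: "\<omega> \<in> {\<omega> \<in> space (M n). \<epsilon> < \<bar>\<bar>f n \<omega>\<bar> powr a\<bar>}"
      then have "\<epsilon> powr (1/a) < (\<bar>f n \<omega>\<bar> powr a) powr (1/a)" using e a by (intro powr_less_mono2) auto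
      then show "\<omega> \<in> {\<omega> \<in> space (M n). \<epsilon> powr (1/a) < \<bar>f n \<omega>\<bar>}" using \<omega> a by (simp add: powr_powr)
    qed
    then show ?case using elim by linarith
  qed
qed

end

lemma powr_abs_add_le:
  fixes a b q :: real
  assumes "0 \<le> q"
  shows "\<bar>a + b\<bar> powr q \<le> 2 powr q * (\<bar>a\<bar> powr q + \<bar>b\<bar> powr q)"
proof -
  define m where "m = max \<bar>a\<bar> \<bar>b\<bar>"
  have "\<bar>a + b\<bar> \<le> 2 * m" unfolding m_def by linarith
  then have "\<bar>a + b\<bar> powr q \<le> (2 * m) powr q" using assms by (intro powr_mono2) auto
  also have "\<dots> = 2 powr q * m powr q" by (simp add: powr_mult m_def)
  also have "m powr q \<le> \<bar>a\<bar> powr q + \<bar>b\<bar> powr q" by (auto simp: m_def max_def)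
  finally show ?thesis by simp
qed

text \<open>The product is bounded by the square of the larger factor, and doubling the exponent 1 +
  \<delta> / 2 lands exactly on the moments that Lyapunov's condition controls.\<close>

lemma powr_abs_mult_le:
  fixes a b \<delta> :: real
  assumes "0 < \<delta>"
  shows "\<bar>a * b\<bar> powr (1 + \<delta> / 2) \<le> \<bar>a\<bar> powr (2 + \<delta>) + \<bar>b\<bar> powr (2 + \<delta>)"
proof -
  define m where "m = max \<bar>a\<bar> \<bar>b\<bar>"
  have m0: "0 \<le> m" by (simp add: m_def)
  have "\<bar>a * b\<bar> \<le> m * m" unfolding abs_mult m_def by (intro mult_mono) auto
  then have "\<bar>a * b\<bar> powr (1 + \<delta>/2) \<le> (m * m) powr (1 + \<delta>/2)" using assms by (intro powr_mono2) auto
  also have "m * m = m powr 2" using m0 by (simp add: power2_eq_square[symmetric])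
  also have "(m powr 2) powr (1 + \<delta>/2) = m powr (2 * (1 + \<delta>/2))" by (rule powr_powr)
  also have "2 * (1 + \<delta>/2) = 2 + \<delta>" by simp
  also have "m powr (2 + \<delta>) \<le> \<bar>a\<bar> powr (2 + \<delta>) + \<bar>b\<bar> powr (2 + \<delta>)" by (auto simp: m_def max_def)
  finally show ?thesis .
qed

section \<open>Central limit theorem, maxima and second moments under Lyapunov's condition\<close>

context iid_array
begin

text \<open>The classical route: Taylor control of a single characteristic function, then comparison
  of N-th powers. The variance \<open>\<sigma>2\<close> may be 0, as happens for the linear
  combination with both coefficients 0.\<close>

lemma lyapunov_clt:
  fixes f :: "nat \<Rightarrow> 'b \<Rightarrow> real"
  assumes f: "\<And>n. f n \<in> borel_measurable (S n)" and \<delta>: "0 < \<delta>"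
    and mom: "eventually (\<lambda>n. integrable (M n) (\<lambda>\<omega>. \<bar>f n (Z n 1 \<omega>)\<bar> powr (2 + \<delta>)) \<and>
      (\<integral>\<omega>. f n (Z n 1 \<omega>) \<partial>M n) = 0 \<and> (\<integral>\<omega>. (f n (Z n 1 \<omega>))\<^sup>2 \<partial>M n) = \<sigma>2) sequentially"
    and lyap: "(\<lambda>n. (\<integral>\<omega>. \<bar>f n (Z n 1 \<omega>)\<bar> powr (2 + \<delta>) \<partial>M n) / N n powr (\<delta> / 2)) \<longlonglongrightarrow> 0"
  shows "(\<lambda>n. \<integral>\<omega>. iexp ((\<Sum>i=1..N n. f n (Z n i \<omega>)) / sqrt (N n)) \<partial>M n) \<longlonglongrightarrow> of_real (exp (- \<sigma>2 / 2))"
proof -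
  define r where "r n = (\<integral>\<omega>. \<bar>f n (Z n 1 \<omega>)\<bar> powr (2 + \<delta>) \<partial>M n) / N n powr (\<delta> / 2)" for n
  have s0: "0 \<le> \<sigma>2"
  proof -
    from mom obtain n where "(\<integral>\<omega>. (f n (Z n 1 \<omega>))\<^sup>2 \<partial>M n) = \<sigma>2" by (auto simp: eventually_sequentially)
    then show ?thesis by (metis integral_nonneg_AE AE_I2 zero_le_power2)
  qed
  \<comment> \<open>Lindeberg's cut at |x| = e t, used with t = sqrt N and \<theta> = 1 / sqrt N:
    below it the cubic term is at most e x^2, above it 6 x^2 is paid for by the moment of order 2 +
    \<delta>.\<close>
  have split: "min (6 * x\<^sup>2) (\<theta> * \<bar>x\<bar> ^ 3) \<le> e * x\<^sup>2 + 6 * \<bar>x\<bar> powr (2 + \<delta>) / (e * t) powr \<delta>"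
    if t: "0 < t" "\<theta> * t = 1" and e: "0 < e" for x \<theta> t e :: real
  proof (cases "\<bar>x\<bar> \<le> e * t")
    case True
    have "0 < \<theta>" using t by (metis zero_less_mult_pos2 zero_less_one)
    then have "\<theta> * \<bar>x\<bar> \<le> \<theta> * (e * t)" using True by simp
    also have "\<dots> = e" using t by (metis mult.assoc mult.commute mult.right_neutral)
    finally have "(\<theta> * \<bar>x\<bar>) * x\<^sup>2 \<le> e * x\<^sup>2" by (rule mult_right_mono) simp
    then have "\<theta> * \<bar>x\<bar> ^ 3 \<le> e * x\<^sup>2" by (simp add: power3_eq_cube power2_eq_square)
    moreover have "0 \<le> 6 * \<bar>x\<bar> powr (2 + \<delta>) / (e * t) powr \<delta>" by simp
    ultimately show ?thesis by linarith
  next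
    case False
    have p: "0 < (e * t) powr \<delta>" using e t by simp
    have "(e * t) powr \<delta> \<le> \<bar>x\<bar> powr \<delta>" using False e t \<delta> by (intro powr_mono2) auto
    then have "x\<^sup>2 * (e * t) powr \<delta> \<le> x\<^sup>2 * \<bar>x\<bar> powr \<delta>" by (rule mult_left_mono) simp
    also have "x\<^sup>2 * \<bar>x\<bar> powr \<delta> = \<bar>x\<bar> powr (2 + \<delta>)" by (simp add: powr_add)
    finally have "x\<^sup>2 \<le> \<bar>x\<bar> powr (2 + \<delta>) / (e * t) powr \<delta>" by (simp only: pos_le_divide_eq[OF p])
    then have "6 * x\<^sup>2 \<le> 6 * \<bar>x\<bar> powr (2 + \<delta>) / (e * t) powr \<delta>" by simp
    moreover have "0 \<le> e * x\<^sup>2" using e by simp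
    ultimately show ?thesis by linarith
  qed
  have main: "eventually (\<lambda>n. cmod ((\<integral>\<omega>. iexp ((\<Sum>i=1..N n. f n (Z n i \<omega>)) / sqrt (N n)) \<partial>M n) - of_real ((1 + (- \<sigma>2 / 2) / N n) ^ N n)) \<le> \<epsilon>) sequentially"
    if \<epsilon>: "0 < \<epsilon>" for \<epsilon> :: real
  proof -
    \<comment> \<open>The summand 1 in the denominator covers the degenerate case
      \<open>\<sigma>2\<close> = 0.\<close>
    define e where "e = \<epsilon> / (\<sigma>2 + 1)"
    have e: "0 < e" using \<epsilon> s0 by (simp add: e_def)
    have es: "e * \<sigma>2 \<le> \<epsilon>"
    proof -
      have "e * \<sigma>2 \<le> e * (\<sigma>2 + 1)" using e by simp
      also have "\<dots> = \<epsilon>" using s0 by (simp add: e_def)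
      finally show ?thesis .
    qed
    have "eventually (\<lambda>n. r n < \<epsilon> / 2 * e powr \<delta>) sequentially"
      using lyap \<epsilon> e unfolding r_def by (intro order_tendstoD(2)) auto
    moreover have "eventually (\<lambda>n. \<sigma>2 \<le> real (N n)) sequentially"
      using N_real by (simp add: filterlim_at_top)
    ultimately show ?thesis using mom N_pos
    proof eventually_elim
      case (elim n)
      interpret prob_space "M n" by (rule prob_M)
      have Nn: "0 < real (N n)" using elim(4) by simp
      define \<theta> where "\<theta> = 1 / sqrt (N n)"
      have \<theta>2: "\<theta>\<^sup>2 = 1 / N n" and \<theta>0: "0 < \<theta>" and \<theta>1: "\<theta> * sqrt (N n) = 1" using Nn by (auto simp: \<theta>_def power_divide)
      let ?X = "\<lambda>\<omega>. f n (Z n 1 \<omega>)"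
      have Xm[measurable]: "?X \<in> borel_measurable (M n)" by (rule fZ1_meas[OF f])
      have ip: "integrable (M n) (\<lambda>\<omega>. \<bar>?X \<omega>\<bar> powr (2 + \<delta>))" using elim(3) by blast
      have i2: "integrable (M n) (\<lambda>\<omega>. (?X \<omega>)\<^sup>2)" by (rule sq_integrable_of_powr[OF Xm ip]) (use \<delta> in simp)
      have i1: "integrable (M n) ?X" by (rule integrable_of_powr[OF Xm ip]) (use \<delta> in simp)
      have E0: "(\<integral>\<omega>. ?X \<omega> \<partial>M n) = 0" and E2: "(\<integral>\<omega>. (?X \<omega>)\<^sup>2 \<partial>M n) = \<sigma>2" using elim(3) by blast+
      define \<phi> where "\<phi> = char (distr (M n) borel ?X) \<theta>"
      have "(\<integral>\<omega>. iexp ((\<Sum>i=1..N n. f n (Z n i \<omega>)) / sqrt (N n)) \<partial>M n)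
          = char (distr (M n) borel (\<lambda>\<omega>. \<Sum>i=1..N n. f n (Z n i \<omega>))) \<theta>"
        unfolding char_def
        by (subst integral_distr) (auto intro!: borel_measurable_sum fZ_meas f simp: \<theta>_def)
      also have "\<dots> = (\<Prod>i=1..N n. char (distr (M n) borel (\<lambda>\<omega>. f n (Z n i \<omega>))) \<theta>)"
        by (rule char_distr_sum[OF indep_fZ[OF f]])
      also have "\<dots> = (\<Prod>i=1..N n. \<phi>)"
      proof (intro prod.cong refl)
        fix i assume i: "i \<in> {1..N n}"
        have "distr (M n) borel (\<lambda>\<omega>. f n (Z n i \<omega>)) = distr (distr (M n) (S n) (Z n i)) borel (f n)"
          using distr_distr[OF f Z_meas[OF i]] by (simp add: comp_def)
        also have "\<dots> = distr (distr (M n) (S n) (Z n 1)) borel (f n)" by (simp only: ident[OF i])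
        also have "\<dots> = distr (M n) borel ?X" using distr_distr[OF f Z1] by (simp add: comp_def)
        finally show "char (distr (M n) borel (\<lambda>\<omega>. f n (Z n i \<omega>))) \<theta> = \<phi>" by (simp only: \<phi>_def)
      qed
      also have "\<dots> = \<phi> ^ N n" by simp
      finally have lhs: "(\<integral>\<omega>. iexp ((\<Sum>i=1..N n. f n (Z n i \<omega>)) / sqrt (N n)) \<partial>M n) = \<phi> ^ N n" .
      have "cmod (\<phi> - (1 - \<theta>\<^sup>2 * \<sigma>2 / 2)) \<le> (\<theta>\<^sup>2 / 6) * expectation (\<lambda>\<omega>. min (6 * (?X \<omega>)\<^sup>2) (\<bar>\<theta>\<bar> * \<bar>?X \<omega>\<bar> ^ 3))"
        unfolding \<phi>_def by (rule char_approx3'[OF Xm i1 i2 E0 _ refl]) (simp only: E0 E2 diff_0_right)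
      then have c3: "cmod (\<phi> - (1 - \<theta>\<^sup>2 * \<sigma>2 / 2)) \<le> (\<theta>\<^sup>2 / 6) * expectation (\<lambda>\<omega>. min (6 * (?X \<omega>)\<^sup>2) (\<theta> * \<bar>?X \<omega>\<bar> ^ 3))"
        using \<theta>0 by simp
      let ?b = "\<lambda>\<omega>. e * (?X \<omega>)\<^sup>2 + 6 * \<bar>?X \<omega>\<bar> powr (2 + \<delta>) / (e * sqrt (N n)) powr \<delta>"
      have "expectation (\<lambda>\<omega>. min (6 * (?X \<omega>)\<^sup>2) (\<theta> * \<bar>?X \<omega>\<bar> ^ 3)) \<le> expectation ?b"
      proof (rule integral_mono)
        show ib: "integrable (M n) ?b" using i2 ip by simp
        show "min (6 * (?X \<omega>)\<^sup>2) (\<theta> * \<bar>?X \<omega>\<bar> ^ 3) \<le> ?b \<omega>" for \<omega>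
          by (rule split[OF _ \<theta>1 e]) (use Nn in simp)
        show "integrable (M n) (\<lambda>\<omega>. min (6 * (?X \<omega>)\<^sup>2) (\<theta> * \<bar>?X \<omega>\<bar> ^ 3))"
        proof (rule Bochner_Integration.integrable_bound)
          show "integrable (M n) (\<lambda>\<omega>. 6 * (?X \<omega>)\<^sup>2)" using i2 by simp
          show "AE \<omega> in M n. norm (min (6 * (?X \<omega>)\<^sup>2) (\<theta> * \<bar>?X \<omega>\<bar> ^ 3)) \<le> norm (6 * (?X \<omega>)\<^sup>2)"
          proof (rule AE_I2)
            fix \<omega>
            have "0 \<le> \<theta> * \<bar>?X \<omega>\<bar> ^ 3" using \<theta>0 by simp
            then show "norm (min (6 * (?X \<omega>)\<^sup>2) (\<theta> * \<bar>?X \<omega>\<bar> ^ 3)) \<le> norm (6 * (?X \<omega>)\<^sup>2)"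
              by (simp add: min_def)
          qed
        qed measurable
      qed
      also have "expectation ?b = e * \<sigma>2 + 6 * (\<integral>\<omega>. \<bar>?X \<omega>\<bar> powr (2 + \<delta>) \<partial>M n) / (e * sqrt (N n)) powr \<delta>"
        using i2 ip E2 by simp
      also have "6 * (\<integral>\<omega>. \<bar>?X \<omega>\<bar> powr (2 + \<delta>) \<partial>M n) / (e * sqrt (N n)) powr \<delta> = 6 * (r n / e powr \<delta>)"
      proof -
        have "(e * sqrt (N n)) powr \<delta> = e powr \<delta> * N n powr (\<delta> / 2)"
          using e Nn by (simp add: powr_mult powr_half_sqrt[symmetric] powr_powr)
        then show ?thesis by (simp add: r_def)
      qed
      also have "r n / e powr \<delta> \<le> (\<epsilon> / 2 * e powr \<delta>) / e powr \<delta>" using elim(1) by (intro divide_right_mono) auto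
      also have "\<dots> = \<epsilon> / 2" using e by simp
      finally have E: "expectation (\<lambda>\<omega>. min (6 * (?X \<omega>)\<^sup>2) (\<theta> * \<bar>?X \<omega>\<bar> ^ 3)) \<le> 4 * \<epsilon>" using es by simp
      \<comment> \<open>Both bases have modulus at most 1, the second because
        \<open>\<sigma>2\<close> <= N, so the powers differ by at most N times the difference of the
        bases; this N is cancelled by \<theta>^2 = 1 / N.\<close>
      have "cmod (\<phi> ^ N n - (of_real (1 - \<theta>\<^sup>2 * \<sigma>2 / 2)) ^ N n) \<le> N n * cmod (\<phi> - of_real (1 - \<theta>\<^sup>2 * \<sigma>2 / 2))"
      proof (rule norm_power_diff)
        show "cmod \<phi> \<le> 1" unfolding \<phi>_def
          by (intro real_distribution.cmod_char_le_1 real_distribution_distr Xm)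
        have "\<bar>1 - \<theta>\<^sup>2 * \<sigma>2 / 2\<bar> \<le> 1" using elim(2) Nn s0 by (auto simp: \<theta>2 abs_le_iff field_simps)
        then show "cmod (of_real (1 - \<theta>\<^sup>2 * \<sigma>2 / 2)) \<le> 1" by (simp only: norm_of_real)
      qed
      also have "\<dots> \<le> N n * ((\<theta>\<^sup>2 / 6) * (4 * \<epsilon>))"
        using c3 E by (intro mult_left_mono order_trans[OF _ mult_left_mono[OF E]]) auto
      also have "\<dots> \<le> \<epsilon>" using Nn \<epsilon> by (simp add: \<theta>2)
      finally show ?case unfolding lhs by (simp add: \<theta>2 mult.commute)
    qed
  qed
  have "(\<lambda>n. (\<integral>\<omega>. iexp ((\<Sum>i=1..N n. f n (Z n i \<omega>)) / sqrt (N n)) \<partial>M n) - of_real ((1 + (- \<sigma>2 / 2) / N n) ^ N n)) \<longlonglongrightarrow> 0"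
  proof (rule tendstoI)
    fix \<epsilon> :: real assume "0 < \<epsilon>"
    then have "0 < \<epsilon> / 2" by simp
    from main[OF this] show "eventually (\<lambda>n. dist ((\<integral>\<omega>. iexp ((\<Sum>i=1..N n. f n (Z n i \<omega>)) / sqrt (N n)) \<partial>M n) - of_real ((1 + (- \<sigma>2 / 2) / N n) ^ N n)) 0 < \<epsilon>) sequentially"
      by eventually_elim (use \<open>0 < \<epsilon>\<close> in \<open>simp add: dist_norm\<close>)
  qed
  moreover have "(\<lambda>n. complex_of_real ((1 + (- \<sigma>2 / 2) / N n) ^ N n)) \<longlonglongrightarrow> of_real (exp (- \<sigma>2 / 2))"
    by (intro tendsto_of_real filterlim_compose[OF tendsto_exp_limit_sequentially N])
  ultimately show ?thesis using tendsto_add by fastforce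
qed

text \<open>The maximum is at most the l^q norm for q = 2 + \<delta>, and the expected q-th power of
  that norm relative to N^(q/2) is precisely Lyapunov's ratio.\<close>

lemma lyapunov_max:
  fixes f :: "nat \<Rightarrow> 'b \<Rightarrow> real"
  assumes f: "\<And>n. f n \<in> borel_measurable (S n)" and \<delta>: "0 < \<delta>"
    and mom: "eventually (\<lambda>n. integrable (M n) (\<lambda>\<omega>. \<bar>f n (Z n 1 \<omega>)\<bar> powr (2 + \<delta>))) sequentially"
    and lyap: "(\<lambda>n. (\<integral>\<omega>. \<bar>f n (Z n 1 \<omega>)\<bar> powr (2 + \<delta>) \<partial>M n) / N n powr (\<delta> / 2)) \<longlonglongrightarrow> 0"
  obtains mx where "op1 M mx" "\<And>n i \<omega>. i \<in> {1..N n} \<Longrightarrow> \<bar>f n (Z n i \<omega>)\<bar> \<le> \<bar>mx n \<omega>\<bar> * sqrt (N n)"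
proof -
  define q where "q = 2 + \<delta>"
  have q: "0 < q" using \<delta> by (simp add: q_def)
  define R where "R n \<omega> = (\<Sum>i=1..N n. \<bar>f n (Z n i \<omega>)\<bar> powr q) / N n powr (q / 2)" for n \<omega>
  have fq: "(\<lambda>z. \<bar>f n z\<bar> powr q) \<in> borel_measurable (S n)" for n using f[of n] by measurable
  have R0: "0 \<le> R n \<omega>" for n \<omega> by (simp add: R_def sum_nonneg)
  have "op1 M R"
  proof (rule op1_of_L1[OF _ _ lyap])
    show "R n \<in> borel_measurable (M n)" for n
      unfolding R_def by (intro borel_measurable_divide borel_measurable_sum borel_measurable_const fZ_meas fq)
    show "eventually (\<lambda>n. integrable (M n) (R n) \<and> (\<integral>\<omega>. \<bar>R n \<omega>\<bar> \<partial>M n) \<le>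
        (\<integral>\<omega>. \<bar>f n (Z n 1 \<omega>)\<bar> powr (2 + \<delta>) \<partial>M n) / N n powr (\<delta> / 2)) sequentially"
      using mom N_pos
    proof eventually_elim
      case (elim n)
      have i: "integrable (M n) (\<lambda>\<omega>. \<bar>f n (Z n i \<omega>)\<bar> powr q)" if "i \<in> {1..N n}" for i
        using integrable_fZ[OF that fq] elim(1) unfolding q_def by blast
      have iR: "integrable (M n) (R n)"
        unfolding R_def by (intro integrable_divide Bochner_Integration.integrable_sum i)
      have "(\<integral>\<omega>. \<bar>R n \<omega>\<bar> \<partial>M n) = (\<integral>\<omega>. R n \<omega> \<partial>M n)" using R0 by simp
      also have "\<dots> = (\<integral>\<omega>. (\<Sum>i=1..N n. \<bar>f n (Z n i \<omega>)\<bar> powr q) \<partial>M n) / N n powr (q / 2)"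
        unfolding R_def by (rule integral_divide_zero)
      also have "(\<integral>\<omega>. (\<Sum>i=1..N n. \<bar>f n (Z n i \<omega>)\<bar> powr q) \<partial>M n) = (\<Sum>i=1..N n. \<integral>\<omega>. \<bar>f n (Z n i \<omega>)\<bar> powr q \<partial>M n)"
        by (rule Bochner_Integration.integral_sum[OF i])
      also have "\<dots> = (\<Sum>i=1..N n. \<integral>\<omega>. \<bar>f n (Z n 1 \<omega>)\<bar> powr q \<partial>M n)"
        by (intro sum.cong refl) (rule integral_fZ[OF _ fq])
      also have "\<dots> / N n powr (q / 2) = (\<integral>\<omega>. \<bar>f n (Z n 1 \<omega>)\<bar> powr q \<partial>M n) / N n powr (\<delta> / 2)"
      proof -
        have "q / 2 = 1 + \<delta> / 2" by (simp add: q_def)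
        then have "real (N n) powr (q / 2) = N n * N n powr (\<delta> / 2)" using elim(2) by (simp only: powr_add) simp
        then show ?thesis using elim(2) by simp
      qed
      finally show ?case using iR by (simp add: q_def)
    qed
  qed
  then have "op1 M (\<lambda>n \<omega>. \<bar>R n \<omega>\<bar> powr (1 / q))" using q by (intro op1_powr) auto
  moreover have "\<bar>f n (Z n i \<omega>)\<bar> \<le> \<bar>\<bar>R n \<omega>\<bar> powr (1 / q)\<bar> * sqrt (N n)" if i: "i \<in> {1..N n}" for n i \<omega>
  proof -
    have Nn: "0 < real (N n)" using i by auto
    have "\<bar>f n (Z n i \<omega>)\<bar> powr q \<le> (\<Sum>i=1..N n. \<bar>f n (Z n i \<omega>)\<bar> powr q)"
      by (rule member_le_sum[OF i]) auto
    also have "\<dots> = R n \<omega> * N n powr (q / 2)" using Nn by (simp add: R_def)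
    finally have "(\<bar>f n (Z n i \<omega>)\<bar> powr q) powr (1 / q) \<le> (R n \<omega> * N n powr (q / 2)) powr (1 / q)"
      using q by (intro powr_mono2) auto
    then have "\<bar>f n (Z n i \<omega>)\<bar> \<le> R n \<omega> powr (1 / q) * N n powr (1 / 2)"
      using q R0[of n \<omega>] by (simp add: powr_powr powr_mult)
    then show ?thesis using Nn R0[of n \<omega>] by (simp add: powr_half_sqrt)
  qed
  ultimately show thesis by (rule that)
qed

text \<open>The product has moments of order q = 1 + \<delta> / 2, and q - 1 = \<delta> / 2 is the
  exponent of N in Lyapunov's condition, so the weak law applies with the same
  normalisation.\<close>

lemma lyapunov_product_wlln:
  fixes f g :: "nat \<Rightarrow> 'b \<Rightarrow> real"
  assumes f: "\<And>n. f n \<in> borel_measurable (S n)" and g: "\<And>n. g n \<in> borel_measurable (S n)" and \<delta>: "0 < \<delta>"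
    and mf: "eventually (\<lambda>n. integrable (M n) (\<lambda>\<omega>. \<bar>f n (Z n 1 \<omega>)\<bar> powr (2 + \<delta>)) \<and> (\<integral>\<omega>. (f n (Z n 1 \<omega>))\<^sup>2 \<partial>M n) = 1) sequentially"
    and mg: "eventually (\<lambda>n. integrable (M n) (\<lambda>\<omega>. \<bar>g n (Z n 1 \<omega>)\<bar> powr (2 + \<delta>)) \<and> (\<integral>\<omega>. (g n (Z n 1 \<omega>))\<^sup>2 \<partial>M n) = 1) sequentially"
    and lf: "(\<lambda>n. (\<integral>\<omega>. \<bar>f n (Z n 1 \<omega>)\<bar> powr (2 + \<delta>) \<partial>M n) / N n powr (\<delta> / 2)) \<longlonglongrightarrow> 0"
    and lg: "(\<lambda>n. (\<integral>\<omega>. \<bar>g n (Z n 1 \<omega>)\<bar> powr (2 + \<delta>) \<partial>M n) / N n powr (\<delta> / 2)) \<longlonglongrightarrow> 0"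
  shows "op1 M (\<lambda>n \<omega>. (\<Sum>i=1..N n. f n (Z n i \<omega>) * g n (Z n i \<omega>)) / N n - (\<integral>\<omega>. f n (Z n 1 \<omega>) * g n (Z n 1 \<omega>) \<partial>M n))"
proof -
  define q where "q = 1 + \<delta> / 2"
  have q: "1 < q" "q - 1 = \<delta> / 2" using \<delta> by (simp_all add: q_def)
  let ?h = "\<lambda>n z. f n z * g n z"
  have h: "?h n \<in> borel_measurable (S n)" for n by (intro borel_measurable_times f g)
  have bnd: "eventually (\<lambda>n. integrable (M n) (\<lambda>\<omega>. \<bar>?h n (Z n 1 \<omega>)\<bar> powr q) \<and> (\<integral>\<omega>. \<bar>?h n (Z n 1 \<omega>)\<bar> \<partial>M n) \<le> 1 \<and>
     (\<integral>\<omega>. \<bar>?h n (Z n 1 \<omega>)\<bar> powr q \<partial>M n) \<le> (\<integral>\<omega>. \<bar>f n (Z n 1 \<omega>)\<bar> powr (2 + \<delta>) \<partial>M n) + (\<integral>\<omega>. \<bar>g n (Z n 1 \<omega>)\<bar> powr (2 + \<delta>) \<partial>M n)) sequentially"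
    using mf mg
  proof eventually_elim
    case (elim n)
    interpret prob_space "M n" by (rule prob_M)
    let ?X = "\<lambda>\<omega>. f n (Z n 1 \<omega>)" and ?Y = "\<lambda>\<omega>. g n (Z n 1 \<omega>)"
    have Xm[measurable]: "?X \<in> borel_measurable (M n)" by (rule fZ1_meas[OF f])
    have Ym[measurable]: "?Y \<in> borel_measurable (M n)" by (rule fZ1_meas[OF g])
    have d0: "0 \<le> \<delta>" using \<delta> by simp
    have X2: "integrable (M n) (\<lambda>\<omega>. (?X \<omega>)\<^sup>2)" by (rule sq_integrable_of_powr[OF Xm _ d0]) (use elim(1) in blast)
    have Y2: "integrable (M n) (\<lambda>\<omega>. (?Y \<omega>)\<^sup>2)" by (rule sq_integrable_of_powr[OF Ym _ d0]) (use elim(2) in blast)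
    have Xq: "integrable (M n) (\<lambda>\<omega>. \<bar>?X \<omega>\<bar> powr (2 + \<delta>))" and Yq: "integrable (M n) (\<lambda>\<omega>. \<bar>?Y \<omega>\<bar> powr (2 + \<delta>))"
      using elim by blast+
    have le: "\<bar>?X \<omega> * ?Y \<omega>\<bar> powr q \<le> \<bar>?X \<omega>\<bar> powr (2 + \<delta>) + \<bar>?Y \<omega>\<bar> powr (2 + \<delta>)" for \<omega>
      unfolding q_def by (rule powr_abs_mult_le[OF \<delta>])
    have iq: "integrable (M n) (\<lambda>\<omega>. \<bar>?X \<omega> * ?Y \<omega>\<bar> powr q)"
    proof (rule Bochner_Integration.integrable_bound)
      show "integrable (M n) (\<lambda>\<omega>. \<bar>?X \<omega>\<bar> powr (2 + \<delta>) + \<bar>?Y \<omega>\<bar> powr (2 + \<delta>))"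
        by (rule Bochner_Integration.integrable_add[OF Xq Yq])
      show "AE \<omega> in M n. norm (\<bar>?X \<omega> * ?Y \<omega>\<bar> powr q) \<le> norm (\<bar>?X \<omega>\<bar> powr (2 + \<delta>) + \<bar>?Y \<omega>\<bar> powr (2 + \<delta>))"
        using le by (intro AE_I2) simp
    qed measurable
    have E1: "(\<integral>\<omega>. \<bar>?X \<omega> * ?Y \<omega>\<bar> \<partial>M n) \<le> (\<integral>\<omega>. (1/2) * (?X \<omega>)\<^sup>2 + (1/2) * (?Y \<omega>)\<^sup>2 \<partial>M n)"
    proof (rule integral_mono)
      show "\<bar>?X \<omega> * ?Y \<omega>\<bar> \<le> (1/2) * (?X \<omega>)\<^sup>2 + (1/2) * (?Y \<omega>)\<^sup>2" for \<omega>
        using sum_squares_bound[of "\<bar>?X \<omega>\<bar>" "\<bar>?Y \<omega>\<bar>"] by (simp add: abs_mult)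
      show "integrable (M n) (\<lambda>\<omega>. \<bar>?X \<omega> * ?Y \<omega>\<bar>)"
        by (intro integrable_abs integrable_mult_of_sq Xm Ym X2 Y2)
    qed (intro Bochner_Integration.integrable_add integrable_mult_right X2 Y2)
    also have "\<dots> = 1" using X2 Y2 elim by simp
    finally have E1: "(\<integral>\<omega>. \<bar>?X \<omega> * ?Y \<omega>\<bar> \<partial>M n) \<le> 1" .
    have "(\<integral>\<omega>. \<bar>?X \<omega> * ?Y \<omega>\<bar> powr q \<partial>M n) \<le> (\<integral>\<omega>. \<bar>?X \<omega>\<bar> powr (2 + \<delta>) + \<bar>?Y \<omega>\<bar> powr (2 + \<delta>) \<partial>M n)"
      by (rule integral_mono[OF iq Bochner_Integration.integrable_add[OF Xq Yq] le])
    also have "\<dots> = (\<integral>\<omega>. \<bar>?X \<omega>\<bar> powr (2 + \<delta>) \<partial>M n) + (\<integral>\<omega>. \<bar>?Y \<omega>\<bar> powr (2 + \<delta>) \<partial>M n)"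
      by (rule Bochner_Integration.integral_add[OF Xq Yq])
    finally show ?case using iq E1 by blast
  qed
  show ?thesis
  proof (rule lyapunov_wlln[where f = ?h, OF h q(1)])
    show "eventually (\<lambda>n. integrable (M n) (\<lambda>\<omega>. \<bar>?h n (Z n 1 \<omega>)\<bar> powr q) \<and> (\<integral>\<omega>. \<bar>?h n (Z n 1 \<omega>)\<bar> \<partial>M n) \<le> 1) sequentially"
      using bnd by (rule eventually_mono) blast
    have lim: "(\<lambda>n. (\<integral>\<omega>. \<bar>f n (Z n 1 \<omega>)\<bar> powr (2 + \<delta>) \<partial>M n) / N n powr (\<delta> / 2) + (\<integral>\<omega>. \<bar>g n (Z n 1 \<omega>)\<bar> powr (2 + \<delta>) \<partial>M n) / N n powr (\<delta> / 2)) \<longlonglongrightarrow> 0"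
      using tendsto_add[OF lf lg] by simp
    show "(\<lambda>n. (\<integral>\<omega>. \<bar>?h n (Z n 1 \<omega>)\<bar> powr q \<partial>M n) / N n powr (q - 1)) \<longlonglongrightarrow> 0"
    proof (rule Lim_null_comparison[OF _ lim])
      show "eventually (\<lambda>n. norm ((\<integral>\<omega>. \<bar>?h n (Z n 1 \<omega>)\<bar> powr q \<partial>M n) / N n powr (q - 1)) \<le>
        (\<integral>\<omega>. \<bar>f n (Z n 1 \<omega>)\<bar> powr (2 + \<delta>) \<partial>M n) / N n powr (\<delta> / 2) + (\<integral>\<omega>. \<bar>g n (Z n 1 \<omega>)\<bar> powr (2 + \<delta>) \<partial>M n) / N n powr (\<delta> / 2)) sequentially"
        using bnd
      proof eventually_elim
        case (elim n)
        have "0 \<le> (\<integral>\<omega>. \<bar>?h n (Z n 1 \<omega>)\<bar> powr q \<partial>M n)" by (intro integral_nonneg_AE AE_I2) simp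
        then show ?case
          using elim unfolding q(2) add_divide_distrib[symmetric] by (simp add: divide_right_mono)
      qed
    qed
  qed
qed

lemma tight_normalized_sum:
  fixes f :: "nat \<Rightarrow> 'b \<Rightarrow> real"
  assumes f: "\<And>n. f n \<in> borel_measurable (S n)"
    and mf: "eventually (\<lambda>n. integrable (M n) (\<lambda>\<omega>. (f n (Z n 1 \<omega>))\<^sup>2) \<and> integrable (M n) (\<lambda>\<omega>. f n (Z n 1 \<omega>)) \<and>
      (\<integral>\<omega>. f n (Z n 1 \<omega>) \<partial>M n) = 0 \<and> (\<integral>\<omega>. (f n (Z n 1 \<omega>))\<^sup>2 \<partial>M n) = 1) sequentially"
  shows "tight_rv M (\<lambda>n \<omega>. (\<Sum>i=1..N n. f n (Z n i \<omega>)) / sqrt (N n))"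
proof (rule tight_rv_of_L2)
  show "(\<lambda>\<omega>. (\<Sum>i=1..N n. f n (Z n i \<omega>)) / sqrt (N n)) \<in> borel_measurable (M n)" for n
    by (intro borel_measurable_divide borel_measurable_sum borel_measurable_const fZ_meas f)
  show "eventually (\<lambda>n. integrable (M n) (\<lambda>\<omega>. ((\<Sum>i=1..N n. f n (Z n i \<omega>)) / sqrt (N n))\<^sup>2) \<and>
      (\<integral>\<omega>. ((\<Sum>i=1..N n. f n (Z n i \<omega>)) / sqrt (N n))\<^sup>2 \<partial>M n) \<le> 1) sequentially"
    using mf N_pos
  proof eventually_elim
    case (elim n)
    have Nn: "0 < real (N n)" using elim(2) by simp
    have m: "integrable (M n) (\<lambda>\<omega>. (f n (Z n 1 \<omega>))\<^sup>2)" "integrable (M n) (\<lambda>\<omega>. f n (Z n 1 \<omega>))"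
      "(\<integral>\<omega>. f n (Z n 1 \<omega>) \<partial>M n) = 0" "(\<integral>\<omega>. (f n (Z n 1 \<omega>))\<^sup>2 \<partial>M n) = 1" using elim(1) by blast+
    have e: "((\<Sum>i=1..N n. f n (Z n i \<omega>)) / sqrt (N n))\<^sup>2 = (\<Sum>i=1..N n. f n (Z n i \<omega>))\<^sup>2 / N n" for \<omega>
      by (simp add: power_divide)
    show ?case
      unfolding e integral_divide_zero variance_fZ(2)[OF f m(1,2,3)] m(4)
      using variance_fZ(1)[OF f m(1,2,3)] Nn by (intro conjI integrable_divide) simp_all
  qed
qed

text \<open>The Cramer-Wold device: \<open>s * fx + t * fy\<close> has variance s^2 + t^2 because
  the coordinates are uncorrelated, and it inherits Lyapunov's condition. The second moment
  conditions come from the weak law for products, tightness and maxima coordinate by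
  coordinate.\<close>

theorem lyapunov_el_array:
  fixes fx fy :: "nat \<Rightarrow> 'b \<Rightarrow> real"
  assumes fx: "\<And>n. fx n \<in> borel_measurable (S n)" and fy: "\<And>n. fy n \<in> borel_measurable (S n)" and \<delta>: "0 < \<delta>"
    and mx: "eventually (\<lambda>n. integrable (M n) (\<lambda>\<omega>. \<bar>fx n (Z n 1 \<omega>)\<bar> powr (2 + \<delta>)) \<and>
      (\<integral>\<omega>. fx n (Z n 1 \<omega>) \<partial>M n) = 0 \<and> (\<integral>\<omega>. (fx n (Z n 1 \<omega>))\<^sup>2 \<partial>M n) = 1) sequentially"
    and my: "eventually (\<lambda>n. integrable (M n) (\<lambda>\<omega>. \<bar>fy n (Z n 1 \<omega>)\<bar> powr (2 + \<delta>)) \<and>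
      (\<integral>\<omega>. fy n (Z n 1 \<omega>) \<partial>M n) = 0 \<and> (\<integral>\<omega>. (fy n (Z n 1 \<omega>))\<^sup>2 \<partial>M n) = 1) sequentially"
    and mxy: "eventually (\<lambda>n. (\<integral>\<omega>. fx n (Z n 1 \<omega>) * fy n (Z n 1 \<omega>) \<partial>M n) = 0) sequentially"
    and lx: "(\<lambda>n. (\<integral>\<omega>. \<bar>fx n (Z n 1 \<omega>)\<bar> powr (2 + \<delta>) \<partial>M n) / N n powr (\<delta> / 2)) \<longlonglongrightarrow> 0"
    and ly: "(\<lambda>n. (\<integral>\<omega>. \<bar>fy n (Z n 1 \<omega>)\<bar> powr (2 + \<delta>) \<partial>M n) / N n powr (\<delta> / 2)) \<longlonglongrightarrow> 0"
  obtains rx ry where "el_array M N (\<lambda>n i \<omega>. fx n (Z n i \<omega>)) (\<lambda>n i \<omega>. fy n (Z n i \<omega>)) rx ry"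
proof -
  have d0: "0 \<le> \<delta>" and d1: "1 \<le> 2 + \<delta>" using \<delta> by auto
  have mx': "eventually (\<lambda>n. integrable (M n) (\<lambda>\<omega>. \<bar>fx n (Z n 1 \<omega>)\<bar> powr (2 + \<delta>)) \<and> (\<integral>\<omega>. (fx n (Z n 1 \<omega>))\<^sup>2 \<partial>M n) = 1) sequentially"
    using mx by (rule eventually_mono) blast
  have my': "eventually (\<lambda>n. integrable (M n) (\<lambda>\<omega>. \<bar>fy n (Z n 1 \<omega>)\<bar> powr (2 + \<delta>)) \<and> (\<integral>\<omega>. (fy n (Z n 1 \<omega>))\<^sup>2 \<partial>M n) = 1) sequentially"
    using my by (rule eventually_mono) blast
  have ix: "eventually (\<lambda>n. integrable (M n) (\<lambda>\<omega>. \<bar>fx n (Z n 1 \<omega>)\<bar> powr (2 + \<delta>))) sequentially"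
    using mx by (rule eventually_mono) blast
  have iy: "eventually (\<lambda>n. integrable (M n) (\<lambda>\<omega>. \<bar>fy n (Z n 1 \<omega>)\<bar> powr (2 + \<delta>))) sequentially"
    using my by (rule eventually_mono) blast
  have int: "integrable (M n) (\<lambda>\<omega>. (f (Z n 1 \<omega>))\<^sup>2) \<and> integrable (M n) (\<lambda>\<omega>. f (Z n 1 \<omega>))"
    if "f \<in> borel_measurable (S n)" "integrable (M n) (\<lambda>\<omega>. \<bar>f (Z n 1 \<omega>)\<bar> powr (2 + \<delta>))" for f :: "'b \<Rightarrow> real" and n
    using prob_space.sq_integrable_of_powr[OF prob_M fZ1_meas[OF that(1)] that(2) d0]
      prob_space.integrable_of_powr[OF prob_M fZ1_meas[OF that(1)] that(2) d1] by blast
  obtain rx where rx: "op1 M rx" "\<And>n i \<omega>. i \<in> {1..N n} \<Longrightarrow> \<bar>fx n (Z n i \<omega>)\<bar> \<le> \<bar>rx n \<omega>\<bar> * sqrt (N n)"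
    using lyapunov_max[OF fx \<delta> ix lx] by metis
  obtain ry where ry: "op1 M ry" "\<And>n i \<omega>. i \<in> {1..N n} \<Longrightarrow> \<bar>fy n (Z n i \<omega>)\<bar> \<le> \<bar>ry n \<omega>\<bar> * sqrt (N n)"
    using lyapunov_max[OF fy \<delta> iy ly] by metis
  have op1_cong: "op1 M g" if f: "op1 M f" and gm: "\<And>n. g n \<in> borel_measurable (M n)"
    and eq: "eventually (\<lambda>n. f n = g n) sequentially" for f g
    by (rule op1_mono[OF f gm], rule eventually_mono[OF eq]) simp
  have pm: "(\<lambda>\<omega>. (\<Sum>i=1..N n. f n (Z n i \<omega>) * g n (Z n i \<omega>)) / N n - c) \<in> borel_measurable (M n)"
    if "\<And>n. f n \<in> borel_measurable (S n)" "\<And>n. g n \<in> borel_measurable (S n)" for f g :: "nat \<Rightarrow> 'b \<Rightarrow> real" and n c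
    by (intro borel_measurable_diff borel_measurable_divide borel_measurable_sum borel_measurable_times borel_measurable_const fZ_meas that)
  have "el_array M N (\<lambda>n i \<omega>. fx n (Z n i \<omega>)) (\<lambda>n i \<omega>. fy n (Z n i \<omega>)) rx ry"
  proof (unfold_locales)
    show "filterlim N at_top sequentially" by (rule N)
    show "(\<lambda>\<omega>. fx n (Z n i \<omega>)) \<in> borel_measurable (M n)" if "i \<in> {1..N n}" for n i by (rule fZ_meas[OF that fx])
    show "(\<lambda>\<omega>. fy n (Z n i \<omega>)) \<in> borel_measurable (M n)" if "i \<in> {1..N n}" for n i by (rule fZ_meas[OF that fy])
    show "tight_rv M (\<lambda>n \<omega>. (\<Sum>i=1..N n. fx n (Z n i \<omega>)) / sqrt (N n))"
      by (rule tight_normalized_sum[OF fx], rule eventually_mono[OF mx]) (use int[OF fx] in blast)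
    show "tight_rv M (\<lambda>n \<omega>. (\<Sum>i=1..N n. fy n (Z n i \<omega>)) / sqrt (N n))"
      by (rule tight_normalized_sum[OF fy], rule eventually_mono[OF my]) (use int[OF fy] in blast)
    show "op1 M rx" "op1 M ry" by (rule rx ry)+
    show "\<bar>fx n (Z n i \<omega>)\<bar> \<le> \<bar>rx n \<omega>\<bar> * sqrt (N n)" if "i \<in> {1..N n}" for n i \<omega> by (rule rx(2)[OF that])
    show "\<bar>fy n (Z n i \<omega>)\<bar> \<le> \<bar>ry n \<omega>\<bar> * sqrt (N n)" if "i \<in> {1..N n}" for n i \<omega> by (rule ry(2)[OF that])
    show "op1 M (\<lambda>n \<omega>. (\<Sum>i=1..N n. fx n (Z n i \<omega>) * fx n (Z n i \<omega>)) / N n - 1)"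
      by (rule op1_cong[OF lyapunov_product_wlln[OF fx fx \<delta> mx' mx' lx lx] pm[OF fx fx]], rule eventually_mono[OF mx'])
         (simp add: power2_eq_square)
    show "op1 M (\<lambda>n \<omega>. (\<Sum>i=1..N n. fy n (Z n i \<omega>) * fy n (Z n i \<omega>)) / N n - 1)"
      by (rule op1_cong[OF lyapunov_product_wlln[OF fy fy \<delta> my' my' ly ly] pm[OF fy fy]], rule eventually_mono[OF my'])
         (simp add: power2_eq_square)
    have "op1 M (\<lambda>n \<omega>. (\<Sum>i=1..N n. fx n (Z n i \<omega>) * fy n (Z n i \<omega>)) / N n - 0)"
      by (rule op1_cong[OF lyapunov_product_wlln[OF fx fy \<delta> mx' my' lx ly] pm[OF fx fy]], rule eventually_mono[OF mxy])
         simp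
    then show "op1 M (\<lambda>n \<omega>. (\<Sum>i=1..N n. fx n (Z n i \<omega>) * fy n (Z n i \<omega>)) / N n)" by simp
    fix s t :: real
    define f where "f n z = s * fx n z + t * fy n z" for n z
    have f: "f n \<in> borel_measurable (S n)" for n
      unfolding f_def by (intro borel_measurable_add borel_measurable_times borel_measurable_const fx fy)
    define q where "q = 2 + \<delta>"
    have q0: "0 \<le> q" using \<delta> by (simp add: q_def)
    define A where "A n = (\<integral>\<omega>. \<bar>fx n (Z n 1 \<omega>)\<bar> powr q \<partial>M n)" for n
    define B where "B n = (\<integral>\<omega>. \<bar>fy n (Z n 1 \<omega>)\<bar> powr q \<partial>M n)" for n
    define a b where "a = 2 powr q * \<bar>s\<bar> powr q" and "b = 2 powr q * \<bar>t\<bar> powr q"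
    have le: "\<bar>f n z\<bar> powr q \<le> a * \<bar>fx n z\<bar> powr q + b * \<bar>fy n z\<bar> powr q" for n z
      using powr_abs_add_le[OF q0, of "s * fx n z" "t * fy n z"]
      by (simp add: f_def a_def b_def abs_mult powr_mult algebra_simps)
    have ev: "eventually (\<lambda>n. (integrable (M n) (\<lambda>\<omega>. \<bar>f n (Z n 1 \<omega>)\<bar> powr q) \<and>
      (\<integral>\<omega>. f n (Z n 1 \<omega>) \<partial>M n) = 0 \<and> (\<integral>\<omega>. (f n (Z n 1 \<omega>))\<^sup>2 \<partial>M n) = s\<^sup>2 + t\<^sup>2) \<and>
      (\<integral>\<omega>. \<bar>f n (Z n 1 \<omega>)\<bar> powr q \<partial>M n) \<le> a * A n + b * B n) sequentially"
      using mx my mxy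
    proof eventually_elim
      case (elim n)
      let ?X = "\<lambda>\<omega>. fx n (Z n 1 \<omega>)" and ?Y = "\<lambda>\<omega>. fy n (Z n 1 \<omega>)"
      note x = int[OF fx[of n] conjunct1[OF elim(1)]] and y = int[OF fy[of n] conjunct1[OF elim(2)]]
      have xy: "integrable (M n) (\<lambda>\<omega>. ?X \<omega> * ?Y \<omega>)"
        using x y by (intro integrable_mult_of_sq fZ1_meas fx fy) auto
      have b: "integrable (M n) (\<lambda>\<omega>. a * \<bar>?X \<omega>\<bar> powr q + b * \<bar>?Y \<omega>\<bar> powr q)"
        using elim unfolding q_def by (intro Bochner_Integration.integrable_add integrable_mult_right) blast+
      have i: "integrable (M n) (\<lambda>\<omega>. \<bar>f n (Z n 1 \<omega>)\<bar> powr q)"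
      proof (rule Bochner_Integration.integrable_bound[OF b])
        have "(\<lambda>z. \<bar>f n z\<bar> powr q) \<in> borel_measurable (S n)" using f[of n] by measurable
        then show "(\<lambda>\<omega>. \<bar>f n (Z n 1 \<omega>)\<bar> powr q) \<in> borel_measurable (M n)" by (rule fZ1_meas)
        show "AE \<omega> in M n. norm (\<bar>f n (Z n 1 \<omega>)\<bar> powr q) \<le> norm (a * \<bar>?X \<omega>\<bar> powr q + b * \<bar>?Y \<omega>\<bar> powr q)"
        proof (rule AE_I2)
          fix \<omega>
          have "0 \<le> \<bar>f n (Z n 1 \<omega>)\<bar> powr q" by simp
          then show "norm (\<bar>f n (Z n 1 \<omega>)\<bar> powr q) \<le> norm (a * \<bar>?X \<omega>\<bar> powr q + b * \<bar>?Y \<omega>\<bar> powr q)"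
            using le[of n "Z n 1 \<omega>"] unfolding real_norm_def by linarith
        qed
      qed
      have "(\<integral>\<omega>. \<bar>f n (Z n 1 \<omega>)\<bar> powr q \<partial>M n) \<le> (\<integral>\<omega>. a * \<bar>?X \<omega>\<bar> powr q + b * \<bar>?Y \<omega>\<bar> powr q \<partial>M n)"
        by (rule integral_mono[OF i b le])
      also have "\<dots> = a * A n + b * B n"
        using elim unfolding A_def B_def q_def
        by (subst Bochner_Integration.integral_add) (auto intro!: integrable_mult_right)
      finally have I: "(\<integral>\<omega>. \<bar>f n (Z n 1 \<omega>)\<bar> powr q \<partial>M n) \<le> a * A n + b * B n" .
      have E0: "(\<integral>\<omega>. f n (Z n 1 \<omega>) \<partial>M n) = 0"
        using x y elim by (simp add: f_def)
      have sq: "(f n (Z n 1 \<omega>))\<^sup>2 = s\<^sup>2 * (?X \<omega>)\<^sup>2 + (2 * s * t) * (?X \<omega> * ?Y \<omega>) + t\<^sup>2 * (?Y \<omega>)\<^sup>2" for \<omega>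
        by (simp add: f_def power2_eq_square algebra_simps)
      have "(\<integral>\<omega>. (f n (Z n 1 \<omega>))\<^sup>2 \<partial>M n) = s\<^sup>2 + t\<^sup>2"
        unfolding sq using x y xy elim by simp
      then show ?case using i E0 I by blast
    qed
    have "(\<lambda>n. \<integral>\<omega>. iexp ((\<Sum>i=1..N n. f n (Z n i \<omega>)) / sqrt (N n)) \<partial>M n) \<longlonglongrightarrow> of_real (exp (- (s\<^sup>2 + t\<^sup>2) / 2))"
    proof (rule lyapunov_clt[OF f \<delta>])
      show "eventually (\<lambda>n. integrable (M n) (\<lambda>\<omega>. \<bar>f n (Z n 1 \<omega>)\<bar> powr (2 + \<delta>)) \<and>
        (\<integral>\<omega>. f n (Z n 1 \<omega>) \<partial>M n) = 0 \<and> (\<integral>\<omega>. (f n (Z n 1 \<omega>))\<^sup>2 \<partial>M n) = s\<^sup>2 + t\<^sup>2) sequentially"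
        using ev unfolding q_def by (rule eventually_mono) blast
      have lim: "(\<lambda>n. a * (A n / N n powr (\<delta> / 2)) + b * (B n / N n powr (\<delta> / 2))) \<longlonglongrightarrow> 0"
        using tendsto_add[OF tendsto_mult_left[OF lx, of a] tendsto_mult_left[OF ly, of b]] by (simp add: A_def B_def q_def)
      show "(\<lambda>n. (\<integral>\<omega>. \<bar>f n (Z n 1 \<omega>)\<bar> powr (2 + \<delta>) \<partial>M n) / N n powr (\<delta> / 2)) \<longlonglongrightarrow> 0"
      proof (rule Lim_null_comparison[OF _ lim])
        show "eventually (\<lambda>n. norm ((\<integral>\<omega>. \<bar>f n (Z n 1 \<omega>)\<bar> powr (2 + \<delta>) \<partial>M n) / N n powr (\<delta> / 2)) \<le>
          a * (A n / N n powr (\<delta> / 2)) + b * (B n / N n powr (\<delta> / 2))) sequentially"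
          using ev
        proof eventually_elim
          case (elim n)
          have "0 \<le> (\<integral>\<omega>. \<bar>f n (Z n 1 \<omega>)\<bar> powr q \<partial>M n)" by (intro integral_nonneg_AE AE_I2) simp
          moreover have "(\<integral>\<omega>. \<bar>f n (Z n 1 \<omega>)\<bar> powr q \<partial>M n) / N n powr (\<delta> / 2) \<le> (a * A n + b * B n) / N n powr (\<delta> / 2)"
            using elim by (intro divide_right_mono) auto
          ultimately show ?case unfolding q_def by (simp add: add_divide_distrib)
        qed
      qed
    qed
    moreover have "(\<Sum>i=1..N n. f n (Z n i \<omega>)) / sqrt (N n) =
        s * ((\<Sum>i=1..N n. fx n (Z n i \<omega>)) / sqrt (N n)) + t * ((\<Sum>i=1..N n. fy n (Z n i \<omega>)) / sqrt (N n))" for n \<omega>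
      by (simp add: f_def sum.distrib sum_distrib_left add_divide_distrib)
    ultimately show "(\<lambda>n. \<integral>\<omega>. iexp (s * ((\<Sum>i=1..N n. fx n (Z n i \<omega>)) / sqrt (N n)) + t * ((\<Sum>i=1..N n. fy n (Z n i \<omega>)) / sqrt (N n))) \<partial>M n)
        \<longlonglongrightarrow> of_real (exp (- (s\<^sup>2 + t\<^sup>2) / 2))"
      by (simp only:)
  qed
  then show thesis by (rule that)
qed

end

section \<open>Stability of the array conditions under small perturbations\<close>

context el_array
begin

text \<open>Only the normalised sum and the mean square of the perturbation have to be negligible.
  The mean square controls the second moments by Cauchy-Schwarz and also the maxima, since a single
  |d i| is at most the root of the sum of squares, that is sqrt N times the root mean
  square.\<close>

lemma perturb:
  fixes x' y' :: "nat \<Rightarrow> nat \<Rightarrow> 'a \<Rightarrow> real"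
  assumes x'm: "\<And>n i. i \<in> {1..N n} \<Longrightarrow> x' n i \<in> borel_measurable (M n)"
    and y'm: "\<And>n i. i \<in> {1..N n} \<Longrightarrow> y' n i \<in> borel_measurable (M n)"
    and dx: "op1 M (\<lambda>n \<omega>. (\<Sum>i=1..N n. x' n i \<omega> - x n i \<omega>) / sqrt (N n))"
    and dy: "op1 M (\<lambda>n \<omega>. (\<Sum>i=1..N n. y' n i \<omega> - y n i \<omega>) / sqrt (N n))"
    and dx2: "op1 M (\<lambda>n \<omega>. (\<Sum>i=1..N n. (x' n i \<omega> - x n i \<omega>)\<^sup>2) / N n)"
    and dy2: "op1 M (\<lambda>n \<omega>. (\<Sum>i=1..N n. (y' n i \<omega> - y n i \<omega>)\<^sup>2) / N n)"
  obtains rx ry where "el_array M N x' y' rx ry"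
proof -
  define Dx where "Dx n \<omega> = (\<Sum>i=1..N n. (x' n i \<omega> - x n i \<omega>)\<^sup>2) / N n" for n \<omega>
  define Dy where "Dy n \<omega> = (\<Sum>i=1..N n. (y' n i \<omega> - y n i \<omega>)\<^sup>2) / N n" for n \<omega>
  have D0: "0 \<le> Dx n \<omega>" "0 \<le> Dy n \<omega>" for n \<omega> by (simp_all add: Dx_def Dy_def sum_nonneg)
  have oD: "op1 M Dx" "op1 M Dy" using dx2 dy2 by (simp_all add: Dx_def[abs_def] Dy_def[abs_def])
  have oS: "op1 M (\<lambda>n \<omega>. sqrt (Dx n \<omega>))" "op1 M (\<lambda>n \<omega>. sqrt (Dy n \<omega>))"
    using op1_sqrt[OF oD(1)] op1_sqrt[OF oD(2)] D0 by simp_all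
  have abs_op1: "op1 M (\<lambda>n \<omega>. \<bar>f n \<omega>\<bar>)" if "op1 M f" for f
    by (rule op1_mono[OF that]) (auto intro: borel_measurable_abs op1_meas[OF that])
  have root_tight: "tight_rv M (\<lambda>n \<omega>. sqrt \<bar>f n \<omega>\<bar>)" if o: "op1 M (\<lambda>n \<omega>. f n \<omega> - 1)" for f :: "nat \<Rightarrow> 'a \<Rightarrow> real"
  proof (rule tight_rv_mono[OF tight_rv_add_op1[OF tight_rv_const[of 2] abs_op1[OF o]]])
    have fm: "(\<lambda>\<omega>. f n \<omega>) \<in> borel_measurable (M n)" for n
      using borel_measurable_add[OF op1_meas[OF o, of n] borel_measurable_const[of 1]] by simp
    show "(\<lambda>\<omega>. sqrt \<bar>f n \<omega>\<bar>) \<in> borel_measurable (M n)" for n using fm[of n] by measurable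
    have "sqrt \<bar>a\<bar> \<le> 2 + \<bar>a - 1\<bar>" for a :: real
    proof (rule real_le_lsqrt)
      define b where "b = \<bar>a - 1\<bar>"
      have "(2 + b)\<^sup>2 = 4 + 4 * b + b\<^sup>2" by (simp add: power2_sum)
      moreover have "\<bar>a\<bar> \<le> 1 + b" "0 \<le> b" unfolding b_def by linarith+
      ultimately show "\<bar>a\<bar> \<le> (2 + \<bar>a - 1\<bar>)\<^sup>2" unfolding b_def[symmetric] using zero_le_power2[of b] by linarith
    qed simp
    then show "eventually (\<lambda>n. \<forall>\<omega>\<in>space (M n). \<bar>sqrt \<bar>f n \<omega>\<bar>\<bar> \<le> \<bar>2 + \<bar>f n \<omega> - 1\<bar>\<bar>) sequentially" by simp
  qed
  \<comment> \<open>Cauchy-Schwarz: a tight root mean square times a negligible one. Every mixed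
    second moment below is of this kind.\<close>
  have prod_op1: "op1 M (\<lambda>n \<omega>. (\<Sum>i=1..N n. b n i \<omega> * d n i \<omega>) / N n)"
    if bm: "\<And>n i. i \<in> {1..N n} \<Longrightarrow> b n i \<in> borel_measurable (M n)"
      and dm: "\<And>n i. i \<in> {1..N n} \<Longrightarrow> d n i \<in> borel_measurable (M n)"
      and tb: "tight_rv M (\<lambda>n \<omega>. sqrt ((\<Sum>i=1..N n. (b n i \<omega>)\<^sup>2) / N n))"
      and od: "op1 M (\<lambda>n \<omega>. sqrt ((\<Sum>i=1..N n. (d n i \<omega>)\<^sup>2) / N n))" for b d :: "nat \<Rightarrow> nat \<Rightarrow> 'a \<Rightarrow> real"
  proof (rule op1_mono[OF op1_mult_tight[OF tb od]])
    show "(\<lambda>\<omega>. (\<Sum>i=1..N n. b n i \<omega> * d n i \<omega>) / N n) \<in> borel_measurable (M n)" for n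
      by (intro borel_measurable_divide borel_measurable_sum borel_measurable_times borel_measurable_const bm dm)
    have "\<bar>(\<Sum>i=1..N n. b n i \<omega> * d n i \<omega>) / N n\<bar> \<le> \<bar>sqrt ((\<Sum>i=1..N n. (b n i \<omega>)\<^sup>2) / N n) * sqrt ((\<Sum>i=1..N n. (d n i \<omega>)\<^sup>2) / N n)\<bar>" for n \<omega>
    proof -
      have "\<bar>\<Sum>i=1..N n. b n i \<omega> * d n i \<omega>\<bar> \<le> (\<Sum>i=1..N n. \<bar>b n i \<omega>\<bar> * \<bar>d n i \<omega>\<bar>)"
        using sum_abs[of "\<lambda>i. b n i \<omega> * d n i \<omega>" "{1..N n}"] by (simp add: abs_mult)
      also have "\<dots> \<le> L2_set (\<lambda>i. b n i \<omega>) {1..N n} * L2_set (\<lambda>i. d n i \<omega>) {1..N n}" by (rule L2_set_mult_ineq)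
      finally have "\<bar>\<Sum>i=1..N n. b n i \<omega> * d n i \<omega>\<bar> / N n \<le> (L2_set (\<lambda>i. b n i \<omega>) {1..N n} * L2_set (\<lambda>i. d n i \<omega>) {1..N n}) / N n"
        by (rule divide_right_mono) simp
      also have "\<dots> = sqrt ((\<Sum>i=1..N n. (b n i \<omega>)\<^sup>2) / N n) * sqrt ((\<Sum>i=1..N n. (d n i \<omega>)\<^sup>2) / N n)"
        by (simp add: L2_set_def real_sqrt_divide)
      finally show ?thesis by simp
    qed
    then show "eventually (\<lambda>n. \<forall>\<omega>\<in>space (M n). \<bar>(\<Sum>i=1..N n. b n i \<omega> * d n i \<omega>) / N n\<bar> \<le>
        \<bar>sqrt ((\<Sum>i=1..N n. (b n i \<omega>)\<^sup>2) / N n) * sqrt ((\<Sum>i=1..N n. (d n i \<omega>)\<^sup>2) / N n)\<bar>) sequentially" by simp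
  qed
  have tx: "tight_rv M (\<lambda>n \<omega>. sqrt ((\<Sum>i=1..N n. (x n i \<omega>)\<^sup>2) / N n))"
    using root_tight[OF o11] by (simp add: s11_def power2_eq_square sum_nonneg)
  have ty: "tight_rv M (\<lambda>n \<omega>. sqrt ((\<Sum>i=1..N n. (y n i \<omega>)\<^sup>2) / N n))"
    using root_tight[OF o22] by (simp add: s22_def power2_eq_square sum_nonneg)
  have dxm: "(\<lambda>\<omega>. x' n i \<omega> - x n i \<omega>) \<in> borel_measurable (M n)"
    and dym: "(\<lambda>\<omega>. y' n i \<omega> - y n i \<omega>) \<in> borel_measurable (M n)" if "i \<in> {1..N n}" for n i
    by (intro borel_measurable_diff x'm y'm x_meas y_meas that)+
  have tight_of_op1: "tight_rv M f" if "op1 M f" for f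
    using tight_rv_add_op1[OF tight_rv_const[of 0] that] by simp
  note oSx = oS(1)[unfolded Dx_def] and oSy = oS(2)[unfolded Dy_def]
  note xdx = prod_op1[of x "\<lambda>n i \<omega>. x' n i \<omega> - x n i \<omega>", OF x_meas dxm tx oSx]
  note ydy = prod_op1[of y "\<lambda>n i \<omega>. y' n i \<omega> - y n i \<omega>", OF y_meas dym ty oSy]
  note xdy = prod_op1[of x "\<lambda>n i \<omega>. y' n i \<omega> - y n i \<omega>", OF x_meas dym tx oSy]
  note ydx = prod_op1[of y "\<lambda>n i \<omega>. x' n i \<omega> - x n i \<omega>", OF y_meas dxm ty oSx]
  note dxdx = prod_op1[of "\<lambda>n i \<omega>. x' n i \<omega> - x n i \<omega>" "\<lambda>n i \<omega>. x' n i \<omega> - x n i \<omega>", OF dxm dxm tight_of_op1[OF oSx] oSx]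
  note dydy = prod_op1[of "\<lambda>n i \<omega>. y' n i \<omega> - y n i \<omega>" "\<lambda>n i \<omega>. y' n i \<omega> - y n i \<omega>", OF dym dym tight_of_op1[OF oSy] oSy]
  note dxdy = prod_op1[of "\<lambda>n i \<omega>. x' n i \<omega> - x n i \<omega>" "\<lambda>n i \<omega>. y' n i \<omega> - y n i \<omega>", OF dxm dym tight_of_op1[OF oSx] oSy]
  define U' where "U' n \<omega> = (\<Sum>i=1..N n. x' n i \<omega>) / sqrt (N n)" for n \<omega>
  define V' where "V' n \<omega> = (\<Sum>i=1..N n. y' n i \<omega>) / sqrt (N n)" for n \<omega>
  have U'U: "op1 M (\<lambda>n \<omega>. U' n \<omega> - U n \<omega>)" and V'V: "op1 M (\<lambda>n \<omega>. V' n \<omega> - V n \<omega>)"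
    using dx dy by (simp_all add: U'_def V'_def U_def V_def sum_subtractf diff_divide_distrib)
  have tU': "tight_rv M U'" and tV': "tight_rv M V'"
    using tight_rv_add_op1[OF tU U'U] tight_rv_add_op1[OF tV V'V] by simp_all
  have mx': "\<bar>x' n i \<omega>\<bar> \<le> \<bar>\<bar>mx n \<omega>\<bar> + sqrt (Dx n \<omega>)\<bar> * sqrt (N n)"
    and my': "\<bar>y' n i \<omega>\<bar> \<le> \<bar>\<bar>my n \<omega>\<bar> + sqrt (Dy n \<omega>)\<bar> * sqrt (N n)" if i: "i \<in> {1..N n}" and \<omega>: "\<omega> \<in> space (M n)" for n i \<omega>
  proof -
    have Nn: "0 < real (N n)" using i by auto
    have root: "\<bar>d i\<bar> \<le> sqrt ((\<Sum>i=1..N n. (d i)\<^sup>2) / N n) * sqrt (N n)" for d :: "nat \<Rightarrow> real"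
    proof -
      have "(d i)\<^sup>2 \<le> (\<Sum>i=1..N n. (d i)\<^sup>2)" using i by (intro member_le_sum) auto
      then have "sqrt ((d i)\<^sup>2) \<le> sqrt (\<Sum>i=1..N n. (d i)\<^sup>2)" by (rule real_sqrt_le_mono)
      also have "\<dots> = sqrt ((\<Sum>i=1..N n. (d i)\<^sup>2) / N n) * sqrt (N n)" using Nn by (simp add: real_sqrt_mult[symmetric])
      finally show ?thesis by simp
    qed
    have "\<bar>x' n i \<omega> - x n i \<omega>\<bar> \<le> sqrt (Dx n \<omega>) * sqrt (N n)" unfolding Dx_def by (rule root)
    then show "\<bar>x' n i \<omega>\<bar> \<le> \<bar>\<bar>mx n \<omega>\<bar> + sqrt (Dx n \<omega>)\<bar> * sqrt (N n)"
      using mx[OF i \<omega>] D0(1)[of n \<omega>] by (simp add: distrib_right)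
    have "\<bar>y' n i \<omega> - y n i \<omega>\<bar> \<le> sqrt (Dy n \<omega>) * sqrt (N n)" unfolding Dy_def by (rule root)
    then show "\<bar>y' n i \<omega>\<bar> \<le> \<bar>\<bar>my n \<omega>\<bar> + sqrt (Dy n \<omega>)\<bar> * sqrt (N n)"
      using my[OF i \<omega>] D0(2)[of n \<omega>] by (simp add: distrib_right)
  qed
  have "el_array M N x' y' (\<lambda>n \<omega>. \<bar>mx n \<omega>\<bar> + sqrt (Dx n \<omega>)) (\<lambda>n \<omega>. \<bar>my n \<omega>\<bar> + sqrt (Dy n \<omega>))"
  proof (unfold_locales)
    show "filterlim N at_top sequentially" by (rule N)
    show "x' n i \<in> borel_measurable (M n)" "y' n i \<in> borel_measurable (M n)" if "i \<in> {1..N n}" for n i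
      by (rule x'm[OF that], rule y'm[OF that])
    show "tight_rv M (\<lambda>n \<omega>. (\<Sum>i=1..N n. x' n i \<omega>) / sqrt (N n))" using tU' by (simp add: U'_def[abs_def])
    show "tight_rv M (\<lambda>n \<omega>. (\<Sum>i=1..N n. y' n i \<omega>) / sqrt (N n))" using tV' by (simp add: V'_def[abs_def])
    show "op1 M (\<lambda>n \<omega>. \<bar>mx n \<omega>\<bar> + sqrt (Dx n \<omega>))" "op1 M (\<lambda>n \<omega>. \<bar>my n \<omega>\<bar> + sqrt (Dy n \<omega>))"
      by (intro op1_add abs_op1 omx omy oS)+
    show "\<bar>x' n i \<omega>\<bar> \<le> \<bar>\<bar>mx n \<omega>\<bar> + sqrt (Dx n \<omega>)\<bar> * sqrt (N n)" if "i \<in> {1..N n}" "\<omega> \<in> space (M n)" for n i \<omega>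
      by (rule mx'[OF that])
    show "\<bar>y' n i \<omega>\<bar> \<le> \<bar>\<bar>my n \<omega>\<bar> + sqrt (Dy n \<omega>)\<bar> * sqrt (N n)" if "i \<in> {1..N n}" "\<omega> \<in> space (M n)" for n i \<omega>
      by (rule my'[OF that])
    have e: "(a + d) * (b + c) = a * b + a * c + b * d + d * c" for a b c d :: real by (simp add: algebra_simps)
    have x'e: "x' n i \<omega> = x n i \<omega> + (x' n i \<omega> - x n i \<omega>)" and y'e: "y' n i \<omega> = y n i \<omega> + (y' n i \<omega> - y n i \<omega>)" for n i \<omega> by simp_all
    have "(\<Sum>i=1..N n. x' n i \<omega> * x' n i \<omega>) / N n - 1 = (s11 n \<omega> - 1) + 2 * ((\<Sum>i=1..N n. x n i \<omega> * (x' n i \<omega> - x n i \<omega>)) / N n)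
        + (\<Sum>i=1..N n. (x' n i \<omega> - x n i \<omega>) * (x' n i \<omega> - x n i \<omega>)) / N n" for n \<omega>
      by (simp add: s11_def add_divide_distrib[symmetric] sum.distrib[symmetric] sum_distrib_left algebra_simps)
    then show "op1 M (\<lambda>n \<omega>. (\<Sum>i=1..N n. x' n i \<omega> * x' n i \<omega>) / N n - 1)"
      using op1_add[OF op1_add[OF o11 op1_cmult[OF xdx, of 2]] dxdx] by (simp only:)
    have "(\<Sum>i=1..N n. y' n i \<omega> * y' n i \<omega>) / N n - 1 = (s22 n \<omega> - 1) + 2 * ((\<Sum>i=1..N n. y n i \<omega> * (y' n i \<omega> - y n i \<omega>)) / N n)
        + (\<Sum>i=1..N n. (y' n i \<omega> - y n i \<omega>) * (y' n i \<omega> - y n i \<omega>)) / N n" for n \<omega>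
      by (simp add: s22_def add_divide_distrib[symmetric] sum.distrib[symmetric] sum_distrib_left algebra_simps)
    then show "op1 M (\<lambda>n \<omega>. (\<Sum>i=1..N n. y' n i \<omega> * y' n i \<omega>) / N n - 1)"
      using op1_add[OF op1_add[OF o22 op1_cmult[OF ydy, of 2]] dydy] by (simp only:)
    have "(\<Sum>i=1..N n. x' n i \<omega> * y' n i \<omega>) / N n = s12 n \<omega> + (\<Sum>i=1..N n. x n i \<omega> * (y' n i \<omega> - y n i \<omega>)) / N n
        + (\<Sum>i=1..N n. y n i \<omega> * (x' n i \<omega> - x n i \<omega>)) / N n
        + (\<Sum>i=1..N n. (x' n i \<omega> - x n i \<omega>) * (y' n i \<omega> - y n i \<omega>)) / N n" for n \<omega>
      by (simp add: s12_def add_divide_distrib[symmetric] sum.distrib[symmetric] algebra_simps)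
    then show "op1 M (\<lambda>n \<omega>. (\<Sum>i=1..N n. x' n i \<omega> * y' n i \<omega>) / N n)"
      using op1_add[OF op1_add[OF op1_add[OF o12 xdy] ydx] dxdy] by (simp only:)
    fix s t :: real
    have Um: "U n \<in> borel_measurable (M n)" "V n \<in> borel_measurable (M n)"
      "U' n \<in> borel_measurable (M n)" "V' n \<in> borel_measurable (M n)" for n
      using tU tV tU' tV' by (simp_all add: tight_rv_def)
    note [measurable] = Um
    define E where "E n \<omega> = iexp (s * U' n \<omega> + t * V' n \<omega>) - iexp (s * U n \<omega> + t * V n \<omega>)" for n \<omega>
    \<comment> \<open>The map from a to exp (i a) is Lipschitz with constant 1, so negligible
      changes of the normalised sums do not affect the limit of the joint characteristic
      function.\<close>
    have le: "cmod (E n \<omega>) \<le> \<bar>s * (U' n \<omega> - U n \<omega>) + t * (V' n \<omega> - V n \<omega>)\<bar>" for n \<omega>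
    proof -
      let ?a = "s * U' n \<omega> + t * V' n \<omega>" and ?b = "s * U n \<omega> + t * V n \<omega>"
      have "E n \<omega> = iexp ?b * (iexp (?a - ?b) - 1)"
        unfolding E_def right_diff_distrib exp_add[symmetric] by (simp add: algebra_simps)
      then have "cmod (E n \<omega>) = cmod (iexp (?a - ?b) - 1)" by (simp add: norm_mult)
      also have "\<dots> \<le> \<bar>?a - ?b\<bar>" using iexp_approx1[of "?a - ?b" 0] by simp
      finally show ?thesis by (simp add: algebra_simps)
    qed
    have le2: "cmod (E n \<omega>) \<le> 2" for n \<omega>
      unfolding E_def by (rule order_trans[OF norm_triangle_ineq4]) simp
    have oE: "op1 M (\<lambda>n \<omega>. cmod (E n \<omega>))"
    proof (rule op1_mono[OF op1_add[OF op1_cmult[OF U'U, of s] op1_cmult[OF V'V, of t]]])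
      show "(\<lambda>\<omega>. cmod (E n \<omega>)) \<in> borel_measurable (M n)" for n unfolding E_def by measurable
    qed (use le in simp)
    have "(\<lambda>n. \<integral>\<omega>. \<bar>cmod (E n \<omega>)\<bar> \<partial>M n) \<longlonglongrightarrow> 0"
      by (rule op1_bounded_integral[OF oE, of 2]) (use le2 in simp)
    then have "(\<lambda>n. \<integral>\<omega>. E n \<omega> \<partial>M n) \<longlonglongrightarrow> 0"
    proof (rule Lim_null_comparison[rotated], intro always_eventually allI)
      show "norm (\<integral>\<omega>. E n \<omega> \<partial>M n) \<le> (\<integral>\<omega>. \<bar>cmod (E n \<omega>)\<bar> \<partial>M n)" for n
        using integral_norm_bound[of "M n" "E n"] by simp
    qed
    moreover have "(\<integral>\<omega>. E n \<omega> \<partial>M n) = (\<integral>\<omega>. iexp (s * U' n \<omega> + t * V' n \<omega>) \<partial>M n) - (\<integral>\<omega>. iexp (s * U n \<omega> + t * V n \<omega>) \<partial>M n)" for n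
    proof -
      interpret prob_space "M n" by (rule prob_M)
      show ?thesis unfolding E_def
        by (rule Bochner_Integration.integral_diff; rule integrable_const_bound[where B = 1]; simp)
    qed
    ultimately have "(\<lambda>n. (\<integral>\<omega>. iexp (s * U' n \<omega> + t * V' n \<omega>) \<partial>M n) - (\<integral>\<omega>. iexp (s * U n \<omega> + t * V n \<omega>) \<partial>M n)) \<longlonglongrightarrow> 0"
      by (simp only:)
    from tendsto_add[OF this char[of s t]]
    have "(\<lambda>n. \<integral>\<omega>. iexp (s * U' n \<omega> + t * V' n \<omega>) \<partial>M n) \<longlonglongrightarrow> of_real (exp (- (s\<^sup>2 + t\<^sup>2) / 2))"
      by (simp only: diff_add_cancel add_0_left)
    then show "(\<lambda>n. \<integral>\<omega>. iexp (s * ((\<Sum>i=1..N n. x' n i \<omega>) / sqrt (N n)) + t * ((\<Sum>i=1..N n. y' n i \<omega>) / sqrt (N n))) \<partial>M n)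
        \<longlonglongrightarrow> of_real (exp (- (s\<^sup>2 + t\<^sup>2) / 2))"
      unfolding U'_def V'_def .
  qed
  then show thesis by (rule that)
qed

end

section \<open>Centring at the sample mean\<close>

lemma integrable_sq_mult:
  fixes f g :: "'a \<Rightarrow> real"
  assumes "f \<in> borel_measurable M" "g \<in> borel_measurable M" "integrable M (\<lambda>x. (f x) ^ 4)" "integrable M (\<lambda>x. (g x) ^ 4)"
  shows "integrable M (\<lambda>x. (f x * g x)\<^sup>2)"
proof -
  have e: "((f x)\<^sup>2)\<^sup>2 = (f x) ^ 4" for f :: "'a \<Rightarrow> real" and x by (simp add: power_mult[symmetric])
  have "integrable M (\<lambda>x. (f x)\<^sup>2 * (g x)\<^sup>2)"
    by (rule integrable_mult_of_sq) (use assms in \<open>simp_all add: e\<close>)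
  then show ?thesis by (simp add: power_mult_distrib)
qed

text \<open>One half of the sample, kept abstract so that it can be interpreted for each half.
  \<open>g a\<close> is the centred a-th coordinate as a function of an observation. A p x p matrix
  is flattened to a function on the index set \<open>P\<close>, so that operators on matrices are
  functions of two index pairs.\<close>

locale iid_vecs = prob_space M for M :: "'a measure" +
  fixes p N :: nat and S :: "'b measure" and Z :: "nat \<Rightarrow> 'a \<Rightarrow> 'b" and g :: "nat \<Rightarrow> 'b \<Rightarrow> real"
    and sg :: "nat \<times> nat \<Rightarrow> real"
  fixes P :: "(nat \<times> nat) set" and x :: "nat \<Rightarrow> nat \<Rightarrow> 'a \<Rightarrow> real"
  defines "P \<equiv> {1..p} \<times> {1..p}" and "x \<equiv> \<lambda>i a \<omega>. g a (Z i \<omega>)"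
  assumes N2: "2 \<le> N"
    and indep: "indep_vars (\<lambda>_. S) Z {1..N}"
    and ident: "\<And>i. i \<in> {1..N} \<Longrightarrow> distr M S (Z i) = distr M S (Z 1)"
    and g: "\<And>a. a \<in> {1..p} \<Longrightarrow> g a \<in> borel_measurable S"
    and x4: "\<And>i a. i \<in> {1..N} \<Longrightarrow> a \<in> {1..p} \<Longrightarrow> integrable M (\<lambda>\<omega>. (x i a \<omega>) ^ 4)"
    and mean0: "\<And>i a. i \<in> {1..N} \<Longrightarrow> a \<in> {1..p} \<Longrightarrow> (\<integral>\<omega>. x i a \<omega> \<partial>M) = 0"
    and cov: "\<And>i a b. i \<in> {1..N} \<Longrightarrow> a \<in> {1..p} \<Longrightarrow> b \<in> {1..p} \<Longrightarrow> (\<integral>\<omega>. x i a \<omega> * x i b \<omega> \<partial>M) = sg (a, b)"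
begin

text \<open>The bilinear form x_j^T A x_k. Sums of these over one or both indices express every
  pairing of \<open>Dl i\<close> with a fixed matrix.\<close>

definition bil :: "(nat \<times> nat \<Rightarrow> real) \<Rightarrow> nat \<Rightarrow> nat \<Rightarrow> 'a \<Rightarrow> real" where
  "bil A j k \<omega> = (\<Sum>\<alpha>\<in>P. A \<alpha> * (x j (fst \<alpha>) \<omega> * x k (snd \<alpha>) \<omega>))"

text \<open>The Frobenius inner product of flattened matrices.\<close>

definition ip :: "(nat \<times> nat \<Rightarrow> real) \<Rightarrow> (nat \<times> nat \<Rightarrow> real) \<Rightarrow> real" where
  "ip A B = (\<Sum>\<alpha>\<in>P. A \<alpha> * B \<alpha>)"

text \<open>
  \<open>W i\<close> is \<open>Y\<^sub>i - \<Sigma>\<close> for the centred vectors \<open>x\<^sub>i\<close>, and \<open>W i + Dl i\<close> is \<open>Y\<^sub>i\<^sup>* - (N - 1)/N \<Sigma>\<close>.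
\<close>

definition W :: "nat \<Rightarrow> 'a \<Rightarrow> nat \<times> nat \<Rightarrow> real" where
  "W j \<omega> \<alpha> = x j (fst \<alpha>) \<omega> * x j (snd \<alpha>) \<omega> - sg \<alpha>"

definition u :: "nat \<Rightarrow> 'a \<Rightarrow> real" where
  "u a \<omega> = (\<Sum>j=1..N. x j a \<omega>) / N"

definition Dl :: "nat \<Rightarrow> 'a \<Rightarrow> nat \<times> nat \<Rightarrow> real" where
  "Dl i \<omega> \<alpha> = - x i (fst \<alpha>) \<omega> * u (snd \<alpha>) \<omega> - u (fst \<alpha>) \<omega> * x i (snd \<alpha>) \<omega>
     + u (fst \<alpha>) \<omega> * u (snd \<alpha>) \<omega> + sg \<alpha> / N"

text \<open>The Kronecker square of the covariance matrix, which is the second moment operator of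
  x_j x_k^T for distinct j and k.\<close>

definition TD :: "nat \<times> nat \<Rightarrow> nat \<times> nat \<Rightarrow> real" where
  "TD \<alpha> \<beta> = sg (fst \<alpha>, fst \<beta>) * sg (snd \<alpha>, snd \<beta>)"

definition qf :: "(nat \<times> nat \<Rightarrow> nat \<times> nat \<Rightarrow> real) \<Rightarrow> (nat \<times> nat \<Rightarrow> real) \<Rightarrow> real" where
  "qf T A = (\<Sum>\<alpha>\<in>P. \<Sum>\<beta>\<in>P. T \<alpha> \<beta> * (A \<alpha> * A \<beta>))"

lemma finP: "finite P" by (simp add: P_def)

lemma P_mem: "\<alpha> \<in> P \<Longrightarrow> fst \<alpha> \<in> {1..p}" "\<alpha> \<in> P \<Longrightarrow> snd \<alpha> \<in> {1..p}" by (auto simp: P_def)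

lemma N0: "0 < real N" using N2 by simp

lemma Z_meas: "i \<in> {1..N} \<Longrightarrow> Z i \<in> measurable M S"
  using indep unfolding indep_vars_def by (elim conjE bspec)

lemma x_meas: "i \<in> {1..N} \<Longrightarrow> a \<in> {1..p} \<Longrightarrow> x i a \<in> borel_measurable M"
  unfolding x_def using measurable_compose[OF Z_meas g] .

lemma xx2: "i \<in> {1..N} \<Longrightarrow> j \<in> {1..N} \<Longrightarrow> a \<in> {1..p} \<Longrightarrow> b \<in> {1..p} \<Longrightarrow> integrable M (\<lambda>\<omega>. (x i a \<omega> * x j b \<omega>)\<^sup>2)"
  by (intro integrable_sq_mult x_meas x4)

lemma xxxx: "i \<in> {1..N} \<Longrightarrow> j \<in> {1..N} \<Longrightarrow> k \<in> {1..N} \<Longrightarrow> l \<in> {1..N} \<Longrightarrow>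
    a \<in> {1..p} \<Longrightarrow> b \<in> {1..p} \<Longrightarrow> c \<in> {1..p} \<Longrightarrow> d \<in> {1..p} \<Longrightarrow>
    integrable M (\<lambda>\<omega>. (x i a \<omega> * x j b \<omega>) * (x k c \<omega> * x l d \<omega>))"
  by (intro integrable_mult_of_sq integrable_sq_mult borel_measurable_times x_meas x4)

lemma sq_int_imp_int: "f \<in> borel_measurable M \<Longrightarrow> integrable M (\<lambda>\<omega>. (f \<omega> :: real)\<^sup>2) \<Longrightarrow> integrable M f"
  using integrable_mult_of_sq[of f M "\<lambda>_. 1"] by simp

lemma x2: "i \<in> {1..N} \<Longrightarrow> a \<in> {1..p} \<Longrightarrow> integrable M (\<lambda>\<omega>. (x i a \<omega>)\<^sup>2)"
  by (rule sq_int_imp_int) (use x4 x_meas in \<open>auto simp: power_mult[symmetric] intro: borel_measurable_power\<close>)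

lemma x1: "i \<in> {1..N} \<Longrightarrow> a \<in> {1..p} \<Longrightarrow> integrable M (x i a)"
  by (rule sq_int_imp_int[OF x_meas x2])

lemma xx: "i \<in> {1..N} \<Longrightarrow> j \<in> {1..N} \<Longrightarrow> a \<in> {1..p} \<Longrightarrow> b \<in> {1..p} \<Longrightarrow> integrable M (\<lambda>\<omega>. x i a \<omega> * x j b \<omega>)"
  by (intro integrable_mult_of_sq x_meas x2)

lemma expectation_indep:
  assumes J: "J \<subseteq> {1..N}" "K \<subseteq> {1..N}" "J \<inter> K = {}"
    and F: "F \<in> borel_measurable (PiM J (\<lambda>_. S))" and G: "G \<in> borel_measurable (PiM K (\<lambda>_. S))"
    and iF: "integrable M (\<lambda>\<omega>. F (restrict (\<lambda>i. Z i \<omega>) J) :: real)" and iG: "integrable M (\<lambda>\<omega>. G (restrict (\<lambda>i. Z i \<omega>) K))"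
  shows "(\<integral>\<omega>. F (restrict (\<lambda>i. Z i \<omega>) J) * G (restrict (\<lambda>i. Z i \<omega>) K) \<partial>M) =
    (\<integral>\<omega>. F (restrict (\<lambda>i. Z i \<omega>) J) \<partial>M) * (\<integral>\<omega>. G (restrict (\<lambda>i. Z i \<omega>) K) \<partial>M)"
proof -
  have "indep_var borel (F \<circ> (\<lambda>\<omega>. restrict (\<lambda>i. Z i \<omega>) J)) borel (G \<circ> (\<lambda>\<omega>. restrict (\<lambda>i. Z i \<omega>) K))"
    by (rule indep_var_compose[OF indep_var_restrict[OF indep J(3,1,2)] F G])
  from indep_var_lebesgue_integral[OF this] show ?thesis using iF iG by (simp add: comp_def)
qed

lemma g_comp_meas: "i \<in> J \<Longrightarrow> a \<in> {1..p} \<Longrightarrow> (\<lambda>z. g a (z i)) \<in> borel_measurable (PiM J (\<lambda>_. S))"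
  using measurable_compose[OF measurable_component_singleton[of i J "\<lambda>_. S"] g] .

text \<open>An index occurring exactly once makes a fourth order product moment vanish.\<close>

lemma moment_once:
  assumes i: "j \<in> {1..N}" "k \<in> {1..N}" "m \<in> {1..N}" "l \<in> {1..N}" and l: "l \<noteq> j" "l \<noteq> k" "l \<noteq> m"
    and a: "a \<in> {1..p}" "b \<in> {1..p}" "c \<in> {1..p}" "d \<in> {1..p}"
  shows "(\<integral>\<omega>. (x j a \<omega> * x k b \<omega> * x m c \<omega>) * x l d \<omega> \<partial>M) = 0"
proof -
  let ?J = "{j, k, m}" and ?K = "{l}"
  have "(\<integral>\<omega>. (\<lambda>z. g a (z j) * g b (z k) * g c (z m)) (restrict (\<lambda>i. Z i \<omega>) ?J) * (\<lambda>z. g d (z l)) (restrict (\<lambda>i. Z i \<omega>) ?K) \<partial>M) =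
    (\<integral>\<omega>. (\<lambda>z. g a (z j) * g b (z k) * g c (z m)) (restrict (\<lambda>i. Z i \<omega>) ?J) \<partial>M) * (\<integral>\<omega>. (\<lambda>z. g d (z l)) (restrict (\<lambda>i. Z i \<omega>) ?K) \<partial>M)"
  proof (rule expectation_indep)
    show "(\<lambda>z. g a (z j) * g b (z k) * g c (z m)) \<in> borel_measurable (PiM ?J (\<lambda>_. S))"
      by (intro borel_measurable_times g_comp_meas a) auto
    show "(\<lambda>z. g d (z l)) \<in> borel_measurable (PiM ?K (\<lambda>_. S))" by (intro g_comp_meas a) auto
    have "integrable M (\<lambda>\<omega>. (x j a \<omega> * x k b \<omega>) * x m c \<omega>)"
      by (intro integrable_mult_of_sq borel_measurable_times x_meas xx2 x2 i a)
    then show "integrable M (\<lambda>\<omega>. g a (restrict (\<lambda>i. Z i \<omega>) ?J j) * g b (restrict (\<lambda>i. Z i \<omega>) ?J k) * g c (restrict (\<lambda>i. Z i \<omega>) ?J m))"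
      by (simp add: x_def)
    show "integrable M (\<lambda>\<omega>. g d (restrict (\<lambda>i. Z i \<omega>) ?K l))" using x1[OF i(4) a(4)] by (simp add: x_def)
  qed (use i l in auto)
  then show ?thesis using mean0[OF i(4) a(4)] by (simp add: x_def)
qed

lemma moment_pair:
  assumes i: "j \<in> {1..N}" "k \<in> {1..N}" "j \<noteq> k"
    and a: "a \<in> {1..p}" "b \<in> {1..p}" "c \<in> {1..p}" "d \<in> {1..p}"
  shows "(\<integral>\<omega>. (x j a \<omega> * x k b \<omega>) * (x j c \<omega> * x k d \<omega>) \<partial>M) = sg (a, c) * sg (b, d)"
proof -
  have "(\<integral>\<omega>. (\<lambda>z. g a (z j) * g c (z j)) (restrict (\<lambda>i. Z i \<omega>) {j}) * (\<lambda>z. g b (z k) * g d (z k)) (restrict (\<lambda>i. Z i \<omega>) {k}) \<partial>M) =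
    (\<integral>\<omega>. (\<lambda>z. g a (z j) * g c (z j)) (restrict (\<lambda>i. Z i \<omega>) {j}) \<partial>M) * (\<integral>\<omega>. (\<lambda>z. g b (z k) * g d (z k)) (restrict (\<lambda>i. Z i \<omega>) {k}) \<partial>M)"
  proof (rule expectation_indep)
    show "(\<lambda>z. g a (z j) * g c (z j)) \<in> borel_measurable (PiM {j} (\<lambda>_. S))"
      "(\<lambda>z. g b (z k) * g d (z k)) \<in> borel_measurable (PiM {k} (\<lambda>_. S))"
      by (intro borel_measurable_times g_comp_meas a; simp)+
    show "integrable M (\<lambda>\<omega>. g a (restrict (\<lambda>i. Z i \<omega>) {j} j) * g c (restrict (\<lambda>i. Z i \<omega>) {j} j))"
      using xx[OF i(1) i(1) a(1) a(3)] by (simp add: x_def)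
    show "integrable M (\<lambda>\<omega>. g b (restrict (\<lambda>i. Z i \<omega>) {k} k) * g d (restrict (\<lambda>i. Z i \<omega>) {k} k))"
      using xx[OF i(2) i(2) a(2) a(4)] by (simp add: x_def)
  qed (use i in auto)
  then show ?thesis using cov[OF i(1) a(1) a(3)] cov[OF i(2) a(2) a(4)] by (simp add: x_def mult_ac)
qed

lemma bil_meas: "j \<in> {1..N} \<Longrightarrow> k \<in> {1..N} \<Longrightarrow> bil A j k \<in> borel_measurable M"
  unfolding bil_def[abs_def]
  by (intro borel_measurable_sum borel_measurable_times borel_measurable_const x_meas P_mem)

lemma bil_mult: "bil A j k \<omega> * bil B l m \<omega> = (\<Sum>\<alpha>\<in>P. \<Sum>\<beta>\<in>P. (A \<alpha> * B \<beta>) *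
    ((x j (fst \<alpha>) \<omega> * x k (snd \<alpha>) \<omega>) * (x l (fst \<beta>) \<omega> * x m (snd \<beta>) \<omega>)))"
  unfolding bil_def sum_product by (intro sum.cong refl) (simp add: mult_ac)

lemma bil_mult_int:
  assumes i: "j \<in> {1..N}" "k \<in> {1..N}" "l \<in> {1..N}" "m \<in> {1..N}"
  shows "integrable M (\<lambda>\<omega>. bil A j k \<omega> * bil B l m \<omega>)"
    and "(\<integral>\<omega>. bil A j k \<omega> * bil B l m \<omega> \<partial>M) = (\<Sum>\<alpha>\<in>P. \<Sum>\<beta>\<in>P. (A \<alpha> * B \<beta>) *
      (\<integral>\<omega>. (x j (fst \<alpha>) \<omega> * x k (snd \<alpha>) \<omega>) * (x l (fst \<beta>) \<omega> * x m (snd \<beta>) \<omega>) \<partial>M))"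
proof -
  have int: "integrable M (\<lambda>\<omega>. (x j (fst \<alpha>) \<omega> * x k (snd \<alpha>) \<omega>) * (x l (fst \<beta>) \<omega> * x m (snd \<beta>) \<omega>))"
    if "\<alpha> \<in> P" "\<beta> \<in> P" for \<alpha> \<beta>
    by (intro xxxx i P_mem that)
  show "integrable M (\<lambda>\<omega>. bil A j k \<omega> * bil B l m \<omega>)"
    unfolding bil_mult by (intro Bochner_Integration.integrable_sum integrable_mult_right int)
  show "(\<integral>\<omega>. bil A j k \<omega> * bil B l m \<omega> \<partial>M) = (\<Sum>\<alpha>\<in>P. \<Sum>\<beta>\<in>P. (A \<alpha> * B \<beta>) *
      (\<integral>\<omega>. (x j (fst \<alpha>) \<omega> * x k (snd \<alpha>) \<omega>) * (x l (fst \<beta>) \<omega> * x m (snd \<beta>) \<omega>) \<partial>M))"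
    unfolding bil_mult
    by (subst Bochner_Integration.integral_sum, intro Bochner_Integration.integrable_sum integrable_mult_right int, assumption+,
        intro sum.cong refl, subst Bochner_Integration.integral_sum, intro integrable_mult_right int, assumption+,
        intro sum.cong refl, rule integral_mult_right_zero)
qed

lemma bil_sq_int: "j \<in> {1..N} \<Longrightarrow> k \<in> {1..N} \<Longrightarrow> integrable M (\<lambda>\<omega>. (bil A j k \<omega>)\<^sup>2)"
  using bil_mult_int(1)[of j k j k A A] by (simp add: power2_eq_square)

text \<open>If both j and k occurred among l and m, the two sets would coincide; so one of j, k
  occurs exactly once among the four indices. The case l = m is allowed, so off-diagonal forms are
  orthogonal to diagonal ones as well.\<close>

lemma bil_orth:
  assumes i: "j \<in> {1..N}" "k \<in> {1..N}" "l \<in> {1..N}" "m \<in> {1..N}" and jk: "j \<noteq> k" "{j, k} \<noteq> {l, m}"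
  shows "(\<integral>\<omega>. bil A j k \<omega> * bil B l m \<omega> \<partial>M) = 0"
proof -
  have "(\<integral>\<omega>. (x j (fst \<alpha>) \<omega> * x k (snd \<alpha>) \<omega>) * (x l (fst \<beta>) \<omega> * x m (snd \<beta>) \<omega>) \<partial>M) = 0" if "\<alpha> \<in> P" "\<beta> \<in> P" for \<alpha> \<beta>
  proof (cases "j \<noteq> l \<and> j \<noteq> m")
    case True
    have "(\<integral>\<omega>. (x k (snd \<alpha>) \<omega> * x l (fst \<beta>) \<omega> * x m (snd \<beta>) \<omega>) * x j (fst \<alpha>) \<omega> \<partial>M) = 0"
      by (rule moment_once) (use i jk True P_mem that in auto)
    then show ?thesis by (simp add: mult_ac)
  next
    case False
    then have "k \<noteq> l \<and> k \<noteq> m" using jk by auto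
    then have "(\<integral>\<omega>. (x j (fst \<alpha>) \<omega> * x l (fst \<beta>) \<omega> * x m (snd \<beta>) \<omega>) * x k (snd \<alpha>) \<omega> \<partial>M) = 0"
      by (intro moment_once) (use i jk P_mem that in auto)
    then show ?thesis by (simp add: mult_ac)
  qed
  then show ?thesis by (simp add: bil_mult_int(2)[OF i])
qed

lemma bil_sq:
  assumes i: "j \<in> {1..N}" "k \<in> {1..N}" "j \<noteq> k"
  shows "(\<integral>\<omega>. (bil A j k \<omega>)\<^sup>2 \<partial>M) = qf TD A"
proof -
  have "(\<integral>\<omega>. (bil A j k \<omega>)\<^sup>2 \<partial>M) = (\<integral>\<omega>. bil A j k \<omega> * bil A j k \<omega> \<partial>M)" by (simp add: power2_eq_square)
  also have "\<dots> = (\<Sum>\<alpha>\<in>P. \<Sum>\<beta>\<in>P. (A \<alpha> * A \<beta>) * TD \<alpha> \<beta>)"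
    unfolding bil_mult_int(2)[OF i(1,2) i(1,2)] TD_def
    by (intro sum.cong refl arg_cong2[where f = "(*)"] moment_pair i P_mem)
  finally show ?thesis by (simp add: qf_def mult_ac)
qed

lemma W_meas: "j \<in> {1..N} \<Longrightarrow> \<alpha> \<in> P \<Longrightarrow> (\<lambda>\<omega>. W j \<omega> \<alpha>) \<in> borel_measurable M"
  unfolding W_def by (intro borel_measurable_diff borel_measurable_times borel_measurable_const x_meas P_mem)

lemma W_int: "j \<in> {1..N} \<Longrightarrow> \<alpha> \<in> P \<Longrightarrow> integrable M (\<lambda>\<omega>. W j \<omega> \<alpha>)"
  unfolding W_def by (intro Bochner_Integration.integrable_diff integrable_const xx P_mem)

lemma W_mean: "j \<in> {1..N} \<Longrightarrow> \<alpha> \<in> P \<Longrightarrow> (\<integral>\<omega>. W j \<omega> \<alpha> \<partial>M) = 0"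
  unfolding W_def using xx[of j j "fst \<alpha>" "snd \<alpha>"] cov[of j "fst \<alpha>" "snd \<alpha>"] P_mem[of \<alpha>]
  by (simp add: prob_space)

lemma sq_int_diff_const:
  fixes f :: "'a \<Rightarrow> real"
  assumes "f \<in> borel_measurable M" "integrable M (\<lambda>\<omega>. (f \<omega>)\<^sup>2)"
  shows "integrable M (\<lambda>\<omega>. (f \<omega> - c)\<^sup>2)"
proof -
  have "(f \<omega> - c)\<^sup>2 = (f \<omega>)\<^sup>2 - (2 * c) * f \<omega> + c\<^sup>2" for \<omega> by (simp add: power2_eq_square algebra_simps)
  then show ?thesis using assms sq_int_imp_int[OF assms] by simp
qed

lemma W_sq_int: "j \<in> {1..N} \<Longrightarrow> \<alpha> \<in> P \<Longrightarrow> integrable M (\<lambda>\<omega>. (W j \<omega> \<alpha>)\<^sup>2)"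
  unfolding W_def by (intro sq_int_diff_const borel_measurable_times x_meas xx2 P_mem)

lemma ip_sq_int:
  assumes "\<And>\<alpha>. \<alpha> \<in> P \<Longrightarrow> (\<lambda>\<omega>. f \<omega> \<alpha>) \<in> borel_measurable M" "\<And>\<alpha>. \<alpha> \<in> P \<Longrightarrow> integrable M (\<lambda>\<omega>. (f \<omega> \<alpha>)\<^sup>2)"
  shows "integrable M (\<lambda>\<omega>. (ip (f \<omega>) A)\<^sup>2)"
    and "(\<integral>\<omega>. (ip (f \<omega>) A)\<^sup>2 \<partial>M) = qf (\<lambda>\<alpha> \<beta>. \<integral>\<omega>. f \<omega> \<alpha> * f \<omega> \<beta> \<partial>M) A"
proof -
  have int: "integrable M (\<lambda>\<omega>. f \<omega> \<alpha> * f \<omega> \<beta>)" if "\<alpha> \<in> P" "\<beta> \<in> P" for \<alpha> \<beta>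
    by (intro integrable_mult_of_sq assms that)
  have e: "(ip (f \<omega>) A)\<^sup>2 = (\<Sum>\<alpha>\<in>P. \<Sum>\<beta>\<in>P. (f \<omega> \<alpha> * f \<omega> \<beta>) * (A \<alpha> * A \<beta>))" for \<omega>
    unfolding ip_def power2_eq_square sum_product by (intro sum.cong refl) (simp add: mult_ac)
  show "integrable M (\<lambda>\<omega>. (ip (f \<omega>) A)\<^sup>2)"
    unfolding e by (intro Bochner_Integration.integrable_sum integrable_mult_left int)
  show "(\<integral>\<omega>. (ip (f \<omega>) A)\<^sup>2 \<partial>M) = qf (\<lambda>\<alpha> \<beta>. \<integral>\<omega>. f \<omega> \<alpha> * f \<omega> \<beta> \<partial>M) A"
    unfolding e qf_def
    by (subst Bochner_Integration.integral_sum, intro Bochner_Integration.integrable_sum integrable_mult_left int, assumption+,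
        intro sum.cong refl, subst Bochner_Integration.integral_sum, intro integrable_mult_left int, assumption+,
        intro sum.cong refl, rule integral_mult_left_zero)
qed

text \<open>The covariance operator of Y_1, acting on flattened matrices.\<close>

definition SW :: "nat \<times> nat \<Rightarrow> nat \<times> nat \<Rightarrow> real" where
  "SW \<alpha> \<beta> = (\<integral>\<omega>. W 1 \<omega> \<alpha> * W 1 \<omega> \<beta> \<partial>M)"

lemma one_mem: "1 \<in> {1..N}" using N2 by simp

lemma SW_eq:
  assumes j: "j \<in> {1..N}" and \<alpha>: "\<alpha> \<in> P" "\<beta> \<in> P"
  shows "(\<integral>\<omega>. W j \<omega> \<alpha> * W j \<omega> \<beta> \<partial>M) = SW \<alpha> \<beta>"
proof -
  define h where "h z = (g (fst \<alpha>) z * g (snd \<alpha>) z - sg \<alpha>) * (g (fst \<beta>) z * g (snd \<beta>) z - sg \<beta>)" for z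
  have h: "h \<in> borel_measurable S"
    unfolding h_def using \<alpha> by (intro borel_measurable_times borel_measurable_diff borel_measurable_const g P_mem)
  have "(\<integral>\<omega>. h (Z j \<omega>) \<partial>M) = (\<integral>\<omega>. h (Z 1 \<omega>) \<partial>M)"
    using integral_distr[OF Z_meas[OF j] h] integral_distr[OF Z_meas[OF one_mem] h] ident[OF j] by simp
  then show ?thesis by (simp add: SW_def W_def h_def x_def)
qed

lemma ipW_sq:
  assumes "j \<in> {1..N}"
  shows "(\<integral>\<omega>. (ip (W j \<omega>) A)\<^sup>2 \<partial>M) = qf SW A"
proof -
  have "(\<integral>\<omega>. (ip (W j \<omega>) A)\<^sup>2 \<partial>M) = qf (\<lambda>\<alpha> \<beta>. \<integral>\<omega>. W j \<omega> \<alpha> * W j \<omega> \<beta> \<partial>M) A"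
    by (rule ip_sq_int(2)[OF W_meas[OF assms] W_sq_int[OF assms]])
  also have "\<dots> = qf SW A"
    unfolding qf_def by (intro sum.cong refl arg_cong2[where f = "(*)"] SW_eq assms)
  finally show ?thesis .
qed

lemma ipW_mean: "j \<in> {1..N} \<Longrightarrow> (\<integral>\<omega>. ip (W j \<omega>) A \<partial>M) = 0"
  unfolding ip_def
  by (subst Bochner_Integration.integral_sum, intro integrable_mult_left W_int, assumption+) (simp add: W_mean)

lemma ipW_meas: "j \<in> {1..N} \<Longrightarrow> (\<lambda>\<omega>. ip (W j \<omega>) A) \<in> borel_measurable M"
  unfolding ip_def by (intro borel_measurable_sum borel_measurable_times borel_measurable_const W_meas)

lemma bil_diag: "bil A j j \<omega> = ip (W j \<omega>) A + ip sg A"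
  unfolding bil_def ip_def W_def sum.distrib[symmetric] by (intro sum.cong refl) (simp add: algebra_simps)

lemma bil_diag_sq:
  assumes j: "j \<in> {1..N}"
  shows "(\<integral>\<omega>. (bil A j j \<omega>)\<^sup>2 \<partial>M) = qf SW A + (ip sg A)\<^sup>2"
proof -
  have i2: "integrable M (\<lambda>\<omega>. (ip (W j \<omega>) A)\<^sup>2)" by (rule ip_sq_int(1)[OF W_meas[OF j] W_sq_int[OF j]])
  have i1: "integrable M (\<lambda>\<omega>. ip (W j \<omega>) A)" by (rule sq_int_imp_int[OF ipW_meas[OF j] i2])
  have "(bil A j j \<omega>)\<^sup>2 = (ip (W j \<omega>) A)\<^sup>2 + (2 * ip sg A) * ip (W j \<omega>) A + (ip sg A)\<^sup>2" for \<omega>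
    unfolding bil_diag by (simp add: power2_eq_square algebra_simps)
  then show ?thesis using i1 i2 ipW_sq[OF j, of A] ipW_mean[OF j, of A] by (simp add: prob_space)
qed

end

lemma sq_sum2_le: "(a + b)\<^sup>2 \<le> 2 * a\<^sup>2 + 2 * (b :: real)\<^sup>2"
  using zero_le_power2[of "a - b"] by (simp add: power2_eq_square algebra_simps)

lemma sq_sum3_le: "(a + b + c)\<^sup>2 \<le> 3 * a\<^sup>2 + 3 * b\<^sup>2 + 3 * (c :: real)\<^sup>2"
  using zero_le_power2[of "a - b"] zero_le_power2[of "a - c"] zero_le_power2[of "b - c"]
  by (simp add: power2_eq_square algebra_simps)

text \<open>The entries (j, k) and (k, j) are grouped because \<open>bil A j k\<close> and
  \<open>bil A k j\<close> may be correlated, whereas forms with different unordered pairs are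
  orthogonal.\<close>

lemma sum_off_diagonal:
  fixes f :: "nat \<Rightarrow> nat \<Rightarrow> real"
  assumes "finite I"
  shows "(\<Sum>j\<in>I. \<Sum>k\<in>I. f j k) = (\<Sum>j\<in>I. f j j) + (\<Sum>(j, k)\<in>{(j, k). j \<in> I \<and> k \<in> I \<and> j < k}. f j k + f k j)"
proof -
  let ?L = "{(j, k). j \<in> I \<and> k \<in> I \<and> j < k}" and ?G = "{(j, k). j \<in> I \<and> k \<in> I \<and> k < j}"
  let ?D = "{(j, k). j \<in> I \<and> k \<in> I \<and> j = k}"
  have fin: "finite ?L" "finite ?G" "finite ?D"
    by (rule finite_subset[of _ "I \<times> I"], use assms in auto)+
  have "(\<Sum>j\<in>I. \<Sum>k\<in>I. f j k) = (\<Sum>(j, k)\<in>I \<times> I. f j k)" by (rule sum.cartesian_product)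
  also have "I \<times> I = (?D \<union> ?L) \<union> ?G" by auto
  also have "(\<Sum>(j, k)\<in>(?D \<union> ?L) \<union> ?G. f j k) = (\<Sum>(j, k)\<in>?D \<union> ?L. f j k) + (\<Sum>(j, k)\<in>?G. f j k)"
    by (rule sum.union_disjoint) (use fin in auto)
  also have "(\<Sum>(j, k)\<in>?D \<union> ?L. f j k) = (\<Sum>(j, k)\<in>?D. f j k) + (\<Sum>(j, k)\<in>?L. f j k)"
    by (rule sum.union_disjoint) (use fin in auto)
  also have "(\<Sum>(j, k)\<in>?D. f j k) = (\<Sum>j\<in>I. f j j)"
    by (rule sum.reindex_bij_witness[of _ "\<lambda>j. (j, j)" fst]) auto
  also have "(\<Sum>(j, k)\<in>?G. f j k) = (\<Sum>(j, k)\<in>?L. f k j)"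
    by (rule sum.reindex_bij_witness[of _ "\<lambda>(j, k). (k, j)" "\<lambda>(j, k). (k, j)"]) auto
  also have "((\<Sum>j\<in>I. f j j) + (\<Sum>(j, k)\<in>?L. f j k)) + (\<Sum>(j, k)\<in>?L. f k j)
      = (\<Sum>j\<in>I. f j j) + (\<Sum>(j, k)\<in>?L. f j k + f k j)"
    by (simp only: split_def sum.distrib add.assoc)
  finally show ?thesis .
qed

section \<open>Second moments of the perturbation caused by the sample mean\<close>

context iid_vecs
begin

text \<open>The form is a second moment, for which two distinct observations are taken; here N >= 2
  enters.\<close>

lemma qf_TD_nonneg: "0 \<le> qf TD A"
proof -
  have "(\<integral>\<omega>. (bil A 1 2 \<omega>)\<^sup>2 \<partial>M) = qf TD A" by (rule bil_sq) (use N2 in auto)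
  then show ?thesis by (metis AE_I2 integral_nonneg_AE zero_le_power2)
qed

lemma qf_SW_nonneg: "0 \<le> qf SW A"
  using ipW_sq[OF one_mem, of A] by (metis AE_I2 integral_nonneg_AE zero_le_power2)

text \<open>The terms of a row are pairwise orthogonal although one of them is diagonal, because
  every other column index occurs only once. The diagonal term alone brings in \<open>SW\<close> and
  the mean.\<close>

lemma bil_row_sum:
  assumes i: "i \<in> {1..N}"
  shows "integrable M (\<lambda>\<omega>. (\<Sum>j=1..N. bil A i j \<omega>)\<^sup>2)"
    and "(\<integral>\<omega>. (\<Sum>j=1..N. bil A i j \<omega>)\<^sup>2 \<partial>M) \<le> N * qf TD A + qf SW A + (ip sg A)\<^sup>2"
proof -
  have orth: "(\<integral>\<omega>. bil A i j \<omega> * bil A i k \<omega> \<partial>M) = 0" if jk: "j \<in> {1..N}" "k \<in> {1..N}" "j \<noteq> k" for j k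
  proof (cases "i = j")
    case True
    have "(\<integral>\<omega>. bil A i k \<omega> * bil A i j \<omega> \<partial>M) = 0" by (rule bil_orth) (use i jk True in auto)
    then show ?thesis by (simp add: mult.commute)
  qed (rule bil_orth, use i jk in auto)
  show "integrable M (\<lambda>\<omega>. (\<Sum>j=1..N. bil A i j \<omega>)\<^sup>2)"
    by (rule uncorrelated_sum_sq(1)[OF _ bil_meas bil_sq_int orth]) (use i in auto)
  have "(\<integral>\<omega>. (\<Sum>j=1..N. bil A i j \<omega>)\<^sup>2 \<partial>M) = (\<Sum>j=1..N. \<integral>\<omega>. (bil A i j \<omega>)\<^sup>2 \<partial>M)"
    by (rule uncorrelated_sum_sq(2)[OF _ bil_meas bil_sq_int orth]) (use i in auto)
  also have "\<dots> \<le> (\<Sum>j=1..N. qf TD A + (if j = i then qf SW A + (ip sg A)\<^sup>2 else 0))"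
  proof (rule sum_mono)
    fix j assume j: "j \<in> {1..N}"
    show "(\<integral>\<omega>. (bil A i j \<omega>)\<^sup>2 \<partial>M) \<le> qf TD A + (if j = i then qf SW A + (ip sg A)\<^sup>2 else 0)"
      using bil_sq[OF i j] bil_diag_sq[OF i, of A] qf_TD_nonneg[of A] by (cases "j = i") auto
  qed
  also have "\<dots> = N * qf TD A + qf SW A + (ip sg A)\<^sup>2" using i by (simp add: sum.distrib)
  finally show "(\<integral>\<omega>. (\<Sum>j=1..N. bil A i j \<omega>)\<^sup>2 \<partial>M) \<le> N * qf TD A + qf SW A + (ip sg A)\<^sup>2" .
qed

text \<open>Columns are treated apart from rows since A need not be symmetric.\<close>

lemma bil_col_sum:
  assumes i: "i \<in> {1..N}"
  shows "integrable M (\<lambda>\<omega>. (\<Sum>j=1..N. bil A j i \<omega>)\<^sup>2)"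
    and "(\<integral>\<omega>. (\<Sum>j=1..N. bil A j i \<omega>)\<^sup>2 \<partial>M) \<le> N * qf TD A + qf SW A + (ip sg A)\<^sup>2"
proof -
  have orth: "(\<integral>\<omega>. bil A j i \<omega> * bil A k i \<omega> \<partial>M) = 0" if jk: "j \<in> {1..N}" "k \<in> {1..N}" "j \<noteq> k" for j k
  proof (cases "i = j")
    case True
    have "(\<integral>\<omega>. bil A k i \<omega> * bil A j i \<omega> \<partial>M) = 0" by (rule bil_orth) (use i jk True in auto)
    then show ?thesis by (simp add: mult.commute)
  qed (rule bil_orth, use i jk in auto)
  show "integrable M (\<lambda>\<omega>. (\<Sum>j=1..N. bil A j i \<omega>)\<^sup>2)"
    by (rule uncorrelated_sum_sq(1)[OF _ bil_meas bil_sq_int orth]) (use i in auto)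
  have "(\<integral>\<omega>. (\<Sum>j=1..N. bil A j i \<omega>)\<^sup>2 \<partial>M) = (\<Sum>j=1..N. \<integral>\<omega>. (bil A j i \<omega>)\<^sup>2 \<partial>M)"
    by (rule uncorrelated_sum_sq(2)[OF _ bil_meas bil_sq_int orth]) (use i in auto)
  also have "\<dots> \<le> (\<Sum>j=1..N. qf TD A + (if j = i then qf SW A + (ip sg A)\<^sup>2 else 0))"
  proof (rule sum_mono)
    fix j assume j: "j \<in> {1..N}"
    show "(\<integral>\<omega>. (bil A j i \<omega>)\<^sup>2 \<partial>M) \<le> qf TD A + (if j = i then qf SW A + (ip sg A)\<^sup>2 else 0)"
      using bil_sq[OF j i] bil_diag_sq[OF i, of A] qf_TD_nonneg[of A] by (cases "j = i") auto
  qed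
  also have "\<dots> = N * qf TD A + qf SW A + (ip sg A)\<^sup>2" using i by (simp add: sum.distrib)
  finally show "(\<integral>\<omega>. (\<Sum>j=1..N. bil A j i \<omega>)\<^sup>2 \<partial>M) \<le> N * qf TD A + qf SW A + (ip sg A)\<^sup>2" .
qed

lemma card_less_pairs: "card {(j, k). j \<in> {1..N} \<and> k \<in> {1..N} \<and> j < k} \<le> N\<^sup>2"
proof -
  have "card {(j, k). j \<in> {1..N} \<and> k \<in> {1..N} \<and> j < k} \<le> card ({1..N} \<times> {1..N})"
    by (rule card_mono) auto
  then show ?thesis by (simp add: card_cartesian_product power2_eq_square)
qed

text \<open>The quadratic form u^T A u of the sample mean, multiplied by N^2 and centred at its
  expectation.\<close>

definition Rm :: "(nat \<times> nat \<Rightarrow> real) \<Rightarrow> 'a \<Rightarrow> real" where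
  "Rm A \<omega> = (\<Sum>j=1..N. \<Sum>k=1..N. bil A j k \<omega>) - N * ip sg A"

text \<open>The centred diagonal terms are independent and the grouped off-diagonal ones orthogonal,
  so neither sum has cross terms. The 8 is a 2 from separating the two sums times a 4 from
  symmetrising a pair, with at most N^2 pairs.\<close>

lemma Rm_sq:
  shows "integrable M (\<lambda>\<omega>. (Rm A \<omega>)\<^sup>2)"
    and "(\<integral>\<omega>. (Rm A \<omega>)\<^sup>2 \<partial>M) \<le> 2 * N * qf SW A + 8 * N\<^sup>2 * qf TD A"
proof -
  let ?L = "{(j, k). j \<in> {1..N} \<and> k \<in> {1..N} \<and> j < k}"
  let ?b = "\<lambda>q \<omega>. bil A (fst q) (snd q) \<omega> + bil A (snd q) (fst q) \<omega>"
  have finL: "finite ?L" by (rule finite_subset[of _ "{1..N} \<times> {1..N}"]) auto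
  have bm: "?b q \<in> borel_measurable M" if "q \<in> ?L" for q
    using that by (intro borel_measurable_add bil_meas) auto
  have Wm: "(\<lambda>\<omega>. ip (W j \<omega>) A) \<in> borel_measurable M" if "j \<in> {1..N}" for j using ipW_meas[OF that] .
  have W2: "integrable M (\<lambda>\<omega>. (ip (W j \<omega>) A)\<^sup>2)" if "j \<in> {1..N}" for j
    by (rule ip_sq_int(1)[OF W_meas[OF that] W_sq_int[OF that]])
  have W1: "integrable M (\<lambda>\<omega>. ip (W j \<omega>) A)" if "j \<in> {1..N}" for j
    by (rule sq_int_imp_int[OF Wm[OF that] W2[OF that]])
  have e: "Rm A \<omega> = (\<Sum>j=1..N. ip (W j \<omega>) A) + (\<Sum>q\<in>?L. ?b q \<omega>)" for \<omega>
    unfolding Rm_def sum_off_diagonal[OF finite_atLeastAtMost] by (simp add: bil_diag sum.distrib case_prod_beta)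
  have b_sq: "(?b q \<omega>)\<^sup>2 \<le> 2 * (bil A (fst q) (snd q) \<omega>)\<^sup>2 + 2 * (bil A (snd q) (fst q) \<omega>)\<^sup>2" for q \<omega>
    by (rule sq_sum2_le)
  have ib2: "integrable M (\<lambda>\<omega>. 2 * (bil A (fst q) (snd q) \<omega>)\<^sup>2 + 2 * (bil A (snd q) (fst q) \<omega>)\<^sup>2)" if "q \<in> ?L" for q
    using that by (intro Bochner_Integration.integrable_add integrable_mult_right bil_sq_int) auto
  have b2: "integrable M (\<lambda>\<omega>. (?b q \<omega>)\<^sup>2)" if q: "q \<in> ?L" for q
  proof (rule Bochner_Integration.integrable_bound[OF ib2[OF q]])
    show "(\<lambda>\<omega>. (?b q \<omega>)\<^sup>2) \<in> borel_measurable M" using bm[OF q] by (rule borel_measurable_power)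
    show "AE \<omega> in M. norm ((?b q \<omega>)\<^sup>2) \<le> norm (2 * (bil A (fst q) (snd q) \<omega>)\<^sup>2 + 2 * (bil A (snd q) (fst q) \<omega>)\<^sup>2)"
      using b_sq[of q] by (intro AE_I2) simp
  qed
  have b_le: "(\<integral>\<omega>. (?b q \<omega>)\<^sup>2 \<partial>M) \<le> 4 * qf TD A" if q: "q \<in> ?L" for q
  proof -
    have q': "fst q \<in> {1..N}" "snd q \<in> {1..N}" "fst q \<noteq> snd q" using q by auto
    have "(\<integral>\<omega>. (?b q \<omega>)\<^sup>2 \<partial>M) \<le> (\<integral>\<omega>. 2 * (bil A (fst q) (snd q) \<omega>)\<^sup>2 + 2 * (bil A (snd q) (fst q) \<omega>)\<^sup>2 \<partial>M)"
      by (rule integral_mono[OF b2[OF q] ib2[OF q] b_sq])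
    also have "\<dots> = 4 * qf TD A"
      using bil_sq_int[OF q'(1,2), of A] bil_sq_int[OF q'(2,1), of A] bil_sq[OF q'(1,2)] bil_sq[OF q'(2,1)] q'(3) by simp
    finally show ?thesis .
  qed
  have orthb: "(\<integral>\<omega>. ?b q \<omega> * ?b r \<omega> \<partial>M) = 0" if qr: "q \<in> ?L" "r \<in> ?L" "q \<noteq> r" for q r
  proof -
    have m: "fst q \<in> {1..N}" "snd q \<in> {1..N}" "fst r \<in> {1..N}" "snd r \<in> {1..N}" using qr by auto
    have ne: "fst q \<noteq> snd q" "{fst q, snd q} \<noteq> {fst r, snd r}" using qr by (auto simp: doubleton_eq_iff)
    have ne': "snd q \<noteq> fst q" "{snd q, fst q} \<noteq> {fst r, snd r}" "{fst q, snd q} \<noteq> {snd r, fst r}" "{snd q, fst q} \<noteq> {snd r, fst r}"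
      using ne by (auto simp: insert_commute)
    have ex: "?b q \<omega> * ?b r \<omega> = bil A (fst q) (snd q) \<omega> * bil A (fst r) (snd r) \<omega> + bil A (fst q) (snd q) \<omega> * bil A (snd r) (fst r) \<omega>
      + (bil A (snd q) (fst q) \<omega> * bil A (fst r) (snd r) \<omega> + bil A (snd q) (fst q) \<omega> * bil A (snd r) (fst r) \<omega>)" for \<omega>
      by (simp add: algebra_simps)
    show ?thesis
      unfolding ex
      by (simp add: bil_mult_int(1)[OF m] bil_mult_int(1)[OF m(1,2,4,3)] bil_mult_int(1)[OF m(2,1,3,4)] bil_mult_int(1)[OF m(2,1,4,3)]
          bil_orth[OF m ne] bil_orth[OF m(1,2,4,3) ne(1) ne'(3)] bil_orth[OF m(2,1,3,4) ne'(1,2)] bil_orth[OF m(2,1,4,3) ne'(1,4)])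
  qed
  have sb: "integrable M (\<lambda>\<omega>. (\<Sum>q\<in>?L. ?b q \<omega>)\<^sup>2)"
    by (rule uncorrelated_sum_sq(1)[OF finL bm b2 orthb])
  have "(\<integral>\<omega>. (\<Sum>q\<in>?L. ?b q \<omega>)\<^sup>2 \<partial>M) = (\<Sum>q\<in>?L. \<integral>\<omega>. (?b q \<omega>)\<^sup>2 \<partial>M)"
    by (rule uncorrelated_sum_sq(2)[OF finL bm b2 orthb])
  also have "\<dots> \<le> (\<Sum>q\<in>?L. 4 * qf TD A)" by (intro sum_mono b_le)
  also have "\<dots> = card ?L * (4 * qf TD A)" by simp
  also have "\<dots> \<le> N\<^sup>2 * (4 * qf TD A)"
    using card_less_pairs qf_TD_nonneg[of A] by (intro mult_right_mono) (auto simp only: of_nat_le_iff)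
  finally have Sb: "(\<integral>\<omega>. (\<Sum>q\<in>?L. ?b q \<omega>)\<^sup>2 \<partial>M) \<le> N\<^sup>2 * (4 * qf TD A)" .
  have orthW: "(\<integral>\<omega>. ip (W j \<omega>) A * ip (W k \<omega>) A \<partial>M) = 0" if jk: "j \<in> {1..N}" "k \<in> {1..N}" "j \<noteq> k" for j k
  proof -
    define h where "h z = ip (\<lambda>\<alpha>. g (fst \<alpha>) z * g (snd \<alpha>) z - sg \<alpha>) A" for z
    have h: "h \<in> borel_measurable S"
      unfolding h_def ip_def
      by (intro borel_measurable_sum borel_measurable_times borel_measurable_diff borel_measurable_const g P_mem)
    have hm: "(\<lambda>z. h (z l)) \<in> borel_measurable (PiM {l} (\<lambda>_. S))" for l
      by (rule measurable_compose[OF measurable_component_singleton[of l "{l}" "\<lambda>_. S"] h]) simp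
    have hW: "h (Z l \<omega>) = ip (W l \<omega>) A" for l \<omega> by (simp add: h_def ip_def W_def x_def)
    have "(\<integral>\<omega>. (\<lambda>z. h (z j)) (restrict (\<lambda>i. Z i \<omega>) {j}) * (\<lambda>z. h (z k)) (restrict (\<lambda>i. Z i \<omega>) {k}) \<partial>M) =
      (\<integral>\<omega>. (\<lambda>z. h (z j)) (restrict (\<lambda>i. Z i \<omega>) {j}) \<partial>M) * (\<integral>\<omega>. (\<lambda>z. h (z k)) (restrict (\<lambda>i. Z i \<omega>) {k}) \<partial>M)"
      by (rule expectation_indep[OF _ _ _ hm hm]) (use jk W1 in \<open>auto simp: hW\<close>)
    then show ?thesis using ipW_mean[OF jk(1), of A] by (simp add: hW)
  qed
  have sW: "integrable M (\<lambda>\<omega>. (\<Sum>j=1..N. ip (W j \<omega>) A)\<^sup>2)"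
    by (rule uncorrelated_sum_sq(1)[OF finite_atLeastAtMost Wm W2 orthW])
  have "(\<integral>\<omega>. (\<Sum>j=1..N. ip (W j \<omega>) A)\<^sup>2 \<partial>M) = (\<Sum>j=1..N. \<integral>\<omega>. (ip (W j \<omega>) A)\<^sup>2 \<partial>M)"
    by (rule uncorrelated_sum_sq(2)[OF finite_atLeastAtMost Wm W2 orthW])
  also have "\<dots> = (\<Sum>j=1..N. qf SW A)" by (intro sum.cong refl ipW_sq)
  finally have SWq: "(\<integral>\<omega>. (\<Sum>j=1..N. ip (W j \<omega>) A)\<^sup>2 \<partial>M) = N * qf SW A" by simp
  have R_le: "(Rm A \<omega>)\<^sup>2 \<le> 2 * (\<Sum>j=1..N. ip (W j \<omega>) A)\<^sup>2 + 2 * (\<Sum>q\<in>?L. ?b q \<omega>)\<^sup>2" for \<omega>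
    unfolding e by (rule sq_sum2_le)
  have iR: "integrable M (\<lambda>\<omega>. 2 * (\<Sum>j=1..N. ip (W j \<omega>) A)\<^sup>2 + 2 * (\<Sum>q\<in>?L. ?b q \<omega>)\<^sup>2)"
    by (intro Bochner_Integration.integrable_add integrable_mult_right sW sb)
  have Rmm: "(\<lambda>\<omega>. (Rm A \<omega>)\<^sup>2) \<in> borel_measurable M"
    unfolding Rm_def by (intro borel_measurable_power borel_measurable_diff borel_measurable_sum borel_measurable_const bil_meas)
  show i: "integrable M (\<lambda>\<omega>. (Rm A \<omega>)\<^sup>2)"
    by (rule Bochner_Integration.integrable_bound[OF iR Rmm]) (use R_le in simp)
  have "(\<integral>\<omega>. (Rm A \<omega>)\<^sup>2 \<partial>M) \<le> (\<integral>\<omega>. 2 * (\<Sum>j=1..N. ip (W j \<omega>) A)\<^sup>2 + 2 * (\<Sum>q\<in>?L. ?b q \<omega>)\<^sup>2 \<partial>M)"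
    by (rule integral_mono[OF i iR R_le])
  also have "\<dots> = 2 * (N * qf SW A) + 2 * (\<integral>\<omega>. (\<Sum>q\<in>?L. ?b q \<omega>)\<^sup>2 \<partial>M)"
    using sW sb SWq by simp
  finally show "(\<integral>\<omega>. (Rm A \<omega>)\<^sup>2 \<partial>M) \<le> 2 * N * qf SW A + 8 * N\<^sup>2 * qf TD A" using Sb by simp
qed

text \<open>Of the two copies of \<open>ip sg A / N\<close> one is the term
  \<open>sg \<alpha> / N\<close> of \<open>Dl\<close>, the other the mean of the quadratic form in
  the sample mean.\<close>

lemma ip_Dl: "ip (Dl i \<omega>) A = - (\<Sum>j=1..N. bil A i j \<omega>) / N - (\<Sum>j=1..N. bil A j i \<omega>) / N + (Rm A \<omega> / N\<^sup>2 + 2 * ip sg A / N)"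
proof -
  have 1: "(\<Sum>\<alpha>\<in>P. x i (fst \<alpha>) \<omega> * u (snd \<alpha>) \<omega> * A \<alpha>) = (\<Sum>j=1..N. bil A i j \<omega>) / N"
    unfolding u_def bil_def sum_divide_distrib
    by (subst sum.swap) (simp add: sum_distrib_left sum_distrib_right mult_ac)
  have 2: "(\<Sum>\<alpha>\<in>P. u (fst \<alpha>) \<omega> * x i (snd \<alpha>) \<omega> * A \<alpha>) = (\<Sum>j=1..N. bil A j i \<omega>) / N"
    unfolding u_def bil_def sum_divide_distrib
    by (subst sum.swap) (simp add: sum_distrib_left sum_distrib_right mult_ac)
  have 3: "(\<Sum>\<alpha>\<in>P. u (fst \<alpha>) \<omega> * u (snd \<alpha>) \<omega> * A \<alpha>) = (\<Sum>j=1..N. \<Sum>k=1..N. bil A j k \<omega>) / N\<^sup>2"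
  proof -
    have "(\<Sum>j=1..N. \<Sum>k=1..N. bil A j k \<omega>) = (\<Sum>\<alpha>\<in>P. \<Sum>j=1..N. \<Sum>k=1..N. A \<alpha> * (x j (fst \<alpha>) \<omega> * x k (snd \<alpha>) \<omega>))"
      unfolding bil_def by (subst sum.swap[of _ P], subst sum.swap[of _ P]) (rule refl)
    also have "\<dots> = (\<Sum>\<alpha>\<in>P. A \<alpha> * ((\<Sum>j=1..N. x j (fst \<alpha>) \<omega>) * (\<Sum>k=1..N. x k (snd \<alpha>) \<omega>)))"
      unfolding sum_product by (simp only: sum_distrib_left)
    also have "\<dots> = N\<^sup>2 * (\<Sum>\<alpha>\<in>P. u (fst \<alpha>) \<omega> * u (snd \<alpha>) \<omega> * A \<alpha>)"
    proof -
      have Nu: "(\<Sum>j=1..N. x j a \<omega>) = N * u a \<omega>" for a using N0 by (simp add: u_def)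
      show ?thesis unfolding Nu sum_distrib_left by (intro sum.cong refl) (simp add: power2_eq_square)
    qed
    finally show ?thesis using N0 by simp
  qed
  have "ip (Dl i \<omega>) A = - (\<Sum>\<alpha>\<in>P. x i (fst \<alpha>) \<omega> * u (snd \<alpha>) \<omega> * A \<alpha>) - (\<Sum>\<alpha>\<in>P. u (fst \<alpha>) \<omega> * x i (snd \<alpha>) \<omega> * A \<alpha>)
      + (\<Sum>\<alpha>\<in>P. u (fst \<alpha>) \<omega> * u (snd \<alpha>) \<omega> * A \<alpha>) + (\<Sum>\<alpha>\<in>P. sg \<alpha> * A \<alpha>) / N"
    unfolding ip_def Dl_def
    by (simp add: sum.distrib sum_subtractf sum_negf[symmetric] sum_divide_distrib algebra_simps)
  also have "\<dots> = - (\<Sum>j=1..N. bil A i j \<omega>) / N - (\<Sum>j=1..N. bil A j i \<omega>) / N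
      + (\<Sum>j=1..N. \<Sum>k=1..N. bil A j k \<omega>) / N\<^sup>2 + ip sg A / N"
    unfolding 1 2 3 ip_def by simp
  finally show ?thesis using N0 by (simp add: Rm_def diff_divide_distrib power2_eq_square)
qed

text \<open>Summation over i replaces x_i by N u, so the two linear terms give -2 N u u^T against N
  u u^T from the quadratic one. What remains is the centred quadratic form in u.\<close>

lemma ip_sum_Dl: "(\<Sum>i=1..N. ip (Dl i \<omega>) A) = - Rm A \<omega> / N"
proof -
  have s: "(\<Sum>i=1..N. \<Sum>j=1..N. bil A j i \<omega>) = (\<Sum>i=1..N. \<Sum>j=1..N. bil A i j \<omega>)" by (rule sum.swap)
  have "(\<Sum>i=1..N. ip (Dl i \<omega>) A) = - (\<Sum>i=1..N. \<Sum>j=1..N. bil A i j \<omega>) / N - (\<Sum>i=1..N. \<Sum>j=1..N. bil A i j \<omega>) / N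
      + N * (Rm A \<omega> / N\<^sup>2 + 2 * ip sg A / N)"
    unfolding ip_Dl by (simp add: sum.distrib sum_subtractf sum_negf sum_divide_distrib[symmetric] s)
  also have "(\<Sum>i=1..N. \<Sum>j=1..N. bil A i j \<omega>) = Rm A \<omega> + N * ip sg A" by (simp add: Rm_def)
  finally show ?thesis using N0 by (simp add: field_simps power2_eq_square)
qed

lemma u_meas: "a \<in> {1..p} \<Longrightarrow> u a \<in> borel_measurable M"
  unfolding u_def[abs_def] by (intro borel_measurable_divide borel_measurable_sum borel_measurable_const x_meas)

lemma Dl_meas: "i \<in> {1..N} \<Longrightarrow> \<alpha> \<in> P \<Longrightarrow> (\<lambda>\<omega>. Dl i \<omega> \<alpha>) \<in> borel_measurable M"
  unfolding Dl_def
  by (intro borel_measurable_add borel_measurable_diff borel_measurable_times borel_measurable_uminus borel_measurable_const x_meas u_meas P_mem)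

lemma ip_Dl_meas: "i \<in> {1..N} \<Longrightarrow> (\<lambda>\<omega>. ip (Dl i \<omega>) A) \<in> borel_measurable M"
  unfolding ip_def by (intro borel_measurable_sum borel_measurable_times borel_measurable_const Dl_meas)

text \<open>After crude use of N >= 1 the coefficients of the \<open>TD\<close>, \<open>SW\<close>
  and mean terms are 54, 18 and 30; 60 is a common bound.\<close>

lemma ip_Dl_sq:
  assumes i: "i \<in> {1..N}"
  shows "integrable M (\<lambda>\<omega>. (ip (Dl i \<omega>) A)\<^sup>2)"
    and "(\<integral>\<omega>. (ip (Dl i \<omega>) A)\<^sup>2 \<partial>M) \<le> 60 * (qf TD A / N + (qf SW A + (ip sg A)\<^sup>2) / N\<^sup>2)"
proof -
  let ?r = "\<lambda>\<omega>. \<Sum>j=1..N. bil A i j \<omega>" and ?c = "\<lambda>\<omega>. \<Sum>j=1..N. bil A j i \<omega>"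
  define D C E where DCE: "D = qf TD A" "C = qf SW A" "E = (ip sg A)\<^sup>2"
  have nonneg: "0 \<le> D" "0 \<le> C" "0 \<le> E" using qf_TD_nonneg qf_SW_nonneg by (auto simp: DCE)
  let ?B = "\<lambda>\<omega>. (3 / N\<^sup>2) * (?r \<omega>)\<^sup>2 + (3 / N\<^sup>2) * (?c \<omega>)\<^sup>2 + ((6 / N ^ 4) * (Rm A \<omega>)\<^sup>2 + 24 * E / N\<^sup>2)"
  have le: "(ip (Dl i \<omega>) A)\<^sup>2 \<le> ?B \<omega>" for \<omega>
  proof -
    have "(ip (Dl i \<omega>) A)\<^sup>2 \<le> 3 * (- ?r \<omega> / N)\<^sup>2 + 3 * (- ?c \<omega> / N)\<^sup>2 + 3 * (Rm A \<omega> / N\<^sup>2 + 2 * ip sg A / N)\<^sup>2"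
      unfolding ip_Dl using sq_sum3_le[of "- ?r \<omega> / N" "- ?c \<omega> / N"] by simp
    moreover have "(Rm A \<omega> / N\<^sup>2 + 2 * ip sg A / N)\<^sup>2 \<le> 2 * (Rm A \<omega> / N\<^sup>2)\<^sup>2 + 2 * (2 * ip sg A / N)\<^sup>2" by (rule sq_sum2_le)
    moreover have "(Rm A \<omega> / N\<^sup>2)\<^sup>2 = (Rm A \<omega>)\<^sup>2 / N ^ 4" "(2 * ip sg A / N)\<^sup>2 = 4 * E / N\<^sup>2"
      "(- ?r \<omega> / N)\<^sup>2 = (?r \<omega>)\<^sup>2 / N\<^sup>2" "(- ?c \<omega> / N)\<^sup>2 = (?c \<omega>)\<^sup>2 / N\<^sup>2"
      by (simp_all add: power_divide power_mult_distrib DCE power_mult[symmetric])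
    ultimately show ?thesis by simp
  qed
  have iB: "integrable M ?B"
    by (intro Bochner_Integration.integrable_add integrable_mult_right integrable_const bil_row_sum(1)[OF i] bil_col_sum(1)[OF i] Rm_sq(1))
  show int: "integrable M (\<lambda>\<omega>. (ip (Dl i \<omega>) A)\<^sup>2)"
    by (rule Bochner_Integration.integrable_bound[OF iB borel_measurable_power[OF ip_Dl_meas[OF i]]])
       (use order_trans[OF le abs_ge_self] in simp)
  have "(\<integral>\<omega>. (ip (Dl i \<omega>) A)\<^sup>2 \<partial>M) \<le> (\<integral>\<omega>. ?B \<omega> \<partial>M)" by (rule integral_mono[OF int iB le])
  also have "\<dots> = (3 / N\<^sup>2) * (\<integral>\<omega>. (?r \<omega>)\<^sup>2 \<partial>M) + (3 / N\<^sup>2) * (\<integral>\<omega>. (?c \<omega>)\<^sup>2 \<partial>M) + ((6 / N ^ 4) * (\<integral>\<omega>. (Rm A \<omega>)\<^sup>2 \<partial>M) + 24 * E / N\<^sup>2)"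
    using bil_row_sum(1)[OF i, of A] bil_col_sum(1)[OF i, of A] Rm_sq(1)[of A] by (simp add: prob_space)
  also have "\<dots> \<le> (3 / N\<^sup>2) * (N * D + C + E) + (3 / N\<^sup>2) * (N * D + C + E) + ((6 / N ^ 4) * (2 * N * C + 8 * N\<^sup>2 * D) + 24 * E / N\<^sup>2)"
    unfolding DCE
    by (intro add_mono mult_left_mono bil_row_sum(2)[OF i] bil_col_sum(2)[OF i] Rm_sq(2) order_refl) auto
  also have "\<dots> = 6 * D / N + 6 * C / N\<^sup>2 + 30 * E / N\<^sup>2 + 12 * C / N ^ 3 + 48 * D / N\<^sup>2"
    using N0 by (simp add: field_simps power2_eq_square power3_eq_cube power4_eq_xxxx)
  also have "\<dots> \<le> 60 * (D / N + (C + E) / N\<^sup>2)"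
  proof -
    have "(D / N) * (1 / N) \<le> (D / N) * 1" using N2 nonneg by (intro mult_left_mono) auto
    then have "D / N\<^sup>2 \<le> D / N" by (simp add: power2_eq_square)
    moreover have "C / N ^ 3 \<le> C / N\<^sup>2" using N0 N2 nonneg by (intro divide_left_mono power_increasing) auto
    moreover have "0 \<le> D / N" "0 \<le> C / N\<^sup>2" "0 \<le> E / N\<^sup>2" using nonneg by auto
    ultimately show ?thesis by (simp add: add_divide_distrib)
  qed
  finally show "(\<integral>\<omega>. (ip (Dl i \<omega>) A)\<^sup>2 \<partial>M) \<le> 60 * (qf TD A / N + (qf SW A + (ip sg A)\<^sup>2) / N\<^sup>2)" by (simp only: DCE)
qed

lemma ip_sum_Dl_sq:
  shows "integrable M (\<lambda>\<omega>. (\<Sum>i=1..N. ip (Dl i \<omega>) A)\<^sup>2)"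
    and "(\<integral>\<omega>. (\<Sum>i=1..N. ip (Dl i \<omega>) A)\<^sup>2 \<partial>M) \<le> 2 * qf SW A / N + 8 * qf TD A"
proof -
  have e: "(\<Sum>i=1..N. ip (Dl i \<omega>) A)\<^sup>2 = (Rm A \<omega>)\<^sup>2 / N\<^sup>2" for \<omega>
    unfolding ip_sum_Dl by (simp add: power_divide)
  show "integrable M (\<lambda>\<omega>. (\<Sum>i=1..N. ip (Dl i \<omega>) A)\<^sup>2)" unfolding e by (intro integrable_divide Rm_sq(1))
  have "(\<integral>\<omega>. (\<Sum>i=1..N. ip (Dl i \<omega>) A)\<^sup>2 \<partial>M) = (\<integral>\<omega>. (Rm A \<omega>)\<^sup>2 \<partial>M) / N\<^sup>2" unfolding e by (rule integral_divide_zero)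
  also have "\<dots> \<le> (2 * N * qf SW A + 8 * N\<^sup>2 * qf TD A) / N\<^sup>2" by (intro divide_right_mono Rm_sq(2)) simp
  also have "\<dots> = 2 * qf SW A / N + 8 * qf TD A" using N0 by (simp add: field_simps power2_eq_square)
  finally show "(\<integral>\<omega>. (\<Sum>i=1..N. ip (Dl i \<omega>) A)\<^sup>2 \<partial>M) \<le> 2 * qf SW A / N + 8 * qf TD A" .
qed

section \<open>Hilbert-Schmidt norms of second moment operators\<close>

definition hs :: "(nat \<times> nat \<Rightarrow> nat \<times> nat \<Rightarrow> real) \<Rightarrow> real" where
  "hs T = L2_set (\<lambda>q. T (fst q) (snd q)) (P \<times> P)"

definition hsip :: "(nat \<times> nat \<Rightarrow> nat \<times> nat \<Rightarrow> real) \<Rightarrow> (nat \<times> nat \<Rightarrow> nat \<times> nat \<Rightarrow> real) \<Rightarrow> real" where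
  "hsip T U = (\<Sum>\<alpha>\<in>P. \<Sum>\<beta>\<in>P. T \<alpha> \<beta> * U \<alpha> \<beta>)"

text \<open>The mixed second moment operator: the expectation of the tensor product of f and
  h.\<close>

definition Sm :: "('a \<Rightarrow> nat \<times> nat \<Rightarrow> real) \<Rightarrow> ('a \<Rightarrow> nat \<times> nat \<Rightarrow> real) \<Rightarrow> nat \<times> nat \<Rightarrow> nat \<times> nat \<Rightarrow> real" where
  "Sm f h \<alpha> \<beta> = (\<integral>\<omega>. f \<omega> \<alpha> * h \<omega> \<beta> \<partial>M)"

definition L2v :: "('a \<Rightarrow> nat \<times> nat \<Rightarrow> real) \<Rightarrow> bool" where
  "L2v f \<longleftrightarrow> (\<forall>\<alpha>\<in>P. (\<lambda>\<omega>. f \<omega> \<alpha>) \<in> borel_measurable M \<and> integrable M (\<lambda>\<omega>. (f \<omega> \<alpha>)\<^sup>2))"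

text \<open>The squared Frobenius norm of the covariance matrix, that is tr(Sigma^2).\<close>

definition tau :: real where "tau = (\<Sum>\<alpha>\<in>P. (sg \<alpha>)\<^sup>2)"

definition sigma :: real where "sigma = hs SW"

text \<open>A common bound for the norms of the second moments of the \<open>Dl i\<close> and, after
  multiplication by N, for that of their sum. The 120 doubles the 60 of \<open>ip_Dl_sq\<close>,
  because two of the terms there contribute \<open>tau\<close>.\<close>

definition eta :: real where "eta = 120 * (tau / N + sigma / N\<^sup>2)"

lemma hs_nonneg: "0 \<le> hs T" by (simp add: hs_def)

lemma hsip_pairs: "hsip T U = (\<Sum>q\<in>P \<times> P. T (fst q) (snd q) * U (fst q) (snd q))"
  unfolding hsip_def sum.cartesian_product by (simp add: split_def)

lemma hsip_le: "\<bar>hsip T U\<bar> \<le> hs T * hs U"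
proof -
  have "\<bar>hsip T U\<bar> \<le> (\<Sum>q\<in>P \<times> P. \<bar>T (fst q) (snd q)\<bar> * \<bar>U (fst q) (snd q)\<bar>)"
    unfolding hsip_pairs using sum_abs[of "\<lambda>q. T (fst q) (snd q) * U (fst q) (snd q)" "P \<times> P"] by (simp add: abs_mult)
  also have "\<dots> \<le> hs T * hs U" unfolding hs_def by (rule L2_set_mult_ineq)
  finally show ?thesis .
qed

lemma hs_sq: "(hs T)\<^sup>2 = hsip T T"
  unfolding hs_def L2_set_def hsip_pairs by (simp add: sum_nonneg power2_eq_square)

lemma hs_triangle: "hs (\<lambda>\<alpha> \<beta>. T \<alpha> \<beta> + U \<alpha> \<beta>) \<le> hs T + hs U"
  unfolding hs_def by (rule L2_set_triangle_ineq)

lemma hs_scale: "hs (\<lambda>\<alpha> \<beta>. c * T \<alpha> \<beta>) = \<bar>c\<bar> * hs T"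
proof -
  have "hs (\<lambda>\<alpha> \<beta>. c * T \<alpha> \<beta>) = hs (\<lambda>\<alpha> \<beta>. \<bar>c\<bar> * T \<alpha> \<beta>)" unfolding hs_def L2_set_def by (simp add: power_mult_distrib)
  also have "\<dots> = \<bar>c\<bar> * hs T" unfolding hs_def by (rule L2_set_right_distrib[symmetric]) simp
  finally show ?thesis .
qed

lemma hs_cong: "(\<And>\<alpha> \<beta>. \<alpha> \<in> P \<Longrightarrow> \<beta> \<in> P \<Longrightarrow> T \<alpha> \<beta> = U \<alpha> \<beta>) \<Longrightarrow> hs T = hs U"
  unfolding hs_def by (intro L2_set_cong) auto

lemma L2v_int: "L2v f \<Longrightarrow> L2v h \<Longrightarrow> \<alpha> \<in> P \<Longrightarrow> \<beta> \<in> P \<Longrightarrow> integrable M (\<lambda>\<omega>. f \<omega> \<alpha> * h \<omega> \<beta>)"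
  unfolding L2v_def by (intro integrable_mult_of_sq) auto

lemma L2v_ip_sq:
  assumes "L2v f"
  shows "integrable M (\<lambda>\<omega>. (ip (f \<omega>) A)\<^sup>2)" and "(\<integral>\<omega>. (ip (f \<omega>) A)\<^sup>2 \<partial>M) = qf (Sm f f) A"
  using ip_sq_int[of f A] assms unfolding L2v_def Sm_def by blast+

text \<open>The expectation of a quadratic form depends on the random vector only through its second
  moment operator.\<close>

lemma integral_qf:
  assumes f: "L2v f"
  shows "integrable M (\<lambda>\<omega>. qf T (f \<omega>))" and "(\<integral>\<omega>. qf T (f \<omega>) \<partial>M) = hsip T (Sm f f)"
proof -
  show "integrable M (\<lambda>\<omega>. qf T (f \<omega>))"
    unfolding qf_def by (intro Bochner_Integration.integrable_sum integrable_mult_right L2v_int f)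
  show "(\<integral>\<omega>. qf T (f \<omega>) \<partial>M) = hsip T (Sm f f)"
    unfolding qf_def hsip_def Sm_def
    by (subst Bochner_Integration.integral_sum, intro Bochner_Integration.integrable_sum integrable_mult_right L2v_int f, assumption+,
        intro sum.cong refl, subst Bochner_Integration.integral_sum, intro integrable_mult_right L2v_int f, assumption+,
        intro sum.cong refl, rule integral_mult_right_zero)
qed

text \<open>Domination of quadratic forms passes to the Hilbert-Schmidt pairing with a second moment
  matrix, by evaluating the forms at the random vector itself.\<close>

lemma hsip_mono:
  assumes f: "L2v f" and le: "\<And>A. qf T A \<le> qf B A"
  shows "hsip T (Sm f f) \<le> hsip B (Sm f f)"
  unfolding integral_qf(2)[OF f, symmetric] by (rule integral_mono[OF integral_qf(1)[OF f] integral_qf(1)[OF f] le])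

text \<open>With S the second moment operator, <S, S> <= <B, S> <= |B| |S|, and one factor |S|
  cancels. This replaces a spectral argument for monotonicity of the norm.\<close>

lemma hs_mono:
  assumes f: "L2v f" and le: "\<And>A. qf (Sm f f) A \<le> qf B A"
  shows "hs (Sm f f) \<le> hs B"
proof (cases "hs (Sm f f) = 0")
  case False
  have "hs (Sm f f) * hs (Sm f f) = hsip (Sm f f) (Sm f f)" using hs_sq by (simp add: power2_eq_square)
  also have "\<dots> \<le> hsip B (Sm f f)" by (rule hsip_mono[OF f le])
  also have "\<dots> \<le> hs B * hs (Sm f f)" using hsip_le[of B "Sm f f"] by linarith
  finally show ?thesis using False hs_nonneg[of "Sm f f"] by (simp add: mult_le_cancel_right)
qed (simp add: hs_nonneg)

lemma hs_TE: "hs (\<lambda>\<alpha> \<beta>. sg \<alpha> * sg \<beta>) = tau"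
proof -
  have "(hs (\<lambda>\<alpha> \<beta>. sg \<alpha> * sg \<beta>))\<^sup>2 = tau\<^sup>2"
    unfolding hs_sq hsip_def tau_def power2_eq_square[of "sum _ _"] sum_product
    by (intro sum.cong refl) (simp add: power2_eq_square)
  then show ?thesis using hs_nonneg by (simp add: tau_def sum_nonneg)
qed

text \<open>The norm of a Kronecker product is the product of the norms; exchanging the second and
  third summation index separates the factors.\<close>

lemma hs_TD: "hs TD = tau"
proof -
  have "(hs TD)\<^sup>2 = (\<Sum>a=1..p. \<Sum>b=1..p. \<Sum>c=1..p. \<Sum>d=1..p. (sg (a, c))\<^sup>2 * (sg (b, d))\<^sup>2)"
    unfolding hs_sq hsip_def P_def sum.cartesian_product[symmetric] TD_def
    by (simp add: sum.cartesian_product' power2_eq_square mult_ac)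
  also have "\<dots> = (\<Sum>a=1..p. \<Sum>c=1..p. \<Sum>b=1..p. \<Sum>d=1..p. (sg (a, c))\<^sup>2 * (sg (b, d))\<^sup>2)"
    by (intro sum.cong refl sum.swap)
  also have "\<dots> = (\<Sum>a=1..p. \<Sum>c=1..p. (sg (a, c))\<^sup>2) * (\<Sum>b=1..p. \<Sum>d=1..p. (sg (b, d))\<^sup>2)"
    by (simp only: sum_distrib_right) (simp only: sum_distrib_left)
  also have "\<dots> = tau\<^sup>2" unfolding tau_def P_def by (simp add: sum.cartesian_product' power2_eq_square)
  finally show ?thesis using hs_nonneg by (simp add: tau_def sum_nonneg)
qed

lemma tau_nonneg: "0 \<le> tau" by (simp add: tau_def sum_nonneg)

lemma sigma_nonneg: "0 \<le> sigma" by (simp add: sigma_def hs_nonneg)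

lemma qf_TE: "qf (\<lambda>\<alpha> \<beta>. sg \<alpha> * sg \<beta>) A = (ip sg A)\<^sup>2"
  unfolding qf_def ip_def power2_eq_square sum_product by (intro sum.cong refl) (simp add: mult_ac)

lemma qf_add: "qf (\<lambda>\<alpha> \<beta>. T \<alpha> \<beta> + U \<alpha> \<beta>) A = qf T A + qf U A"
  unfolding qf_def by (simp add: distrib_right sum.distrib)

lemma qf_scale: "qf (\<lambda>\<alpha> \<beta>. c * T \<alpha> \<beta>) A = c * qf T A"
  unfolding qf_def by (simp add: sum_distrib_left mult_ac)

lemma L2v_W: "j \<in> {1..N} \<Longrightarrow> L2v (W j)"
  unfolding L2v_def using W_meas W_sq_int by blast

text \<open>Pairing with a matrix unit, by which bounds for all forms give square integrability of
  single entries.\<close>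

lemma ip_single: "\<alpha> \<in> P \<Longrightarrow> ip f (\<lambda>\<beta>. if \<beta> = \<alpha> then 1 else 0) = f \<alpha>"
proof -
  assume "\<alpha> \<in> P"
  moreover have "f \<beta> * (if \<beta> = \<alpha> then 1 else 0) = (if \<beta> = \<alpha> then f \<beta> else 0)" for \<beta> by simp
  ultimately show ?thesis unfolding ip_def by (simp only: sum.delta[OF finP] if_True)
qed

lemma L2v_Dl:
  assumes i: "i \<in> {1..N}"
  shows "L2v (Dl i)"
  unfolding L2v_def
proof (intro ballI conjI Dl_meas i)
  fix \<alpha> assume "\<alpha> \<in> P"
  then show "integrable M (\<lambda>\<omega>. (Dl i \<omega> \<alpha>)\<^sup>2)"
    using ip_Dl_sq(1)[OF i, of "\<lambda>\<beta>. if \<beta> = \<alpha> then 1 else 0"] by (simp add: ip_single)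
qed

lemma Sm_W: "j \<in> {1..N} \<Longrightarrow> \<alpha> \<in> P \<Longrightarrow> \<beta> \<in> P \<Longrightarrow> Sm (W j) (W j) \<alpha> \<beta> = SW \<alpha> \<beta>"
  unfolding Sm_def by (rule SW_eq)

lemma hs_Sm_W: "j \<in> {1..N} \<Longrightarrow> hs (Sm (W j) (W j)) = sigma"
  unfolding sigma_def by (rule hs_cong[OF Sm_W])

lemma hs_Sm_Dl:
  assumes i: "i \<in> {1..N}"
  shows "hs (Sm (Dl i) (Dl i)) \<le> eta"
proof -
  let ?B = "\<lambda>\<alpha> \<beta>. (60 / N) * TD \<alpha> \<beta> + ((60 / N\<^sup>2) * SW \<alpha> \<beta> + (60 / N\<^sup>2) * (sg \<alpha> * sg \<beta>))"
  have "hs (Sm (Dl i) (Dl i)) \<le> hs ?B"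
  proof (rule hs_mono[OF L2v_Dl[OF i]])
    fix A
    have "qf (Sm (Dl i) (Dl i)) A \<le> 60 * (qf TD A / N + (qf SW A + (ip sg A)\<^sup>2) / N\<^sup>2)"
      using ip_Dl_sq(2)[OF i, of A] unfolding L2v_ip_sq(2)[OF L2v_Dl[OF i]] .
    also have "\<dots> = qf ?B A" unfolding qf_add qf_scale qf_TE by (simp add: add_divide_distrib)
    finally show "qf (Sm (Dl i) (Dl i)) A \<le> qf ?B A" .
  qed
  also have "\<dots> \<le> hs (\<lambda>\<alpha> \<beta>. (60 / N) * TD \<alpha> \<beta>) + (hs (\<lambda>\<alpha> \<beta>. (60 / N\<^sup>2) * SW \<alpha> \<beta>) + hs (\<lambda>\<alpha> \<beta>. (60 / N\<^sup>2) * (sg \<alpha> * sg \<beta>)))"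
    by (rule order_trans[OF hs_triangle add_left_mono[OF hs_triangle]])
  also have "\<dots> = 60 * (tau / N) + (60 * (sigma / N\<^sup>2) + 60 * (tau / N\<^sup>2))"
    unfolding hs_scale hs_TD hs_TE sigma_def[symmetric] by simp
  also have "tau / N\<^sup>2 \<le> tau / N"
  proof -
    have "(tau / N) * (1 / N) \<le> (tau / N) * 1" using N2 tau_nonneg by (intro mult_left_mono) auto
    then show ?thesis by (simp add: power2_eq_square)
  qed
  finally have "hs (Sm (Dl i) (Dl i)) \<le> 60 * (tau / N) + (60 * (sigma / N\<^sup>2) + 60 * (tau / N))" by simp
  moreover have "0 \<le> sigma / N\<^sup>2" using sigma_nonneg by simp
  moreover have "h \<le> 120 * (a + b)" if "h \<le> 60 * a + (60 * b + 60 * a)" "0 \<le> b" for h a b :: real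
    using that by simp
  ultimately show ?thesis unfolding eta_def by blast
qed

definition Gd :: "'a \<Rightarrow> nat \<times> nat \<Rightarrow> real" where
  "Gd \<omega> \<alpha> = (\<Sum>i=1..N. Dl i \<omega> \<alpha>)"

lemma ip_Gd: "ip (Gd \<omega>) A = (\<Sum>i=1..N. ip (Dl i \<omega>) A)"
  unfolding ip_def Gd_def by (subst sum.swap) (simp add: sum_distrib_right)

lemma L2v_Gd: "L2v Gd"
  unfolding L2v_def
proof (intro ballI conjI)
  fix \<alpha> assume \<alpha>: "\<alpha> \<in> P"
  show "(\<lambda>\<omega>. Gd \<omega> \<alpha>) \<in> borel_measurable M" unfolding Gd_def by (intro borel_measurable_sum Dl_meas \<alpha>)
  show "integrable M (\<lambda>\<omega>. (Gd \<omega> \<alpha>)\<^sup>2)"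
    using ip_sum_Dl_sq(1)[of "\<lambda>\<beta>. if \<beta> = \<alpha> then 1 else 0"] unfolding Gd_def ip_single[OF \<alpha>] .
qed

text \<open>The triangle inequality alone would give N^2 \<open>eta\<close>; the cancellation in
  \<open>ip_sum_Dl\<close> saves a factor N.\<close>

lemma hs_Sm_Gd: "hs (Sm Gd Gd) \<le> N * eta"
proof -
  let ?B = "\<lambda>\<alpha> \<beta>. (2 / N) * SW \<alpha> \<beta> + 8 * TD \<alpha> \<beta>"
  have "hs (Sm Gd Gd) \<le> hs ?B"
  proof (rule hs_mono[OF L2v_Gd])
    fix A
    have "qf (Sm Gd Gd) A \<le> 2 * qf SW A / N + 8 * qf TD A"
      using ip_sum_Dl_sq(2)[of A] unfolding ip_Gd[symmetric] L2v_ip_sq(2)[OF L2v_Gd] .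
    also have "\<dots> = qf ?B A" unfolding qf_add qf_scale by simp
    finally show "qf (Sm Gd Gd) A \<le> qf ?B A" .
  qed
  also have "\<dots> \<le> hs (\<lambda>\<alpha> \<beta>. (2 / N) * SW \<alpha> \<beta>) + hs (\<lambda>\<alpha> \<beta>. 8 * TD \<alpha> \<beta>)" by (rule hs_triangle)
  also have "\<dots> = 2 * (sigma / N) + 8 * tau" unfolding hs_scale hs_TD sigma_def[symmetric] by simp
  also have "\<dots> \<le> 120 * (sigma / N) + 120 * tau" using tau_nonneg sigma_nonneg by (intro add_mono mult_right_mono) auto
  also have "\<dots> = N * eta" using N0 by (simp add: eta_def field_simps power2_eq_square)
  finally show ?thesis .
qed

section \<open>Exchangeability of the perturbations\<close>

lemma swap_perm:
  fixes i k i' k' :: nat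
  assumes "i \<in> I" "k \<in> I" "i' \<in> I" "k' \<in> I" "i \<noteq> k" "i' \<noteq> k'"
  obtains \<pi> where "\<pi> permutes I" "\<pi> i = i'" "\<pi> k = k'"
proof -
  let ?p = "Transposition.transpose i i'"
  let ?m = "?p k"
  have m: "?m \<in> I" "?m \<noteq> i'" using assms by (auto simp: Transposition.transpose_def)
  let ?q = "Transposition.transpose ?m k'"
  have "?q \<circ> ?p permutes I" using assms m by (intro permutes_compose permutes_swap_id)
  moreover have "(?q \<circ> ?p) i = i'" using m assms by (auto simp: Transposition.transpose_def)
  moreover have "(?q \<circ> ?p) k = k'" by simp
  ultimately show thesis by (rule that)
qed

text \<open>The law of the sample is a power of a single measure and therefore invariant under
  permutations of the coordinates.\<close>

lemma exchangeable:
  assumes \<pi>: "\<pi> permutes {1..N}" and F: "F \<in> borel_measurable (PiM {1..N} (\<lambda>_. S))"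
  shows "(\<integral>\<omega>. F (\<lambda>i\<in>{1..N}. Z (\<pi> i) \<omega>) \<partial>M) = (\<integral>\<omega>. F (\<lambda>i\<in>{1..N}. Z i \<omega>) \<partial>M :: real)"
proof -
  let ?I = "{1..N}" and ?D = "distr M S (Z 1)"
  have D: "prob_space ?D" by (rule prob_space_distr[OF Z_meas[OF one_mem]])
  have ne: "?I \<noteq> {}" using one_mem by blast
  let ?z = "\<lambda>\<omega>. \<lambda>i\<in>?I. Z i \<omega>"
  have zm: "?z \<in> measurable M (PiM ?I (\<lambda>_. S))" by (intro measurable_restrict Z_meas)
  have d1: "distr M (PiM ?I (\<lambda>_. S)) ?z = PiM ?I (\<lambda>_. ?D)"
  proof -
    have "distr M (PiM ?I (\<lambda>_. S)) ?z = PiM ?I (\<lambda>i. distr M S (Z i))"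
      using indep_vars_iff_distr_eq_PiM'[OF ne Z_meas] indep by simp
    also have "\<dots> = PiM ?I (\<lambda>_. ?D)" by (intro PiM_cong refl ident)
    finally show ?thesis .
  qed
  let ?t = "\<lambda>z. \<lambda>i\<in>?I. z (\<pi> i)"
  have \<pi>I: "\<pi> i \<in> ?I" if "i \<in> ?I" for i using permutes_in_image[OF \<pi>] that by blast
  have tm: "?t \<in> measurable (PiM ?I (\<lambda>_. S)) (PiM ?I (\<lambda>_. S))"
    by (intro measurable_restrict measurable_component_singleton \<pi>I)
  have setsD: "sets (PiM ?I (\<lambda>_. ?D)) = sets (PiM ?I (\<lambda>_. S))" by (intro sets_PiM_cong) simp_all
  have d2: "distr (PiM ?I (\<lambda>_. ?D)) (PiM ?I (\<lambda>_. ?D)) ?t = PiM ?I (\<lambda>_. ?D)"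
    by (rule distr_PiM_reindex[OF D]) (use \<pi> \<pi>I permutes_inj_on[OF \<pi>] in auto)
  have FD: "F \<in> borel_measurable (PiM ?I (\<lambda>_. ?D))" using F by (simp add: measurable_cong_sets[OF setsD refl])
  have tD: "?t \<in> measurable (PiM ?I (\<lambda>_. ?D)) (PiM ?I (\<lambda>_. ?D))"
    using tm by (simp add: measurable_cong_sets[OF setsD setsD])
  have "(\<integral>\<omega>. F (\<lambda>i\<in>?I. Z i \<omega>) \<partial>M) = (\<integral>z. F z \<partial>PiM ?I (\<lambda>_. ?D))"
    unfolding d1[symmetric] by (rule integral_distr[OF zm F, symmetric])
  also have "\<dots> = (\<integral>z. F z \<partial>distr (PiM ?I (\<lambda>_. ?D)) (PiM ?I (\<lambda>_. ?D)) ?t)" by (simp only: d2)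
  also have "\<dots> = (\<integral>z. F (?t z) \<partial>PiM ?I (\<lambda>_. ?D))" by (rule integral_distr[OF tD FD])
  also have "\<dots> = (\<integral>\<omega>. F (?t (?z \<omega>)) \<partial>M)"
    unfolding d1[symmetric] by (rule integral_distr[OF zm measurable_compose[OF tm F]])
  also have "\<dots> = (\<integral>\<omega>. F (\<lambda>i\<in>?I. Z (\<pi> i) \<omega>) \<partial>M)"
    by (intro Bochner_Integration.integral_cong refl arg_cong[where f = F] restrict_ext) (simp only: restrict_apply'[OF \<pi>I])
  finally show ?thesis by simp
qed

text \<open>\<open>Dl\<close> as a function of the sample alone: exchangeability permutes this
  argument, and independence of the halves needs each perturbation as a function of one
  half.\<close>

definition DlF :: "nat \<Rightarrow> nat \<times> nat \<Rightarrow> (nat \<Rightarrow> 'b) \<Rightarrow> real" where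
  "DlF i \<alpha> z = (let v = (\<lambda>a. (\<Sum>j=1..N. g a (z j)) / N) in
     - g (fst \<alpha>) (z i) * v (snd \<alpha>) - v (fst \<alpha>) * g (snd \<alpha>) (z i) + v (fst \<alpha>) * v (snd \<alpha>) + sg \<alpha> / N)"

lemma Dl_DlF: "i \<in> {1..N} \<Longrightarrow> Dl i \<omega> \<alpha> = DlF i \<alpha> (\<lambda>i\<in>{1..N}. Z i \<omega>)"
  unfolding Dl_def DlF_def u_def x_def Let_def by simp

lemma DlF_meas: "i \<in> {1..N} \<Longrightarrow> \<alpha> \<in> P \<Longrightarrow> DlF i \<alpha> \<in> borel_measurable (PiM {1..N} (\<lambda>_. S))"
  unfolding DlF_def[abs_def] Let_def
  by (intro borel_measurable_add borel_measurable_diff borel_measurable_times borel_measurable_divide borel_measurable_uminus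
      borel_measurable_sum borel_measurable_const g_comp_meas P_mem)

text \<open>A permutation of the observations leaves the sample mean unchanged and merely renames i
  and k.\<close>

lemma Sm_Dl_exchange:
  assumes i: "i \<in> {1..N}" "k \<in> {1..N}" "i \<noteq> k" "i' \<in> {1..N}" "k' \<in> {1..N}" "i' \<noteq> k'" and \<alpha>: "\<alpha> \<in> P" "\<beta> \<in> P"
  shows "Sm (Dl i) (Dl k) \<alpha> \<beta> = Sm (Dl i') (Dl k') \<alpha> \<beta>"
proof -
  obtain \<pi> where \<pi>: "\<pi> permutes {1..N}" "\<pi> i = i'" "\<pi> k = k'" by (rule swap_perm[OF i(1,2,4,5,3,6)])
  have bij: "(\<Sum>j=1..N. h (\<pi> j)) = (\<Sum>j=1..N. h j)" for h :: "nat \<Rightarrow> real"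
    using sum.permute[OF \<pi>(1), of h] by (simp add: comp_def)
  have D: "DlF j \<alpha> (\<lambda>i\<in>{1..N}. Z (\<pi> i) \<omega>) = Dl (\<pi> j) \<omega> \<alpha>" if "j \<in> {1..N}" for j \<alpha> \<omega>
    using that bij[of "\<lambda>i. g (fst \<alpha>) (Z i \<omega>)"] bij[of "\<lambda>i. g (snd \<alpha>) (Z i \<omega>)"]
    unfolding Dl_def DlF_def u_def x_def Let_def by simp
  let ?F = "\<lambda>z. DlF i \<alpha> z * DlF k \<beta> z"
  have "(\<integral>\<omega>. ?F (\<lambda>i\<in>{1..N}. Z (\<pi> i) \<omega>) \<partial>M) = (\<integral>\<omega>. ?F (\<lambda>i\<in>{1..N}. Z i \<omega>) \<partial>M)"
    by (rule exchangeable[OF \<pi>(1)]) (intro borel_measurable_times DlF_meas i \<alpha>)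
  then show ?thesis unfolding Sm_def D[OF i(1)] D[OF i(2)] \<pi> Dl_DlF[OF i(1), symmetric] Dl_DlF[OF i(2), symmetric] by simp
qed

lemma hs_sum_le:
  assumes "finite I"
  shows "hs (\<lambda>\<alpha> \<beta>. \<Sum>i\<in>I. T i \<alpha> \<beta>) \<le> (\<Sum>i\<in>I. hs (T i))"
  using assms
proof (induction I)
  case empty
  then show ?case by (simp add: hs_def L2_set_def)
next
  case (insert a F)
  then show ?case using hs_triangle[of "T a" "\<lambda>\<alpha> \<beta>. \<Sum>i\<in>F. T i \<alpha> \<beta>"] by simp
qed

text \<open>The off-diagonal second moments are all equal, so they are controlled by the second moment
  matrix of the total \<open>\<Sum>\<^sub>i Dl i\<close>, which is small because the terms linear in \<open>x i\<close> cancel.\<close>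

lemma hs_Sm_Dl_off:
  assumes i: "i \<in> {1..N}" "k \<in> {1..N}" "i \<noteq> k"
  shows "hs (Sm (Dl i) (Dl k)) \<le> 4 * eta / N"
proof -
  let ?Q = "Sm (Dl i) (Dl k)" and ?I = "{1..N}"
  let ?S = "\<lambda>\<alpha> \<beta>. \<Sum>j\<in>?I. Sm (Dl j) (Dl j) \<alpha> \<beta>"
  have key: "real N * (real N - 1) * ?Q \<alpha> \<beta> = Sm Gd Gd \<alpha> \<beta> + (- 1) * ?S \<alpha> \<beta>" if \<alpha>: "\<alpha> \<in> P" "\<beta> \<in> P" for \<alpha> \<beta>
  proof -
    have int: "integrable M (\<lambda>\<omega>. Dl j \<omega> \<alpha> * Dl l \<omega> \<beta>)" if "j \<in> ?I" "l \<in> ?I" for j l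
      by (intro L2v_int L2v_Dl that \<alpha>)
    have "Sm Gd Gd \<alpha> \<beta> = (\<integral>\<omega>. (\<Sum>j\<in>?I. \<Sum>l\<in>?I. Dl j \<omega> \<alpha> * Dl l \<omega> \<beta>) \<partial>M)"
      unfolding Sm_def Gd_def sum_product by (rule refl)
    also have "\<dots> = (\<Sum>j\<in>?I. \<Sum>l\<in>?I. Sm (Dl j) (Dl l) \<alpha> \<beta>)"
      unfolding Sm_def
      by (subst Bochner_Integration.integral_sum, intro Bochner_Integration.integrable_sum int, assumption+,
          intro sum.cong refl, subst Bochner_Integration.integral_sum, intro int, assumption+, rule refl)
    also have "\<dots> = (\<Sum>j\<in>?I. \<Sum>l\<in>?I. ?Q \<alpha> \<beta> + (if l = j then Sm (Dl j) (Dl j) \<alpha> \<beta> - ?Q \<alpha> \<beta> else 0))"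
    proof (intro sum.cong refl)
      fix j l assume jl: "j \<in> ?I" "l \<in> ?I"
      show "Sm (Dl j) (Dl l) \<alpha> \<beta> = ?Q \<alpha> \<beta> + (if l = j then Sm (Dl j) (Dl j) \<alpha> \<beta> - ?Q \<alpha> \<beta> else 0)"
        using Sm_Dl_exchange[OF jl _ i \<alpha>] by (cases "l = j") auto
    qed
    also have "\<dots> = N * N * ?Q \<alpha> \<beta> + (?S \<alpha> \<beta> - N * ?Q \<alpha> \<beta>)"
      by (simp add: sum.distrib sum_subtractf)
    finally show ?thesis by (simp add: algebra_simps)
  qed
  \<comment> \<open>This costs a factor 2, and the two contributions N \<open>eta\<close> give
    another one, whence the 4.\<close>
  have N1: "real N / 2 \<le> real N - 1" using N2 by simp
  have "real N * (real N - 1) * hs ?Q = hs (\<lambda>\<alpha> \<beta>. real N * (real N - 1) * ?Q \<alpha> \<beta>)"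
    unfolding hs_scale using N2 by simp
  also have "\<dots> = hs (\<lambda>\<alpha> \<beta>. Sm Gd Gd \<alpha> \<beta> + (- 1) * ?S \<alpha> \<beta>)" by (rule hs_cong[OF key])
  also have "\<dots> \<le> hs (Sm Gd Gd) + hs (\<lambda>\<alpha> \<beta>. (- 1) * ?S \<alpha> \<beta>)" by (rule hs_triangle)
  also have "hs (\<lambda>\<alpha> \<beta>. (- 1) * ?S \<alpha> \<beta>) = hs ?S" unfolding hs_scale by simp
  also have "hs ?S \<le> (\<Sum>j\<in>?I. hs (Sm (Dl j) (Dl j)))" by (rule hs_sum_le) simp
  also have "\<dots> \<le> (\<Sum>j\<in>?I. eta)" by (intro sum_mono hs_Sm_Dl)
  also have "hs (Sm Gd Gd) \<le> N * eta" by (rule hs_Sm_Gd)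
  finally have "real N * (real N - 1) * hs ?Q \<le> 2 * (N * eta)" by simp
  moreover have "real N * (real N / 2) * hs ?Q \<le> real N * (real N - 1) * hs ?Q"
    using N1 hs_nonneg by (intro mult_right_mono mult_left_mono) auto
  ultimately have "real N * (real N / 2) * hs ?Q \<le> 2 * (N * eta)" by linarith
  then show ?thesis using N0 by (simp add: field_simps)
qed

end

section \<open>The two halves of the sample\<close>

text \<open>Monotone convergence, with f cut to 0 rather than to k beyond the level: in this form a
  cut square is again the square of a bounded variable.\<close>

lemma integrable_of_truncations:
  fixes f :: "'a \<Rightarrow> real"
  assumes f[measurable]: "f \<in> borel_measurable M" and f0: "\<And>x. 0 \<le> f x"
    and i: "\<And>k::nat. integrable M (\<lambda>x. if f x \<le> k then f x else 0)"
    and b: "\<And>k::nat. (\<integral>x. (if f x \<le> k then f x else 0) \<partial>M) \<le> B"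
  shows "integrable M f"
proof -
  let ?t = "\<lambda>(k::nat) x. if f x \<le> k then f x else 0"
  have mono: "?t k x \<le> ?t l x" if "k \<le> l" for k l x using that f0[of x] by (auto intro: order_trans)
  have "incseq (\<lambda>k. \<integral>x. ?t k x \<partial>M)"
    unfolding incseq_def by (intro allI impI integral_mono i mono)
  then obtain L where L: "(\<lambda>k. \<integral>x. ?t k x \<partial>M) \<longlonglongrightarrow> L"
    using incseq_convergent[of "\<lambda>k. \<integral>x. ?t k x \<partial>M" B] b by blast
  show ?thesis
  proof (rule integrable_monotone_convergence[OF i _ _ L f])
    show "AE x in M. mono (\<lambda>n. ?t n x)" by (intro AE_I2 monoI mono)
    show "AE x in M. (\<lambda>n. ?t n x) \<longlonglongrightarrow> f x"
    proof (rule AE_I2)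
      fix x
      have "eventually (\<lambda>n. ?t n x = f x) sequentially"
        using eventually_ge_at_top[of "nat \<lceil>f x\<rceil>"] by eventually_elim (simp add: nat_le_iff ceiling_le_iff)
      then show "(\<lambda>n. ?t n x) \<longlonglongrightarrow> f x" by (rule tendsto_eventually)
    qed
  qed
qed

text \<open>Only second moments of the coordinates are assumed here; their fourth moments are
  derived from \<open>e2\<close>.\<close>

locale cov_sample = prob_space M for M :: "'a measure" +
  fixes p N :: nat and X :: "nat \<Rightarrow> 'a \<Rightarrow> nat \<Rightarrow> real" and \<mu> :: "nat \<Rightarrow> real" and Sg :: "nat \<Rightarrow> nat \<Rightarrow> real"
  fixes I :: "(nat \<times> nat) set" and c :: "nat \<Rightarrow> nat \<Rightarrow> 'a \<Rightarrow> real" and w :: "nat \<Rightarrow> nat \<times> nat \<Rightarrow> 'a \<Rightarrow> real"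
  defines "I \<equiv> {1..p} \<times> {1..p}" and "c \<equiv> \<lambda>i a \<omega>. X i \<omega> a - \<mu> a"
    and "w \<equiv> \<lambda>i \<alpha> \<omega>. c i (fst \<alpha>) \<omega> * c i (snd \<alpha>) \<omega> - Sg (fst \<alpha>) (snd \<alpha>)"
  assumes N2: "2 \<le> N"
    and indep: "indep_vars (\<lambda>_. Rvec p) X {1..2 * N}"
    and ident: "\<And>i. i \<in> {1..2 * N} \<Longrightarrow> distr M (Rvec p) (X i) = distr M (Rvec p) (X 1)"
    and second_moment: "\<And>i a. i \<in> {1..2 * N} \<Longrightarrow> a \<in> {1..p} \<Longrightarrow> integrable M (\<lambda>\<omega>. (X i \<omega> a)\<^sup>2)"
    and mean: "\<And>i a. i \<in> {1..2 * N} \<Longrightarrow> a \<in> {1..p} \<Longrightarrow> (\<integral>\<omega>. X i \<omega> a \<partial>M) = \<mu> a"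
    and covariance: "\<And>i a b. i \<in> {1..2 * N} \<Longrightarrow> a \<in> {1..p} \<Longrightarrow> b \<in> {1..p} \<Longrightarrow>
      (\<integral>\<omega>. (X i \<omega> a - \<mu> a) * (X i \<omega> b - \<mu> b) \<partial>M) = Sg a b"
    and e2: "integrable M (\<lambda>\<omega>. (\<Sum>\<alpha>\<in>I. w 1 \<alpha> \<omega> * w (1 + N) \<alpha> \<omega>)\<^sup>2)"
begin

lemma I_mem: "\<alpha> \<in> I \<Longrightarrow> fst \<alpha> \<in> {1..p}" "\<alpha> \<in> I \<Longrightarrow> snd \<alpha> \<in> {1..p}" by (auto simp: I_def)

lemma finI: "finite I" by (simp add: I_def)

lemma X_meas: "i \<in> {1..2 * N} \<Longrightarrow> X i \<in> measurable M (Rvec p)"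
  using indep unfolding indep_vars_def by (elim conjE bspec)

lemma coord_meas: "a \<in> {1..p} \<Longrightarrow> (\<lambda>z. z a - \<mu> a) \<in> borel_measurable (Rvec p)"
  using measurable_component_singleton[of a "{1..p}" "\<lambda>_. borel :: real measure"]
  by (intro borel_measurable_diff borel_measurable_const) auto

lemma c_meas: "i \<in> {1..2 * N} \<Longrightarrow> a \<in> {1..p} \<Longrightarrow> c i a \<in> borel_measurable M"
  unfolding c_def using measurable_compose[OF X_meas coord_meas] .

lemma Xa_meas: "i \<in> {1..2 * N} \<Longrightarrow> a \<in> {1..p} \<Longrightarrow> (\<lambda>\<omega>. X i \<omega> a) \<in> borel_measurable M"
  using borel_measurable_add[OF c_meas borel_measurable_const[of "\<mu> a"], of i a] by (simp add: c_def)

lemma c_sq: "i \<in> {1..2 * N} \<Longrightarrow> a \<in> {1..p} \<Longrightarrow> integrable M (\<lambda>\<omega>. (c i a \<omega>)\<^sup>2)"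
proof -
  assume i: "i \<in> {1..2 * N}" "a \<in> {1..p}"
  have "integrable M (\<lambda>\<omega>. X i \<omega> a * 1)"
    by (rule integrable_mult_of_sq) (use second_moment[OF i] Xa_meas[OF i] in simp_all)
  moreover have "(c i a \<omega>)\<^sup>2 = (X i \<omega> a)\<^sup>2 - (2 * \<mu> a) * X i \<omega> a + (\<mu> a)\<^sup>2" for \<omega>
    by (simp add: c_def power2_eq_square algebra_simps)
  ultimately show ?thesis using second_moment[OF i] by simp
qed

lemma w_meas: "i \<in> {1..2 * N} \<Longrightarrow> \<alpha> \<in> I \<Longrightarrow> w i \<alpha> \<in> borel_measurable M"
  unfolding w_def by (intro borel_measurable_diff borel_measurable_times borel_measurable_const c_meas I_mem)

lemma w_int: "i \<in> {1..2 * N} \<Longrightarrow> \<alpha> \<in> I \<Longrightarrow> integrable M (w i \<alpha>)"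
  unfolding w_def by (intro Bochner_Integration.integrable_diff integrable_const integrable_mult_of_sq c_meas c_sq I_mem)

lemma mem1: "1 \<in> {1..2 * N}" "1 + N \<in> {1..2 * N}" using N2 by auto

text \<open>Only the square integrability of \<open>e\<close> is assumed.  Testing \<open>e\<close> against \<open>h(X\<^sub>1) h(X\<^sub>1\<^sub>+\<^sub>N)\<close>, with \<open>h\<close> a
  truncation of one entry of the centred matrix, makes every entry square integrable.\<close>

lemma w_sq:
  assumes \<alpha>: "\<alpha> \<in> I"
  shows "integrable M (\<lambda>\<omega>. (w 1 \<alpha> \<omega>)\<^sup>2)"
proof (rule integrable_of_truncations[where B = "1 + (\<integral>\<omega>. (\<Sum>\<alpha>\<in>I. w 1 \<alpha> \<omega> * w (1 + N) \<alpha> \<omega>)\<^sup>2 \<partial>M)"])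
  let ?e = "\<lambda>\<omega>. \<Sum>\<alpha>\<in>I. w 1 \<alpha> \<omega> * w (1 + N) \<alpha> \<omega>"
  show "(\<lambda>\<omega>. (w 1 \<alpha> \<omega>)\<^sup>2) \<in> borel_measurable M" by (intro borel_measurable_power w_meas mem1 \<alpha>)
  fix k :: nat
  define wz where "wz \<beta> z = (z (fst \<beta>) - \<mu> (fst \<beta>)) * (z (snd \<beta>) - \<mu> (snd \<beta>)) - Sg (fst \<beta>) (snd \<beta>)" for \<beta> and z :: "nat \<Rightarrow> real"
  have wz_meas: "wz \<beta> \<in> borel_measurable (Rvec p)" if "\<beta> \<in> I" for \<beta>
    unfolding wz_def using that by (intro borel_measurable_diff[of _ "Rvec p" "\<lambda>_. Sg _ _"] borel_measurable_times borel_measurable_const coord_meas I_mem)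
  have wz: "wz \<beta> (X i \<omega>) = w i \<beta> \<omega>" for \<beta> i \<omega> by (simp add: wz_def w_def c_def)
  \<comment> \<open>Cutting to 0 makes h times the entry equal to h^2, which yields m \<alpha> = t
    below.\<close>
  define hz where "hz z = (if (wz \<alpha> z)\<^sup>2 \<le> k then wz \<alpha> z else 0)" for z
  have hz_meas: "hz \<in> borel_measurable (Rvec p)"
    unfolding hz_def using wz_meas[OF \<alpha>] by measurable
  define h where "h i \<omega> = hz (X i \<omega>)" for i \<omega>
  have h_meas: "h i \<in> borel_measurable M" if "i \<in> {1..2 * N}" for i
    unfolding h_def using measurable_compose[OF X_meas[OF that] hz_meas] .
  have hb: "(h i \<omega>)\<^sup>2 \<le> k" for i \<omega> by (simp add: h_def hz_def)
  have hb': "\<bar>h i \<omega>\<bar> \<le> sqrt k" for i \<omega> using real_sqrt_le_mono[OF hb[of i \<omega>]] by simp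
  have t_eq: "(if (w 1 \<alpha> \<omega>)\<^sup>2 \<le> k then (w 1 \<alpha> \<omega>)\<^sup>2 else 0) = (h 1 \<omega>)\<^sup>2" for \<omega>
    by (simp add: h_def hz_def wz)
  have h2: "integrable M (\<lambda>\<omega>. (h i \<omega>)\<^sup>2)" if "i \<in> {1..2 * N}" for i
    by (rule integrable_const_bound[of _ "real k"]) (use hb h_meas[OF that] in auto)
  show "integrable M (\<lambda>\<omega>. if (w 1 \<alpha> \<omega>)\<^sup>2 \<le> k then (w 1 \<alpha> \<omega>)\<^sup>2 else 0)" unfolding t_eq by (rule h2[OF mem1(1)])
  define t where "t = (\<integral>\<omega>. (h 1 \<omega>)\<^sup>2 \<partial>M)"
  have t0: "0 \<le> t" by (simp add: t_def)
  have same: "(\<integral>\<omega>. f (X (1 + N) \<omega>) \<partial>M) = (\<integral>\<omega>. f (X 1 \<omega>) \<partial>M)" if "f \<in> borel_measurable (Rvec p)" for f :: "(nat \<Rightarrow> real) \<Rightarrow> real"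
    using integral_distr[OF X_meas[OF mem1(2)] that] integral_distr[OF X_meas[OF mem1(1)] that] ident[OF mem1(2)] by simp
  have ind: "indep_var borel (\<lambda>\<omega>. f (X 1 \<omega>)) borel (\<lambda>\<omega>. f' (X (1 + N) \<omega>))"
    if f: "f \<in> borel_measurable (Rvec p)" "f' \<in> borel_measurable (Rvec p)" for f f' :: "(nat \<Rightarrow> real) \<Rightarrow> real"
  proof -
    have iv: "indep_var (PiM {1} (\<lambda>_. Rvec p)) (\<lambda>\<omega>. restrict (\<lambda>i. X i \<omega>) {1}) (PiM {1 + N} (\<lambda>_. Rvec p)) (\<lambda>\<omega>. restrict (\<lambda>i. X i \<omega>) {1 + N})"
      by (rule indep_var_restrict[OF indep]) (use mem1 N2 in auto)
    have m: "(\<lambda>z. f (z j)) \<in> borel_measurable (PiM {j} (\<lambda>_. Rvec p))" if "f \<in> borel_measurable (Rvec p)" for j :: nat and f :: "(nat \<Rightarrow> real) \<Rightarrow> real"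
      by (rule measurable_compose[OF measurable_component_singleton[of j "{j}" "\<lambda>_. Rvec p"] that]) simp
    show ?thesis using indep_var_compose[OF iv m[OF f(1)] m[OF f(2)]] by (simp add: comp_def)
  qed
  have hw: "integrable M (\<lambda>\<omega>. h i \<omega> * w i \<beta> \<omega>)" if "i \<in> {1..2 * N}" "\<beta> \<in> I" for i \<beta>
  proof (rule Bochner_Integration.integrable_bound)
    show "integrable M (\<lambda>\<omega>. sqrt k * \<bar>w i \<beta> \<omega>\<bar>)" by (intro integrable_mult_right integrable_abs w_int that)
    show "(\<lambda>\<omega>. h i \<omega> * w i \<beta> \<omega>) \<in> borel_measurable M" by (intro borel_measurable_times h_meas w_meas that)
    show "AE \<omega> in M. norm (h i \<omega> * w i \<beta> \<omega>) \<le> norm (sqrt k * \<bar>w i \<beta> \<omega>\<bar>)"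
      using hb' by (intro AE_I2) (simp add: abs_mult mult_right_mono)
  qed
  define m where "m \<beta> = (\<integral>\<omega>. h 1 \<omega> * w 1 \<beta> \<omega> \<partial>M)" for \<beta>
  have prod_m: "integrable M (\<lambda>\<omega>. (h 1 \<omega> * w 1 \<beta> \<omega>) * (h (1 + N) \<omega> * w (1 + N) \<beta> \<omega>))"
    "(\<integral>\<omega>. (h 1 \<omega> * w 1 \<beta> \<omega>) * (h (1 + N) \<omega> * w (1 + N) \<beta> \<omega>) \<partial>M) = m \<beta> * m \<beta>" if \<beta>: "\<beta> \<in> I" for \<beta>
  proof -
    let ?f = "\<lambda>z. hz z * wz \<beta> z"
    have fm: "?f \<in> borel_measurable (Rvec p)" by (intro borel_measurable_times hz_meas wz_meas \<beta>)
    have iv: "indep_var borel (\<lambda>\<omega>. h 1 \<omega> * w 1 \<beta> \<omega>) borel (\<lambda>\<omega>. h (1 + N) \<omega> * w (1 + N) \<beta> \<omega>)"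
      using ind[OF fm fm] by (simp add: wz h_def)
    show "integrable M (\<lambda>\<omega>. (h 1 \<omega> * w 1 \<beta> \<omega>) * (h (1 + N) \<omega> * w (1 + N) \<beta> \<omega>))"
      by (rule indep_var_integrable[OF iv hw[OF mem1(1) \<beta>] hw[OF mem1(2) \<beta>]])
    have "m \<beta> = (\<integral>\<omega>. h (1 + N) \<omega> * w (1 + N) \<beta> \<omega> \<partial>M)"
      unfolding m_def using same[OF fm] by (simp add: wz h_def)
    then show "(\<integral>\<omega>. (h 1 \<omega> * w 1 \<beta> \<omega>) * (h (1 + N) \<omega> * w (1 + N) \<beta> \<omega>) \<partial>M) = m \<beta> * m \<beta>"
      using indep_var_lebesgue_integral[OF iv hw[OF mem1(1) \<beta>] hw[OF mem1(2) \<beta>]] by (simp add: m_def)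
  qed
  \<comment> \<open>Independence and equality in law of the two observations turn the mean of each
    summand into a square, so the total is at least its term at \<open>\<alpha>\<close>, which is
    t^2.\<close>
  have expand: "(h 1 \<omega> * h (1 + N) \<omega>) * ?e \<omega> = (\<Sum>\<beta>\<in>I. (h 1 \<omega> * w 1 \<beta> \<omega>) * (h (1 + N) \<omega> * w (1 + N) \<beta> \<omega>))" for \<omega>
    by (simp add: sum_distrib_left mult_ac)
  have i_e: "integrable M (\<lambda>\<omega>. (h 1 \<omega> * h (1 + N) \<omega>) * ?e \<omega>)"
    unfolding expand by (intro Bochner_Integration.integrable_sum prod_m)
  have E_e: "(\<integral>\<omega>. (h 1 \<omega> * h (1 + N) \<omega>) * ?e \<omega> \<partial>M) = (\<Sum>\<beta>\<in>I. m \<beta> * m \<beta>)"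
    unfolding expand by (subst Bochner_Integration.integral_sum) (auto intro!: sum.cong prod_m)
  have hh: "integrable M (\<lambda>\<omega>. (h 1 \<omega>)\<^sup>2 * (h (1 + N) \<omega>)\<^sup>2)" "(\<integral>\<omega>. (h 1 \<omega>)\<^sup>2 * (h (1 + N) \<omega>)\<^sup>2 \<partial>M) = t * t"
  proof -
    let ?f = "\<lambda>z. (hz z)\<^sup>2"
    have fm: "?f \<in> borel_measurable (Rvec p)" by (intro borel_measurable_power hz_meas)
    have iv: "indep_var borel (\<lambda>\<omega>. (h 1 \<omega>)\<^sup>2) borel (\<lambda>\<omega>. (h (1 + N) \<omega>)\<^sup>2)"
      using ind[OF fm fm] by (simp add: h_def)
    show "integrable M (\<lambda>\<omega>. (h 1 \<omega>)\<^sup>2 * (h (1 + N) \<omega>)\<^sup>2)" by (rule indep_var_integrable[OF iv h2[OF mem1(1)] h2[OF mem1(2)]])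
    show "(\<integral>\<omega>. (h 1 \<omega>)\<^sup>2 * (h (1 + N) \<omega>)\<^sup>2 \<partial>M) = t * t"
      using indep_var_lebesgue_integral[OF iv h2[OF mem1(1)] h2[OF mem1(2)]] same[OF fm] by (simp add: t_def h_def)
  qed
  have m\<alpha>: "m \<alpha> = t"
  proof -
    have "h 1 \<omega> * w 1 \<alpha> \<omega> = (h 1 \<omega>)\<^sup>2" for \<omega> by (simp add: h_def hz_def wz power2_eq_square)
    then show ?thesis by (simp add: m_def t_def)
  qed
  have "t * t \<le> (\<Sum>\<beta>\<in>I. m \<beta> * m \<beta>)"
    using member_le_sum[OF \<alpha>, of "\<lambda>\<beta>. m \<beta> * m \<beta>"] finI by (simp add: m\<alpha>)
  also have "\<dots> = (\<integral>\<omega>. (h 1 \<omega> * h (1 + N) \<omega>) * ?e \<omega> \<partial>M)" by (rule E_e[symmetric])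
  \<comment> \<open>The weight 1/2 lets t^2 be absorbed on the left.\<close>
  also have "\<dots> \<le> (\<integral>\<omega>. (1/2) * ((h 1 \<omega>)\<^sup>2 * (h (1 + N) \<omega>)\<^sup>2) + (1/2) * (?e \<omega>)\<^sup>2 \<partial>M)"
  proof (rule integral_mono[OF i_e])
    show "integrable M (\<lambda>\<omega>. (1/2) * ((h 1 \<omega>)\<^sup>2 * (h (1 + N) \<omega>)\<^sup>2) + (1/2) * (?e \<omega>)\<^sup>2)"
      by (intro Bochner_Integration.integrable_add integrable_mult_right hh e2)
    show "(h 1 \<omega> * h (1 + N) \<omega>) * ?e \<omega> \<le> (1/2) * ((h 1 \<omega>)\<^sup>2 * (h (1 + N) \<omega>)\<^sup>2) + (1/2) * (?e \<omega>)\<^sup>2" for \<omega>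
      using sum_squares_bound[of "h 1 \<omega> * h (1 + N) \<omega>" "?e \<omega>"] by (simp add: power_mult_distrib)
  qed
  also have "\<dots> = (1/2) * (t * t) + (1/2) * (\<integral>\<omega>. (?e \<omega>)\<^sup>2 \<partial>M)"
    using hh e2 by simp
  finally have tt: "t * t \<le> (\<integral>\<omega>. (?e \<omega>)\<^sup>2 \<partial>M)" by simp
  \<comment> \<open>What has been bounded is t^2; this converts it into a bound for t, still uniform
    in the truncation level k.\<close>
  have "t \<le> 1 + t * t"
  proof (cases "t \<le> 1")
    case False
    then have "t * 1 \<le> t * t" using t0 by (intro mult_left_mono) auto
    then show ?thesis by simp
  qed (use t0 in \<open>simp add: add_increasing2\<close>)
  then show "(\<integral>\<omega>. (if (w 1 \<alpha> \<omega>)\<^sup>2 \<le> k then (w 1 \<alpha> \<omega>)\<^sup>2 else 0) \<partial>M) \<le> 1 + (\<integral>\<omega>. (?e \<omega>)\<^sup>2 \<partial>M)"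
    unfolding t_eq t_def[symmetric] using tt by linarith
qed simp

text \<open>The diagonal entry (a, a) of the centred matrix is the square of a coordinate minus a
  constant, so its square integrability is a fourth moment.\<close>

lemma c4:
  assumes i: "i \<in> {1..2 * N}" and a: "a \<in> {1..p}"
  shows "integrable M (\<lambda>\<omega>. (c i a \<omega>) ^ 4)"
proof -
  have aa: "(a, a) \<in> I" using a by (simp add: I_def)
  have w1: "integrable M (w 1 (a, a))" by (rule w_int[OF mem1(1) aa])
  have "(c 1 a \<omega>) ^ 4 = (w 1 (a, a) \<omega>)\<^sup>2 + (2 * Sg a a) * w 1 (a, a) \<omega> + (Sg a a)\<^sup>2" for \<omega>
    by (simp add: w_def power2_eq_square power4_eq_xxxx algebra_simps)
  then have c1: "integrable M (\<lambda>\<omega>. (c 1 a \<omega>) ^ 4)" using w_sq[OF aa] w1 by simp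
  let ?f = "\<lambda>z. (z a - \<mu> a) ^ 4"
  have fm: "?f \<in> borel_measurable (Rvec p)" by (intro borel_measurable_power coord_meas a)
  show ?thesis
    using c1 integrable_distr_eq[OF X_meas[OF i] fm] integrable_distr_eq[OF X_meas[OF mem1(1)] fm] ident[OF i]
    by (simp add: c_def)
qed

abbreviation "gz \<equiv> \<lambda>a z. z a - \<mu> a :: real"
abbreviation "sgp \<equiv> \<lambda>\<alpha>. Sg (fst \<alpha>) (snd \<alpha>)"

lemma c_mean: "i \<in> {1..2 * N} \<Longrightarrow> a \<in> {1..p} \<Longrightarrow> (\<integral>\<omega>. c i a \<omega> \<partial>M) = 0"
proof -
  assume i: "i \<in> {1..2 * N}" "a \<in> {1..p}"
  have "integrable M (\<lambda>\<omega>. X i \<omega> a * 1)"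
    by (rule integrable_mult_of_sq) (use second_moment[OF i] Xa_meas[OF i] in simp_all)
  then show ?thesis using mean[OF i] by (simp add: c_def prob_space)
qed

sublocale H1: iid_vecs M p N "Rvec p" X gz sgp I "\<lambda>i a \<omega>. gz a (X i \<omega>)"
proof unfold_locales
  show "2 \<le> N" by (rule N2)
  show "indep_vars (\<lambda>_. Rvec p) X {1..N}" by (rule indep_vars_subset[OF indep]) auto
  show "gz a \<in> borel_measurable (Rvec p)" if "a \<in> {1..p}" for a by (rule coord_meas[OF that])
  fix i a b assume i: "i \<in> {1..N}"
  then have i': "i \<in> {1..2 * N}" by auto
  show "distr M (Rvec p) (X i) = distr M (Rvec p) (X 1)" by (rule ident[OF i'])
  assume a: "a \<in> {1..p}"
  show "integrable M (\<lambda>\<omega>. (X i \<omega> a - \<mu> a) ^ 4)" using c4[OF i' a] by (simp add: c_def)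
  show "(\<integral>\<omega>. X i \<omega> a - \<mu> a \<partial>M) = 0" using c_mean[OF i' a] by (simp add: c_def)
  assume b: "b \<in> {1..p}"
  show "(\<integral>\<omega>. (X i \<omega> a - \<mu> a) * (X i \<omega> b - \<mu> b) \<partial>M) = sgp (a, b)" using covariance[OF i' a b] by simp
qed

sublocale H2: iid_vecs M p N "Rvec p" "\<lambda>i. X (i + N)" gz sgp I "\<lambda>i a \<omega>. gz a (X (i + N) \<omega>)"
proof unfold_locales
  show "2 \<le> N" by (rule N2)
  show "indep_vars (\<lambda>_. Rvec p) (\<lambda>i. X (i + N)) {1..N}"
  proof -
    have d: "disjoint_family_on (\<lambda>i. {i + N}) {1..N}" by (auto simp: disjoint_family_on_def)
    have "indep_vars (\<lambda>i. PiM {i + N} (\<lambda>_. Rvec p)) (\<lambda>i \<omega>. restrict (\<lambda>j. X j \<omega>) {i + N}) {1..N}"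
      by (rule indep_vars_restrict[OF indep _ d]) auto
    then have "indep_vars (\<lambda>_. Rvec p) (\<lambda>i \<omega>. (\<lambda>z. z (i + N)) (restrict (\<lambda>j. X j \<omega>) {i + N})) {1..N}"
    proof (rule indep_vars_compose2)
      fix i
      show "(\<lambda>z. z (i + N)) \<in> measurable (PiM {i + N} (\<lambda>_. Rvec p)) (Rvec p)"
        using measurable_component_singleton[of "i + N" "{i + N}" "\<lambda>_. Rvec p"] by simp
    qed
    then show ?thesis by simp
  qed
  show "gz a \<in> borel_measurable (Rvec p)" if "a \<in> {1..p}" for a by (rule coord_meas[OF that])
  fix i a b assume i: "i \<in> {1..N}"
  then have i': "i + N \<in> {1..2 * N}" by auto
  show "distr M (Rvec p) (X (i + N)) = distr M (Rvec p) (X (1 + N))" using ident[OF i'] ident[OF mem1(2)] by simp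
  assume a: "a \<in> {1..p}"
  show "integrable M (\<lambda>\<omega>. (X (i + N) \<omega> a - \<mu> a) ^ 4)" using c4[OF i' a] by (simp add: c_def)
  show "(\<integral>\<omega>. X (i + N) \<omega> a - \<mu> a \<partial>M) = 0" using c_mean[OF i' a] by (simp add: c_def)
  assume b: "b \<in> {1..p}"
  show "(\<integral>\<omega>. (X (i + N) \<omega> a - \<mu> a) * (X (i + N) \<omega> b - \<mu> b) \<partial>M) = sgp (a, b)" using covariance[OF i' a b] by simp
qed

lemma SW_12: "\<alpha> \<in> I \<Longrightarrow> \<beta> \<in> I \<Longrightarrow> H2.SW \<alpha> \<beta> = H1.SW \<alpha> \<beta>"
proof -
  assume \<alpha>: "\<alpha> \<in> I" "\<beta> \<in> I"
  define h where "h z = (gz (fst \<alpha>) z * gz (snd \<alpha>) z - sgp \<alpha>) * (gz (fst \<beta>) z * gz (snd \<beta>) z - sgp \<beta>)" for z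
  have h: "h \<in> borel_measurable (Rvec p)"
    unfolding h_def using \<alpha>
    by (intro borel_measurable_times borel_measurable_diff[of _ "Rvec p" "\<lambda>_. sgp _"] borel_measurable_const coord_meas I_mem)
  have "(\<integral>\<omega>. h (X (1 + N) \<omega>) \<partial>M) = (\<integral>\<omega>. h (X 1 \<omega>) \<partial>M)"
    using integral_distr[OF X_meas[OF mem1(2)] h] integral_distr[OF X_meas[OF mem1(1)] h] ident[OF mem1(2)] by simp
  then show ?thesis by (simp add: H1.SW_def H2.SW_def H1.W_def H2.W_def h_def)
qed

lemma sigma_12: "H2.sigma = H1.sigma"
  unfolding H1.sigma_def H2.sigma_def by (rule H1.hs_cong[OF SW_12])

lemma eta_12: "H2.eta = H1.eta"
  unfolding H1.eta_def H2.eta_def sigma_12 by (rule refl)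

lemma qfSW_12: "H2.qf H2.SW A = H1.qf H1.SW A"
  unfolding H1.qf_def by (intro sum.cong refl) (simp add: SW_12)

end

context iid_vecs
begin

lemma Sm_W_off:
  assumes jk: "j \<in> {1..N}" "k \<in> {1..N}" "j \<noteq> k" and \<alpha>: "\<alpha> \<in> P" "\<beta> \<in> P"
  shows "Sm (W j) (W k) \<alpha> \<beta> = 0"
proof -
  define h where "h \<gamma> z = g (fst \<gamma>) z * g (snd \<gamma>) z - sg \<gamma>" for \<gamma> z
  have h: "h \<gamma> \<in> borel_measurable S" if "\<gamma> \<in> P" for \<gamma>
    unfolding h_def using that by (intro borel_measurable_times borel_measurable_diff borel_measurable_const g P_mem)
  have hm: "(\<lambda>z. h \<gamma> (z l)) \<in> borel_measurable (PiM {l} (\<lambda>_. S))" if "\<gamma> \<in> P" for l \<gamma>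
    by (rule measurable_compose[OF measurable_component_singleton[of l "{l}" "\<lambda>_. S"] h[OF that]]) simp
  have hW: "h \<gamma> (Z l \<omega>) = W l \<omega> \<gamma>" for l \<omega> \<gamma> by (simp add: h_def W_def x_def)
  have "(\<integral>\<omega>. (\<lambda>z. h \<alpha> (z j)) (restrict (\<lambda>i. Z i \<omega>) {j}) * (\<lambda>z. h \<beta> (z k)) (restrict (\<lambda>i. Z i \<omega>) {k}) \<partial>M) =
    (\<integral>\<omega>. (\<lambda>z. h \<alpha> (z j)) (restrict (\<lambda>i. Z i \<omega>) {j}) \<partial>M) * (\<integral>\<omega>. (\<lambda>z. h \<beta> (z k)) (restrict (\<lambda>i. Z i \<omega>) {k}) \<partial>M)"
    by (rule expectation_indep[OF _ _ _ hm[OF \<alpha>(1)] hm[OF \<alpha>(2)]]) (use jk W_int \<alpha> in \<open>auto simp: hW\<close>)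
  then show ?thesis using W_mean[OF jk(1) \<alpha>(1)] by (simp add: hW Sm_def)
qed

lemma hsip_zero: "(\<And>\<alpha> \<beta>. \<alpha> \<in> P \<Longrightarrow> \<beta> \<in> P \<Longrightarrow> T \<alpha> \<beta> = 0) \<Longrightarrow> hsip T U = 0" "(\<And>\<alpha> \<beta>. \<alpha> \<in> P \<Longrightarrow> \<beta> \<in> P \<Longrightarrow> U \<alpha> \<beta> = 0) \<Longrightarrow> hsip T U = 0"
  unfolding hsip_def by simp_all

lemma hsip_bound: "hs T \<le> a \<Longrightarrow> hs U \<le> b \<Longrightarrow> hsip T U \<le> a * b"
  using hsip_le[of T U] mult_mono[of "hs T" a "hs U" b] hs_nonneg[of T] hs_nonneg[of U] by linarith

text \<open>At the all-ones matrix the Kronecker square factorises, which is how the sum of all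
  entries of Sigma comes to govern the corrections of v.\<close>

lemma qf_TD_ones: "qf TD (\<lambda>_. 1) = (ip sg (\<lambda>_. 1))\<^sup>2"
proof -
  have "qf TD (\<lambda>_. 1) = (\<Sum>a=1..p. \<Sum>b=1..p. \<Sum>c=1..p. \<Sum>d=1..p. sg (a, c) * sg (b, d))"
    unfolding qf_def P_def TD_def by (simp add: sum.cartesian_product')
  also have "\<dots> = (\<Sum>a=1..p. \<Sum>c=1..p. \<Sum>b=1..p. \<Sum>d=1..p. sg (a, c) * sg (b, d))"
    by (intro sum.cong refl sum.swap)
  also have "\<dots> = (\<Sum>a=1..p. \<Sum>c=1..p. sg (a, c)) * (\<Sum>b=1..p. \<Sum>d=1..p. sg (b, d))"
    by (simp only: sum_distrib_right) (simp only: sum_distrib_left)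
  also have "\<dots> = (ip sg (\<lambda>_. 1))\<^sup>2" unfolding ip_def P_def by (simp add: sum.cartesian_product' power2_eq_square)
  finally show ?thesis .
qed

end

section \<open>Moments of e and v and of their corrections\<close>

context cov_sample
begin

definition z1 :: "'a \<Rightarrow> nat \<Rightarrow> nat \<Rightarrow> real" where "z1 \<omega> = (\<lambda>i\<in>{1..N}. X i \<omega>)"

definition z2 :: "'a \<Rightarrow> nat \<Rightarrow> nat \<Rightarrow> real" where "z2 \<omega> = (\<lambda>i\<in>{1..N}. X (i + N) \<omega>)"

abbreviation Half :: "(nat \<Rightarrow> nat \<Rightarrow> real) measure" where "Half \<equiv> PiM {1..N} (\<lambda>_. Rvec p)"

lemma indep_halves: "indep_var Half z1 Half z2"
proof -
  let ?A = "{1..N}" and ?B = "{N + 1..2 * N}"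
  have iv: "indep_var (PiM ?A (\<lambda>_. Rvec p)) (\<lambda>\<omega>. restrict (\<lambda>i. X i \<omega>) ?A) (PiM ?B (\<lambda>_. Rvec p)) (\<lambda>\<omega>. restrict (\<lambda>i. X i \<omega>) ?B)"
    by (rule indep_var_restrict[OF indep]) auto
  have m: "(\<lambda>z. \<lambda>i\<in>?A. z (i + N)) \<in> measurable (PiM ?B (\<lambda>_. Rvec p)) Half"
    by (intro measurable_restrict measurable_component_singleton) auto
  have e: "(\<lambda>z. \<lambda>i\<in>?A. z (i + N)) \<circ> (\<lambda>\<omega>. restrict (\<lambda>i. X i \<omega>) ?B) = z2"
    unfolding z2_def comp_def by (intro ext restrict_ext arg_cong2[where f = restrict] refl) (auto simp: restrict_def)
  show ?thesis
    using indep_var_compose[OF iv measurable_ident m] unfolding e by (simp add: z1_def[abs_def] comp_def)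
qed

lemma indep_fun_halves:
  assumes "F \<in> borel_measurable Half" "G \<in> borel_measurable Half"
  shows "indep_var borel (\<lambda>\<omega>. F (z1 \<omega>) :: real) borel (\<lambda>\<omega>. G (z2 \<omega>) :: real)"
  using indep_var_compose[OF indep_halves assms] by (simp add: comp_def)

text \<open>Dependence on the first half only, expressed by a factorisation so that
  \<open>indep_fun_halves\<close> applies entry by entry.\<close>

definition half1 :: "('a \<Rightarrow> nat \<times> nat \<Rightarrow> real) \<Rightarrow> bool" where
  "half1 f \<longleftrightarrow> (\<forall>\<alpha>\<in>I. \<exists>F\<in>borel_measurable Half. \<forall>\<omega>. f \<omega> \<alpha> = F (z1 \<omega>))"

definition half2 :: "('a \<Rightarrow> nat \<times> nat \<Rightarrow> real) \<Rightarrow> bool" where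
  "half2 f \<longleftrightarrow> (\<forall>\<alpha>\<in>I. \<exists>F\<in>borel_measurable Half. \<forall>\<omega>. f \<omega> \<alpha> = F (z2 \<omega>))"

definition wF :: "nat \<Rightarrow> nat \<times> nat \<Rightarrow> (nat \<Rightarrow> nat \<Rightarrow> real) \<Rightarrow> real" where
  "wF i \<alpha> z = gz (fst \<alpha>) (z i) * gz (snd \<alpha>) (z i) - sgp \<alpha>"

lemma wF_meas: "i \<in> {1..N} \<Longrightarrow> \<alpha> \<in> I \<Longrightarrow> wF i \<alpha> \<in> borel_measurable Half"
  unfolding wF_def[abs_def]
  by (intro borel_measurable_diff[of _ Half "\<lambda>_. sgp _"] borel_measurable_times borel_measurable_const
      measurable_compose[OF measurable_component_singleton[of i "{1..N}" "\<lambda>_. Rvec p"] coord_meas] I_mem)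

lemma half1_W: "i \<in> {1..N} \<Longrightarrow> half1 (H1.W i)"
  unfolding half1_def
  by (intro ballI bexI[OF _ wF_meas]) (auto simp: H1.W_def wF_def z1_def)

lemma half2_W: "i \<in> {1..N} \<Longrightarrow> half2 (H2.W i)"
  unfolding half2_def
  by (intro ballI bexI[OF _ wF_meas]) (auto simp: H2.W_def wF_def z2_def)

lemma half1_Dl: "i \<in> {1..N} \<Longrightarrow> half1 (H1.Dl i)"
  unfolding half1_def z1_def using H1.Dl_DlF H1.DlF_meas by blast

lemma half2_Dl: "i \<in> {1..N} \<Longrightarrow> half2 (H2.Dl i)"
  unfolding half2_def z2_def using H2.Dl_DlF H2.DlF_meas by blast

text \<open>Each term of the expanded product splits into a function of the first half and one of
  the second, so expectations multiply. Products of independent integrable variables are integrable,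
  hence second moments of the four families suffice.\<close>

lemma cross_moment:
  assumes f: "half1 f" "half1 h" "half2 f'" "half2 h'" and L: "H1.L2v f" "H1.L2v h" "H1.L2v f'" "H1.L2v h'"
  shows "integrable M (\<lambda>\<omega>. H1.ip (f \<omega>) (f' \<omega>) * H1.ip (h \<omega>) (h' \<omega>))"
    and "(\<integral>\<omega>. H1.ip (f \<omega>) (f' \<omega>) * H1.ip (h \<omega>) (h' \<omega>) \<partial>M) = H1.hsip (H1.Sm f h) (H1.Sm f' h')"
proof -
  have e: "H1.ip (f \<omega>) (f' \<omega>) * H1.ip (h \<omega>) (h' \<omega>) = (\<Sum>\<alpha>\<in>I. \<Sum>\<beta>\<in>I. (f \<omega> \<alpha> * h \<omega> \<beta>) * (f' \<omega> \<alpha> * h' \<omega> \<beta>))" for \<omega>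
    unfolding H1.ip_def sum_product by (intro sum.cong refl) (simp add: mult_ac)
  have iv: "indep_var borel (\<lambda>\<omega>. f \<omega> \<alpha> * h \<omega> \<beta>) borel (\<lambda>\<omega>. f' \<omega> \<alpha> * h' \<omega> \<beta>)" if \<alpha>: "\<alpha> \<in> I" "\<beta> \<in> I" for \<alpha> \<beta>
  proof -
    obtain F where F: "F \<in> borel_measurable Half" "\<And>\<omega>. f \<omega> \<alpha> = F (z1 \<omega>)" using f(1) \<alpha>(1) unfolding half1_def by blast
    obtain G where G: "G \<in> borel_measurable Half" "\<And>\<omega>. h \<omega> \<beta> = G (z1 \<omega>)" using f(2) \<alpha>(2) unfolding half1_def by blast
    obtain F' where F': "F' \<in> borel_measurable Half" "\<And>\<omega>. f' \<omega> \<alpha> = F' (z2 \<omega>)" using f(3) \<alpha>(1) unfolding half2_def by blast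
    obtain G' where G': "G' \<in> borel_measurable Half" "\<And>\<omega>. h' \<omega> \<beta> = G' (z2 \<omega>)" using f(4) \<alpha>(2) unfolding half2_def by blast
    show ?thesis
      unfolding F(2) G(2) F'(2) G'(2)
      by (rule indep_fun_halves[OF borel_measurable_times[OF F(1) G(1)] borel_measurable_times[OF F'(1) G'(1)]])
  qed
  have i1: "integrable M (\<lambda>\<omega>. f \<omega> \<alpha> * h \<omega> \<beta>)" and i2: "integrable M (\<lambda>\<omega>. f' \<omega> \<alpha> * h' \<omega> \<beta>)" if "\<alpha> \<in> I" "\<beta> \<in> I" for \<alpha> \<beta>
    using H1.L2v_int[OF L(1,2) that] H1.L2v_int[OF L(3,4) that] by blast+
  have int: "integrable M (\<lambda>\<omega>. (f \<omega> \<alpha> * h \<omega> \<beta>) * (f' \<omega> \<alpha> * h' \<omega> \<beta>))" if "\<alpha> \<in> I" "\<beta> \<in> I" for \<alpha> \<beta>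
    by (rule indep_var_integrable[OF iv[OF that] i1[OF that] i2[OF that]])
  have E: "(\<integral>\<omega>. (f \<omega> \<alpha> * h \<omega> \<beta>) * (f' \<omega> \<alpha> * h' \<omega> \<beta>) \<partial>M) = H1.Sm f h \<alpha> \<beta> * H1.Sm f' h' \<alpha> \<beta>" if "\<alpha> \<in> I" "\<beta> \<in> I" for \<alpha> \<beta>
    unfolding H1.Sm_def by (rule indep_var_lebesgue_integral[OF iv[OF that] i1[OF that] i2[OF that]])
  show "integrable M (\<lambda>\<omega>. H1.ip (f \<omega>) (f' \<omega>) * H1.ip (h \<omega>) (h' \<omega>))"
    unfolding e by (intro Bochner_Integration.integrable_sum int)
  show "(\<integral>\<omega>. H1.ip (f \<omega>) (f' \<omega>) * H1.ip (h \<omega>) (h' \<omega>) \<partial>M) = H1.hsip (H1.Sm f h) (H1.Sm f' h')"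
    unfolding e H1.hsip_def
    by (subst Bochner_Integration.integral_sum, intro Bochner_Integration.integrable_sum int, assumption+,
        intro sum.cong refl, subst Bochner_Integration.integral_sum, intro int, assumption+,
        intro sum.cong refl E)
qed

lemma ip_meas:
  assumes "H1.L2v f" "H1.L2v f'"
  shows "(\<lambda>\<omega>. H1.ip (f \<omega>) (f' \<omega>)) \<in> borel_measurable M"
  using assms unfolding H1.ip_def H1.L2v_def by (intro borel_measurable_sum borel_measurable_times) auto

lemma cross_sq:
  assumes "half1 f" "half2 f'" "H1.L2v f" "H1.L2v f'"
  shows "integrable M (\<lambda>\<omega>. (H1.ip (f \<omega>) (f' \<omega>))\<^sup>2)"
    and "(\<integral>\<omega>. (H1.ip (f \<omega>) (f' \<omega>))\<^sup>2 \<partial>M) = H1.hsip (H1.Sm f f) (H1.Sm f' f')"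
  using cross_moment[of f f f' f'] assms by (simp_all add: power2_eq_square)

definition ev :: "nat \<Rightarrow> 'a \<Rightarrow> real" where "ev i \<omega> = H1.ip (H1.W i \<omega>) (H2.W i \<omega>)"

definition vv :: "nat \<Rightarrow> 'a \<Rightarrow> real" where "vv i \<omega> = H1.ip (H1.W i \<omega>) (\<lambda>_. 1) + H1.ip (H2.W i \<omega>) (\<lambda>_. 1)"

text \<open>The correction of e for the unknown mean: the pairing of \<open>W i + Dl i\<close> of
  both halves without its leading term.\<close>

definition de :: "nat \<Rightarrow> 'a \<Rightarrow> real" where
  "de i \<omega> = H1.ip (H1.W i \<omega>) (H2.Dl i \<omega>) + H1.ip (H1.Dl i \<omega>) (H2.W i \<omega>) + H1.ip (H1.Dl i \<omega>) (H2.Dl i \<omega>)"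

definition dv :: "nat \<Rightarrow> 'a \<Rightarrow> real" where "dv i \<omega> = H1.ip (H1.Dl i \<omega>) (\<lambda>_. 1) + H1.ip (H2.Dl i \<omega>) (\<lambda>_. 1)"

lemma E_ev_sq: "i \<in> {1..N} \<Longrightarrow> (\<integral>\<omega>. (ev i \<omega>)\<^sup>2 \<partial>M) = H1.sigma\<^sup>2"
proof -
  assume i: "i \<in> {1..N}"
  note c = cross_sq[OF half1_W[OF i] half2_W[OF i] H1.L2v_W[OF i] H2.L2v_W[OF i]]
  have "H1.hsip (H1.Sm (H1.W i) (H1.W i)) (H1.Sm (H2.W i) (H2.W i)) = H1.hsip H1.SW H1.SW"
    unfolding H1.hsip_def by (intro sum.cong refl) (simp add: H1.Sm_W[OF i] H2.Sm_W[OF i] SW_12)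
  then show "(\<integral>\<omega>. (ev i \<omega>)\<^sup>2 \<partial>M) = H1.sigma\<^sup>2" using c(2) by (simp add: ev_def H1.hs_sq[symmetric] H1.sigma_def)
qed

lemma hs_bounds:
  assumes i: "i \<in> {1..N}"
  shows "H1.hs (H1.Sm (H1.W i) (H1.W i)) \<le> H1.sigma" "H1.hs (H1.Sm (H2.W i) (H2.W i)) \<le> H1.sigma"
    "H1.hs (H1.Sm (H1.Dl i) (H1.Dl i)) \<le> H1.eta" "H1.hs (H1.Sm (H2.Dl i) (H2.Dl i)) \<le> H1.eta"
  using H1.hs_Sm_W[OF i] H2.hs_Sm_W[OF i] H1.hs_Sm_Dl[OF i] H2.hs_Sm_Dl[OF i] by (simp_all add: sigma_12 eta_12)

lemma integral_sq3:
  fixes a b d :: "'a \<Rightarrow> real"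
  assumes m: "a \<in> borel_measurable M" "b \<in> borel_measurable M" "d \<in> borel_measurable M"
    and i: "integrable M (\<lambda>\<omega>. (a \<omega>)\<^sup>2)" "integrable M (\<lambda>\<omega>. (b \<omega>)\<^sup>2)" "integrable M (\<lambda>\<omega>. (d \<omega>)\<^sup>2)"
    and B: "(\<integral>\<omega>. (a \<omega>)\<^sup>2 \<partial>M) \<le> A1" "(\<integral>\<omega>. (b \<omega>)\<^sup>2 \<partial>M) \<le> A2" "(\<integral>\<omega>. (d \<omega>)\<^sup>2 \<partial>M) \<le> A3"
  shows "integrable M (\<lambda>\<omega>. (a \<omega> + b \<omega> + d \<omega>)\<^sup>2)" "(\<integral>\<omega>. (a \<omega> + b \<omega> + d \<omega>)\<^sup>2 \<partial>M) \<le> 3 * (A1 + A2 + A3)"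
proof -
  let ?B = "\<lambda>\<omega>. 3 * (a \<omega>)\<^sup>2 + 3 * (b \<omega>)\<^sup>2 + 3 * (d \<omega>)\<^sup>2"
  have le: "(a \<omega> + b \<omega> + d \<omega>)\<^sup>2 \<le> ?B \<omega>" for \<omega> by (rule sq_sum3_le)
  have iB: "integrable M ?B" using i by simp
  show int: "integrable M (\<lambda>\<omega>. (a \<omega> + b \<omega> + d \<omega>)\<^sup>2)"
  proof (rule Bochner_Integration.integrable_bound[OF iB])
    show "(\<lambda>\<omega>. (a \<omega> + b \<omega> + d \<omega>)\<^sup>2) \<in> borel_measurable M" by (intro borel_measurable_power borel_measurable_add m)
    show "AE \<omega> in M. norm ((a \<omega> + b \<omega> + d \<omega>)\<^sup>2) \<le> norm (?B \<omega>)"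
      using order_trans[OF le abs_ge_self] by (intro AE_I2) simp
  qed
  have "(\<integral>\<omega>. (a \<omega> + b \<omega> + d \<omega>)\<^sup>2 \<partial>M) \<le> (\<integral>\<omega>. ?B \<omega> \<partial>M)" by (rule integral_mono[OF int iB le])
  also have "\<dots> = 3 * (\<integral>\<omega>. (a \<omega>)\<^sup>2 \<partial>M) + 3 * (\<integral>\<omega>. (b \<omega>)\<^sup>2 \<partial>M) + 3 * (\<integral>\<omega>. (d \<omega>)\<^sup>2 \<partial>M)" using i by simp
  finally have fin: "(\<integral>\<omega>. (a \<omega> + b \<omega> + d \<omega>)\<^sup>2 \<partial>M)
      \<le> 3 * (\<integral>\<omega>. (a \<omega>)\<^sup>2 \<partial>M) + 3 * (\<integral>\<omega>. (b \<omega>)\<^sup>2 \<partial>M) + 3 * (\<integral>\<omega>. (d \<omega>)\<^sup>2 \<partial>M)" .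
  show "(\<integral>\<omega>. (a \<omega> + b \<omega> + d \<omega>)\<^sup>2 \<partial>M) \<le> 3 * (A1 + A2 + A3)"
  proof -
    have "t \<le> 3 * (A1 + A2 + A3)" if "t \<le> 3 * u + 3 * v + 3 * w" "u \<le> A1" "v \<le> A2" "w \<le> A3" for t u v w :: real
      using that by simp
    then show ?thesis using fin B by blast
  qed
qed

lemma de_sq:
  assumes i: "i \<in> {1..N}"
  shows "integrable M (\<lambda>\<omega>. (de i \<omega>)\<^sup>2)"
    and "(\<integral>\<omega>. (de i \<omega>)\<^sup>2 \<partial>M) \<le> 3 * (2 * H1.sigma * H1.eta + H1.eta\<^sup>2)"
proof -
  note 1 = cross_sq[OF half1_W[OF i] half2_Dl[OF i] H1.L2v_W[OF i] H2.L2v_Dl[OF i]]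
  note 2 = cross_sq[OF half1_Dl[OF i] half2_W[OF i] H1.L2v_Dl[OF i] H2.L2v_W[OF i]]
  note 3 = cross_sq[OF half1_Dl[OF i] half2_Dl[OF i] H1.L2v_Dl[OF i] H2.L2v_Dl[OF i]]
  note b = hs_bounds[OF i]
  note s = integral_sq3[OF ip_meas[OF H1.L2v_W[OF i] H2.L2v_Dl[OF i]] ip_meas[OF H1.L2v_Dl[OF i] H2.L2v_W[OF i]]
      ip_meas[OF H1.L2v_Dl[OF i] H2.L2v_Dl[OF i]] 1(1) 2(1) 3(1)
      eq_refl[OF 1(2), THEN order_trans, OF H1.hsip_bound[OF b(1) b(4)]]
      eq_refl[OF 2(2), THEN order_trans, OF H1.hsip_bound[OF b(3) b(2)]]
      eq_refl[OF 3(2), THEN order_trans, OF H1.hsip_bound[OF b(3) b(4)]]]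
  show "integrable M (\<lambda>\<omega>. (de i \<omega>)\<^sup>2)" using s(1) unfolding de_def .
  show "(\<integral>\<omega>. (de i \<omega>)\<^sup>2 \<partial>M) \<le> 3 * (2 * H1.sigma * H1.eta + H1.eta\<^sup>2)"
    using s(2) unfolding de_def by (simp add: power2_eq_square mult_ac)
qed

text \<open>Mixed terms are orthogonal for different i, because the \<open>W i\<close> of one half
  are uncorrelated, and cost N \<open>sigma\<close> \<open>eta\<close> for each half. Products of
  two perturbations have N diagonal moments of size \<open>eta\<close>^2 and at most N^2 others
  bounded by (4 \<open>eta\<close> / N)^2, which explains the 16.\<close>

lemma sum_de_sq:
  shows "integrable M (\<lambda>\<omega>. (\<Sum>i=1..N. de i \<omega>)\<^sup>2)"
    and "(\<integral>\<omega>. (\<Sum>i=1..N. de i \<omega>)\<^sup>2 \<partial>M) \<le> 3 * (2 * N * H1.sigma * H1.eta + (N + 16) * H1.eta\<^sup>2)"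
proof -
  let ?J = "{1..N}"
  let ?a = "\<lambda>i \<omega>. H1.ip (H1.W i \<omega>) (H2.Dl i \<omega>)" and ?b = "\<lambda>i \<omega>. H1.ip (H1.Dl i \<omega>) (H2.W i \<omega>)" and ?d = "\<lambda>i \<omega>. H1.ip (H1.Dl i \<omega>) (H2.Dl i \<omega>)"
  have am: "?a i \<in> borel_measurable M" and bm: "?b i \<in> borel_measurable M" and dm: "?d i \<in> borel_measurable M" if "i \<in> ?J" for i
    by (intro ip_meas H1.L2v_W H2.L2v_W H1.L2v_Dl H2.L2v_Dl that)+
  have a2: "integrable M (\<lambda>\<omega>. (?a i \<omega>)\<^sup>2)" and a3: "(\<integral>\<omega>. (?a i \<omega>)\<^sup>2 \<partial>M) \<le> H1.sigma * H1.eta" if i: "i \<in> ?J" for i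
    using cross_sq[OF half1_W[OF i] half2_Dl[OF i] H1.L2v_W[OF i] H2.L2v_Dl[OF i]] H1.hsip_bound[OF hs_bounds(1)[OF i] hs_bounds(4)[OF i]] by auto
  have b2: "integrable M (\<lambda>\<omega>. (?b i \<omega>)\<^sup>2)" and b3: "(\<integral>\<omega>. (?b i \<omega>)\<^sup>2 \<partial>M) \<le> H1.eta * H1.sigma" if i: "i \<in> ?J" for i
    using cross_sq[OF half1_Dl[OF i] half2_W[OF i] H1.L2v_Dl[OF i] H2.L2v_W[OF i]] H1.hsip_bound[OF hs_bounds(3)[OF i] hs_bounds(2)[OF i]] by auto
  have ao: "(\<integral>\<omega>. ?a i \<omega> * ?a k \<omega> \<partial>M) = 0" if i: "i \<in> ?J" "k \<in> ?J" "i \<noteq> k" for i k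
    using cross_moment(2)[OF half1_W[OF i(1)] half1_W[OF i(2)] half2_Dl[OF i(1)] half2_Dl[OF i(2)]
        H1.L2v_W[OF i(1)] H1.L2v_W[OF i(2)] H2.L2v_Dl[OF i(1)] H2.L2v_Dl[OF i(2)]]
      H1.hsip_zero(1)[OF H1.Sm_W_off[OF i]] by simp
  have bo: "(\<integral>\<omega>. ?b i \<omega> * ?b k \<omega> \<partial>M) = 0" if i: "i \<in> ?J" "k \<in> ?J" "i \<noteq> k" for i k
    using cross_moment(2)[OF half1_Dl[OF i(1)] half1_Dl[OF i(2)] half2_W[OF i(1)] half2_W[OF i(2)]
        H1.L2v_Dl[OF i(1)] H1.L2v_Dl[OF i(2)] H2.L2v_W[OF i(1)] H2.L2v_W[OF i(2)]]
      H1.hsip_zero(2)[OF H2.Sm_W_off[OF i]] by simp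
  have A: "integrable M (\<lambda>\<omega>. (\<Sum>i\<in>?J. ?a i \<omega>)\<^sup>2)" "(\<integral>\<omega>. (\<Sum>i\<in>?J. ?a i \<omega>)\<^sup>2 \<partial>M) \<le> N * (H1.sigma * H1.eta)"
  proof -
    show "integrable M (\<lambda>\<omega>. (\<Sum>i\<in>?J. ?a i \<omega>)\<^sup>2)" by (rule uncorrelated_sum_sq(1)[OF _ am a2 ao]) auto
    have "(\<integral>\<omega>. (\<Sum>i\<in>?J. ?a i \<omega>)\<^sup>2 \<partial>M) = (\<Sum>i\<in>?J. \<integral>\<omega>. (?a i \<omega>)\<^sup>2 \<partial>M)" by (rule uncorrelated_sum_sq(2)[OF _ am a2 ao]) auto
    also have "\<dots> \<le> (\<Sum>i\<in>?J. H1.sigma * H1.eta)" by (intro sum_mono a3)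
    finally show "(\<integral>\<omega>. (\<Sum>i\<in>?J. ?a i \<omega>)\<^sup>2 \<partial>M) \<le> N * (H1.sigma * H1.eta)" by simp
  qed
  have B: "integrable M (\<lambda>\<omega>. (\<Sum>i\<in>?J. ?b i \<omega>)\<^sup>2)" "(\<integral>\<omega>. (\<Sum>i\<in>?J. ?b i \<omega>)\<^sup>2 \<partial>M) \<le> N * (H1.eta * H1.sigma)"
  proof -
    show "integrable M (\<lambda>\<omega>. (\<Sum>i\<in>?J. ?b i \<omega>)\<^sup>2)" by (rule uncorrelated_sum_sq(1)[OF _ bm b2 bo]) auto
    have "(\<integral>\<omega>. (\<Sum>i\<in>?J. ?b i \<omega>)\<^sup>2 \<partial>M) = (\<Sum>i\<in>?J. \<integral>\<omega>. (?b i \<omega>)\<^sup>2 \<partial>M)" by (rule uncorrelated_sum_sq(2)[OF _ bm b2 bo]) auto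
    also have "\<dots> \<le> (\<Sum>i\<in>?J. H1.eta * H1.sigma)" by (intro sum_mono b3)
    finally show "(\<integral>\<omega>. (\<Sum>i\<in>?J. ?b i \<omega>)\<^sup>2 \<partial>M) \<le> N * (H1.eta * H1.sigma)" by simp
  qed
  have cm: "integrable M (\<lambda>\<omega>. ?d i \<omega> * ?d k \<omega>)"
    "(\<integral>\<omega>. ?d i \<omega> * ?d k \<omega> \<partial>M) = H1.hsip (H1.Sm (H1.Dl i) (H1.Dl k)) (H1.Sm (H2.Dl i) (H2.Dl k))" if i: "i \<in> ?J" "k \<in> ?J" for i k
    by (rule cross_moment[OF half1_Dl[OF i(1)] half1_Dl[OF i(2)] half2_Dl[OF i(1)] half2_Dl[OF i(2)]
        H1.L2v_Dl[OF i(1)] H1.L2v_Dl[OF i(2)] H2.L2v_Dl[OF i(1)] H2.L2v_Dl[OF i(2)]])+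
  have de_le: "(\<integral>\<omega>. ?d i \<omega> * ?d k \<omega> \<partial>M) \<le> 16 * H1.eta\<^sup>2 / N\<^sup>2 + (if k = i then H1.eta\<^sup>2 else 0)" if i: "i \<in> ?J" "k \<in> ?J" for i k
  proof (cases "k = i")
    case True
    have "(\<integral>\<omega>. ?d i \<omega> * ?d k \<omega> \<partial>M) \<le> H1.eta * H1.eta"
      unfolding True cm(2)[OF i(1) i(1)] by (rule H1.hsip_bound[OF hs_bounds(3)[OF i(1)] hs_bounds(4)[OF i(1)]])
    also have "\<dots> \<le> 16 * H1.eta\<^sup>2 / N\<^sup>2 + H1.eta\<^sup>2"
      unfolding power2_eq_square[of H1.eta, symmetric] by (rule le_add_same_cancel2[THEN iffD2]) simp
    finally show ?thesis unfolding if_P[OF True] .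
  next
    case False
    have "(\<integral>\<omega>. ?d i \<omega> * ?d k \<omega> \<partial>M) \<le> (4 * H1.eta / N) * (4 * H1.eta / N)"
      unfolding cm(2)[OF i]
      by (rule H1.hsip_bound[OF H1.hs_Sm_Dl_off[OF i] H2.hs_Sm_Dl_off[OF i, unfolded eta_12]]) (use False in auto)
    then show ?thesis using False by (simp add: power2_eq_square)
  qed
  have ed: "(\<Sum>i\<in>?J. ?d i \<omega>)\<^sup>2 = (\<Sum>i\<in>?J. \<Sum>k\<in>?J. ?d i \<omega> * ?d k \<omega>)" for \<omega> by (simp add: power2_eq_square sum_product)
  have D: "integrable M (\<lambda>\<omega>. (\<Sum>i\<in>?J. ?d i \<omega>)\<^sup>2)" "(\<integral>\<omega>. (\<Sum>i\<in>?J. ?d i \<omega>)\<^sup>2 \<partial>M) \<le> (N + 16) * H1.eta\<^sup>2"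
  proof -
    show "integrable M (\<lambda>\<omega>. (\<Sum>i\<in>?J. ?d i \<omega>)\<^sup>2)" unfolding ed by (intro Bochner_Integration.integrable_sum cm)
    have "(\<integral>\<omega>. (\<Sum>i\<in>?J. ?d i \<omega>)\<^sup>2 \<partial>M) = (\<Sum>i\<in>?J. \<Sum>k\<in>?J. \<integral>\<omega>. ?d i \<omega> * ?d k \<omega> \<partial>M)"
      unfolding ed
      by (subst Bochner_Integration.integral_sum, intro Bochner_Integration.integrable_sum cm, assumption+,
          intro sum.cong refl, subst Bochner_Integration.integral_sum, intro cm, assumption+, rule refl)
    also have "\<dots> \<le> (\<Sum>i\<in>?J. \<Sum>k\<in>?J. 16 * H1.eta\<^sup>2 / N\<^sup>2 + (if k = i then H1.eta\<^sup>2 else 0))" by (intro sum_mono de_le)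
    also have "\<dots> = N * (N * (16 * H1.eta\<^sup>2 / N\<^sup>2) + H1.eta\<^sup>2)" by (simp add: sum.distrib)
    also have "\<dots> = (N + 16) * H1.eta\<^sup>2" using H1.N0 by (simp add: field_simps power2_eq_square)
    finally show "(\<integral>\<omega>. (\<Sum>i\<in>?J. ?d i \<omega>)\<^sup>2 \<partial>M) \<le> (N + 16) * H1.eta\<^sup>2" .
  qed
  have e: "(\<Sum>i\<in>?J. de i \<omega>) = (\<Sum>i\<in>?J. ?a i \<omega>) + (\<Sum>i\<in>?J. ?b i \<omega>) + (\<Sum>i\<in>?J. ?d i \<omega>)" for \<omega>
    unfolding de_def by (simp only: sum.distrib)
  have ms: "(\<lambda>\<omega>. \<Sum>i\<in>?J. ?a i \<omega>) \<in> borel_measurable M" "(\<lambda>\<omega>. \<Sum>i\<in>?J. ?b i \<omega>) \<in> borel_measurable M" "(\<lambda>\<omega>. \<Sum>i\<in>?J. ?d i \<omega>) \<in> borel_measurable M"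
    by (intro borel_measurable_sum am, assumption, intro borel_measurable_sum bm, assumption, intro borel_measurable_sum dm)
  note s = integral_sq3[OF ms A(1) B(1) D(1) A(2) B(2) D(2)]
  show "integrable M (\<lambda>\<omega>. (\<Sum>i=1..N. de i \<omega>)\<^sup>2)" using s(1) unfolding e .
  show "(\<integral>\<omega>. (\<Sum>i=1..N. de i \<omega>)\<^sup>2 \<partial>M) \<le> 3 * (2 * N * H1.sigma * H1.eta + (N + 16) * H1.eta\<^sup>2)"
    using s(2) unfolding e by (simp add: mult_ac)
qed

abbreviation "ssum \<equiv> H1.ip sgp (\<lambda>_. 1)"
abbreviation "Cv \<equiv> H1.qf H1.SW (\<lambda>_. 1)"

lemma integral_sq2:
  fixes a b :: "'a \<Rightarrow> real"
  assumes m: "a \<in> borel_measurable M" "b \<in> borel_measurable M"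
    and i: "integrable M (\<lambda>\<omega>. (a \<omega>)\<^sup>2)" "integrable M (\<lambda>\<omega>. (b \<omega>)\<^sup>2)"
    and B: "(\<integral>\<omega>. (a \<omega>)\<^sup>2 \<partial>M) \<le> A" "(\<integral>\<omega>. (b \<omega>)\<^sup>2 \<partial>M) \<le> A"
  shows "integrable M (\<lambda>\<omega>. (a \<omega> + b \<omega>)\<^sup>2)" "(\<integral>\<omega>. (a \<omega> + b \<omega>)\<^sup>2 \<partial>M) \<le> 6 * A"
  using integral_sq3[OF m borel_measurable_const[of 0] i _ B, of 0] by simp_all

lemma dv_sq:
  assumes i: "i \<in> {1..N}"
  shows "integrable M (\<lambda>\<omega>. (dv i \<omega>)\<^sup>2)"
    and "(\<integral>\<omega>. (dv i \<omega>)\<^sup>2 \<partial>M) \<le> 6 * (60 * (ssum\<^sup>2 / N + (Cv + ssum\<^sup>2) / N\<^sup>2))"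
proof -
  note s = integral_sq2[OF H1.ip_Dl_meas[OF i] H2.ip_Dl_meas[OF i] H1.ip_Dl_sq(1)[OF i] H2.ip_Dl_sq(1)[OF i]
    H1.ip_Dl_sq(2)[OF i] H2.ip_Dl_sq(2)[OF i, unfolded qfSW_12], of "\<lambda>_. 1", unfolded H1.qf_TD_ones]
  show "integrable M (\<lambda>\<omega>. (dv i \<omega>)\<^sup>2)" using s(1) unfolding dv_def .
  show "(\<integral>\<omega>. (dv i \<omega>)\<^sup>2 \<partial>M) \<le> 6 * (60 * (ssum\<^sup>2 / N + (Cv + ssum\<^sup>2) / N\<^sup>2))" using s(2) unfolding dv_def .
qed

lemma sum_dv_sq:
  shows "integrable M (\<lambda>\<omega>. (\<Sum>i=1..N. dv i \<omega>)\<^sup>2)"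
    and "(\<integral>\<omega>. (\<Sum>i=1..N. dv i \<omega>)\<^sup>2 \<partial>M) \<le> 6 * (2 * Cv / N + 8 * ssum\<^sup>2)"
proof -
  have m: "(\<lambda>\<omega>. \<Sum>i=1..N. H1.ip (H1.Dl i \<omega>) (\<lambda>_. 1)) \<in> borel_measurable M" "(\<lambda>\<omega>. \<Sum>i=1..N. H1.ip (H2.Dl i \<omega>) (\<lambda>_. 1)) \<in> borel_measurable M"
    by (intro borel_measurable_sum H1.ip_Dl_meas, assumption, intro borel_measurable_sum H2.ip_Dl_meas)
  note s = integral_sq2[OF m H1.ip_sum_Dl_sq(1) H2.ip_sum_Dl_sq(1) H1.ip_sum_Dl_sq(2) H2.ip_sum_Dl_sq(2)[unfolded qfSW_12],
      unfolded H1.qf_TD_ones]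
  show "integrable M (\<lambda>\<omega>. (\<Sum>i=1..N. dv i \<omega>)\<^sup>2)" using s(1) unfolding dv_def sum.distrib .
  show "(\<integral>\<omega>. (\<Sum>i=1..N. dv i \<omega>)\<^sup>2 \<partial>M) \<le> 6 * (2 * Cv / N + 8 * ssum\<^sup>2)" using s(2) unfolding dv_def sum.distrib .
qed

lemma mem11: "1 \<in> {1..N}" using N2 by simp

lemma indep_W: "\<alpha> \<in> I \<Longrightarrow> \<beta> \<in> I \<Longrightarrow> indep_var borel (\<lambda>\<omega>. H1.W 1 \<omega> \<alpha>) borel (\<lambda>\<omega>. H2.W 1 \<omega> \<beta>)"
  using indep_fun_halves[OF wF_meas[OF mem11] wF_meas[OF mem11], of \<alpha> \<beta>] N2
  by (simp add: H1.W_def[abs_def] H2.W_def[abs_def] wF_def z1_def z2_def)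

lemma ipW1_indep:
  assumes F: "F = (\<lambda>z. \<Sum>\<alpha>\<in>I. wF 1 \<alpha> z * A \<alpha>)"
  shows "F \<in> borel_measurable Half" "H1.ip (H1.W 1 \<omega>) A = F (z1 \<omega>)" "H1.ip (H2.W 1 \<omega>) A = F (z2 \<omega>)"
proof -
  show "F \<in> borel_measurable Half" unfolding F by (intro borel_measurable_sum borel_measurable_times borel_measurable_const wF_meas mem11)
  show "H1.ip (H1.W 1 \<omega>) A = F (z1 \<omega>)" "H1.ip (H2.W 1 \<omega>) A = F (z2 \<omega>)"
    using N2 unfolding F H1.ip_def by (auto simp: H1.W_def H2.W_def wF_def z1_def z2_def intro!: sum.cong)
qed

lemma ipW_props:
  shows "integrable M (\<lambda>\<omega>. (H1.ip (H1.W 1 \<omega>) A)\<^sup>2)" "integrable M (\<lambda>\<omega>. (H1.ip (H2.W 1 \<omega>) A)\<^sup>2)"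
    "integrable M (\<lambda>\<omega>. H1.ip (H1.W 1 \<omega>) A)" "integrable M (\<lambda>\<omega>. H1.ip (H2.W 1 \<omega>) A)"
proof -
  show 1: "integrable M (\<lambda>\<omega>. (H1.ip (H1.W 1 \<omega>) A)\<^sup>2)" by (rule H1.L2v_ip_sq(1)[OF H1.L2v_W[OF mem11]])
  show 2: "integrable M (\<lambda>\<omega>. (H1.ip (H2.W 1 \<omega>) A)\<^sup>2)" by (rule H1.L2v_ip_sq(1)[OF H2.L2v_W[OF mem11]])
  show "integrable M (\<lambda>\<omega>. H1.ip (H1.W 1 \<omega>) A)" by (rule H1.sq_int_imp_int[OF H1.ipW_meas[OF mem11] 1])
  show "integrable M (\<lambda>\<omega>. H1.ip (H2.W 1 \<omega>) A)" by (rule H1.sq_int_imp_int[OF H2.ipW_meas[OF mem11] 2])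
qed

lemma E_vv: "(\<integral>\<omega>. vv 1 \<omega> \<partial>M) = 0"
  unfolding vv_def using ipW_props[of "\<lambda>_. 1"] H1.ipW_mean[OF mem11] H2.ipW_mean[OF mem11] by simp

lemma E_vv_sq: "integrable M (\<lambda>\<omega>. (vv 1 \<omega>)\<^sup>2)" "(\<integral>\<omega>. (vv 1 \<omega>)\<^sup>2 \<partial>M) = 2 * Cv"
proof -
  let ?a = "\<lambda>\<omega>. H1.ip (H1.W 1 \<omega>) (\<lambda>_. 1)" and ?b = "\<lambda>\<omega>. H1.ip (H2.W 1 \<omega>) (\<lambda>_. 1)"
  note F = ipW1_indep[OF refl, where A = "\<lambda>_. 1"]
  have iv: "indep_var borel ?a borel ?b" unfolding F(2,3) by (rule indep_fun_halves[OF F(1) F(1)])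
  note p = ipW_props[of "\<lambda>_. 1"]
  have ab: "integrable M (\<lambda>\<omega>. ?a \<omega> * ?b \<omega>)" "(\<integral>\<omega>. ?a \<omega> * ?b \<omega> \<partial>M) = 0"
    using indep_var_integrable[OF iv p(3,4)] indep_var_lebesgue_integral[OF iv p(3,4)] H1.ipW_mean[OF mem11, of "\<lambda>_. 1"] by simp_all
  have e: "(vv 1 \<omega>)\<^sup>2 = (?a \<omega>)\<^sup>2 + (?b \<omega>)\<^sup>2 + 2 * (?a \<omega> * ?b \<omega>)" for \<omega>
    by (simp add: vv_def power2_eq_square algebra_simps)
  show "integrable M (\<lambda>\<omega>. (vv 1 \<omega>)\<^sup>2)" unfolding e using p ab by simp
  show "(\<integral>\<omega>. (vv 1 \<omega>)\<^sup>2 \<partial>M) = 2 * Cv"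
    unfolding e using p ab H1.ipW_sq[OF mem11, of "\<lambda>_. 1"] H2.ipW_sq[OF mem11, of "\<lambda>_. 1"] by (simp add: qfSW_12)
qed

lemma E_ev: "(\<integral>\<omega>. ev 1 \<omega> \<partial>M) = 0"
proof -
  have t: "integrable M (\<lambda>\<omega>. H1.W 1 \<omega> \<alpha> * H2.W 1 \<omega> \<alpha>)" "(\<integral>\<omega>. H1.W 1 \<omega> \<alpha> * H2.W 1 \<omega> \<alpha> \<partial>M) = 0" if \<alpha>: "\<alpha> \<in> I" for \<alpha>
    using indep_var_integrable[OF indep_W[OF \<alpha> \<alpha>] H1.W_int[OF mem11 \<alpha>] H2.W_int[OF mem11 \<alpha>]]
      indep_var_lebesgue_integral[OF indep_W[OF \<alpha> \<alpha>] H1.W_int[OF mem11 \<alpha>] H2.W_int[OF mem11 \<alpha>]] H1.W_mean[OF mem11 \<alpha>] by simp_all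
  show ?thesis unfolding ev_def H1.ip_def by (subst Bochner_Integration.integral_sum) (auto simp: t)
qed

text \<open>Each of the two summands of \<open>vv\<close> depends on one half only, so in the
  product with \<open>ev\<close> the factor W of the other half stands alone; it is centred and
  independent of the rest.\<close>

lemma E_ev_vv: "(\<integral>\<omega>. ev 1 \<omega> * vv 1 \<omega> \<partial>M) = 0"
proof -
  note F = ipW1_indep[OF refl, where A = "\<lambda>_. 1"]
  let ?a = "\<lambda>\<omega>. H1.ip (H1.W 1 \<omega>) (\<lambda>_. 1)" and ?b = "\<lambda>\<omega>. H1.ip (H2.W 1 \<omega>) (\<lambda>_. 1)"
  have W1: "H1.W 1 \<omega> \<alpha> = wF 1 \<alpha> (z1 \<omega>)" and W2: "H2.W 1 \<omega> \<alpha> = wF 1 \<alpha> (z2 \<omega>)" for \<omega> \<alpha>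
    using N2 by (simp_all add: H1.W_def H2.W_def wF_def z1_def z2_def)
  have t1: "integrable M (\<lambda>\<omega>. (H1.W 1 \<omega> \<alpha> * ?a \<omega>) * H2.W 1 \<omega> \<alpha>)" "(\<integral>\<omega>. (H1.W 1 \<omega> \<alpha> * ?a \<omega>) * H2.W 1 \<omega> \<alpha> \<partial>M) = 0" if \<alpha>: "\<alpha> \<in> I" for \<alpha>
  proof -
    have iv: "indep_var borel (\<lambda>\<omega>. H1.W 1 \<omega> \<alpha> * ?a \<omega>) borel (\<lambda>\<omega>. H2.W 1 \<omega> \<alpha>)"
      unfolding F(2) W1 W2 by (rule indep_fun_halves[OF borel_measurable_times[OF wF_meas[OF mem11 \<alpha>] F(1)] wF_meas[OF mem11 \<alpha>]])
    have i: "integrable M (\<lambda>\<omega>. H1.W 1 \<omega> \<alpha> * ?a \<omega>)"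
      by (rule integrable_mult_of_sq[OF H1.W_meas[OF mem11 \<alpha>] H1.ipW_meas[OF mem11] H1.W_sq_int[OF mem11 \<alpha>] ipW_props(1)])
    show "integrable M (\<lambda>\<omega>. (H1.W 1 \<omega> \<alpha> * ?a \<omega>) * H2.W 1 \<omega> \<alpha>)" by (rule indep_var_integrable[OF iv i H2.W_int[OF mem11 \<alpha>]])
    show "(\<integral>\<omega>. (H1.W 1 \<omega> \<alpha> * ?a \<omega>) * H2.W 1 \<omega> \<alpha> \<partial>M) = 0"
      using indep_var_lebesgue_integral[OF iv i H2.W_int[OF mem11 \<alpha>]] H2.W_mean[OF mem11 \<alpha>] by simp
  qed
  have t2: "integrable M (\<lambda>\<omega>. H1.W 1 \<omega> \<alpha> * (H2.W 1 \<omega> \<alpha> * ?b \<omega>))" "(\<integral>\<omega>. H1.W 1 \<omega> \<alpha> * (H2.W 1 \<omega> \<alpha> * ?b \<omega>) \<partial>M) = 0" if \<alpha>: "\<alpha> \<in> I" for \<alpha>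
  proof -
    have iv: "indep_var borel (\<lambda>\<omega>. H1.W 1 \<omega> \<alpha>) borel (\<lambda>\<omega>. H2.W 1 \<omega> \<alpha> * ?b \<omega>)"
      unfolding F(3) W1 W2 by (rule indep_fun_halves[OF wF_meas[OF mem11 \<alpha>] borel_measurable_times[OF wF_meas[OF mem11 \<alpha>] F(1)]])
    have i: "integrable M (\<lambda>\<omega>. H2.W 1 \<omega> \<alpha> * ?b \<omega>)"
      by (rule integrable_mult_of_sq[OF H2.W_meas[OF mem11 \<alpha>] H2.ipW_meas[OF mem11] H2.W_sq_int[OF mem11 \<alpha>] ipW_props(2)])
    show "integrable M (\<lambda>\<omega>. H1.W 1 \<omega> \<alpha> * (H2.W 1 \<omega> \<alpha> * ?b \<omega>))" by (rule indep_var_integrable[OF iv H1.W_int[OF mem11 \<alpha>] i])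
    show "(\<integral>\<omega>. H1.W 1 \<omega> \<alpha> * (H2.W 1 \<omega> \<alpha> * ?b \<omega>) \<partial>M) = 0"
      using indep_var_lebesgue_integral[OF iv H1.W_int[OF mem11 \<alpha>] i] H1.W_mean[OF mem11 \<alpha>] by simp
  qed
  have e: "ev 1 \<omega> * vv 1 \<omega> = (\<Sum>\<alpha>\<in>I. (H1.W 1 \<omega> \<alpha> * ?a \<omega>) * H2.W 1 \<omega> \<alpha> + H1.W 1 \<omega> \<alpha> * (H2.W 1 \<omega> \<alpha> * ?b \<omega>))" for \<omega>
    unfolding ev_def vv_def H1.ip_def[of "H1.W 1 \<omega>" "H2.W 1 \<omega>"] sum_distrib_right by (intro sum.cong refl) (simp add: algebra_simps)
  show ?thesis
    unfolding e by (subst Bochner_Integration.integral_sum) (auto simp: t1 t2 intro!: sum.neutral Bochner_Integration.integrable_add)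
qed

text \<open>The assumed positivity of E[v^2] thereby yields positivity of E[e^2], by which e is
  standardised.\<close>

lemma sigma_pos:
  assumes "0 < Cv"
  shows "0 < H1.sigma"
proof (rule ccontr)
  assume "\<not> 0 < H1.sigma"
  then have "H1.hs H1.SW = 0" using H1.sigma_nonneg by (simp add: H1.sigma_def)
  then have "H1.SW \<alpha> \<beta> = 0" if "\<alpha> \<in> I" "\<beta> \<in> I" for \<alpha> \<beta>
    using that finI unfolding H1.hs_def by (subst (asm) L2_set_eq_0_iff) auto
  then have "Cv = 0" unfolding H1.qf_def by simp
  then show False using assms by simp
qed

end

section \<open>The covariance matrix test\<close>

text \<open>The trace pairs entry (a, b) with entry (b, a); symmetry turns it into a Frobenius
  product, the form in which the moment bounds are stated.\<close>

lemma e_stat_sum: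
  assumes sym: "\<forall>a\<in>{1..p}. \<forall>b\<in>{1..p}. A a b = A b a"
  shows "e_stat p N \<mu> x A i = (\<Sum>\<alpha>\<in>{1..p} \<times> {1..p}.
    ((x i (fst \<alpha>) - \<mu> (fst \<alpha>)) * (x i (snd \<alpha>) - \<mu> (snd \<alpha>)) - A (fst \<alpha>) (snd \<alpha>)) *
    ((x (i + N) (fst \<alpha>) - \<mu> (fst \<alpha>)) * (x (i + N) (snd \<alpha>) - \<mu> (snd \<alpha>)) - A (fst \<alpha>) (snd \<alpha>)))"
  unfolding e_stat_def mtrace_def mmult_def Ymat_def outer_sq_def sum.cartesian_product' fst_conv snd_conv
  by (intro sum.cong refl) (use sym in \<open>simp add: mult_ac\<close>)

lemma v_stat_sum:
  "v_stat p N \<mu> x A i = (\<Sum>\<alpha>\<in>{1..p} \<times> {1..p}. (x i (fst \<alpha>) - \<mu> (fst \<alpha>)) * (x i (snd \<alpha>) - \<mu> (snd \<alpha>)) - A (fst \<alpha>) (snd \<alpha>)) +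
    (\<Sum>\<alpha>\<in>{1..p} \<times> {1..p}. (x (i + N) (fst \<alpha>) - \<mu> (fst \<alpha>)) * (x (i + N) (snd \<alpha>) - \<mu> (snd \<alpha>)) - A (fst \<alpha>) (snd \<alpha>))"
  unfolding v_stat_def quad_form_def Ymat_def outer_sq_def sum.cartesian_product' fst_conv snd_conv sum.distrib[symmetric]
  by (intro sum.cong refl) (simp add: algebra_simps)

lemma e_star_sum:
  assumes sym: "\<forall>a\<in>{1..p}. \<forall>b\<in>{1..p}. A a b = A b a" and i: "i \<in> {1..N}"
  shows "e_star p N x A i = (\<Sum>\<alpha>\<in>{1..p} \<times> {1..p}.
    ((x i (fst \<alpha>) - Xbar1 N x (fst \<alpha>)) * (x i (snd \<alpha>) - Xbar1 N x (snd \<alpha>)) - (real N - 1) / N * A (fst \<alpha>) (snd \<alpha>)) *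
    ((x (i + N) (fst \<alpha>) - Xbar2 N x (fst \<alpha>)) * (x (i + N) (snd \<alpha>) - Xbar2 N x (snd \<alpha>)) - (real N - 1) / N * A (fst \<alpha>) (snd \<alpha>)))"
proof -
  \<comment> \<open>Since i >= 1, the index i + N falls into the branch centred at the second sample
    mean.\<close>
  have "i \<le> N" "\<not> i + N \<le> N" using i by auto
  then show ?thesis
    unfolding e_star_def mtrace_def mmult_def Ymat_star_def outer_sq_def sum.cartesian_product' fst_conv snd_conv
    by (intro sum.cong refl) (use sym in \<open>simp add: mult_ac\<close>)
qed

lemma v_star_sum:
  assumes i: "i \<in> {1..N}"
  shows "v_star p N x A i = (\<Sum>\<alpha>\<in>{1..p} \<times> {1..p}.
     (x i (fst \<alpha>) - Xbar1 N x (fst \<alpha>)) * (x i (snd \<alpha>) - Xbar1 N x (snd \<alpha>)) - (real N - 1) / N * A (fst \<alpha>) (snd \<alpha>)) +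
    (\<Sum>\<alpha>\<in>{1..p} \<times> {1..p}. (x (i + N) (fst \<alpha>) - Xbar2 N x (fst \<alpha>)) * (x (i + N) (snd \<alpha>) - Xbar2 N x (snd \<alpha>)) - (real N - 1) / N * A (fst \<alpha>) (snd \<alpha>))"
proof -
  have "i \<le> N" "\<not> i + N \<le> N" using i by auto
  then show ?thesis
    unfolding v_star_def quad_form_def Ymat_star_def outer_sq_def sum.cartesian_product' fst_conv snd_conv sum.distrib[symmetric]
    by (intro sum.cong refl) (simp add: algebra_simps)
qed

section \<open>The test statistics in terms of \<open>W\<close> and \<open>Dl\<close>\<close>

context cov_sample
begin

lemma Sg_sym: "\<forall>a\<in>{1..p}. \<forall>b\<in>{1..p}. Sg a b = Sg b a"
proof (intro ballI)
  show "Sg a b = Sg b a" if "a \<in> {1..p}" "b \<in> {1..p}" for a b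
    using covariance[OF mem1(1) that] covariance[OF mem1(1) that(2,1)] by (simp add: mult.commute)
qed

lemma e_stat_ev: "e_stat p N \<mu> (\<lambda>i. X i \<omega>) Sg i = ev i \<omega>"
  unfolding e_stat_sum[of p Sg, OF Sg_sym] ev_def H1.ip_def H1.W_def H2.W_def I_def by (rule refl)

lemma v_stat_vv: "v_stat p N \<mu> (\<lambda>i. X i \<omega>) Sg i = vv i \<omega>"
  unfolding v_stat_sum vv_def H1.ip_def H1.W_def H2.W_def I_def by simp

text \<open>Centring at the sample mean absorbs any shift, so \<open>\<mu>\<close> may be subtracted
  beforehand.\<close>

lemma Xbar1_u: "X i \<omega> a - Xbar1 N (\<lambda>i. X i \<omega>) a = gz a (X i \<omega>) - H1.u a \<omega>"
  using H1.N0 by (simp add: Xbar1_def H1.u_def sum_subtractf field_simps)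

lemma Xbar2_u: "X i \<omega> a - Xbar2 N (\<lambda>i. X i \<omega>) a = gz a (X i \<omega>) - H2.u a \<omega>"
proof -
  have "(\<Sum>j=N+1..2*N. X j \<omega> a) = (\<Sum>j=1..N. X (j + N) \<omega> a)"
    by (rule sum.reindex_bij_witness[of _ "\<lambda>j. j + N" "\<lambda>j. j - N"]) auto
  then show ?thesis using H1.N0 by (simp add: Xbar2_def H2.u_def sum_subtractf field_simps)
qed

text \<open>Splitting (N - 1) / N as 1 - 1 / N moves the part \<open>sgp \<alpha> / N\<close> into
  \<open>Dl\<close>, where it balances the mean of the other terms.\<close>

lemma W_Dl1: "(X i \<omega> (fst \<alpha>) - Xbar1 N (\<lambda>i. X i \<omega>) (fst \<alpha>)) * (X i \<omega> (snd \<alpha>) - Xbar1 N (\<lambda>i. X i \<omega>) (snd \<alpha>)) - (real N - 1) / N * sgp \<alpha>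
    = H1.W i \<omega> \<alpha> + H1.Dl i \<omega> \<alpha>"
  unfolding Xbar1_u H1.W_def H1.Dl_def using H1.N0 by (simp add: field_simps)

lemma W_Dl2: "(X (i + N) \<omega> (fst \<alpha>) - Xbar2 N (\<lambda>i. X i \<omega>) (fst \<alpha>)) * (X (i + N) \<omega> (snd \<alpha>) - Xbar2 N (\<lambda>i. X i \<omega>) (snd \<alpha>)) - (real N - 1) / N * sgp \<alpha>
    = H2.W i \<omega> \<alpha> + H2.Dl i \<omega> \<alpha>"
  unfolding Xbar2_u H2.W_def H2.Dl_def using H1.N0 by (simp add: field_simps)

lemma e_star_ev:
  assumes i: "i \<in> {1..N}"
  shows "e_star p N (\<lambda>i. X i \<omega>) Sg i = ev i \<omega> + de i \<omega>"
  unfolding e_star_sum[of p Sg, OF Sg_sym i] W_Dl1 W_Dl2 ev_def de_def H1.ip_def I_def sum.distrib[symmetric]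
  by (intro sum.cong refl) (simp add: algebra_simps)

lemma v_star_vv:
  assumes i: "i \<in> {1..N}"
  shows "v_star p N (\<lambda>i. X i \<omega>) Sg i = vv i \<omega> + dv i \<omega>"
  unfolding v_star_sum[OF i] W_Dl1 W_Dl2 vv_def dv_def H1.ip_def I_def sum.distrib[symmetric]
  by (intro sum.cong refl) (simp add: algebra_simps)

lemma tau_eq: "mtrace p (mmult p Sg Sg) = H1.tau"
  unfolding mtrace_def mmult_def H1.tau_def I_def sum.cartesian_product' fst_conv snd_conv
  by (intro sum.cong refl) (use Sg_sym in \<open>simp add: power2_eq_square\<close>)

lemma ssum_eq: "(\<Sum>a=1..p. \<Sum>b=1..p. Sg a b) = ssum"
  unfolding H1.ip_def I_def sum.cartesian_product' fst_conv snd_conv by simp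

end

text \<open>Everything is stated at the true \<open>\<Sigma>\<close>; the hypothesised matrix enters
  only in the final theorem. Finiteness of the moments is an asymptotic assumption, so the facts
  about them hold eventually.\<close>

locale covariance_test =
  fixes M :: "nat \<Rightarrow> 'a measure"
    and p :: "nat \<Rightarrow> nat"
    and X :: "nat \<Rightarrow> nat \<Rightarrow> 'a \<Rightarrow> nat \<Rightarrow> real"
    and \<mu> :: "nat \<Rightarrow> nat \<Rightarrow> real"
    and \<Sigma> :: "nat \<Rightarrow> nat \<Rightarrow> nat \<Rightarrow> real"
    and \<delta> :: real
  fixes N :: "nat \<Rightarrow> nat" and e v es vs :: "nat \<Rightarrow> nat \<Rightarrow> 'a \<Rightarrow> real"
  defines "N \<equiv> \<lambda>n. n div 2"
    and "e \<equiv> \<lambda>n i \<omega>. e_stat (p n) (n div 2) (\<mu> n) (\<lambda>i. X n i \<omega>) (\<Sigma> n) i"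
    and "v \<equiv> \<lambda>n i \<omega>. v_stat (p n) (n div 2) (\<mu> n) (\<lambda>i. X n i \<omega>) (\<Sigma> n) i"
    and "es \<equiv> \<lambda>n i \<omega>. e_star (p n) (n div 2) (\<lambda>i. X n i \<omega>) (\<Sigma> n) i"
    and "vs \<equiv> \<lambda>n i \<omega>. v_star (p n) (n div 2) (\<lambda>i. X n i \<omega>) (\<Sigma> n) i"
  assumes prob: "\<And>n. prob_space (M n)"
    and indep: "\<And>n. prob_space.indep_vars (M n) (\<lambda>_. Rvec (p n)) (X n) {1..n}"
    and ident: "\<And>n i. i \<in> {1..n} \<Longrightarrow>
          distr (M n) (Rvec (p n)) (X n i) = distr (M n) (Rvec (p n)) (X n 1)"
    and second_moment: "\<And>n i a. i \<in> {1..n} \<Longrightarrow> a \<in> {1..p n} \<Longrightarrow>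
          integrable (M n) (\<lambda>\<omega>. (X n i \<omega> a)\<^sup>2)"
    and mean: "\<And>n i a. i \<in> {1..n} \<Longrightarrow> a \<in> {1..p n} \<Longrightarrow>
          (\<integral>\<omega>. X n i \<omega> a \<partial>M n) = \<mu> n a"
    and covariance: "\<And>n i a b. i \<in> {1..n} \<Longrightarrow> a \<in> {1..p n} \<Longrightarrow> b \<in> {1..p n} \<Longrightarrow>
          (\<integral>\<omega>. (X n i \<omega> a - \<mu> n a) * (X n i \<omega> b - \<mu> n b) \<partial>M n) = \<Sigma> n a b"
    and v_pos: "\<And>n. n \<ge> 2 \<Longrightarrow> (\<integral>\<omega>. (v n 1 \<omega>)\<^sup>2 \<partial>M n) > 0"
    and delta_pos: "\<delta> > 0"
    and moments_finite: "eventually (\<lambda>n. integrable (M n) (\<lambda>\<omega>. \<bar>e n 1 \<omega>\<bar> powr (2 + \<delta>)) \<and>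
          integrable (M n) (\<lambda>\<omega>. \<bar>v n 1 \<omega>\<bar> powr (2 + \<delta>))) sequentially"
    and moment_ratio: "(\<lambda>n. max
          ((\<integral>\<omega>. \<bar>e n 1 \<omega>\<bar> powr (2 + \<delta>) \<partial>M n) / (\<integral>\<omega>. (e n 1 \<omega>)\<^sup>2 \<partial>M n) powr ((2 + \<delta>) / 2))
          ((\<integral>\<omega>. \<bar>v n 1 \<omega>\<bar> powr (2 + \<delta>) \<partial>M n) / (\<integral>\<omega>. (v n 1 \<omega>)\<^sup>2 \<partial>M n) powr ((2 + \<delta>) / 2)))
        \<in> o(\<lambda>n. real (N n) powr ((\<delta> + min 2 \<delta>) / 4))"
begin

definition s where "s n = sqrt (\<integral>\<omega>. (e n 1 \<omega>)\<^sup>2 \<partial>M n)"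

definition r where "r n = sqrt (\<integral>\<omega>. (v n 1 \<omega>)\<^sup>2 \<partial>M n)"

lemma N_top: "filterlim N at_top sequentially"
  unfolding filterlim_at_top
proof
  fix Z :: nat
  show "eventually (\<lambda>n. Z \<le> N n) sequentially"
    using eventually_ge_at_top[of "2 * Z"] by eventually_elim (simp add: N_def)
qed

lemma X_meas: "i \<in> {1..n} \<Longrightarrow> X n i \<in> measurable (M n) (Rvec (p n))"
  using indep[of n] unfolding prob_space.indep_vars_def[OF prob] by (elim conjE bspec)

lemma Xa_meas: "i \<in> {1..n} \<Longrightarrow> a \<in> {1..p n} \<Longrightarrow> (\<lambda>\<omega>. X n i \<omega> a) \<in> borel_measurable (M n)"
  using measurable_compose[OF X_meas measurable_component_singleton[of a "{1..p n}" "\<lambda>_. borel :: real measure"]] by simp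

lemma \<Sigma>_sym:
  assumes n: "1 \<le> n"
  shows "\<forall>a\<in>{1..p n}. \<forall>b\<in>{1..p n}. \<Sigma> n a b = \<Sigma> n b a"
proof (intro ballI)
  have 1: "1 \<in> {1..n}" using n by simp
  show "\<Sigma> n a b = \<Sigma> n b a" if "a \<in> {1..p n}" "b \<in> {1..p n}" for a b
    using covariance[OF 1 that] covariance[OF 1 that(2,1)] by (simp add: mult.commute)
qed

lemma index_N: "i \<in> {1..N n} \<Longrightarrow> i \<in> {1..n} \<and> i + N n \<in> {1..n} \<and> 1 \<le> n"
  by (auto simp: N_def)

text \<open>From n = 4 on the half size N is at least 2, and the moment of order 2 + \<delta> gives
  the square integrability of e.\<close>

lemma cov_sample_ev: "eventually (\<lambda>n. cov_sample (M n) (p n) (N n) (X n) (\<mu> n) (\<Sigma> n)) sequentially"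
  using moments_finite eventually_ge_at_top[of 4]
proof eventually_elim
  case (elim n)
  interpret prob_space "M n" by (rule prob)
  have N2: "2 \<le> N n" using elim(2) by (simp add: N_def)
  have sub: "{1..2 * N n} \<subseteq> {1..n}" by (auto simp: N_def)
  have d: "0 \<le> \<delta>" using delta_pos by simp
  have n1: "1 \<le> n" using elim(2) by simp
  let ?w = "\<lambda>i \<alpha> \<omega>. (X n i \<omega> (fst \<alpha>) - \<mu> n (fst \<alpha>)) * (X n i \<omega> (snd \<alpha>) - \<mu> n (snd \<alpha>)) - \<Sigma> n (fst \<alpha>) (snd \<alpha>)"
  have ee: "e n 1 \<omega> = (\<Sum>\<alpha>\<in>{1..p n} \<times> {1..p n}. ?w 1 \<alpha> \<omega> * ?w (1 + N n) \<alpha> \<omega>)" for \<omega>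
    unfolding e_def e_stat_sum[of "p n" "\<Sigma> n", OF \<Sigma>_sym[OF n1]] N_def by (rule refl)
  have em: "e n 1 \<in> borel_measurable (M n)"
    unfolding ee[abs_def]
    by (intro borel_measurable_sum borel_measurable_times borel_measurable_diff borel_measurable_const Xa_meas) (use N2 sub in auto)
  have "integrable (M n) (\<lambda>\<omega>. (e n 1 \<omega>)\<^sup>2)" by (rule sq_integrable_of_powr[OF em conjunct1[OF elim(1)] d])
  then have e2: "integrable (M n) (\<lambda>\<omega>. (\<Sum>\<alpha>\<in>{1..p n} \<times> {1..p n}. ?w 1 \<alpha> \<omega> * ?w (1 + N n) \<alpha> \<omega>)\<^sup>2)" unfolding ee .
  show ?case
    by (unfold_locales; (rule N2 e2 indep_vars_subset[OF indep sub] | (rule ident second_moment mean covariance; use sub in blast)))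
qed

sublocale prob_seq M by (rule prob_seq.intro) (rule prob)

abbreviation I where "I n \<equiv> {1..p n} \<times> {1..p n}"

abbreviation S where "S n \<equiv> Rvec (p n) \<Otimes>\<^sub>M Rvec (p n)"

definition g :: "nat \<Rightarrow> nat \<times> nat \<Rightarrow> (nat \<Rightarrow> real) \<Rightarrow> real" where
  "g n \<alpha> u = (u (fst \<alpha>) - \<mu> n (fst \<alpha>)) * (u (snd \<alpha>) - \<mu> n (snd \<alpha>)) - \<Sigma> n (fst \<alpha>) (snd \<alpha>)"

text \<open>Expressing e and v through the pair of observations i and i + N reduces the sample to an
  i.i.d. array of pairs.\<close>

definition ef where "ef n z = (\<Sum>\<alpha>\<in>I n. g n \<alpha> (fst z) * g n \<alpha> (snd z))"

definition vf where "vf n z = (\<Sum>\<alpha>\<in>I n. g n \<alpha> (fst z)) + (\<Sum>\<alpha>\<in>I n. g n \<alpha> (snd z))"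

text \<open>When \<open>N n = 0\<close> there are no pairs; a constant keeps the first entry of the array measurable.\<close>

definition Z :: "nat \<Rightarrow> nat \<Rightarrow> 'a \<Rightarrow> (nat \<Rightarrow> real) \<times> (nat \<Rightarrow> real)" where
  "Z n i \<omega> = (if 1 \<le> N n then (X n i \<omega>, X n (i + N n) \<omega>) else (\<lambda>_\<in>{1..p n}. 0, \<lambda>_\<in>{1..p n}. 0))"

lemma g_meas: "\<alpha> \<in> I n \<Longrightarrow> g n \<alpha> \<in> borel_measurable (Rvec (p n))"
  unfolding g_def[abs_def]
  by (intro borel_measurable_diff borel_measurable_times borel_measurable_const measurable_component_singleton) auto

lemma ef_meas: "ef n \<in> borel_measurable (S n)"
  unfolding ef_def[abs_def]
  by (intro borel_measurable_sum borel_measurable_times measurable_compose[OF measurable_fst g_meas] measurable_compose[OF measurable_snd g_meas])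

lemma vf_meas: "vf n \<in> borel_measurable (S n)"
  unfolding vf_def[abs_def]
  by (intro borel_measurable_add borel_measurable_sum measurable_compose[OF measurable_fst g_meas] measurable_compose[OF measurable_snd g_meas])

lemma e_N: "e n i \<omega> = e_stat (p n) (N n) (\<mu> n) (\<lambda>i. X n i \<omega>) (\<Sigma> n) i"
  and v_N: "v n i \<omega> = v_stat (p n) (N n) (\<mu> n) (\<lambda>i. X n i \<omega>) (\<Sigma> n) i"
  and es_N: "es n i \<omega> = e_star (p n) (N n) (\<lambda>i. X n i \<omega>) (\<Sigma> n) i"
  and vs_N: "vs n i \<omega> = v_star (p n) (N n) (\<lambda>i. X n i \<omega>) (\<Sigma> n) i"
  by (simp_all add: e_def v_def es_def vs_def N_def)

lemma Z_pair: "i \<in> {1..N n} \<Longrightarrow> Z n i \<omega> = (X n i \<omega>, X n (i + N n) \<omega>)" by (simp add: Z_def)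

lemma ef_Z:
  assumes i: "i \<in> {1..N n}"
  shows "ef n (Z n i \<omega>) = e n i \<omega>" "vf n (Z n i \<omega>) = v n i \<omega>"
proof -
  have n: "1 \<le> n" using index_N[OF i] by blast
  show "ef n (Z n i \<omega>) = e n i \<omega>"
    unfolding e_N e_stat_sum[of "p n" "\<Sigma> n", OF \<Sigma>_sym[OF n]] ef_def Z_pair[OF i] g_def fst_conv snd_conv by (rule refl)
  show "vf n (Z n i \<omega>) = v n i \<omega>"
    unfolding v_N v_stat_sum vf_def Z_pair[OF i] g_def fst_conv snd_conv by (rule refl)
qed

lemma Z_meas: "i \<in> {1..N n} \<Longrightarrow> Z n i \<in> measurable (M n) (S n)"
  using index_N[of i n] by (subst measurable_cong[OF Z_pair]) (auto intro!: measurable_Pair X_meas)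

lemma Z1_meas: "Z n 1 \<in> measurable (M n) (S n)"
proof (cases "1 \<le> N n")
  case True
  then show ?thesis by (intro Z_meas) simp
next
  case False
  have "Z n 1 = (\<lambda>_. (\<lambda>_\<in>{1..p n}. 0, \<lambda>_\<in>{1..p n}. 0))" using False by (intro ext) (simp add: Z_def)
  then show ?thesis by (simp add: space_pair_measure space_PiM)
qed

lemma indep_pair:
  assumes i: "i \<in> {1..N n}"
  shows "prob_space.indep_var (M n) (Rvec (p n)) (X n i) (Rvec (p n)) (X n (i + N n))"
proof -
  interpret prob_space "M n" by (rule prob)
  let ?A = "{i}" and ?B = "{i + N n}"
  have iv: "indep_var (PiM ?A (\<lambda>_. Rvec (p n))) (\<lambda>\<omega>. restrict (\<lambda>i. X n i \<omega>) ?A) (PiM ?B (\<lambda>_. Rvec (p n))) (\<lambda>\<omega>. restrict (\<lambda>i. X n i \<omega>) ?B)"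
    by (rule indep_var_restrict[OF indep]) (use index_N[OF i] i in auto)
  have "(\<lambda>z. z i) \<in> measurable (PiM ?A (\<lambda>_. Rvec (p n))) (Rvec (p n))" "(\<lambda>z. z (i + N n)) \<in> measurable (PiM ?B (\<lambda>_. Rvec (p n))) (Rvec (p n))"
    by (intro measurable_component_singleton; simp)+
  from indep_var_compose[OF iv this] show ?thesis by (simp add: comp_def)
qed

lemma iid_Z: "iid_array M N S Z"
proof unfold_locales
  show "filterlim N at_top sequentially" by (rule N_top)
  show "Z n 1 \<in> measurable (M n) (S n)" for n by (rule Z1_meas)
  show "prob_space.indep_vars (M n) (\<lambda>_. S n) (Z n) {1..N n}" for n
  proof -
    interpret prob_space "M n" by (rule prob)
    \<comment> \<open>For 1 <= j <= N the blocks {j, j + N} are pairwise disjoint.\<close>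
    have 1: "indep_vars (\<lambda>j. PiM {j, j + N n} (\<lambda>_. Rvec (p n))) (\<lambda>j \<omega>. restrict (\<lambda>i. X n i \<omega>) {j, j + N n}) {1..N n}"
      by (rule indep_vars_restrict[OF indep]) (auto simp: disjoint_family_on_def N_def)
    have 2: "(\<lambda>z. (z j, z (j + N n))) \<in> measurable (PiM {j, j + N n} (\<lambda>_. Rvec (p n))) (S n)" for j
      by (intro measurable_Pair measurable_component_singleton) auto
    have "indep_vars (\<lambda>_. S n) (\<lambda>j \<omega>. (restrict (\<lambda>i. X n i \<omega>) {j, j + N n} j, restrict (\<lambda>i. X n i \<omega>) {j, j + N n} (j + N n))) {1..N n}"
      by (rule indep_vars_compose2[OF 1 2])
    then show ?thesis
      by (rule indep_vars_cong[THEN iffD1, rotated -1]) (auto simp: Z_pair)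
  qed
  show "distr (M n) (S n) (Z n i) = distr (M n) (S n) (Z n 1)" if i: "i \<in> {1..N n}" for n i
  proof -
    interpret prob_space "M n" by (rule prob)
    \<comment> \<open>The common law of the pairs is the product of two copies of the law of the
      first observation, whatever j is.\<close>
    have d: "distr (M n) (S n) (Z n j) = distr (M n) (Rvec (p n)) (X n 1) \<Otimes>\<^sub>M distr (M n) (Rvec (p n)) (X n 1)" if j: "j \<in> {1..N n}" for j
    proof -
      have "distr (M n) (S n) (Z n j) = distr (M n) (S n) (\<lambda>\<omega>. (X n j \<omega>, X n (j + N n) \<omega>))"
        by (rule distr_cong) (auto simp: Z_pair[OF j])
      also have "\<dots> = distr (M n) (Rvec (p n)) (X n j) \<Otimes>\<^sub>M distr (M n) (Rvec (p n)) (X n (j + N n))"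
        using indep_pair[OF j] unfolding indep_var_distribution_eq by (elim conjE) (rule sym)
      finally show ?thesis using ident index_N[OF j] by metis
    qed
    have "1 \<in> {1..N n}" using i by simp
    from d[OF i] d[OF this] show ?thesis by simp
  qed
qed

lemma moments_ev: "eventually (\<lambda>n. 0 < s n \<and> 0 < r n \<and> (\<integral>\<omega>. e n 1 \<omega> \<partial>M n) = 0 \<and> (\<integral>\<omega>. v n 1 \<omega> \<partial>M n) = 0 \<and>
    (\<integral>\<omega>. e n 1 \<omega> * v n 1 \<omega> \<partial>M n) = 0) sequentially"
  using cov_sample_ev eventually_ge_at_top[of 2]
proof eventually_elim
  case (elim n)
  interpret C: cov_sample "M n" "p n" "N n" "X n" "\<mu> n" "\<Sigma> n" "I n" "\<lambda>i a \<omega>. X n i \<omega> a - \<mu> n a"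
      "\<lambda>i \<alpha> \<omega>. (X n i \<omega> (fst \<alpha>) - \<mu> n (fst \<alpha>)) * (X n i \<omega> (snd \<alpha>) - \<mu> n (snd \<alpha>)) - \<Sigma> n (fst \<alpha>) (snd \<alpha>)"
    by (rule elim(1) reflexive)+
  have ee: "e n 1 = C.ev 1" by (rule ext) (unfold e_N C.e_stat_ev, rule refl)
  have vv: "v n 1 = C.vv 1" by (rule ext) (unfold v_N C.v_stat_vv, rule refl)
  have "0 < C.Cv" using v_pos[OF elim(2)] unfolding vv C.E_vv_sq(2) by simp
  then have "0 < C.H1.sigma" by (rule C.sigma_pos)
  then have "0 < s n" unfolding s_def ee C.E_ev_sq[OF C.mem11] by simp
  moreover have "0 < r n" unfolding r_def using v_pos[OF elim(2)] by simp
  ultimately show ?case using C.E_ev C.E_vv C.E_ev_vv unfolding ee vv by blast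
qed

lemma s_sq: "(s n)\<^sup>2 = (\<integral>\<omega>. (e n 1 \<omega>)\<^sup>2 \<partial>M n)" and r_sq: "(r n)\<^sup>2 = (\<integral>\<omega>. (v n 1 \<omega>)\<^sup>2 \<partial>M n)"
  by (simp_all add: s_def r_def)

text \<open>The exponent (\<delta> + min 2 \<delta>) / 4 is at most \<delta> / 2, so the assumed
  rate implies Lyapunov's. A general q below the maximum serves e and v alike.\<close>

lemma ratio_lim:
  assumes le: "\<And>n. 0 \<le> q n \<and> q n \<le> max
          ((\<integral>\<omega>. \<bar>e n 1 \<omega>\<bar> powr (2 + \<delta>) \<partial>M n) / (\<integral>\<omega>. (e n 1 \<omega>)\<^sup>2 \<partial>M n) powr ((2 + \<delta>) / 2))
          ((\<integral>\<omega>. \<bar>v n 1 \<omega>\<bar> powr (2 + \<delta>) \<partial>M n) / (\<integral>\<omega>. (v n 1 \<omega>)\<^sup>2 \<partial>M n) powr ((2 + \<delta>) / 2))"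
  shows "(\<lambda>n. q n / N n powr (\<delta> / 2)) \<longlonglongrightarrow> 0"
proof (rule tendsto_sandwich[OF _ _ tendsto_const smalloD_tendsto[OF moment_ratio]])
  show "eventually (\<lambda>n. 0 \<le> q n / N n powr (\<delta> / 2)) sequentially" using le by simp
  have "eventually (\<lambda>n. 1 \<le> N n) sequentially" using N_top by (auto simp: filterlim_at_top)
  then show "eventually (\<lambda>n. q n / N n powr (\<delta> / 2) \<le> max
          ((\<integral>\<omega>. \<bar>e n 1 \<omega>\<bar> powr (2 + \<delta>) \<partial>M n) / (\<integral>\<omega>. (e n 1 \<omega>)\<^sup>2 \<partial>M n) powr ((2 + \<delta>) / 2))
          ((\<integral>\<omega>. \<bar>v n 1 \<omega>\<bar> powr (2 + \<delta>) \<partial>M n) / (\<integral>\<omega>. (v n 1 \<omega>)\<^sup>2 \<partial>M n) powr ((2 + \<delta>) / 2))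
          / real (N n) powr ((\<delta> + min 2 \<delta>) / 4)) sequentially"
  proof eventually_elim
    case (elim n)
    have "real (N n) powr ((\<delta> + min 2 \<delta>) / 4) \<le> real (N n) powr (\<delta> / 2)" using elim by (intro powr_mono) auto
    moreover have "0 < real (N n) powr ((\<delta> + min 2 \<delta>) / 4)" using elim by simp
    ultimately show ?case using le[of n] by (intro frac_le) auto
  qed
qed

text \<open>Standardisation turns the moment of order 2 + \<delta> into the ratio of the assumption,
  since (c^2)^((2 + \<delta>) / 2) = c^(2 + \<delta>).\<close>

lemma integral_scaled:
  fixes f :: "'a \<Rightarrow> real"
  assumes c: "0 < c" "c\<^sup>2 = (\<integral>\<omega>. (f \<omega>)\<^sup>2 \<partial>M n)"
  shows "(\<integral>\<omega>. (f \<omega> / c)\<^sup>2 \<partial>M n) = 1"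
    and "(\<integral>\<omega>. \<bar>f \<omega> / c\<bar> powr (2 + \<delta>) \<partial>M n) = (\<integral>\<omega>. \<bar>f \<omega>\<bar> powr (2 + \<delta>) \<partial>M n) / (\<integral>\<omega>. (f \<omega>)\<^sup>2 \<partial>M n) powr ((2 + \<delta>) / 2)"
    and "integrable (M n) (\<lambda>\<omega>. \<bar>f \<omega>\<bar> powr (2 + \<delta>)) \<Longrightarrow> integrable (M n) (\<lambda>\<omega>. \<bar>f \<omega> / c\<bar> powr (2 + \<delta>))"
proof -
  have "(\<integral>\<omega>. (f \<omega> / c)\<^sup>2 \<partial>M n) = (\<integral>\<omega>. (f \<omega>)\<^sup>2 \<partial>M n) / c\<^sup>2" by (simp add: power_divide)
  then show "(\<integral>\<omega>. (f \<omega> / c)\<^sup>2 \<partial>M n) = 1" unfolding c(2)[symmetric] using c(1) by simp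
  have e: "\<bar>f \<omega> / c\<bar> powr (2 + \<delta>) = \<bar>f \<omega>\<bar> powr (2 + \<delta>) / c powr (2 + \<delta>)" for \<omega>
    using c(1) by (simp add: powr_divide)
  have "(c\<^sup>2) powr ((2 + \<delta>) / 2) = (c powr 2) powr ((2 + \<delta>) / 2)" using c(1) by simp
  also have "\<dots> = c powr (2 + \<delta>)" unfolding powr_powr by (intro arg_cong2[where f = "(powr)"] refl) simp
  finally have "(c\<^sup>2) powr ((2 + \<delta>) / 2) = c powr (2 + \<delta>)" .
  then show "(\<integral>\<omega>. \<bar>f \<omega> / c\<bar> powr (2 + \<delta>) \<partial>M n) = (\<integral>\<omega>. \<bar>f \<omega>\<bar> powr (2 + \<delta>) \<partial>M n) / (\<integral>\<omega>. (f \<omega>)\<^sup>2 \<partial>M n) powr ((2 + \<delta>) / 2)"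
    unfolding e using c(2) by simp
  show "integrable (M n) (\<lambda>\<omega>. \<bar>f \<omega> / c\<bar> powr (2 + \<delta>))" if "integrable (M n) (\<lambda>\<omega>. \<bar>f \<omega>\<bar> powr (2 + \<delta>))"
    unfolding e using that by simp
qed

lemma array_ev: obtains rx ry where "el_array M N (\<lambda>n i \<omega>. ef n (Z n i \<omega>) / s n) (\<lambda>n i \<omega>. vf n (Z n i \<omega>) / r n) rx ry"
proof -
  let ?E = "\<lambda>n. (\<integral>\<omega>. \<bar>e n 1 \<omega>\<bar> powr (2 + \<delta>) \<partial>M n) / (\<integral>\<omega>. (e n 1 \<omega>)\<^sup>2 \<partial>M n) powr ((2 + \<delta>) / 2)"
  let ?V = "\<lambda>n. (\<integral>\<omega>. \<bar>v n 1 \<omega>\<bar> powr (2 + \<delta>) \<partial>M n) / (\<integral>\<omega>. (v n 1 \<omega>)\<^sup>2 \<partial>M n) powr ((2 + \<delta>) / 2)"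
  have ev1: "eventually (\<lambda>n. 1 \<in> {1..N n}) sequentially" using N_top by (auto simp: filterlim_at_top)
  have all: "eventually (\<lambda>n. (integrable (M n) (\<lambda>\<omega>. \<bar>ef n (Z n 1 \<omega>) / s n\<bar> powr (2 + \<delta>)) \<and>
      (\<integral>\<omega>. ef n (Z n 1 \<omega>) / s n \<partial>M n) = 0 \<and> (\<integral>\<omega>. (ef n (Z n 1 \<omega>) / s n)\<^sup>2 \<partial>M n) = 1) \<and>
      (integrable (M n) (\<lambda>\<omega>. \<bar>vf n (Z n 1 \<omega>) / r n\<bar> powr (2 + \<delta>)) \<and>
      (\<integral>\<omega>. vf n (Z n 1 \<omega>) / r n \<partial>M n) = 0 \<and> (\<integral>\<omega>. (vf n (Z n 1 \<omega>) / r n)\<^sup>2 \<partial>M n) = 1) \<and>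
      (\<integral>\<omega>. ef n (Z n 1 \<omega>) / s n * (vf n (Z n 1 \<omega>) / r n) \<partial>M n) = 0 \<and>
      (\<integral>\<omega>. \<bar>ef n (Z n 1 \<omega>) / s n\<bar> powr (2 + \<delta>) \<partial>M n) = ?E n \<and> (\<integral>\<omega>. \<bar>vf n (Z n 1 \<omega>) / r n\<bar> powr (2 + \<delta>) \<partial>M n) = ?V n) sequentially"
    using ev1 moments_ev moments_finite
  proof eventually_elim
    case (elim n)
    have s0: "0 < s n" and r0: "0 < r n" using elim(2) by blast+
    have z: "(\<integral>\<omega>. e n 1 \<omega> / s n \<partial>M n) = 0" "(\<integral>\<omega>. v n 1 \<omega> / r n \<partial>M n) = 0" "(\<integral>\<omega>. e n 1 \<omega> / s n * (v n 1 \<omega> / r n) \<partial>M n) = 0"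
      using elim(2) by simp_all
    show ?case unfolding ef_Z[OF elim(1)]
      using z integral_scaled[OF s0 s_sq] integral_scaled[OF r0 r_sq] elim(3) by blast
  qed
  have E0: "0 \<le> ?E n" "0 \<le> ?V n" for n by simp_all
  have l1: "(\<lambda>n. ?E n / N n powr (\<delta> / 2)) \<longlonglongrightarrow> 0" by (rule ratio_lim) (intro conjI E0 max.cobounded1)
  have l2: "(\<lambda>n. ?V n / N n powr (\<delta> / 2)) \<longlonglongrightarrow> 0" by (rule ratio_lim) (intro conjI E0 max.cobounded2)
  interpret iid_array M N S Z by (rule iid_Z)
  show ?thesis
  proof (rule lyapunov_el_array[where fx = "\<lambda>n z. ef n z / s n" and fy = "\<lambda>n z. vf n z / r n", OF _ _ delta_pos])
    show "(\<lambda>z. ef n z / s n) \<in> borel_measurable (S n)" "(\<lambda>z. vf n z / r n) \<in> borel_measurable (S n)" for n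
      by (intro borel_measurable_divide ef_meas vf_meas borel_measurable_const)+
    show "(\<lambda>n. (\<integral>\<omega>. \<bar>ef n (Z n 1 \<omega>) / s n\<bar> powr (2 + \<delta>) \<partial>M n) / N n powr (\<delta> / 2)) \<longlonglongrightarrow> 0"
      by (rule Lim_transform_eventually[OF l1], rule eventually_mono[OF all]) simp
    show "(\<lambda>n. (\<integral>\<omega>. \<bar>vf n (Z n 1 \<omega>) / r n\<bar> powr (2 + \<delta>) \<partial>M n) / N n powr (\<delta> / 2)) \<longlonglongrightarrow> 0"
      by (rule Lim_transform_eventually[OF l2], rule eventually_mono[OF all]) simp
  next
    fix rx ry assume "el_array M N (\<lambda>n i \<omega>. ef n (Z n i \<omega>) / s n) (\<lambda>n i \<omega>. vf n (Z n i \<omega>) / r n) rx ry"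
    then show ?thesis by (rule that)
  qed (use all in \<open>simp_all only: eventually_conj_iff\<close>)
qed

definition tau where "tau n = mtrace (p n) (mmult (p n) (\<Sigma> n) (\<Sigma> n))"

definition ssum where "ssum n = (\<Sum>a=1..p n. \<Sum>b=1..p n. \<Sigma> n a b)"

text \<open>The bound \<open>eta\<close> of a half sample as a sequence in n, with
  \<open>s n\<close> in the role of \<open>sigma\<close>.\<close>

definition h where "h n = 120 * (tau n / N n + s n / (real (N n))\<^sup>2)"

lemma e_meas: "i \<in> {1..N n} \<Longrightarrow> e n i \<in> borel_measurable (M n)"
  using measurable_compose[OF Z_meas ef_meas] by (simp only: ef_Z)

lemma v_meas: "i \<in> {1..N n} \<Longrightarrow> v n i \<in> borel_measurable (M n)"
  using measurable_compose[OF Z_meas vf_meas] by (simp only: ef_Z)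

text \<open>\<open>cov_sample\<close> is available only for large n, whereas convergence in
  distribution demands measurability for every n; hence a direct proof.\<close>

lemma centred_meas:
  assumes i: "i \<in> {1..N n}" and \<alpha>: "\<alpha> \<in> I n"
  shows "(\<lambda>\<omega>. (X n i \<omega> (fst \<alpha>) - Xbar1 (N n) (\<lambda>i. X n i \<omega>) (fst \<alpha>)) * (X n i \<omega> (snd \<alpha>) - Xbar1 (N n) (\<lambda>i. X n i \<omega>) (snd \<alpha>))
      - (real (N n) - 1) / N n * \<Sigma> n (fst \<alpha>) (snd \<alpha>)) \<in> borel_measurable (M n)"
    and "(\<lambda>\<omega>. (X n (i + N n) \<omega> (fst \<alpha>) - Xbar2 (N n) (\<lambda>i. X n i \<omega>) (fst \<alpha>)) * (X n (i + N n) \<omega> (snd \<alpha>) - Xbar2 (N n) (\<lambda>i. X n i \<omega>) (snd \<alpha>))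
      - (real (N n) - 1) / N n * \<Sigma> n (fst \<alpha>) (snd \<alpha>)) \<in> borel_measurable (M n)"
proof -
  have a: "fst \<alpha> \<in> {1..p n}" "snd \<alpha> \<in> {1..p n}" using \<alpha> by auto
  have n: "{1..N n} \<subseteq> {1..n}" "{N n + 1..2 * N n} \<subseteq> {1..n}" by (auto simp: N_def)
  have 1: "(\<lambda>\<omega>. Xbar1 (N n) (\<lambda>i. X n i \<omega>) a) \<in> borel_measurable (M n)" "(\<lambda>\<omega>. Xbar2 (N n) (\<lambda>i. X n i \<omega>) a) \<in> borel_measurable (M n)"
    if "a \<in> {1..p n}" for a
    unfolding Xbar1_def Xbar2_def
    by (intro borel_measurable_times borel_measurable_sum borel_measurable_const Xa_meas that, use n in blast)+
  show "(\<lambda>\<omega>. (X n i \<omega> (fst \<alpha>) - Xbar1 (N n) (\<lambda>i. X n i \<omega>) (fst \<alpha>)) * (X n i \<omega> (snd \<alpha>) - Xbar1 (N n) (\<lambda>i. X n i \<omega>) (snd \<alpha>))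
      - (real (N n) - 1) / N n * \<Sigma> n (fst \<alpha>) (snd \<alpha>)) \<in> borel_measurable (M n)"
    "(\<lambda>\<omega>. (X n (i + N n) \<omega> (fst \<alpha>) - Xbar2 (N n) (\<lambda>i. X n i \<omega>) (fst \<alpha>)) * (X n (i + N n) \<omega> (snd \<alpha>) - Xbar2 (N n) (\<lambda>i. X n i \<omega>) (snd \<alpha>))
      - (real (N n) - 1) / N n * \<Sigma> n (fst \<alpha>) (snd \<alpha>)) \<in> borel_measurable (M n)"
    using index_N[OF i]
    by (intro borel_measurable_diff borel_measurable_times borel_measurable_const Xa_meas 1 a; blast)+
qed

lemma es_meas:
  assumes i: "i \<in> {1..N n}"
  shows "es n i \<in> borel_measurable (M n)"
proof -
  have n: "1 \<le> n" using index_N[OF i] by blast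
  show ?thesis
    unfolding es_N[abs_def] e_star_sum[of "p n" "\<Sigma> n", OF \<Sigma>_sym[OF n] i]
    by (intro borel_measurable_sum borel_measurable_times[OF centred_meas[OF i]])
qed

lemma vs_meas: "i \<in> {1..N n} \<Longrightarrow> vs n i \<in> borel_measurable (M n)"
  unfolding vs_N[abs_def] v_star_sum
  by (intro borel_measurable_add borel_measurable_sum centred_meas)

lemma star_ev: "eventually (\<lambda>n.
    (\<forall>i\<in>{1..N n}. integrable (M n) (\<lambda>\<omega>. (es n i \<omega> - e n i \<omega>)\<^sup>2) \<and>
      (\<integral>\<omega>. (es n i \<omega> - e n i \<omega>)\<^sup>2 \<partial>M n) \<le> 3 * (2 * s n * h n + (h n)\<^sup>2)) \<and>
    integrable (M n) (\<lambda>\<omega>. (\<Sum>i=1..N n. es n i \<omega> - e n i \<omega>)\<^sup>2) \<and>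
    (\<integral>\<omega>. (\<Sum>i=1..N n. es n i \<omega> - e n i \<omega>)\<^sup>2 \<partial>M n) \<le> 3 * (2 * N n * s n * h n + (N n + 16) * (h n)\<^sup>2)) sequentially"
  and star_vv: "eventually (\<lambda>n.
    (\<forall>i\<in>{1..N n}. integrable (M n) (\<lambda>\<omega>. (vs n i \<omega> - v n i \<omega>)\<^sup>2) \<and>
      (\<integral>\<omega>. (vs n i \<omega> - v n i \<omega>)\<^sup>2 \<partial>M n) \<le> 6 * (60 * ((ssum n)\<^sup>2 / N n + ((r n)\<^sup>2 / 2 + (ssum n)\<^sup>2) / (real (N n))\<^sup>2))) \<and>
    integrable (M n) (\<lambda>\<omega>. (\<Sum>i=1..N n. vs n i \<omega> - v n i \<omega>)\<^sup>2) \<and>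
    (\<integral>\<omega>. (\<Sum>i=1..N n. vs n i \<omega> - v n i \<omega>)\<^sup>2 \<partial>M n) \<le> 6 * (2 * ((r n)\<^sup>2 / 2) / N n + 8 * (ssum n)\<^sup>2)) sequentially"
proof -
  have *: "(\<forall>i\<in>{1..N n}. integrable (M n) (\<lambda>\<omega>. (es n i \<omega> - e n i \<omega>)\<^sup>2) \<and>
      (\<integral>\<omega>. (es n i \<omega> - e n i \<omega>)\<^sup>2 \<partial>M n) \<le> 3 * (2 * s n * h n + (h n)\<^sup>2)) \<and>
    integrable (M n) (\<lambda>\<omega>. (\<Sum>i=1..N n. es n i \<omega> - e n i \<omega>)\<^sup>2) \<and>
    (\<integral>\<omega>. (\<Sum>i=1..N n. es n i \<omega> - e n i \<omega>)\<^sup>2 \<partial>M n) \<le> 3 * (2 * N n * s n * h n + (N n + 16) * (h n)\<^sup>2)"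
    (is ?E)
    "(\<forall>i\<in>{1..N n}. integrable (M n) (\<lambda>\<omega>. (vs n i \<omega> - v n i \<omega>)\<^sup>2) \<and>
      (\<integral>\<omega>. (vs n i \<omega> - v n i \<omega>)\<^sup>2 \<partial>M n) \<le> 6 * (60 * ((ssum n)\<^sup>2 / N n + ((r n)\<^sup>2 / 2 + (ssum n)\<^sup>2) / (real (N n))\<^sup>2))) \<and>
    integrable (M n) (\<lambda>\<omega>. (\<Sum>i=1..N n. vs n i \<omega> - v n i \<omega>)\<^sup>2) \<and>
    (\<integral>\<omega>. (\<Sum>i=1..N n. vs n i \<omega> - v n i \<omega>)\<^sup>2 \<partial>M n) \<le> 6 * (2 * ((r n)\<^sup>2 / 2) / N n + 8 * (ssum n)\<^sup>2)"
    (is ?V)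
    if cs: "cov_sample (M n) (p n) (N n) (X n) (\<mu> n) (\<Sigma> n)" for n
  proof -
    interpret C: cov_sample "M n" "p n" "N n" "X n" "\<mu> n" "\<Sigma> n" "I n" "\<lambda>i a \<omega>. X n i \<omega> a - \<mu> n a"
        "\<lambda>i \<alpha> \<omega>. (X n i \<omega> (fst \<alpha>) - \<mu> n (fst \<alpha>)) * (X n i \<omega> (snd \<alpha>) - \<mu> n (snd \<alpha>)) - \<Sigma> n (fst \<alpha>) (snd \<alpha>)"
      by (rule cs reflexive)+
    have ee: "e n i = C.ev i" for i by (rule ext) (unfold e_N C.e_stat_ev, rule refl)
    have vv: "v n i = C.vv i" for i by (rule ext) (unfold v_N C.v_stat_vv, rule refl)
    have de: "es n i \<omega> - e n i \<omega> = C.de i \<omega>" "vs n i \<omega> - v n i \<omega> = C.dv i \<omega>" if "i \<in> {1..N n}" for i \<omega>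
      unfolding es_N vs_N C.e_star_ev[OF that] C.v_star_vv[OF that] ee vv by simp_all
    have dS: "(\<Sum>i=1..N n. es n i \<omega> - e n i \<omega>) = (\<Sum>i=1..N n. C.de i \<omega>)" "(\<Sum>i=1..N n. vs n i \<omega> - v n i \<omega>) = (\<Sum>i=1..N n. C.dv i \<omega>)" for \<omega>
      by (intro sum.cong refl de; assumption)+
    have s: "s n = C.H1.sigma" unfolding s_def ee C.E_ev_sq[OF C.mem11] using C.H1.sigma_nonneg by simp
    have t: "tau n = C.H1.tau" unfolding tau_def by (rule C.tau_eq)
    have h: "h n = C.H1.eta" unfolding h_def C.H1.eta_def s t by simp
    have ss: "ssum n = C.ssum" unfolding ssum_def by (rule C.ssum_eq)
    have r: "(r n)\<^sup>2 / 2 = C.Cv" unfolding r_sq vv C.E_vv_sq(2) by simp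
    have dI: "integrable (M n) (\<lambda>\<omega>. (es n i \<omega> - e n i \<omega>)\<^sup>2)"
        "(\<integral>\<omega>. (es n i \<omega> - e n i \<omega>)\<^sup>2 \<partial>M n) \<le> 3 * (2 * C.H1.sigma * C.H1.eta + C.H1.eta\<^sup>2)"
        "integrable (M n) (\<lambda>\<omega>. (vs n i \<omega> - v n i \<omega>)\<^sup>2)"
        "(\<integral>\<omega>. (vs n i \<omega> - v n i \<omega>)\<^sup>2 \<partial>M n) \<le> 6 * (60 * (C.ssum\<^sup>2 / N n + (C.Cv + C.ssum\<^sup>2) / (N n)\<^sup>2))"
      if "i \<in> {1..N n}" for i
      unfolding de[OF that] by (rule C.de_sq[OF that] C.dv_sq[OF that])+
    show ?E unfolding dS s h by (intro conjI ballI C.sum_de_sq dI)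
    show ?V unfolding dS ss r of_nat_power[symmetric] by (intro conjI ballI C.sum_dv_sq dI)
  qed
  show "eventually (\<lambda>n.
    (\<forall>i\<in>{1..N n}. integrable (M n) (\<lambda>\<omega>. (es n i \<omega> - e n i \<omega>)\<^sup>2) \<and>
      (\<integral>\<omega>. (es n i \<omega> - e n i \<omega>)\<^sup>2 \<partial>M n) \<le> 3 * (2 * s n * h n + (h n)\<^sup>2)) \<and>
    integrable (M n) (\<lambda>\<omega>. (\<Sum>i=1..N n. es n i \<omega> - e n i \<omega>)\<^sup>2) \<and>
    (\<integral>\<omega>. (\<Sum>i=1..N n. es n i \<omega> - e n i \<omega>)\<^sup>2 \<partial>M n) \<le> 3 * (2 * N n * s n * h n + (N n + 16) * (h n)\<^sup>2)) sequentially"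
    using cov_sample_ev by (rule eventually_mono) (rule *(1))
  show "eventually (\<lambda>n.
    (\<forall>i\<in>{1..N n}. integrable (M n) (\<lambda>\<omega>. (vs n i \<omega> - v n i \<omega>)\<^sup>2) \<and>
      (\<integral>\<omega>. (vs n i \<omega> - v n i \<omega>)\<^sup>2 \<partial>M n) \<le> 6 * (60 * ((ssum n)\<^sup>2 / N n + ((r n)\<^sup>2 / 2 + (ssum n)\<^sup>2) / (real (N n))\<^sup>2))) \<and>
    integrable (M n) (\<lambda>\<omega>. (\<Sum>i=1..N n. vs n i \<omega> - v n i \<omega>)\<^sup>2) \<and>
    (\<integral>\<omega>. (\<Sum>i=1..N n. vs n i \<omega> - v n i \<omega>)\<^sup>2 \<partial>M n) \<le> 6 * (2 * ((r n)\<^sup>2 / 2) / N n + 8 * (ssum n)\<^sup>2)) sequentially"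
    using cov_sample_ev by (rule eventually_mono) (rule *(2))
qed

text \<open>The bridge to \<open>perturb\<close>: \<open>k\<close> and \<open>l\<close> bound the
  second moments of single corrections and of their sum divided by sqrt N, relative to the variance
  c^2.\<close>

lemma op1_scaled:
  fixes a :: "nat \<Rightarrow> nat \<Rightarrow> 'a \<Rightarrow> real" and c k l :: "nat \<Rightarrow> real"
  assumes a: "\<And>n i. i \<in> {1..N n} \<Longrightarrow> a n i \<in> borel_measurable (M n)"
    and bnd: "eventually (\<lambda>n. 0 < c n \<and> (\<forall>i\<in>{1..N n}. integrable (M n) (\<lambda>\<omega>. (a n i \<omega>)\<^sup>2) \<and> (\<integral>\<omega>. (a n i \<omega>)\<^sup>2 \<partial>M n) \<le> (c n)\<^sup>2 * k n) \<and>
      integrable (M n) (\<lambda>\<omega>. (\<Sum>i=1..N n. a n i \<omega>)\<^sup>2) \<and> (\<integral>\<omega>. (\<Sum>i=1..N n. a n i \<omega>)\<^sup>2 \<partial>M n) \<le> N n * ((c n)\<^sup>2 * l n)) sequentially"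
    and k: "k \<longlonglongrightarrow> 0" and l: "l \<longlonglongrightarrow> 0"
  shows "op1 M (\<lambda>n \<omega>. (\<Sum>i=1..N n. a n i \<omega> / c n) / sqrt (N n))"
    and "op1 M (\<lambda>n \<omega>. (\<Sum>i=1..N n. (a n i \<omega> / c n)\<^sup>2) / N n)"
proof -
  have N1: "eventually (\<lambda>n. 1 \<le> N n) sequentially" using N_top by (auto simp: filterlim_at_top)
  show "op1 M (\<lambda>n \<omega>. (\<Sum>i=1..N n. a n i \<omega> / c n) / sqrt (N n))"
  proof (rule op1_of_L2[OF _ _ l])
    show "(\<lambda>\<omega>. (\<Sum>i=1..N n. a n i \<omega> / c n) / sqrt (N n)) \<in> borel_measurable (M n)" for n
      by (intro borel_measurable_divide borel_measurable_sum borel_measurable_const a)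
    show "eventually (\<lambda>n. integrable (M n) (\<lambda>\<omega>. ((\<Sum>i=1..N n. a n i \<omega> / c n) / sqrt (N n))\<^sup>2) \<and>
        (\<integral>\<omega>. ((\<Sum>i=1..N n. a n i \<omega> / c n) / sqrt (N n))\<^sup>2 \<partial>M n) \<le> l n) sequentially"
      using bnd N1
    proof eventually_elim
      case (elim n)
      have e: "((\<Sum>i=1..N n. a n i \<omega> / c n) / sqrt (N n))\<^sup>2 = (\<Sum>i=1..N n. a n i \<omega>)\<^sup>2 / (N n * (c n)\<^sup>2)" for \<omega>
        by (simp add: sum_divide_distrib[symmetric] power_divide power_mult_distrib mult.commute)
      have "0 < N n * (c n)\<^sup>2" using elim by simp
      then have "(\<integral>\<omega>. (\<Sum>i=1..N n. a n i \<omega>)\<^sup>2 \<partial>M n) / (N n * (c n)\<^sup>2) \<le> l n"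
        using elim by (subst pos_divide_le_eq) (simp_all add: mult_ac)
      then show ?case unfolding e using elim by simp
    qed
  qed
  show "op1 M (\<lambda>n \<omega>. (\<Sum>i=1..N n. (a n i \<omega> / c n)\<^sup>2) / N n)"
  proof (rule op1_of_L1[OF _ _ k])
    show "(\<lambda>\<omega>. (\<Sum>i=1..N n. (a n i \<omega> / c n)\<^sup>2) / N n) \<in> borel_measurable (M n)" for n
      by (intro borel_measurable_divide borel_measurable_sum borel_measurable_power borel_measurable_const a)
    show "eventually (\<lambda>n. integrable (M n) (\<lambda>\<omega>. (\<Sum>i=1..N n. (a n i \<omega> / c n)\<^sup>2) / N n) \<and>
        (\<integral>\<omega>. \<bar>(\<Sum>i=1..N n. (a n i \<omega> / c n)\<^sup>2) / N n\<bar> \<partial>M n) \<le> k n) sequentially"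
      using bnd N1
    proof eventually_elim
      case (elim n)
      have i: "integrable (M n) (\<lambda>\<omega>. (a n i \<omega> / c n)\<^sup>2)" "(\<integral>\<omega>. (a n i \<omega> / c n)\<^sup>2 \<partial>M n) \<le> k n" if "i \<in> {1..N n}" for i
      proof -
        have "(\<integral>\<omega>. (a n i \<omega>)\<^sup>2 \<partial>M n) / (c n)\<^sup>2 \<le> k n"
          using elim that by (subst pos_divide_le_eq) (simp_all add: mult_ac)
        then show "integrable (M n) (\<lambda>\<omega>. (a n i \<omega> / c n)\<^sup>2)" "(\<integral>\<omega>. (a n i \<omega> / c n)\<^sup>2 \<partial>M n) \<le> k n"
          unfolding power_divide using elim that by simp_all
      qed
      have "(\<integral>\<omega>. (\<Sum>i=1..N n. (a n i \<omega> / c n)\<^sup>2) / N n \<partial>M n) = (\<Sum>i=1..N n. \<integral>\<omega>. (a n i \<omega> / c n)\<^sup>2 \<partial>M n) / N n"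
        unfolding integral_divide_zero by (subst Bochner_Integration.integral_sum[OF i(1)]) (assumption, rule refl)
      also have "\<dots> \<le> (\<Sum>i=1..N n. k n) / N n" by (intro divide_right_mono sum_mono i(2) of_nat_0_le_iff)
      also have "\<dots> = k n" using elim by simp
      finally have "(\<integral>\<omega>. (\<Sum>i=1..N n. (a n i \<omega> / c n)\<^sup>2) / N n \<partial>M n) \<le> k n" .
      moreover have "\<bar>(\<Sum>i=1..N n. (a n i \<omega> / c n)\<^sup>2) / N n\<bar> = (\<Sum>i=1..N n. (a n i \<omega> / c n)\<^sup>2) / N n" for \<omega>
        by (simp add: sum_nonneg)
      moreover have "integrable (M n) (\<lambda>\<omega>. (\<Sum>i=1..N n. (a n i \<omega> / c n)\<^sup>2) / N n)"
        by (intro Bochner_Integration.integrable_divide Bochner_Integration.integrable_sum i(1))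
      ultimately show ?case by presburger
    qed
  qed
qed

text \<open>Weak convergence concerns only large n, where \<open>s n\<close> and \<open>r n\<close>
  are positive and scale invariance removes them.\<close>

lemma converges_of_array:
  assumes arr: "el_array M N (\<lambda>n i \<omega>. a n i \<omega> / s n) (\<lambda>n i \<omega>. b n i \<omega> / r n) rx ry"
    and a: "\<And>n i. i \<in> {1..N n} \<Longrightarrow> a n i \<in> borel_measurable (M n)"
    and b: "\<And>n i. i \<in> {1..N n} \<Longrightarrow> b n i \<in> borel_measurable (M n)"
  shows "converges_in_distr M (\<lambda>n \<omega>. neg2log (el_ratio (N n) (\<lambda>i. (a n i \<omega>, b n i \<omega>)))) (chi_square 2)"
  unfolding converges_in_distr_def
proof (intro conjI allI)
  show "(\<lambda>\<omega>. neg2log (el_ratio (N n) (\<lambda>i. (a n i \<omega>, b n i \<omega>)))) \<in> borel_measurable (M n)" for n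
    by (rule measurable_compose[OF _ borel_measurable_neg2log])
      (intro borel_measurable_el_ratio borel_measurable_Pair a b)
  show "weak_conv (\<lambda>n t. measure (M n) {\<omega> \<in> space (M n). neg2log (el_ratio (N n) (\<lambda>i. (a n i \<omega>, b n i \<omega>))) \<le> ereal t}) (cdf (chi_square 2))"
    unfolding weak_conv_def
  proof (intro allI impI)
    fix t assume t: "isCont (cdf (chi_square 2)) t"
    have w: "(\<lambda>n. measure (M n) {\<omega> \<in> space (M n). neg2log (el_ratio (N n) (\<lambda>i. (a n i \<omega> / s n, b n i \<omega> / r n))) \<le> ereal t}) \<longlonglongrightarrow> cdf (chi_square 2) t"
      using el_array.el_ratio_weak_conv[OF arr] t unfolding weak_conv_def by blast
    show "(\<lambda>n. measure (M n) {\<omega> \<in> space (M n). neg2log (el_ratio (N n) (\<lambda>i. (a n i \<omega>, b n i \<omega>))) \<le> ereal t}) \<longlonglongrightarrow> cdf (chi_square 2) t"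
    proof (rule Lim_transform_eventually[OF w], rule eventually_mono[OF moments_ev])
      fix n assume n: "0 < s n \<and> 0 < r n \<and> (\<integral>\<omega>. e n 1 \<omega> \<partial>M n) = 0 \<and> (\<integral>\<omega>. v n 1 \<omega> \<partial>M n) = 0 \<and> (\<integral>\<omega>. e n 1 \<omega> * v n 1 \<omega> \<partial>M n) = 0"
      have "el_ratio (N n) (\<lambda>i. (a n i \<omega> / s n, b n i \<omega> / r n)) = el_ratio (N n) (\<lambda>i. (a n i \<omega>, b n i \<omega>))" for \<omega>
        using el_ratio_scale[of "1 / s n" "1 / r n" "N n" "\<lambda>i. a n i \<omega>" "\<lambda>i. b n i \<omega>"] n by simp
      then show "measure (M n) {\<omega> \<in> space (M n). neg2log (el_ratio (N n) (\<lambda>i. (a n i \<omega> / s n, b n i \<omega> / r n))) \<le> ereal t} =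
          measure (M n) {\<omega> \<in> space (M n). neg2log (el_ratio (N n) (\<lambda>i. (a n i \<omega>, b n i \<omega>))) \<le> ereal t}" by simp
    qed
  qed
qed

theorem L1_converges:
  "converges_in_distr M (\<lambda>n \<omega>. neg2log (L1 (p n) (N n) (\<mu> n) (\<lambda>i. X n i \<omega>) (\<Sigma> n))) (chi_square 2)"
proof -
  obtain rx ry where arr: "el_array M N (\<lambda>n i \<omega>. ef n (Z n i \<omega>) / s n) (\<lambda>n i \<omega>. vf n (Z n i \<omega>) / r n) rx ry" by (rule array_ev)
  have m: "(\<lambda>\<omega>. ef n (Z n i \<omega>)) \<in> borel_measurable (M n)" "(\<lambda>\<omega>. vf n (Z n i \<omega>)) \<in> borel_measurable (M n)" if "i \<in> {1..N n}" for n i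
    by (rule measurable_compose[OF Z_meas[OF that] ef_meas], rule measurable_compose[OF Z_meas[OF that] vf_meas])
  have "el_ratio (N n) (\<lambda>i. (ef n (Z n i \<omega>), vf n (Z n i \<omega>))) = L1 (p n) (N n) (\<mu> n) (\<lambda>i. X n i \<omega>) (\<Sigma> n)" for n \<omega>
    unfolding L1_def by (rule el_ratio_cong) (unfold e_N[symmetric] v_N[symmetric], simp only: ef_Z)
  with converges_of_array[OF arr m] show ?thesis by simp
qed

theorem L2_converges:
  assumes t: "(\<lambda>n. (mtrace (p n) (mmult (p n) (\<Sigma> n) (\<Sigma> n)))\<^sup>2) \<in> o(\<lambda>n. (real (N n))\<^sup>2 * (\<integral>\<omega>. (e n 1 \<omega>)\<^sup>2 \<partial>M n))"
    and ss: "(\<lambda>n. (\<Sum>a=1..p n. \<Sum>b=1..p n. \<Sigma> n a b)\<^sup>2) \<in> o(\<lambda>n. real (N n) * (\<integral>\<omega>. (v n 1 \<omega>)\<^sup>2 \<partial>M n))"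
  shows "converges_in_distr M (\<lambda>n \<omega>. neg2log (L2 (p n) (N n) (\<lambda>i. X n i \<omega>) (\<Sigma> n))) (chi_square 2)"
proof -
  obtain rx ry where arr: "el_array M N (\<lambda>n i \<omega>. ef n (Z n i \<omega>) / s n) (\<lambda>n i \<omega>. vf n (Z n i \<omega>) / r n) rx ry" by (rule array_ev)
  \<comment> \<open>Relative sizes of the corrections: \<open>d\<close> tends to 0 by the condition
    on tr(Sigma^2), and \<open>b\<close> by the one on the sum of the entries.\<close>
  define d where "d n = h n / s n" for n
  define b where "b n = (ssum n)\<^sup>2 / (N n * (r n)\<^sup>2)" for n
  have N1: "eventually (\<lambda>n. 1 \<le> N n) sequentially" using N_top by (auto simp: filterlim_at_top)
  have Ni: "(\<lambda>n. 1 / (real (N n))\<^sup>2) \<longlonglongrightarrow> 0"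
    by (intro real_tendsto_divide_at_top[OF tendsto_const] filterlim_pow_at_top filterlim_compose[OF filterlim_real_sequentially N_top]) simp
  have "(\<lambda>n. (tau n)\<^sup>2 / ((real (N n))\<^sup>2 * (s n)\<^sup>2)) \<longlonglongrightarrow> 0" unfolding tau_def s_sq by (rule smalloD_tendsto[OF t])
  from tendsto_real_sqrt[OF this] have "(\<lambda>n. \<bar>tau n / (N n * s n)\<bar>) \<longlonglongrightarrow> 0"
    by (simp add: power_mult_distrib[symmetric] power_divide[symmetric] real_sqrt_abs)
  then have tl: "(\<lambda>n. tau n / (N n * s n)) \<longlonglongrightarrow> 0" by (rule tendsto_rabs_zero_cancel)
  have "(\<lambda>n. 120 * (tau n / (N n * s n) + 1 / (real (N n))\<^sup>2)) \<longlonglongrightarrow> 120 * (0 + 0)" by (intro tendsto_intros tl Ni)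
  then have *: "(\<lambda>n. 120 * (tau n / (N n * s n) + 1 / (real (N n))\<^sup>2)) \<longlonglongrightarrow> 0" by simp
  have d: "d \<longlonglongrightarrow> 0"
  proof (rule Lim_transform_eventually[OF *])
    show "eventually (\<lambda>n. 120 * (tau n / (N n * s n) + 1 / (real (N n))\<^sup>2) = d n) sequentially"
      using moments_ev by eventually_elim (simp add: d_def h_def field_simps)
  qed
  have b: "b \<longlonglongrightarrow> 0" unfolding b_def ssum_def r_sq by (rule smalloD_tendsto[OF ss])
  have kl: "(\<lambda>n. 3 * (2 * d n + 17 * (d n)\<^sup>2)) \<longlonglongrightarrow> 0" "(\<lambda>n. 360 * (2 * b n + 1 / (real (N n))\<^sup>2)) \<longlonglongrightarrow> 0"
    "(\<lambda>n. 6 * (1 / (real (N n))\<^sup>2 + 8 * b n)) \<longlonglongrightarrow> 0"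
  proof -
    note i = tendsto_mult[OF tendsto_const] tendsto_add tendsto_power d b Ni
    have "(\<lambda>n. 3 * (2 * d n + 17 * (d n)\<^sup>2)) \<longlonglongrightarrow> 3 * (2 * 0 + 17 * 0\<^sup>2)"
      "(\<lambda>n. 360 * (2 * b n + 1 / (real (N n))\<^sup>2)) \<longlonglongrightarrow> 360 * (2 * 0 + 0)"
      "(\<lambda>n. 6 * (1 / (real (N n))\<^sup>2 + 8 * b n)) \<longlonglongrightarrow> 6 * (0 + 8 * 0)"
      by (intro i)+
    then show "(\<lambda>n. 3 * (2 * d n + 17 * (d n)\<^sup>2)) \<longlonglongrightarrow> 0" "(\<lambda>n. 360 * (2 * b n + 1 / (real (N n))\<^sup>2)) \<longlonglongrightarrow> 0"
      "(\<lambda>n. 6 * (1 / (real (N n))\<^sup>2 + 8 * b n)) \<longlonglongrightarrow> 0" by simp_all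
  qed
  have mE: "(\<lambda>\<omega>. es n i \<omega> - e n i \<omega>) \<in> borel_measurable (M n)" and mV: "(\<lambda>\<omega>. vs n i \<omega> - v n i \<omega>) \<in> borel_measurable (M n)"
    if "i \<in> {1..N n}" for n i
    by (intro borel_measurable_diff es_meas e_meas vs_meas v_meas that)+
  have bE: "eventually (\<lambda>n. 0 < s n \<and> (\<forall>i\<in>{1..N n}. integrable (M n) (\<lambda>\<omega>. (es n i \<omega> - e n i \<omega>)\<^sup>2) \<and>
      (\<integral>\<omega>. (es n i \<omega> - e n i \<omega>)\<^sup>2 \<partial>M n) \<le> (s n)\<^sup>2 * (3 * (2 * d n + 17 * (d n)\<^sup>2))) \<and>
      integrable (M n) (\<lambda>\<omega>. (\<Sum>i=1..N n. es n i \<omega> - e n i \<omega>)\<^sup>2) \<and>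
      (\<integral>\<omega>. (\<Sum>i=1..N n. es n i \<omega> - e n i \<omega>)\<^sup>2 \<partial>M n) \<le> N n * ((s n)\<^sup>2 * (3 * (2 * d n + 17 * (d n)\<^sup>2)))) sequentially"
    using moments_ev star_ev N1
  proof eventually_elim
    case (elim n)
    have s0: "0 < s n" using elim by blast
    have hd: "h n = s n * d n" using s0 by (simp add: d_def)
    have "3 * (2 * s n * h n + (h n)\<^sup>2) = (s n)\<^sup>2 * (3 * (2 * d n + (d n)\<^sup>2))" unfolding hd by (simp add: power2_eq_square algebra_simps)
    also have "\<dots> \<le> (s n)\<^sup>2 * (3 * (2 * d n + 17 * (d n)\<^sup>2))" by (intro mult_left_mono add_left_mono) auto
    finally have 1: "3 * (2 * s n * h n + (h n)\<^sup>2) \<le> (s n)\<^sup>2 * (3 * (2 * d n + 17 * (d n)\<^sup>2))" .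
    \<comment> \<open>For N >= 1 one has N + 16 <= 17 N, the origin of the 17.\<close>
    have "3 * (2 * N n * s n * h n + (N n + 16) * (h n)\<^sup>2) = 3 * (2 * N n * s n * h n) + 3 * ((N n + 16) * (h n)\<^sup>2)" by simp
    also have "\<dots> \<le> 3 * (2 * N n * s n * h n) + 3 * ((17 * N n) * (h n)\<^sup>2)"
      using elim(3) by (intro add_left_mono mult_left_mono mult_right_mono) auto
    also have "\<dots> = N n * ((s n)\<^sup>2 * (3 * (2 * d n + 17 * (d n)\<^sup>2)))" unfolding hd by (simp add: power2_eq_square algebra_simps)
    finally have 2: "3 * (2 * N n * s n * h n + (N n + 16) * (h n)\<^sup>2) \<le> N n * ((s n)\<^sup>2 * (3 * (2 * d n + 17 * (d n)\<^sup>2)))" .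
    show ?case using s0 elim(2) order_trans[OF _ 1] order_trans[OF _ 2] by blast
  qed
  have bV: "eventually (\<lambda>n. 0 < r n \<and> (\<forall>i\<in>{1..N n}. integrable (M n) (\<lambda>\<omega>. (vs n i \<omega> - v n i \<omega>)\<^sup>2) \<and>
      (\<integral>\<omega>. (vs n i \<omega> - v n i \<omega>)\<^sup>2 \<partial>M n) \<le> (r n)\<^sup>2 * (360 * (2 * b n + 1 / (real (N n))\<^sup>2))) \<and>
      integrable (M n) (\<lambda>\<omega>. (\<Sum>i=1..N n. vs n i \<omega> - v n i \<omega>)\<^sup>2) \<and>
      (\<integral>\<omega>. (\<Sum>i=1..N n. vs n i \<omega> - v n i \<omega>)\<^sup>2 \<partial>M n) \<le> N n * ((r n)\<^sup>2 * (6 * (1 / (real (N n))\<^sup>2 + 8 * b n)))) sequentially"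
    using moments_ev star_vv N1
  proof eventually_elim
    case (elim n)
    have r0: "0 < r n" using elim by blast
    have N0: "1 \<le> real (N n)" using elim(3) by simp
    have hb: "(ssum n)\<^sup>2 = N n * ((r n)\<^sup>2 * b n)" using r0 N0 by (simp add: b_def)
    have b0: "0 \<le> b n" by (simp add: b_def)
    have "6 * (60 * ((ssum n)\<^sup>2 / N n + ((r n)\<^sup>2 / 2 + (ssum n)\<^sup>2) / (real (N n))\<^sup>2)) = 360 * ((r n)\<^sup>2 * (b n + b n / N n + 1 / 2 / (real (N n))\<^sup>2))"
      unfolding hb using N0 by (simp add: field_simps power2_eq_square)
    \<comment> \<open>As N >= 1, the term b / N is replaced by b, which gives 2 b, and 1/2 by
      1.\<close>
    also have "\<dots> \<le> 360 * ((r n)\<^sup>2 * (b n + b n / 1 + 1 / (real (N n))\<^sup>2))"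
      by (intro mult_left_mono add_mono divide_left_mono divide_right_mono order_refl) (use N0 b0 in auto)
    also have "\<dots> = (r n)\<^sup>2 * (360 * (2 * b n + 1 / (real (N n))\<^sup>2))" by (simp add: algebra_simps)
    finally have 1: "6 * (60 * ((ssum n)\<^sup>2 / N n + ((r n)\<^sup>2 / 2 + (ssum n)\<^sup>2) / (real (N n))\<^sup>2)) \<le> (r n)\<^sup>2 * (360 * (2 * b n + 1 / (real (N n))\<^sup>2))" .
    have "6 * (2 * ((r n)\<^sup>2 / 2) / N n + 8 * (ssum n)\<^sup>2) = N n * ((r n)\<^sup>2 * (6 * (1 / (real (N n))\<^sup>2 + 8 * b n)))"
      unfolding hb using N0 by (simp add: field_simps power2_eq_square)
    then have 2: "6 * (2 * ((r n)\<^sup>2 / 2) / N n + 8 * (ssum n)\<^sup>2) \<le> N n * ((r n)\<^sup>2 * (6 * (1 / (real (N n))\<^sup>2 + 8 * b n)))" by simp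
    show ?case using r0 elim(2) order_trans[OF _ 1] order_trans[OF _ 2] by blast
  qed
  note oE = op1_scaled[OF mE bE kl(1) kl(1)] and oV = op1_scaled[OF mV bV kl(2) kl(3)]
  have fE: "es n i \<omega> / s n - ef n (Z n i \<omega>) / s n = (es n i \<omega> - e n i \<omega>) / s n"
    and fV: "vs n i \<omega> / r n - vf n (Z n i \<omega>) / r n = (vs n i \<omega> - v n i \<omega>) / r n" if "i \<in> {1..N n}" for n i \<omega>
    unfolding ef_Z[OF that] by (simp_all add: diff_divide_distrib)
  interpret A: el_array M N "\<lambda>n i \<omega>. ef n (Z n i \<omega>) / s n" "\<lambda>n i \<omega>. vf n (Z n i \<omega>) / r n" rx ry
    "\<lambda>n \<omega>. (\<Sum>i=1..N n. ef n (Z n i \<omega>) / s n) / sqrt (N n)" "\<lambda>n \<omega>. (\<Sum>i=1..N n. vf n (Z n i \<omega>) / r n) / sqrt (N n)"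
    "\<lambda>n \<omega>. (\<Sum>i=1..N n. ef n (Z n i \<omega>) / s n * (ef n (Z n i \<omega>) / s n)) / N n"
    "\<lambda>n \<omega>. (\<Sum>i=1..N n. ef n (Z n i \<omega>) / s n * (vf n (Z n i \<omega>) / r n)) / N n"
    "\<lambda>n \<omega>. (\<Sum>i=1..N n. vf n (Z n i \<omega>) / r n * (vf n (Z n i \<omega>) / r n)) / N n"
    by (rule arr reflexive)+
  obtain qx qy where "el_array M N (\<lambda>n i \<omega>. es n i \<omega> / s n) (\<lambda>n i \<omega>. vs n i \<omega> / r n) qx qy"
  proof (rule A.perturb[where x' = "\<lambda>n i \<omega>. es n i \<omega> / s n" and y' = "\<lambda>n i \<omega>. vs n i \<omega> / r n"])
    show "(\<lambda>\<omega>. es n i \<omega> / s n) \<in> borel_measurable (M n)" "(\<lambda>\<omega>. vs n i \<omega> / r n) \<in> borel_measurable (M n)" if "i \<in> {1..N n}" for n i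
      by (intro borel_measurable_divide borel_measurable_const es_meas vs_meas that)+
  qed (use oE oV in \<open>simp_all only: fE fV cong: sum.cong\<close>)
  from converges_of_array[OF this es_meas vs_meas] show ?thesis unfolding L2_def es_N vs_N .
qed

end

text \<open>The null hypothesis equates the two matrices only at indices up to p, and the statistics
  read no others.\<close>

lemma e_stat_cong:
  assumes "\<And>a b. a \<in> {1..p} \<Longrightarrow> b \<in> {1..p} \<Longrightarrow> A a b = B a b"
  shows "e_stat p N \<mu> x A i = e_stat p N \<mu> x B i"
  unfolding e_stat_def mtrace_def mmult_def by (intro sum.cong refl) (simp only: assms)

lemma v_stat_cong:
  assumes "\<And>a b. a \<in> {1..p} \<Longrightarrow> b \<in> {1..p} \<Longrightarrow> A a b = B a b"
  shows "v_stat p N \<mu> x A i = v_stat p N \<mu> x B i"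
  unfolding v_stat_def quad_form_def by (intro sum.cong refl) (simp only: assms)

lemma e_star_cong:
  assumes "\<And>a b. a \<in> {1..p} \<Longrightarrow> b \<in> {1..p} \<Longrightarrow> A a b = B a b"
  shows "e_star p N x A i = e_star p N x B i"
  unfolding e_star_def mtrace_def mmult_def by (intro sum.cong refl) (simp only: assms)

lemma v_star_cong:
  assumes "\<And>a b. a \<in> {1..p} \<Longrightarrow> b \<in> {1..p} \<Longrightarrow> A a b = B a b"
  shows "v_star p N x A i = v_star p N x B i"
  unfolding v_star_def quad_form_def by (intro sum.cong refl) (simp only: assms)

text \<open>\<open>moments_finite\<close> makes explicit what the ratio of moments presupposes: the
  Bochner integral of a non-integrable function is 0, so the rate alone would say nothing about
  infinite moments. For n < 2 there are no pairs, hence positivity is asked from n = 2 on.\<close>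

theorem theorem2p1:
  fixes M :: "nat \<Rightarrow> 'a measure"
    and p :: "nat \<Rightarrow> nat"
    and X :: "nat \<Rightarrow> nat \<Rightarrow> 'a \<Rightarrow> nat \<Rightarrow> real"
    and \<mu> :: "nat \<Rightarrow> nat \<Rightarrow> real"
    and \<Sigma> \<Sigma>\<^sub>0 :: "nat \<Rightarrow> nat \<Rightarrow> nat \<Rightarrow> real"
    and \<delta> :: real
  assumes prob: "\<And>n. prob_space (M n)"
    and indep: "\<And>n. prob_space.indep_vars (M n) (\<lambda>_. Rvec (p n)) (X n) {1..n}"
    and ident: "\<And>n i. i \<in> {1..n} \<Longrightarrow>
          distr (M n) (Rvec (p n)) (X n i) = distr (M n) (Rvec (p n)) (X n 1)"
    and second_moment: "\<And>n i a. i \<in> {1..n} \<Longrightarrow> a \<in> {1..p n} \<Longrightarrow>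
          integrable (M n) (\<lambda>\<omega>. (X n i \<omega> a)\<^sup>2)"
    and mean: "\<And>n i a. i \<in> {1..n} \<Longrightarrow> a \<in> {1..p n} \<Longrightarrow>
          (\<integral>\<omega>. X n i \<omega> a \<partial>M n) = \<mu> n a"
    and covariance: "\<And>n i a b. i \<in> {1..n} \<Longrightarrow> a \<in> {1..p n} \<Longrightarrow> b \<in> {1..p n} \<Longrightarrow>
          (\<integral>\<omega>. (X n i \<omega> a - \<mu> n a) * (X n i \<omega> b - \<mu> n b) \<partial>M n) = \<Sigma> n a b"
    and v_pos: "\<And>n. n \<ge> 2 \<Longrightarrow>
          (\<integral>\<omega>. (v_stat (p n) (n div 2) (\<mu> n) (\<lambda>i. X n i \<omega>) (\<Sigma> n) 1)\<^sup>2 \<partial>M n) > 0"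
    and delta_pos: "\<delta> > 0"
    and moments_finite: "eventually (\<lambda>n.
          integrable (M n) (\<lambda>\<omega>.
            \<bar>e_stat (p n) (n div 2) (\<mu> n) (\<lambda>i. X n i \<omega>) (\<Sigma> n) 1\<bar> powr (2 + \<delta>)) \<and>
          integrable (M n) (\<lambda>\<omega>.
            \<bar>v_stat (p n) (n div 2) (\<mu> n) (\<lambda>i. X n i \<omega>) (\<Sigma> n) 1\<bar> powr (2 + \<delta>))) sequentially"
    and moment_ratio: "(\<lambda>n. max
          ((\<integral>\<omega>. \<bar>e_stat (p n) (n div 2) (\<mu> n) (\<lambda>i. X n i \<omega>) (\<Sigma> n) 1\<bar> powr (2 + \<delta>) \<partial>M n) /
           (\<integral>\<omega>. (e_stat (p n) (n div 2) (\<mu> n) (\<lambda>i. X n i \<omega>) (\<Sigma> n) 1)\<^sup>2 \<partial>M n)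
             powr ((2 + \<delta>) / 2))
          ((\<integral>\<omega>. \<bar>v_stat (p n) (n div 2) (\<mu> n) (\<lambda>i. X n i \<omega>) (\<Sigma> n) 1\<bar> powr (2 + \<delta>) \<partial>M n) /
           (\<integral>\<omega>. (v_stat (p n) (n div 2) (\<mu> n) (\<lambda>i. X n i \<omega>) (\<Sigma> n) 1)\<^sup>2 \<partial>M n)
             powr ((2 + \<delta>) / 2)))
        \<in> o(\<lambda>n. real (n div 2) powr ((\<delta> + min 2 \<delta>) / 4))"
    and H0: "\<And>n a b. a \<in> {1..p n} \<Longrightarrow> b \<in> {1..p n} \<Longrightarrow> \<Sigma> n a b = \<Sigma>\<^sub>0 n a b"
  shows "converges_in_distr M
           (\<lambda>n \<omega>. neg2log (L1 (p n) (n div 2) (\<mu> n) (\<lambda>i. X n i \<omega>) (\<Sigma>\<^sub>0 n))) (chi_square 2) \<and>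
         ((\<lambda>n. (mtrace (p n) (mmult (p n) (\<Sigma> n) (\<Sigma> n)))\<^sup>2) \<in>
            o(\<lambda>n. (real (n div 2))\<^sup>2 *
              (\<integral>\<omega>. (e_stat (p n) (n div 2) (\<mu> n) (\<lambda>i. X n i \<omega>) (\<Sigma> n) 1)\<^sup>2 \<partial>M n)) \<and>
          (\<lambda>n. (\<Sum>a=1..p n. \<Sum>b=1..p n. \<Sigma> n a b)\<^sup>2) \<in>
            o(\<lambda>n. real (n div 2) *
              (\<integral>\<omega>. (v_stat (p n) (n div 2) (\<mu> n) (\<lambda>i. X n i \<omega>) (\<Sigma> n) 1)\<^sup>2 \<partial>M n)) \<longrightarrow>
          converges_in_distr M
           (\<lambda>n \<omega>. neg2log (L2 (p n) (n div 2) (\<lambda>i. X n i \<omega>) (\<Sigma>\<^sub>0 n))) (chi_square 2))"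
proof -
  have ct: "covariance_test M p X \<mu> \<Sigma> \<delta>"
    by (rule covariance_test.intro) (fact assms)+
  have "e_stat (p n) k m x (\<Sigma>\<^sub>0 n) i = e_stat (p n) k m x (\<Sigma> n) i" "v_stat (p n) k m x (\<Sigma>\<^sub>0 n) i = v_stat (p n) k m x (\<Sigma> n) i"
    "e_star (p n) k x (\<Sigma>\<^sub>0 n) i = e_star (p n) k x (\<Sigma> n) i" "v_star (p n) k x (\<Sigma>\<^sub>0 n) i = v_star (p n) k x (\<Sigma> n) i" for n k m x i
    by (rule e_stat_cong v_stat_cong e_star_cong v_star_cong; rule H0[symmetric]; assumption)+
  then have "L1 (p n) k m x (\<Sigma>\<^sub>0 n) = L1 (p n) k m x (\<Sigma> n)" "L2 (p n) k x (\<Sigma>\<^sub>0 n) = L2 (p n) k x (\<Sigma> n)" for n k m x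
    by (simp_all only: L1_def L2_def)
  then show ?thesis
    using covariance_test.L1_converges[OF ct] covariance_test.L2_converges[OF ct] by (simp only: simp_thms) blast
qed

end
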